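(* Let $n\ge 2$ and let $\omega_0,\dots,\omega_{n-1}\in[0,+\infty]$ satisfy $\omega_0\ge \frac1n$ and, for every $1\le d\le n-1$, \[\frac{d\,\omega_d}{\omega_d+d+1}\le\omega_{d-1}\le\frac{(n-d)\omega_d-1}{n-d+1}\] (the left-hand side being interpreted as $d$ if $\omega_d=+\infty$). Then \[\dim_P\Big(\bigcap_{d=0}^{n-1}\mathbf{W}_n^d(\omega_d)^*\Big)=\dim_P\Big(\bigcap_{d=0}^{n-1}\mathbf{W}_n^d(\omega_d)\Big)=n.\] In particular, for each $0\le d\le n-1$, $\dim_P(\mathbf{W}_n^d(\omega_d)^* )=\dim_P(\mathbf{W}_n^d(\omega_d))=n$.
   Context: $\dim_P$ denotes packing dimension. For $\boldsymbol\theta\in\mathbb{R}^n$ and $0\le d\le n-1$, the ordinary exponent $\omega_d(\boldsymbol\theta)$ is the supremum of real numbers $\omega$ such that for arbitrarily large real $H$ there exists a rational affine subspace $L\subset\mathbb{R}^n$ with $\dim L=d$, $H(L)\le H$ and $H(L)\,d(\boldsymbol\theta,L)\le H^{-\omega}$; here $H(L)$ is the (Schmidt) height of the rational affine subspace $L$ and $d(\boldsymbol\theta,L)=\min_{P\in L}d(\boldsymbol\theta,P)$. (These exponents are considered for $\boldsymbol\theta$ with $1,\theta_1,\dots,\theta_n$ linearly independent over $\mathbb{Q}$.) The Diophantine sets are $\mathbf{W}_n^d(\omega_d)=\{\boldsymbol\theta\in\mathbb{R}^n:\omega_d(\boldsymbol\theta)\ge\omega_d\}$ and $\mathbf{W}_n^d(\omega_d)^*=\{\boldsymbol\theta\in\mathbb{R}^n:\omega_d(\boldsymbol\theta)=\omega_d\}$.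 *)

theory Defs
  imports "HOL-Analysis.Analysis"
begin

text \<open>Packing premeasure at scale delta: supremum of sums of (diameter)^s over
countable families of pairwise disjoint closed balls with centres in E and
radii at most delta. In a normed space the diameter of cball x r (r > 0) is 2r.\<close>

definition packing_premeasure_delta :: "real \<Rightarrow> real \<Rightarrow> ('a::real_normed_vector) set \<Rightarrow> ennreal" where
  "packing_premeasure_delta s \<delta> E =
     (SUP p \<in> {(I::nat set, x::nat \<Rightarrow> 'a, r::nat \<Rightarrow> real).
                 (\<forall>i\<in>I. x i \<in> E \<and> 0 < r i \<and> r i \<le> \<delta>) \<and>
                 (\<forall>i\<in>I. \<forall>j\<in>I. i \<noteq> j \<longrightarrow> cball (x i) (r i) \<inter> cball (x j) (r j) = {})}.
        (case p of (I, x, r) \<Rightarrow> (\<Sum>i. if i \<in> I then ennreal ((2 * r i) powr s) else 0)))"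

definition packing_premeasure :: "real \<Rightarrow> ('a::real_normed_vector) set \<Rightarrow> ennreal" where
  "packing_premeasure s E = (INF \<delta> \<in> {0<..}. packing_premeasure_delta s \<delta> E)"

definition packing_measure :: "real \<Rightarrow> ('a::real_normed_vector) set \<Rightarrow> ennreal" where
  "packing_measure s E =
     (INF A \<in> {A :: nat \<Rightarrow> 'a set. E \<subseteq> (\<Union>i. A i)}. \<Sum>i. packing_premeasure s (A i))"

definition packing_dim :: "('a::real_normed_vector) set \<Rightarrow> real" where
  "packing_dim E = Inf {s. 0 \<le> s \<and> packing_measure s E = 0}"

definition rational_point :: "real ^ 'n \<Rightarrow> bool" where
  "rational_point x \<longleftrightarrow> (\<forall>i. x $ i \<in> \<rat>)"

definition rat_affine_subspace :: "nat \<Rightarrow> (real ^ 'n) set \<Rightarrow> bool" where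
  "rat_affine_subspace d L \<longleftrightarrow>
     (\<exists>S. S \<subseteq> {x. rational_point x} \<and> L = affine hull S \<and> aff_dim L = int d)"

definition integer_point :: "real \<times> (real ^ 'n) \<Rightarrow> bool" where
  "integer_point v \<longleftrightarrow> fst v \<in> \<int> \<and> (\<forall>i. snd v $ i \<in> \<int>)"

definition gram_det :: "nat \<Rightarrow> (nat \<Rightarrow> 'a::real_inner) \<Rightarrow> real" where
  "gram_det k b = (\<Sum>p \<in> {p. p permutes {..<k}}. of_int (sign p) * (\<Prod>i<k. inner (b i) (b (p i))))"

definition lift_space :: "(real ^ 'n) set \<Rightarrow> (real \<times> (real ^ 'n)) set" where
  "lift_space L = span ((\<lambda>x. (1::real, x)) ` L)"

text \<open>Schmidt height: covolume of the lattice of integer points of the lifted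
space, i.e. sqrt of the Gram determinant of a Z-basis of that lattice.\<close>
definition height :: "(real ^ 'n) set \<Rightarrow> real" where
  "height L =
     (let V = lift_space L; Z = {v \<in> V. integer_point v}; k = dim V;
          b = (SOME b :: nat \<Rightarrow> real \<times> (real ^ 'n).
                 (\<forall>i<k. b i \<in> Z) \<and>
                 (\<forall>z\<in>Z. \<exists>c :: nat \<Rightarrow> int. z = (\<Sum>i<k. of_int (c i) *\<^sub>R b i)))
      in sqrt (gram_det k b))"

definition omega_exp :: "nat \<Rightarrow> real ^ 'n \<Rightarrow> ereal" where
  "omega_exp d \<theta> =
     Sup {ereal w | w. \<forall>H0. \<exists>H \<ge> H0. \<exists>L. rat_affine_subspace d L \<and> height L \<le> H \<and>
                                 height L * infdist \<theta> L \<le> H powr (- w)}"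

definition Q_lin_indep :: "real ^ 'n \<Rightarrow> bool" where
  "Q_lin_indep \<theta> \<longleftrightarrow>
     (\<forall>(c0::int) (c::'n \<Rightarrow> int).
        real_of_int c0 + (\<Sum>i\<in>UNIV. real_of_int (c i) * \<theta> $ i) = 0 \<longrightarrow> c0 = 0 \<and> (\<forall>i. c i = 0))"

definition W_set :: "nat \<Rightarrow> ereal \<Rightarrow> (real ^ 'n) set" where
  "W_set d w = {\<theta>. Q_lin_indep \<theta> \<and> omega_exp d \<theta> \<ge> w}"

definition W_star :: "nat \<Rightarrow> ereal \<Rightarrow> (real ^ 'n) set" where
  "W_star d w = {\<theta>. Q_lin_indep \<theta> \<and> omega_exp d \<theta> = w}"

end

(*
A point theta is described by the trajectory of the integer lattice under the flow
diag(exp (-n t), exp t, ..., exp t) attached to theta. Most of the time the lattice is kept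
balanced. At sparse times t one inserts an excursion towards a rational d-dimensional subspace of
height about exp ((n - d) t), at the end of which theta is within exp (-(n + 1) Theta t) of that
subspace; during it the lattice has d + 1 short and n - d long directions of equal sizes. Such an
excursion contributes exactly w to omega_d, where (n - d) (1 + w) = (n + 1) Theta, and the
transference inequalities between the omega_e say that it contributes at most omega_e to every
other exponent. Cycling through all d realises all exponents at once.

In a balanced phase theta may move to any member of a set of positive measure, namely the image of
badly approximable parameters. A set whose packing premeasure of dimension s < n is small leaves a
ball around one of these points free. If the set of points with the given exponents had packing
measure zero in dimension s, it would be covered by countably many such sets, and a nested sequence
of balls avoiding them one after the other would give a point with the given exponents outside the
cover.
*)

theory Submission
  imports Defs "Jordan_Normal_Form.Determinant"
begin

text \<open>Badly approximable points in the strict sense form a null set, so the parameters are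
  badly approximable only up to an exponent \<epsilon>, and factors
  \<open>exp (\<epsilon> t)\<close> are lost everywhere. These losses must not pile up: an excursion
  lasts a time proportional to its starting time and enlarges the loss. The balanced phase repairs
  this. Its end is free, so the state at its start becomes a constant, and the new loss can be made
  as small as the next excursion demands. The same freedom fits packing dimension: the scale at
  which a ball escapes from a set of small premeasure is not under control, and the phase simply
  lasts until that scale is reached.

  For the upper bounds on exponents, integer vectors of known sizes complete a basis of the
  sublattice of a rational subspace to a system of determinant at least 1. By Hadamard's inequality
  this sublattice cannot have small covolume, whereas a subspace of small height near \<theta>
  would. With one short and one long block the worst completion is explicit, and the transference
  inequalities say that it is harmless for every exponent.\<close>

no_notation vec_index (infixl "$" 100)
no_notation scalar_prod (infix "\<bullet>" 70)

section \<open>Gram determinants as squared volumes\<close>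

lemma gram_det_mat:
  "gram_det k b = Determinant.det (Matrix.mat k k (\<lambda>(i, j). inner (b i) (b j)))"
proof -
  have *: "{0..<k} = {..<k}" by auto
  have "(\<Prod>i<k. inner (b i) (b (p i))) = (\<Prod>i<k. Matrix.mat k k (\<lambda>(i, j). inner (b i) (b j)) $$ (i, p i))"
    if "p permutes {..<k}" for p
    using permutes_in_image[OF that] by (intro prod.cong) auto
  then show ?thesis
    unfolding gram_det_def Determinant.det_def * by (auto intro!: sum.cong simp: *)
qed

lemma gram_det_cong: "(\<And>i. i < k \<Longrightarrow> b i = b' i) \<Longrightarrow> gram_det k b = gram_det k b'"
  unfolding gram_det_mat by (intro arg_cong[where f = Determinant.det] eq_matI) auto

text \<open>The new Gram matrix is C G C^T. For an integral C this compares the volumes of a lattice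
  and a sublattice; for a change of coordinates it isolates the factor that depends on C
  only.\<close>

lemma gram_det_linear_combination:
  fixes a :: "nat \<Rightarrow> 'a::real_inner"
  shows "gram_det k (\<lambda>i. \<Sum>j<k. C i j *\<^sub>R a j)
    = (Determinant.det (Matrix.mat k k (\<lambda>(i, j). C i j)))\<^sup>2 * gram_det k a"
proof -
  let ?C = "Matrix.mat k k (\<lambda>(i, j). C i j)"
  let ?G = "Matrix.mat k k (\<lambda>(i, j). inner (a i) (a j))"
  have "Matrix.mat k k (\<lambda>(i, j). inner (\<Sum>j<k. C i j *\<^sub>R a j) (\<Sum>i<k. C j i *\<^sub>R a i))
     = ?C * ?G * transpose_mat ?C" (is "?L = ?R")
  proof (rule eq_matI)
    show "dim_row ?L = dim_row ?R" "dim_col ?L = dim_col ?R" by auto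
  next
    fix i j assume ij: "i < dim_row ?R" "j < dim_col ?R"
    then have ij: "i < k" "j < k" by auto
    have "?R $$ (i,j) = (\<Sum>m\<in>{0..<k}. (\<Sum>l\<in>{0..<k}. C i l * inner (a l) (a m)) * C j m)"
      using ij by (auto simp: Matrix.scalar_prod_def intro!: sum.cong)
    also have "\<dots> = (\<Sum>m\<in>{0..<k}. \<Sum>l\<in>{0..<k}. C j m * (C i l * inner (a l) (a m)))"
      by (intro sum.cong refl) (simp only: mult.commute[of _ "C j _"] sum_distrib_left)
    also have "\<dots> = (\<Sum>l<k. \<Sum>m<k. C j m * (C i l * inner (a l) (a m)))"
      by (subst sum.swap) (simp add: atLeast0LessThan)
    also have "\<dots> = ?L $$ (i,j)"
      using ij by (simp add: inner_sum_left inner_sum_right sum_distrib_left mult_ac)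
        (rule sum.swap)
    finally show "?L $$ (i,j) = ?R $$ (i,j)" by simp
  qed
  moreover have "Determinant.det ?R = Determinant.det ?C * Determinant.det ?G * Determinant.det ?C"
  proof -
    have C: "?C \<in> carrier_mat k k" and G: "?G \<in> carrier_mat k k" by auto
    show ?thesis
      using det_mult[OF mult_carrier_mat[OF C G], of "transpose_mat ?C"] det_mult[OF C G]
        Determinant.det_transpose[OF C] C by simp
  qed
  ultimately show ?thesis
    by (simp add: gram_det_mat power2_eq_square mult_ac)
qed

lemma gram_det_0 [simp]: "gram_det 0 b = 1"
  by (simp add: gram_det_mat)

lemma gram_det_orthogonal_Suc:
  assumes "\<And>i. i < k \<Longrightarrow> inner (b i) (b k) = 0"
  shows "gram_det (Suc k) b = gram_det k b * (norm (b k))\<^sup>2"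
proof -
  let ?G = "\<lambda>k. Matrix.mat k k (\<lambda>(i, j). inner (b i) (b j))"
  have "?G (Suc k) = four_block_mat (?G k) (0\<^sub>m k 1) (0\<^sub>m 1 k) (Matrix.mat 1 1 (\<lambda>_. inner (b k) (b k)))"
    by (rule eq_matI) (use assms in \<open>auto simp: less_Suc_eq inner_commute\<close>)
  then have "Determinant.det (?G (Suc k)) = Determinant.det (?G k) *
      Determinant.det (Matrix.mat 1 1 (\<lambda>_. inner (b k) (b k)))"
    by (simp only:) (rule det_four_block_mat_upper_right_zero_col, auto)
  then show ?thesis
    by (simp add: gram_det_mat det_single power2_norm_eq_inner)
qed

lemma span_image_lessThan:
  fixes b :: "nat \<Rightarrow> 'a::real_vector"
  assumes "u \<in> span (b ` {..<k})"
  shows "\<exists>a. u = (\<Sum>i<k. a i *\<^sub>R b i)"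
  using assms
proof (induction rule: span_induct_alt)
  case base
  show ?case by (rule exI[of _ "\<lambda>_. 0"]) simp
next
  case (step c x y)
  then obtain a i where a: "y = (\<Sum>i<k. a i *\<^sub>R b i)" and i: "i < k" "x = b i" by auto
  have "(\<Sum>j<k. (a j + (if j = i then c else 0)) *\<^sub>R b j)
      = y + (\<Sum>j<k. (if j = i then c *\<^sub>R b j else 0))"
    unfolding a sum.distrib[symmetric] by (rule sum.cong) (auto simp: algebra_simps)
  also have "\<dots> = c *\<^sub>R x + y" using i by simp
  finally show ?case by metis
qed

text \<open>A shear: the matrix that subtracts u from the last vector is lower triangular with unit
  diagonal.\<close>

lemma gram_det_shift:
  fixes b :: "nat \<Rightarrow> 'a::real_inner"
  assumes "u \<in> span (b ` {..<k})"
  shows "gram_det (Suc k) (b(k := b k - u)) = gram_det (Suc k) b"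
proof -
  obtain a where a: "u = (\<Sum>i<k. a i *\<^sub>R b i)"
    using span_image_lessThan[OF assms] by auto
  define C :: "nat \<Rightarrow> nat \<Rightarrow> real" where
    "C i j = (if i = j then 1 else if i = k then - a j else 0)" for i j
  have "(\<Sum>j<Suc k. C i j *\<^sub>R b j) = (b(k := b k - u)) i" if "i < Suc k" for i
  proof (cases "i = k")
    case True
    have "(\<Sum>j<k. C k j *\<^sub>R b j) = (\<Sum>j<k. - (a j *\<^sub>R b j))"
      by (rule sum.cong) (auto simp: C_def)
    then show ?thesis using True by (simp add: C_def a sum_negf)
  next
    case False
    then have "(\<Sum>j<Suc k. C i j *\<^sub>R b j) = (\<Sum>j<Suc k. if j = i then b j else 0)"
      by (intro sum.cong) (auto simp: C_def)
    then show ?thesis using False that by simp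
  qed
  then have "gram_det (Suc k) (b(k := b k - u)) = gram_det (Suc k) (\<lambda>i. \<Sum>j<Suc k. C i j *\<^sub>R b j)"
    by (intro gram_det_cong) (metis)
  moreover have "Determinant.det (Matrix.mat (Suc k) (Suc k) (\<lambda>(i, j). C i j)) = 1"
    by (subst det_lower_triangular[of "Suc k"]) (auto simp: C_def prod_list_diag_prod)
  ultimately show ?thesis by (simp only: gram_det_linear_combination) simp
qed

text \<open>Volume is base times height: v is the component of the last vector orthogonal to the
  preceding ones. Nonnegativity, the criterion for independence and Hadamard's inequality all come
  from this.\<close>

lemma gram_det_Suc_projection:
  fixes b :: "nat \<Rightarrow> 'a::euclidean_space"
  obtains v where "b k - v \<in> span (b ` {..<k})" "\<And>w. w \<in> span (b ` {..<k}) \<Longrightarrow> inner w v = 0"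
    "gram_det (Suc k) b = gram_det k b * (norm v)\<^sup>2"
proof -
  obtain y z where yz: "y \<in> span (b ` {..<k})" "\<And>w. w \<in> span (b ` {..<k}) \<Longrightarrow> inner w z = 0"
    "b k = y + z"
    using orthogonal_subspace_decomp_exists[of "b ` {..<k}" "b k"]
    by (metis Linear_Algebra.orthogonal_def inner_commute)
  have "gram_det (Suc k) b = gram_det (Suc k) (b(k := z))"
    using gram_det_shift[OF yz(1)] yz(3) by simp
  also have "\<dots> = gram_det k (b(k := z)) * (norm z)\<^sup>2"
    using gram_det_orthogonal_Suc[of k "b(k := z)"] yz(2)[OF span_base]
    by auto
  also have "gram_det k (b(k := z)) = gram_det k b"
    by (rule gram_det_cong) auto
  finally show ?thesis
    using yz by (intro that[of z]) auto
qed

lemma gram_det_nonneg: "0 \<le> gram_det k (b :: nat \<Rightarrow> 'a::euclidean_space)"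
proof (induction k)
  case (Suc k)
  then show ?case by (metis gram_det_Suc_projection mult_nonneg_nonneg zero_le_power2)
qed simp

text \<open>By Pythagoras the orthogonal component is the shortest of all vectors
  \<open>b k - u\<close>.\<close>

lemma gram_det_Suc_le:
  fixes b :: "nat \<Rightarrow> 'a::euclidean_space"
  assumes "u \<in> span (b ` {..<k})"
  shows "gram_det (Suc k) b \<le> gram_det k b * (norm (b k - u))\<^sup>2"
proof -
  obtain v where v: "b k - v \<in> span (b ` {..<k})" "\<And>w. w \<in> span (b ` {..<k}) \<Longrightarrow> inner w v = 0"
    "gram_det (Suc k) b = gram_det k b * (norm v)\<^sup>2"
    using gram_det_Suc_projection[where b = b and k = k] by blast
  define w where "w = b k - v - u"
  have "w \<in> span (b ` {..<k})" unfolding w_def using v(1) assms by (rule span_diff)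
  then have "inner w v = 0" by (rule v(2))
  then have "(norm (w + v))\<^sup>2 = (norm w)\<^sup>2 + (norm v)\<^sup>2"
    by (simp add: power2_norm_eq_inner inner_add inner_commute)
  then have "(norm v)\<^sup>2 \<le> (norm (b k - u))\<^sup>2" by (simp add: w_def)
  then show ?thesis unfolding v(3) by (intro mult_left_mono gram_det_nonneg)
qed

lemma gram_det_pos_iff:
  fixes b :: "nat \<Rightarrow> 'a::euclidean_space"
  shows "0 < gram_det k b \<longleftrightarrow> inj_on b {..<k} \<and> independent (b ` {..<k})"
proof (induction k)
  case (Suc k)
  obtain v where v: "b k - v \<in> span (b ` {..<k})" "\<And>w. w \<in> span (b ` {..<k}) \<Longrightarrow> inner w v = 0"
    "gram_det (Suc k) b = gram_det k b * (norm v)\<^sup>2"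
    using gram_det_Suc_projection[where b = b and k = k] by blast
  have v0: "v = 0 \<longleftrightarrow> b k \<in> span (b ` {..<k})"
  proof
    assume "b k \<in> span (b ` {..<k})"
    then have "v \<in> span (b ` {..<k})" using span_diff[OF _ v(1)] by fastforce
    then show "v = 0" using v(2) by force
  qed (use v(1) in simp)
  have img: "b ` {..<Suc k} = insert (b k) (b ` {..<k})" by (auto simp: lessThan_Suc)
  have inj: "inj_on b {..<Suc k} \<longleftrightarrow> inj_on b {..<k} \<and> b k \<notin> b ` {..<k}"
    by (simp add: lessThan_Suc)
  have "0 < gram_det (Suc k) b \<longleftrightarrow> 0 < gram_det k b \<and> v \<noteq> 0"
    unfolding v(3) using gram_det_nonneg[of k b] by (auto simp: zero_less_mult_iff)
  then show ?case
    unfolding img inj Suc.IH v0 independent_insert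
    by (metis imageI inj_onI span_base)
qed (simp add: independent_empty)

text \<open>Hadamard's inequality relative to the first k vectors, whose volume is kept.\<close>

lemma gram_det_le_prod:
  fixes b :: "nat \<Rightarrow> 'a::euclidean_space"
  shows "gram_det (k + m) b \<le> gram_det k b * (\<Prod>i<m. (norm (b (k + i)))\<^sup>2)"
proof (induction m)
  case (Suc m)
  have "gram_det (k + Suc m) b \<le> gram_det (k + m) b * (norm (b (k + m)))\<^sup>2"
    using gram_det_Suc_le[OF span_0, of "k + m" b] by simp
  also have "\<dots> \<le> gram_det k b * (\<Prod>i<m. (norm (b (k + i)))\<^sup>2) * (norm (b (k + m)))\<^sup>2"
    by (intro mult_right_mono Suc.IH) auto
  finally show ?case by (simp add: mult_ac)
qed simp

text \<open>Hadamard's inequality after multiples of \<open>b 0\<close> have been removed from the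
  other vectors. Lattice vectors close to one common direction may all be long, but become short
  once that direction is removed; the plain product of norms would be far too large for
  them.\<close>

lemma gram_det_le_prod_reduced:
  fixes b :: "nat \<Rightarrow> 'a::euclidean_space"
  shows "gram_det (Suc k) b \<le> (norm (b 0))\<^sup>2 * (\<Prod>i<k. (norm (b (Suc i) - c i *\<^sub>R b 0))\<^sup>2)"
proof (induction k)
  case 0
  show ?case using gram_det_orthogonal_Suc[of 0 b] by simp
next
  case (Suc k)
  have "c k *\<^sub>R b 0 \<in> span (b ` {..<Suc k})" by (intro span_scale span_base) auto
  then have "gram_det (Suc (Suc k)) b
      \<le> gram_det (Suc k) b * (norm (b (Suc k) - c k *\<^sub>R b 0))\<^sup>2"
    by (rule gram_det_Suc_le)
  also have "\<dots> \<le> (norm (b 0))\<^sup>2 * (\<Prod>i<k. (norm (b (Suc i) - c i *\<^sub>R b 0))\<^sup>2)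
      * (norm (b (Suc k) - c k *\<^sub>R b 0))\<^sup>2"
    by (intro mult_right_mono Suc.IH) auto
  finally show ?case by (simp add: mult_ac)
qed

lemma det_Ints:
  assumes "\<And>i j. i < k \<Longrightarrow> j < k \<Longrightarrow> C i j \<in> \<int>"
  shows "Determinant.det (Matrix.mat k k (\<lambda>(i, j). C i j :: real)) \<in> \<int>"
proof -
  have "C i (p i) \<in> \<int>" if "p permutes {0..<k}" "i < k" for p i
    using assms[of i "p i"] that permutes_in_image[OF that(1), of i] by auto
  then show ?thesis
    by (subst det_def'[of _ k]) (auto intro!: Ints_sum Ints_mult Ints_prod)
qed

hide_const (open) Matrix.orthogonal

lemma independent_of_card_le_dim:
  fixes B :: "'a::euclidean_space set"
  assumes "span B = V" "finite B" "card B \<le> dim V"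
  shows "independent B"
  using assms card_le_dim_spanning span_superset by (metis order_refl)

lemma gram_det_permute:
  fixes b :: "nat \<Rightarrow> 'a::real_inner"
  assumes "p permutes {..<k}"
  shows "gram_det k (\<lambda>i. b (p i)) = gram_det k b"
proof -
  have p: "p permutes {0..<k}" using assms by (simp add: atLeast0LessThan)
  define C :: "nat \<Rightarrow> nat \<Rightarrow> real" where "C i j = (if p i = j then 1 else 0)" for i j
  have "(\<Sum>j<k. C i j *\<^sub>R b j) = b (p i)" if "i < k" for i
  proof -
    have "(\<Sum>j<k. C i j *\<^sub>R b j) = (\<Sum>j<k. if j = p i then b j else 0)"
      by (intro sum.cong) (auto simp: C_def)
    then show ?thesis using permutes_in_image[OF assms, of i] that by simp
  qed
  then have "gram_det k (\<lambda>i. b (p i)) = gram_det k (\<lambda>i. \<Sum>j<k. C i j *\<^sub>R b j)"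
    by (intro gram_det_cong) simp
  moreover have "Matrix.mat k k (\<lambda>(i, j). C i j) = Matrix.mat k k (\<lambda>(i, j). (1\<^sub>m k :: real mat) $$ (p i, j))"
    using permutes_in_image[OF p] by (intro eq_matI) (auto simp: C_def)
  then have "Determinant.det (Matrix.mat k k (\<lambda>(i, j). C i j)) = signof p"
    using det_permute_rows[of "1\<^sub>m k :: real mat" k p] p by simp
  moreover have "(signof p :: real)\<^sup>2 = 1" by (simp add: sign_def)
  ultimately show ?thesis by (simp only: gram_det_linear_combination mult_1)
qed

text \<open>Cramer's rule, squared: only the coefficient of the replaced vector matters. The j-th
  vector is moved to the last place, where the rest of the combination is removed by a
  shear.\<close>

lemma gram_det_replace:
  fixes b :: "nat \<Rightarrow> 'a::real_inner"
  assumes j: "j < k"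
  shows "gram_det k (b(j := \<Sum>i<k. a i *\<^sub>R b i)) = (a j)\<^sup>2 * gram_det k b"
proof -
  obtain k' where k': "k = Suc k'" using j by (cases k) auto
  define p where "p = Transposition.transpose j k'"
  have p: "p permutes {..<k}" unfolding p_def by (rule permutes_swap_id) (use j k' in auto)
  define c where "c i = b (p i)" for i
  have pk: "p k' = j" by (simp add: p_def)
  have pj: "p i \<noteq> j" if "i < k'" for i
    using that by (auto simp: p_def Transposition.transpose_def)
  have u: "(\<Sum>i<k. a i *\<^sub>R b i) = (\<Sum>i<k'. a (p i) *\<^sub>R c i) + a j *\<^sub>R c k'"
    using sum.permute[OF p, of "\<lambda>i. a i *\<^sub>R b i"] by (simp add: k' c_def comp_def pk)
  let ?u = "\<Sum>i<k. a i *\<^sub>R b i"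
  let ?w = "\<Sum>i<k'. a (p i) *\<^sub>R c i"
  have "gram_det k (b(j := ?u)) = gram_det k (\<lambda>i. (b(j := ?u)) (p i))"
    by (rule gram_det_permute[OF p, symmetric])
  also have "\<dots> = gram_det k (c(k' := ?u))"
    by (rule gram_det_cong) (use pj pk in \<open>auto simp: k' c_def less_Suc_eq\<close>)
  also have "\<dots> = gram_det (Suc k') ((c(k' := ?u))(k' := (c(k' := ?u)) k' - ?w))"
    unfolding k' by (rule gram_det_shift[symmetric]) (intro span_sum span_scale span_base, auto)
  also have "\<dots> = gram_det (Suc k') (c(k' := a j *\<^sub>R c k'))"
    using u by simp
  also have "\<dots> = (a j)\<^sup>2 * gram_det k c"
  proof -
    define C where "C i l = (if i = l then if i = k' then a j else 1 else 0)" for i l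
    have "(\<Sum>l<Suc k'. C i l *\<^sub>R c l) = (c(k' := a j *\<^sub>R c k')) i" if "i < Suc k'" for i
    proof -
      have "(\<Sum>l<Suc k'. C i l *\<^sub>R c l) = (\<Sum>l<Suc k'. if l = i then (c(k' := a j *\<^sub>R c k')) l else 0)"
        by (intro sum.cong) (auto simp: C_def)
      then show ?thesis using that by simp
    qed
    then have "gram_det (Suc k') (c(k' := a j *\<^sub>R c k')) = gram_det (Suc k') (\<lambda>i. \<Sum>l<Suc k'. C i l *\<^sub>R c l)"
      by (intro gram_det_cong) metis
    moreover have "Determinant.det (Matrix.mat (Suc k') (Suc k') (\<lambda>(i, j). C i j)) = a j"
      by (subst det_lower_triangular[of "Suc k'"]) (auto simp: C_def prod_list_diag_prod)
    ultimately show ?thesis by (simp only: gram_det_linear_combination k')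
  qed
  also have "gram_det k c = gram_det k b"
    unfolding c_def by (rule gram_det_permute[OF p])
  finally show ?thesis .
qed

section \<open>Integer points and heights\<close>

lemma integer_point_0: "integer_point 0"
  and integer_point_add: "integer_point x \<Longrightarrow> integer_point y \<Longrightarrow> integer_point (x + y)"
  and integer_point_diff: "integer_point x \<Longrightarrow> integer_point y \<Longrightarrow> integer_point (x - y)"
  and integer_point_scale: "integer_point x \<Longrightarrow> c \<in> \<int> \<Longrightarrow> integer_point (c *\<^sub>R x)"
  by (auto simp: integer_point_def)

lemma integer_point_sum: "(\<And>i. i \<in> I \<Longrightarrow> integer_point (f i)) \<Longrightarrow> integer_point (sum f I)"
  by (induction I rule: infinite_finite_induct) (auto intro: integer_point_0 integer_point_add)

lemma inner_integer_points: "integer_point x \<Longrightarrow> integer_point y \<Longrightarrow> inner x y \<in> \<int>"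
  by (auto simp: integer_point_def inner_prod_def inner_vec_def)

lemma gram_det_integer_points:
  fixes b :: "nat \<Rightarrow> real \<times> (real ^ 'n)"
  assumes "\<And>i. i < k \<Longrightarrow> integer_point (b i)"
  shows "gram_det k b \<in> \<int>"
  unfolding gram_det_mat by (rule det_Ints) (intro inner_integer_points assms)

lemma gram_det_integer_points_ge_1:
  fixes b :: "nat \<Rightarrow> real \<times> (real ^ 'n)"
  assumes "\<And>i. i < k \<Longrightarrow> integer_point (b i)" "inj_on b {..<k}" "independent (b ` {..<k})"
  shows "1 \<le> gram_det k b"
proof -
  have "0 < gram_det k b" using assms(2,3) gram_det_pos_iff by blast
  moreover obtain m where "gram_det k b = of_int m"
    by (rule Ints_cases[OF gram_det_integer_points[OF assms(1)]])
  ultimately show ?thesis by simp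
qed

text \<open>Gram determinants of independent integer points are positive integers, so among the
  systems of k independent integer points of the subspace one of smallest volume exists. It is a
  basis of the lattice: a point with a non-integral j-th coordinate, reduced modulo the system,
  could replace the j-th vector and would multiply the Gram determinant by the square of a
  fractional part.\<close>

lemma integer_lattice_basis_exists:
  fixes b0 :: "nat \<Rightarrow> real \<times> (real ^ 'n)"
  assumes b0: "\<And>i. i < k \<Longrightarrow> integer_point (b0 i)" "inj_on b0 {..<k}" "independent (b0 ` {..<k})"
  defines "Z \<equiv> {v \<in> span (b0 ` {..<k}). integer_point v}"
  shows "\<exists>b. (\<forall>i<k. b i \<in> Z) \<and> (\<forall>z\<in>Z. \<exists>c :: nat \<Rightarrow> int. z = (\<Sum>i<k. of_int (c i) *\<^sub>R b i))"
proof -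
  define P where "P m \<longleftrightarrow> (\<exists>b. (\<forall>i<k. b i \<in> Z) \<and> gram_det k b = real m \<and> 0 < m)" for m
  have fin: "\<exists>m. gram_det k b = real m \<and> 0 < m" if "\<forall>i<k. b i \<in> Z" "0 < gram_det k b" for b
  proof -
    have "gram_det k b \<in> \<int>"
      by (rule gram_det_integer_points) (use that in \<open>auto simp: Z_def\<close>)
    then obtain m where "gram_det k b = of_int m" by (rule Ints_cases)
    then show ?thesis using that by (intro exI[of _ "nat m"]) auto
  qed
  have "\<forall>i<k. b0 i \<in> Z" using b0(1) by (auto simp: Z_def intro: span_base)
  then have "\<exists>m. P m" using fin[of b0] gram_det_pos_iff[of k b0] b0 by (auto simp: P_def)
  then obtain m where m: "P m" "\<And>m'. m' < m \<Longrightarrow> \<not> P m'"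
    using exists_least_iff[of P] by auto
  then obtain b where b: "\<forall>i<k. b i \<in> Z" "gram_det k b = real m" "0 < m"
    by (auto simp: P_def)
  have ind: "inj_on b {..<k}" "independent (b ` {..<k})"
    using gram_det_pos_iff[of k b] b by auto
  have "span (b ` {..<k}) = span (b0 ` {..<k})"
  proof
    show "span (b ` {..<k}) \<subseteq> span (b0 ` {..<k})"
      by (rule span_minimal) (use b(1) in \<open>auto simp: Z_def\<close>)
    have "b ` {..<k} \<subseteq> span (b0 ` {..<k})" using b(1) by (auto simp: Z_def)
    moreover have "card (b ` {..<k}) = dim (span (b0 ` {..<k}))"
      using b0 ind by (simp add: card_image dim_eq_card_independent)
    ultimately show "span (b0 ` {..<k}) \<subseteq> span (b ` {..<k})"
      using ind card_ge_dim_independent by (metis order_refl)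
  qed
  then have sp: "z \<in> span (b ` {..<k})" if "z \<in> Z" for z using that by (auto simp: Z_def)
  have "\<exists>c :: nat \<Rightarrow> int. z = (\<Sum>i<k. of_int (c i) *\<^sub>R b i)" if z: "z \<in> Z" for z
  proof -
    obtain a where a: "z = (\<Sum>i<k. a i *\<^sub>R b i)" using span_image_lessThan[OF sp[OF z]] by auto
    have int: "frac (a j) = 0" if j: "j < k" for j
    proof (rule ccontr)
      assume "frac (a j) \<noteq> 0"
      then have fr: "0 < frac (a j)" "frac (a j) < 1"
        using frac_ge_0[of "a j"] frac_lt_1[of "a j"] by auto
      let ?u = "\<Sum>i<k. frac (a i) *\<^sub>R b i"
      have u: "?u = z - (\<Sum>i<k. of_int \<lfloor>a i\<rfloor> *\<^sub>R b i)"
        by (simp add: a frac_def scaleR_diff_left sum_subtractf)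
      have "integer_point ?u" unfolding u
        by (intro integer_point_diff integer_point_sum integer_point_scale) (use z b in \<open>auto simp: Z_def\<close>)
      moreover have "?u \<in> span (b0 ` {..<k})"
        by (intro span_sum span_scale) (use b in \<open>auto simp: Z_def\<close>)
      ultimately have uZ: "\<forall>i<k. (b(j := ?u)) i \<in> Z" using b by (auto simp: Z_def)
      have g: "gram_det k (b(j := ?u)) = (frac (a j))\<^sup>2 * real m"
        using gram_det_replace[OF j, of b "\<lambda>i. frac (a i)"] b by simp
      then have "0 < gram_det k (b(j := ?u))" using fr b by simp
      with fin[OF uZ] obtain m' where m': "gram_det k (b(j := ?u)) = real m'" "0 < m'" by blast
      then have "P m'" using uZ unfolding P_def by blast
      moreover have "(frac (a j))\<^sup>2 < 1" using fr by (simp add: power_less_one_iff abs_square_less_1)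
      then have "real m' < real m" using g m' b by simp
      ultimately show False using m(2) by auto
    qed
    have "z = (\<Sum>i<k. of_int \<lfloor>a i\<rfloor> *\<^sub>R b i)"
      unfolding a by (intro sum.cong refl) (use int in \<open>auto simp: frac_def\<close>)
    then show ?thesis by (rule exI[where x = "\<lambda>i. \<lfloor>a i\<rfloor>"])
  qed
  then show ?thesis using b(1) by blast
qed

text \<open>The choice operator in \<open>height\<close> is opened here once: since bases exist, the
  chosen system is one, and being k vectors that span a space of dimension k it is
  independent.\<close>

lemma height_lattice_basis:
  fixes L :: "(real ^ 'n) set"
  assumes b0: "\<And>i. i < k \<Longrightarrow> integer_point (b0 i)" "inj_on b0 {..<k}" "independent (b0 ` {..<k})"
    and sp: "span (b0 ` {..<k}) = lift_space L"
  obtains b where "\<And>i. i < k \<Longrightarrow> integer_point (b i)" "inj_on b {..<k}" "independent (b ` {..<k})"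
    "span (b ` {..<k}) = lift_space L" "height L = sqrt (gram_det k b)"
    "\<And>z. z \<in> lift_space L \<Longrightarrow> integer_point z \<Longrightarrow> \<exists>c :: nat \<Rightarrow> int. z = (\<Sum>i<k. of_int (c i) *\<^sub>R b i)"
proof -
  have dim: "dim (lift_space L) = k"
    using b0 sp dim_eq_card_independent[OF b0(3)] dim_span[of "b0 ` {..<k}"] by (simp add: card_image)
  define Z where "Z = {v \<in> lift_space L. integer_point v}"
  define Q where "Q b \<longleftrightarrow> (\<forall>i<k. b i \<in> Z) \<and> (\<forall>z\<in>Z. \<exists>c :: nat \<Rightarrow> int. z = (\<Sum>i<k. of_int (c i) *\<^sub>R b i))" for b
  have ex: "\<exists>b. Q b"
    using integer_lattice_basis_exists[OF b0] unfolding Q_def Z_def sp by blast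
  define b where "b = (SOME b. Q b)"
  have b: "Q b" unfolding b_def using ex by (rule someI_ex)
  have ht: "height L = sqrt (gram_det k b)"
    unfolding height_def Let_def dim Z_def[symmetric] Q_def[symmetric] b_def[symmetric] ..
  have sp': "span (b ` {..<k}) = lift_space L"
  proof
    show "span (b ` {..<k}) \<subseteq> lift_space L"
      unfolding lift_space_def by (rule span_minimal) (use b in \<open>auto simp: Q_def Z_def lift_space_def\<close>)
    have "b0 i \<in> span (b ` {..<k})" if "i < k" for i
    proof -
      have "b0 i \<in> Z" using b0(1)[OF that] that by (auto simp: Z_def sp[symmetric] intro: span_base)
      then obtain c :: "nat \<Rightarrow> int" where "b0 i = (\<Sum>i<k. of_int (c i) *\<^sub>R b i)"
        using b unfolding Q_def by blast
      then show ?thesis by (simp only:) (intro span_sum span_scale span_base, auto)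
    qed
    then show "lift_space L \<subseteq> span (b ` {..<k})"
      unfolding sp[symmetric] by (intro span_minimal) auto
  qed
  have le: "card (b ` {..<k}) \<le> k" using card_image_le[of "{..<k}" b] by simp
  have ind: "independent (b ` {..<k})"
    by (rule independent_of_card_le_dim[OF sp']) (use le dim in auto)
  then have "card (b ` {..<k}) = k"
    using dim_eq_card_independent[OF ind] dim_span[of "b ` {..<k}"] sp' dim by simp
  then have inj: "inj_on b {..<k}" by (intro eq_card_imp_inj_on) auto
  show ?thesis
    by (rule that[of b]) (use b ht sp' ind inj in \<open>auto simp: Q_def Z_def\<close>)
qed

text \<open>The given points are integral combinations of a lattice basis, and a nonzero integral
  determinant has square at least 1. So heights can be bounded above by any independent integer
  points that span the lifted space, without knowing a basis.\<close>

lemma height_le_gram_det: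
  fixes L :: "(real ^ 'n) set"
  assumes b0: "\<And>i. i < k \<Longrightarrow> integer_point (b0 i)" "inj_on b0 {..<k}" "independent (b0 ` {..<k})"
    and sp: "span (b0 ` {..<k}) = lift_space L"
  shows "height L \<le> sqrt (gram_det k b0)"
proof -
  obtain b where b: "height L = sqrt (gram_det k b)"
    "\<And>z. z \<in> lift_space L \<Longrightarrow> integer_point z \<Longrightarrow> \<exists>c :: nat \<Rightarrow> int. z = (\<Sum>i<k. of_int (c i) *\<^sub>R b i)"
    using height_lattice_basis[OF b0 sp] by metis
  have "b0 i \<in> lift_space L" if "i < k" for i unfolding sp[symmetric] by (rule span_base) (use that in auto)
  then have "\<forall>i. \<exists>c :: nat \<Rightarrow> int. i < k \<longrightarrow> b0 i = (\<Sum>i<k. of_int (c i) *\<^sub>R b i)"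
    using b(2) b0(1) by blast
  then obtain c :: "nat \<Rightarrow> nat \<Rightarrow> int" where c: "\<And>i. i < k \<Longrightarrow> b0 i = (\<Sum>j<k. of_int (c i j) *\<^sub>R b j)"
    by metis
  let ?D = "Determinant.det (Matrix.mat k k (\<lambda>(i, j). real_of_int (c i j)))"
  have g: "gram_det k b0 = ?D\<^sup>2 * gram_det k b"
    unfolding gram_det_linear_combination[symmetric] by (rule gram_det_cong) (rule c)
  obtain m where m: "?D = of_int m" using det_Ints[of k "\<lambda>i j. of_int (c i j)"] by (auto elim: Ints_cases)
  have "0 < gram_det k b0" using b0 gram_det_pos_iff by blast
  then have "m \<noteq> 0" using g m by auto
  then have "1 \<le> m\<^sup>2" by (simp add: int_one_le_iff_zero_less)
  then have "1 \<le> ?D\<^sup>2" unfolding m by (metis of_int_1_le_iff of_int_power)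
  then have "gram_det k b \<le> gram_det k b0"
    unfolding g using gram_det_nonneg[of k b] mult_right_mono by fastforce
  then show ?thesis using b(1) by simp
qed

section \<open>Rational affine subspaces as linear subspaces spanned by integer points\<close>

text \<open>An affine relation, with coefficients of sum 0, is a linear relation between the lifted
  points: the first coordinate records the sum.\<close>

lemma independent_lift_iff:
  fixes B :: "('a::real_vector) set"
  assumes "finite B"
  shows "independent ((\<lambda>x. (1::real, x)) ` B) \<longleftrightarrow> \<not> affine_dependent B"
proof -
  have inj: "inj_on (\<lambda>x::'a. (1::real, x)) B" by (auto intro: inj_onI)
  have "dependent ((\<lambda>x. (1::real, x)) ` B) \<longleftrightarrow>
    (\<exists>u. (\<exists>v\<in>B. u (1, v) \<noteq> 0) \<and> (\<Sum>v\<in>B. u (1::real, v) *\<^sub>R (1::real, v)) = 0)"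
    using assms by (subst dependent_finite) (auto simp: sum.reindex[OF inj])
  also have "\<dots> \<longleftrightarrow> (\<exists>u. (\<exists>v\<in>B. u v \<noteq> 0) \<and> (\<Sum>v\<in>B. u v *\<^sub>R (1::real, v)) = 0)"
  proof safe
    fix u :: "real \<times> 'a \<Rightarrow> real" and v
    assume "(\<Sum>v\<in>B. u (1::real, v) *\<^sub>R (1::real, v)) = 0" "v \<in> B" "u (1, v) \<noteq> 0"
    then show "\<exists>u. (\<exists>v\<in>B. u v \<noteq> 0) \<and> (\<Sum>v\<in>B. u v *\<^sub>R (1::real, v)) = 0"
      by (intro exI[of _ "\<lambda>v. u (1, v)"]) auto
  next
    fix u :: "'a \<Rightarrow> real" and v
    assume "(\<Sum>v\<in>B. u v *\<^sub>R (1::real, v)) = 0" "v \<in> B" "u v \<noteq> 0"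
    then show "\<exists>u. (\<exists>v\<in>B. u (1, v) \<noteq> 0) \<and> (\<Sum>v\<in>B. u (1::real, v) *\<^sub>R (1::real, v)) = 0"
      by (intro exI[of _ "\<lambda>v. u (snd v)"]) auto
  qed
  also have "\<dots> \<longleftrightarrow> affine_dependent B"
    unfolding affine_dependent_explicit_finite[OF assms]
    by (auto simp: prod_eq_iff fst_sum snd_sum)
  finally show ?thesis by blast
qed

lemma mem_affine_hull_iff_lift:
  fixes B :: "('a::real_vector) set"
  assumes "finite B"
  shows "P \<in> affine hull B \<longleftrightarrow> (1::real, P) \<in> span ((\<lambda>x. (1::real, x)) ` B)"
proof -
  have inj: "inj_on (\<lambda>x::'a. (1::real, x)) B" by (auto intro: inj_onI)
  have "(1::real, P) \<in> span ((\<lambda>x. (1::real, x)) ` B) \<longleftrightarrow>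
     (\<exists>u. (1, P) = (\<Sum>v\<in>B. u (1::real, v) *\<^sub>R (1::real, v)))"
    by (simp only: span_finite[OF finite_imageI[OF assms]] sum.reindex[OF inj] comp_def
        image_iff bex_UNIV)
  also have "\<dots> \<longleftrightarrow> (\<exists>u. (1, P) = (\<Sum>v\<in>B. u v *\<^sub>R (1::real, v)))"
  proof safe
    fix u :: "real \<times> 'a \<Rightarrow> real"
    assume "(1, P) = (\<Sum>v\<in>B. u (1, v) *\<^sub>R (1::real, v))"
    then show "\<exists>u. (1, P) = (\<Sum>v\<in>B. u v *\<^sub>R (1::real, v))" by (intro exI[of _ "\<lambda>v. u (1, v)"]) auto
  next
    fix u :: "'a \<Rightarrow> real"
    assume "(1, P) = (\<Sum>v\<in>B. u v *\<^sub>R (1::real, v))"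
    then show "\<exists>u. (1, P) = (\<Sum>v\<in>B. u (1::real, v) *\<^sub>R (1::real, v))" by (intro exI[of _ "\<lambda>v. u (snd v)"]) auto
  qed
  also have "\<dots> \<longleftrightarrow> P \<in> affine hull B"
    by (subst affine_hull_finite[OF assms]) (auto simp: prod_eq_iff fst_sum snd_sum)
  finally show ?thesis by blast
qed

lemma lift_space_affine_hull:
  assumes "finite B"
  shows "lift_space (affine hull B) = span ((\<lambda>x. (1::real, x)) ` B)"
  unfolding lift_space_def
proof
  show "span ((\<lambda>x. (1::real, x)) ` (affine hull B)) \<subseteq> span ((\<lambda>x. (1, x)) ` B)"
    by (rule span_minimal) (use mem_affine_hull_iff_lift[OF assms] in auto)
  show "span ((\<lambda>x. (1, x)) ` B) \<subseteq> span ((\<lambda>x. (1, x)) ` (affine hull B))"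
    by (rule span_mono) (use hull_subset in fastforce)
qed

lemma rational_point_clear_denominators:
  assumes "rational_point (x :: real ^ 'n)"
  shows "\<exists>m::nat. 0 < m \<and> integer_point (real m *\<^sub>R (1, x))"
proof -
  have "\<forall>i. \<exists>b::nat. 0 < b \<and> real b * x $ i \<in> \<int>"
  proof
    fix i
    obtain a b where "b \<noteq> (0::nat)" "\<bar>x $ i\<bar> = real a / real b"
      using assms Rats_abs_nat_div_natE[of "x $ i"] unfolding rational_point_def by metis
    then have "real b * x $ i = real a \<or> real b * x $ i = - real a" "0 < b"
      by (auto simp: abs_if field_simps split: if_splits)
    then show "\<exists>b::nat. 0 < b \<and> real b * x $ i \<in> \<int>" by (intro exI[of _ b]) auto
  qed
  then obtain b :: "'n \<Rightarrow> nat" where b: "\<And>i. 0 < b i" "\<And>i. real (b i) * x $ i \<in> \<int>" by metis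
  have "real (\<Prod>i\<in>UNIV. b i) * x $ j \<in> \<int>" for j
  proof -
    have "real (\<Prod>i\<in>UNIV. b i) * x $ j = real (\<Prod>i\<in>UNIV - {j}. b i) * (real (b j) * x $ j)"
      using prod.remove[of UNIV j b] by simp
    then show ?thesis using b(2) by (metis Ints_mult Ints_of_nat)
  qed
  then show ?thesis
    using b(1) by (intro exI[of _ "\<Prod>i\<in>UNIV. b i"]) (auto simp: integer_point_def prod_pos simp del: of_nat_prod)
qed

lemma span_scaled_image:
  fixes f :: "'b \<Rightarrow> 'a::real_vector"
  assumes "\<And>x. x \<in> B \<Longrightarrow> c x \<noteq> 0"
  shows "span ((\<lambda>x. c x *\<^sub>R f x) ` B) = span (f ` B)"
proof
  show "span ((\<lambda>x. c x *\<^sub>R f x) ` B) \<subseteq> span (f ` B)"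
    by (rule span_minimal) (auto intro: span_scale span_base)
  have "f x \<in> span ((\<lambda>x. c x *\<^sub>R f x) ` B)" if "x \<in> B" for x
  proof -
    have "(1 / c x) *\<^sub>R (c x *\<^sub>R f x) \<in> span ((\<lambda>x. c x *\<^sub>R f x) ` B)"
      by (intro span_scale span_base) (use that in auto)
    then show ?thesis using assms[OF that] by simp
  qed
  then show "span (f ` B) \<subseteq> span ((\<lambda>x. c x *\<^sub>R f x) ` B)"
    by (intro span_minimal) auto
qed

text \<open>An affine basis is chosen among the rational points and its denominators are cleared.
  The result is only some independent system of integer points, which is what
  \<open>height_lattice_basis\<close> starts from.\<close>

lemma rat_affine_subspace_lattice:
  fixes L :: "(real ^ 'n) set"
  assumes "rat_affine_subspace d L"
  obtains b where "\<And>i. i < Suc d \<Longrightarrow> integer_point (b i)" "inj_on b {..<Suc d}"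
    "independent (b ` {..<Suc d})" "span (b ` {..<Suc d}) = lift_space L"
proof -
  obtain S where S: "S \<subseteq> {x. rational_point x}" "L = affine hull S" "aff_dim L = int d"
    using assms unfolding rat_affine_subspace_def by auto
  obtain B where B: "B \<subseteq> S" "\<not> affine_dependent B" "affine hull S = affine hull B"
    using affine_basis_exists[of S] by blast
  have fin: "finite B" using B(2) by (rule aff_independent_finite)
  have card: "card B = Suc d"
    using aff_dim_unique[of B S] B S aff_dim_affine_hull[of S] by simp
  have "\<forall>x. \<exists>m::nat. x \<in> B \<longrightarrow> 0 < m \<and> integer_point (real m *\<^sub>R (1, x))"
    using rational_point_clear_denominators B(1) S(1) by blast
  then obtain m :: "real ^ 'n \<Rightarrow> nat" where m: "\<And>x. x \<in> B \<Longrightarrow> 0 < m x"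
    "\<And>x. x \<in> B \<Longrightarrow> integer_point (real (m x) *\<^sub>R (1, x))" by metis
  obtain h where h: "bij_betw h {..<Suc d} B"
    using ex_bij_betw_nat_finite[OF fin] card by (auto simp: atLeast0LessThan)
  define b where "b i = real (m (h i)) *\<^sub>R (1::real, h i)" for i
  have bimg: "b ` {..<Suc d} = (\<lambda>x. real (m x) *\<^sub>R (1::real, x)) ` B"
    using h unfolding b_def bij_betw_def by (metis (no_types, lifting) image_cong image_image)
  have sp: "span (b ` {..<Suc d}) = lift_space L"
    unfolding bimg S(2) B(3) lift_space_affine_hull[OF fin]
    by (rule span_scaled_image) (use m in fastforce)
  have "inj_on (\<lambda>x::real ^ 'n. (1::real, x)) B" by (auto intro: inj_onI)
  then have dim: "dim (lift_space L) = Suc d"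
    unfolding S(2) B(3) lift_space_affine_hull[OF fin] dim_span
    using B(2) independent_lift_iff[OF fin] card dim_eq_card_independent card_image by metis
  have le: "card (b ` {..<Suc d}) \<le> Suc d" using card_image_le[of "{..<Suc d}" b] by simp
  have ind: "independent (b ` {..<Suc d})"
    by (rule independent_of_card_le_dim[OF sp]) (use le dim in auto)
  then have "card (b ` {..<Suc d}) = Suc d"
    using dim_eq_card_independent[OF ind] dim_span[of "b ` {..<Suc d}"] sp dim by simp
  then have inj: "inj_on b {..<Suc d}" by (intro eq_card_imp_inj_on) auto
  have "h i \<in> B" if "i < Suc d" for i using h that by (auto simp: bij_betw_def)
  then show ?thesis
    by (intro that[of b] inj ind sp) (auto simp: b_def m(2) simp del: scaleR_Pair)
qed

text \<open>The converse passage: integer vectors are projected to the affine chart with first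
  coordinate 1. This is one reason why the signs of first coordinates are watched throughout the
  construction.\<close>

lemma rat_affine_subspace_of_lattice:
  fixes T :: "(real \<times> (real ^ 'n)) set"
  assumes T: "finite T" "independent T" "card T = Suc d"
    and int: "\<And>u. u \<in> T \<Longrightarrow> integer_point u" and pos: "\<And>u. u \<in> T \<Longrightarrow> 0 < fst u"
  obtains L where "rat_affine_subspace d L" "lift_space L = span T"
    "\<And>P. (1, P) \<in> span T \<Longrightarrow> P \<in> L"
proof -
  define f :: "real \<times> (real ^ 'n) \<Rightarrow> real ^ 'n" where "f u = (1 / fst u) *\<^sub>R snd u" for u
  have lift: "(1, f u) = (1 / fst u) *\<^sub>R u" if "u \<in> T" for u
    using pos[OF that] by (simp add: f_def prod_eq_iff)
  have "(\<lambda>x. (1::real, x)) ` (f ` T) = (\<lambda>u. (1 / fst u) *\<^sub>R u) ` T"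
    unfolding image_image by (rule image_cong) (use lift in auto)
  then have sp: "span ((\<lambda>x. (1::real, x)) ` (f ` T)) = span T"
    using span_scaled_image[of T "\<lambda>u. 1 / fst u" "\<lambda>u. u"] pos by (metis image_ident less_irrefl divide_eq_0_iff zero_neq_one)
  have dim: "dim (span T) = Suc d" using T by (simp add: dim_eq_card_independent)
  have cle: "card ((\<lambda>x. (1::real, x)) ` (f ` T)) \<le> Suc d"
    unfolding T(3)[symmetric] image_image using T(1) by (rule card_image_le)
  have ind: "independent ((\<lambda>x. (1::real, x)) ` (f ` T))"
    by (rule independent_of_card_le_dim[OF sp]) (use cle dim T in auto)
  then have naff: "\<not> affine_dependent (f ` T)" using independent_lift_iff[of "f ` T"] T by simp
  have "card ((\<lambda>x. (1::real, x)) ` (f ` T)) = Suc d"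
    using dim_eq_card_independent[OF ind] sp dim dim_span by metis
  then have "card (f ` T) = Suc d" by (subst (asm) card_image) (auto intro: inj_onI)
  then have "aff_dim (affine hull (f ` T)) = int d"
    using aff_dim_unique[of "f ` T" "f ` T"] naff by (simp add: aff_dim_affine_hull)
  moreover have "rational_point (f u)" if "u \<in> T" for u
    using int[OF that] unfolding rational_point_def integer_point_def f_def
    by (auto intro!: Rats_divide dest: subsetD[OF Ints_subset_Rats])
  ultimately have "rat_affine_subspace d (affine hull (f ` T))"
    unfolding rat_affine_subspace_def by blast
  moreover have "lift_space (affine hull (f ` T)) = span T"
    using lift_space_affine_hull[of "f ` T"] T sp by simp
  moreover have "P \<in> affine hull (f ` T)" if "(1, P) \<in> span T" for P
    using mem_affine_hull_iff_lift[of "f ` T" P] T sp that by simp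
  ultimately show ?thesis by (rule that)
qed

section \<open>The diagonal flow\<close>

definition flow :: "real \<Rightarrow> real ^ 'n \<Rightarrow> real \<times> (real ^ 'n) \<Rightarrow> real \<times> (real ^ 'n)" where
  "flow t \<theta> x = (exp (- real CARD('n) * t) * fst x, exp t *\<^sub>R (snd x - fst x *\<^sub>R \<theta>))"

lemma linear_flow: "linear (flow t \<theta>)"
  by (rule linearI) (auto simp: flow_def algebra_simps)

lemmas flow_add = linear_add[OF linear_flow]
  and flow_diff = linear_diff[OF linear_flow]
  and flow_scaleR = linear_scale[OF linear_flow]
  and flow_sum = linear_sum[OF linear_flow]

lemma norm_flow_le:
  "norm (flow t \<theta> (x :: real \<times> (real ^ 'n))) \<le>
    exp (- real CARD('n) * t) * \<bar>fst x\<bar> + exp t * norm (snd x - fst x *\<^sub>R \<theta>)"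
  unfolding flow_def by (rule order_trans[OF norm_Pair_le]) (simp add: abs_mult)

lemma flow_fst_le: "\<bar>fst x\<bar> \<le> exp (real CARD('n) * t) * norm (flow t \<theta> (x :: real \<times> (real ^ 'n)))"
proof -
  have "exp (- real CARD('n) * t) * \<bar>fst x\<bar> \<le> norm (flow t \<theta> x)"
    using norm_fst_le[of "fst (flow t \<theta> x)" "snd (flow t \<theta> x)"] by (simp add: flow_def abs_mult)
  then show ?thesis by (simp add: exp_minus field_simps)
qed

lemma flow_snd_le: "norm (snd x - fst x *\<^sub>R \<theta>) \<le> exp (- t) * norm (flow t \<theta> x)"
proof -
  have "exp t * norm (snd x - fst x *\<^sub>R \<theta>) \<le> norm (flow t \<theta> x)"
    using norm_snd_le[of "snd (flow t \<theta> x)" "fst (flow t \<theta> x)"] by (simp add: flow_def)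
  then show ?thesis by (simp add: exp_minus field_simps)
qed

text \<open>All weights of the flow are at most 1, so no vector grows faster than
  \<open>exp (t' - t)\<close>.\<close>

lemma norm_flow_later:
  assumes "t \<le> t'"
  shows "norm (flow t' \<theta> (x :: real \<times> (real ^ 'n))) \<le> exp (t' - t) * norm (flow t \<theta> x)"
proof -
  define a where "a = exp (- real CARD('n) * t) * fst x"
  define b where "b = exp t *\<^sub>R (snd x - fst x *\<^sub>R \<theta>)"
  let ?s = "t' - t"
  have f: "flow t' \<theta> x = (exp (- real CARD('n) * ?s) * a, exp ?s *\<^sub>R b)"
    by (simp add: flow_def a_def b_def flip: exp_add) (simp add: algebra_simps flip: exp_add)
  have "exp (- real CARD('n) * ?s) \<le> exp ?s" using assms by (simp add: mult_nonneg_nonneg order_trans[of _ 0])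
  then have "norm (exp (- real CARD('n) * ?s) * a) \<le> norm (exp ?s * a)"
    by (simp add: abs_mult mult_right_mono)
  then have "norm (flow t' \<theta> x) \<le> norm (exp ?s *\<^sub>R (a, b))"
    unfolding f by (simp add: norm_Pair abs_le_square_iff)
  then show ?thesis
    by (simp only: norm_scaleR flow_def[of t] a_def b_def abs_exp_cancel)
qed

text \<open>Moving \<theta> shears along the first coordinate, which is at most
  \<open>exp (n t)\<close> times the norm at time t. Hence a move by \<open>exp (-(n + 1) t)\<close>
  changes all norms at time t by a bounded factor only; this is the natural radius for the balls of
  the construction.\<close>

lemma norm_flow_perturb:
  "norm (flow t \<theta>' (x :: real \<times> (real ^ 'n))) \<le>
    (1 + exp (real (Suc CARD('n)) * t) * norm (\<theta> - \<theta>')) * norm (flow t \<theta> x)"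
proof -
  have "flow t \<theta>' x = flow t \<theta> x + (0, (exp t * fst x) *\<^sub>R (\<theta> - \<theta>'))"
    by (simp add: flow_def algebra_simps)
  then have "norm (flow t \<theta>' x) \<le> norm (flow t \<theta> x) + exp t * \<bar>fst x\<bar> * norm (\<theta> - \<theta>')"
    using norm_triangle_ineq[of "flow t \<theta> x" "(0, (exp t * fst x) *\<^sub>R (\<theta> - \<theta>'))"]
    by (simp add: norm_Pair abs_mult)
  also have "exp t * \<bar>fst x\<bar> * norm (\<theta> - \<theta>') \<le>
      exp t * (exp (real CARD('n) * t) * norm (flow t \<theta> x)) * norm (\<theta> - \<theta>')"
    by (intro mult_left_mono mult_right_mono flow_fst_le) auto
  also have "norm (flow t \<theta> x) + \<dots> = (1 + exp (real (Suc CARD('n)) * t) * norm (\<theta> - \<theta>')) * norm (flow t \<theta> x)"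
    by (simp add: algebra_simps exp_add)
  finally show ?thesis by simp
qed

lemma gram_det_orthogonal:
  fixes b :: "nat \<Rightarrow> 'a::real_inner"
  assumes "\<And>i j. i < j \<Longrightarrow> j < k \<Longrightarrow> inner (b i) (b j) = 0"
  shows "gram_det k b = (\<Prod>i<k. (norm (b i))\<^sup>2)"
  using assms
proof (induction k)
  case (Suc k)
  then show ?case by (subst gram_det_orthogonal_Suc) auto
qed simp

text \<open>The weight -n and the n weights 1 cancel, so the flow preserves volume. The contribution
  of \<theta> to the image of (1, 0) is removed by a shear, after which the images are
  orthogonal.\<close>

lemma gram_det_flow_standard_basis:
  fixes e :: "nat \<Rightarrow> real \<times> (real ^ 'n)"
  assumes f: "bij_betw f {..<CARD('n)} UNIV"
    and e: "\<And>i. e i = (if i < CARD('n) then (0, axis (f i) 1) else (1, 0))"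
  shows "gram_det (Suc CARD('n)) (\<lambda>i. flow t \<theta> (e i)) = 1"
proof -
  let ?n = "CARD('n)"
  define b where "b i = flow t \<theta> (e i)" for i
  have bi: "b i = (0, exp t *\<^sub>R axis (f i) 1)" if "i < ?n" for i
    using that by (simp add: b_def e flow_def)
  have bn: "b ?n = (exp (- real ?n * t), - (exp t *\<^sub>R \<theta>))"
    by (simp add: b_def e flow_def)
  define u where "u = (0::real, - (exp t *\<^sub>R \<theta>))"
  have "(\<Sum>i<?n. (- (\<theta> $ f i)) *\<^sub>R b i) = (\<Sum>i<?n. (0, (- (exp t * (\<theta> $ f i))) *\<^sub>R axis (f i) 1))"
    by (intro sum.cong refl) (simp add: bi mult.commute)
  also have "\<dots> = (\<Sum>j\<in>UNIV. (0, (- (exp t * (\<theta> $ j))) *\<^sub>R axis j 1))"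
    by (rule sum.reindex_bij_betw[OF f])
  also have "\<dots> = u"
    by (simp add: u_def prod_eq_iff fst_sum snd_sum Finite_Cartesian_Product.vec_eq_iff axis_def if_distrib cong: if_cong)
  finally have "u \<in> span (b ` {..<?n})"
    by (metis (no_types, lifting) span_sum span_scale span_base imageI)
  then have "gram_det (Suc ?n) b = gram_det (Suc ?n) (b(?n := b ?n - u))"
    using gram_det_shift by metis
  also have "b ?n - u = (exp (- real ?n * t), 0)" by (simp add: bn u_def)
  also have "gram_det (Suc ?n) (b(?n := (exp (- real ?n * t), 0)))
      = (\<Prod>i<Suc ?n. (norm ((b(?n := (exp (- real ?n * t), 0))) i))\<^sup>2)"
  proof (rule gram_det_orthogonal)
    fix i j assume ij: "i < j" "j < Suc ?n"
    show "inner ((b(?n := (exp (- real ?n * t), 0))) i) ((b(?n := (exp (- real ?n * t), 0))) j) = 0"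
    proof (cases "j = ?n")
      case True
      then show ?thesis using ij by (simp add: bi)
    next
      case False
      then have "f i \<noteq> f j"
        using inj_onD[OF bij_betw_imp_inj_on[OF f], of i j] ij by auto
      then show ?thesis using ij False by (simp add: bi inner_axis_axis)
    qed
  qed
  also have "\<dots> = (\<Prod>i<?n. (exp t)\<^sup>2) * (exp (- real ?n * t))\<^sup>2"
    by (simp add: bi norm_Pair)
  also have "\<dots> = 1" by (simp flip: exp_of_nat_mult exp_add)
  finally show ?thesis by (simp add: b_def)
qed

lemma gram_det_flow:
  fixes b :: "nat \<Rightarrow> real \<times> (real ^ 'n)"
  shows "gram_det (Suc CARD('n)) (\<lambda>i. flow t \<theta> (b i)) = gram_det (Suc CARD('n)) b"
proof -
  let ?n = "CARD('n)"
  obtain f :: "nat \<Rightarrow> 'n" where f: "bij_betw f {..<?n} UNIV"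
    using ex_bij_betw_nat_finite[of "UNIV :: 'n set"] by (auto simp: atLeast0LessThan)
  define e :: "nat \<Rightarrow> real \<times> (real ^ 'n)" where "e i = (if i < ?n then (0, axis (f i) 1) else (1, 0))" for i
  define C where "C i j = (if j < ?n then snd (b i) $ f j else fst (b i))" for i j
  have b: "b i = (\<Sum>j<Suc ?n. C i j *\<^sub>R e j)" for i
  proof -
    have "(\<Sum>j<?n. C i j *\<^sub>R e j) = (\<Sum>j<?n. (0, (snd (b i) $ f j) *\<^sub>R axis (f j) 1))"
      by (intro sum.cong refl) (simp add: C_def e_def)
    also have "\<dots> = (\<Sum>j\<in>UNIV. (0, (snd (b i) $ j) *\<^sub>R axis j 1))"
      by (rule sum.reindex_bij_betw[OF f])
    also have "\<dots> = (0, snd (b i))"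
      by (simp add: prod_eq_iff fst_sum snd_sum Finite_Cartesian_Product.vec_eq_iff axis_def if_distrib cong: if_cong)
    finally show ?thesis by (simp add: C_def e_def prod_eq_iff)
  qed
  have "flow t \<theta> (b i) = (\<Sum>j<Suc ?n. C i j *\<^sub>R flow t \<theta> (e j))" for i
    unfolding b[of i] by (simp only: flow_sum flow_scaleR)
  then have "gram_det (Suc ?n) (\<lambda>i. flow t \<theta> (b i)) = gram_det (Suc ?n) (\<lambda>i. \<Sum>j<Suc ?n. C i j *\<^sub>R flow t \<theta> (e j))"
    by simp
  also have "\<dots> = (Determinant.det (Matrix.mat (Suc ?n) (Suc ?n) (\<lambda>(i, j). C i j)))\<^sup>2"
    unfolding gram_det_linear_combination using gram_det_flow_standard_basis[OF f e_def] by simp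
  \<comment> \<open>\<open>flow 0 0\<close> is the identity, so the formula in terms of the
    coefficient matrix also computes the volume of b itself.\<close>
  also have "\<dots> = gram_det (Suc ?n) (\<lambda>i. \<Sum>j<Suc ?n. C i j *\<^sub>R flow 0 0 (e j))"
    unfolding gram_det_linear_combination using gram_det_flow_standard_basis[OF f e_def, of 0 0] by simp
  also have "(\<lambda>i. \<Sum>j<Suc ?n. C i j *\<^sub>R flow 0 0 (e j)) = b"
    using b by (auto simp: flow_def)
  finally show ?thesis .
qed

section \<open>Lower bounds for covolumes\<close>

text \<open>The given independent points are completed by members Y of X to a basis of the whole
  space. It consists of integer points, so its volume is at least 1; the flow preserves it, and
  Hadamard's inequality charges each added vector with its norm. Short vectors X thus force a large
  covolume on every rational subspace.\<close>

lemma covolume_lower_bound: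
  fixes b :: "nat \<Rightarrow> real \<times> (real ^ 'n)"
  assumes b: "\<And>i. i < k \<Longrightarrow> integer_point (b i)" "inj_on b {..<k}" "independent (b ` {..<k})"
    and X: "finite X" "span X = UNIV" "\<And>x. x \<in> X \<Longrightarrow> integer_point x"
  obtains Y where "Y \<subseteq> X" "card Y = Suc CARD('n) - k"
    "1 \<le> gram_det k (\<lambda>i. flow t \<theta> (b i)) * (\<Prod>y\<in>Y. norm (flow t \<theta> y))\<^sup>2"
proof -
  let ?N = "Suc CARD('n)"
  obtain B where B: "b ` {..<k} \<subseteq> B" "B \<subseteq> b ` {..<k} \<union> X" "independent B" "b ` {..<k} \<union> X \<subseteq> span B"
    using maximal_independent_subset_extend[of "b ` {..<k}" "b ` {..<k} \<union> X"] b(3) by auto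
  have fB: "finite B" using B(2) X(1) finite_subset by blast
  have "span B = UNIV" using B(4) X(2) span_minimal[of X "span B"] by auto
  then have cB: "card B = ?N"
    using dim_eq_card_independent[OF B(3)] dim_span[of B] dim_UNIV[where 'a = "real \<times> (real ^ 'n)"] by simp
  define Y where "Y = B - b ` {..<k}"
  have cY: "card Y = ?N - k"
    using B(1) b(2) cB fB by (simp add: Y_def card_Diff_subset card_image)
  have kN: "k \<le> ?N" using card_mono[OF fB B(1)] b(2) cB by (simp add: card_image)
  obtain h where h: "bij_betw h {..<?N - k} Y"
    using ex_bij_betw_nat_finite[of Y] fB cY by (auto simp: atLeast0LessThan Y_def)
  define a where "a i = (if i < k then b i else h (i - k))" for i
  have "a ` {..<?N} = B"
  proof -
    have "{..<?N} = {..<k} \<union> {k..<?N}" using kN by auto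
    moreover have "a ` {..<k} = b ` {..<k}" by (auto simp: a_def)
    moreover have "a ` {k..<?N} = h ` {..<?N - k}"
    proof -
      have "{..<?N - k} = (\<lambda>i. i - k) ` {k..<?N}" using image_minus_const_atLeastLessThan_nat[of k k ?N]
        by (auto simp: image_iff)
      then show ?thesis by (auto simp: a_def image_image)
    qed
    ultimately show ?thesis using h B(1) by (auto simp: image_Un bij_betw_def Y_def)
  qed
  then have a: "inj_on a {..<?N}" "independent (a ` {..<?N})"
    using cB B(3) by (auto intro: eq_card_imp_inj_on)
  have "integer_point (a i)" if "i < ?N" for i
  proof -
    have "h (i - k) \<in> Y" if "\<not> i < k"
      using h that \<open>i < ?N\<close> by (auto simp: bij_betw_def)
    moreover have "integer_point y" if "y \<in> Y" for y
      using that B(2) X(3) unfolding Y_def by blast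
    ultimately show ?thesis using b(1) by (simp add: a_def)
  qed
  then have "1 \<le> gram_det ?N a" using a by (rule gram_det_integer_points_ge_1)
  also have "\<dots> = gram_det (k + (?N - k)) (\<lambda>i. flow t \<theta> (a i))"
    using kN by (simp add: gram_det_flow)
  also have "\<dots> \<le> gram_det k (\<lambda>i. flow t \<theta> (a i)) * (\<Prod>i<?N - k. (norm (flow t \<theta> (a (k + i))))\<^sup>2)"
    by (rule gram_det_le_prod)
  also have "gram_det k (\<lambda>i. flow t \<theta> (a i)) = gram_det k (\<lambda>i. flow t \<theta> (b i))"
    by (rule gram_det_cong) (simp add: a_def)
  also have "(\<Prod>i<?N - k. (norm (flow t \<theta> (a (k + i))))\<^sup>2) = (\<Prod>i<?N - k. (norm (flow t \<theta> (h i)))\<^sup>2)"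
    by (simp add: a_def)
  also have "\<dots> = (\<Prod>y\<in>Y. (norm (flow t \<theta> y))\<^sup>2)"
    by (rule prod.reindex_bij_betw[OF h])
  also have "\<dots> = (\<Prod>y\<in>Y. norm (flow t \<theta> y))\<^sup>2" by (simp add: prod_power_distrib)
  finally show ?thesis
    by (intro that[of Y] cY) (use B(2) in \<open>auto simp: Y_def\<close>)
qed

lemma norm_flow_le_operator:
  fixes x :: "real \<times> (real ^ 'n)"
  assumes "0 \<le> t"
  shows "norm (flow t \<theta> x) \<le> (2 + norm \<theta>) * exp t * norm x"
proof -
  have f: "\<bar>fst x\<bar> \<le> norm x" "norm (snd x) \<le> norm x"
    using norm_fst_le[of "fst x" "snd x"] norm_snd_le[of "snd x" "fst x"] by auto
  have "exp (- real CARD('n) * t) \<le> exp t" using assms by (simp add: order_trans[of _ 0])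
  then have "exp (- real CARD('n) * t) * \<bar>fst x\<bar> \<le> exp t * norm x"
    using f by (intro mult_mono) auto
  moreover have "norm (snd x - fst x *\<^sub>R \<theta>) \<le> norm x + norm x * norm \<theta>"
    using norm_triangle_ineq4[of "snd x" "fst x *\<^sub>R \<theta>"] f mult_right_mono[OF f(1), of "norm \<theta>"] by simp
  then have "exp t * norm (snd x - fst x *\<^sub>R \<theta>) \<le> exp t * (norm x + norm x * norm \<theta>)"
    by (rule mult_left_mono) simp
  ultimately show ?thesis using norm_flow_le[of t \<theta> x] by (simp add: algebra_simps)
qed

text \<open>The opposite estimate: a subspace of small height through a point P near \<theta> has
  small covolume at time t. Along (1, P) the flow is almost as contracting as along (1, \<theta>),
  and on each of the e remaining orthogonal directions it expands by at most a multiple of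
  \<open>exp t\<close>.\<close>

lemma covolume_flow_upper_bound:
  fixes b :: "nat \<Rightarrow> real \<times> (real ^ 'n)"
  assumes b: "inj_on b {..<Suc e}" "independent (b ` {..<Suc e})"
    and P: "(1, P) \<in> span (b ` {..<Suc e})" and t: "0 \<le> t"
  shows "gram_det (Suc e) (\<lambda>i. flow t \<theta> (b i)) \<le> gram_det (Suc e) b *
    ((exp (- real CARD('n) * t) + exp t * dist \<theta> P) * ((2 + norm \<theta>) * exp t) ^ e)\<^sup>2"
proof -
  let ?V = "span (b ` {..<Suc e})"
  define f0 where "f0 = (1::real, P)"
  define W where "W = {v \<in> ?V. inner v f0 = 0}"
  have "subspace W" unfolding W_def
    by (rule subspaceI) (simp_all only: mem_Collect_eq span_0 span_add span_scale inner_add_left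
        inner_scaleR_left inner_zero_left mult_zero_right add_0)
  then obtain B where B: "B \<subseteq> W" "pairwise orthogonal B" "\<And>x. x \<in> B \<Longrightarrow> norm x = 1"
    "independent B" "span B = W"
    using orthonormal_basis_subspace[of W] by metis
  have fB: "finite B" using B(4) by (rule independent_imp_finite)
  have f0: "f0 \<noteq> 0" "1 \<le> (norm f0)\<^sup>2" by (auto simp: f0_def norm_Pair prod_eq_iff)
  have f0B: "f0 \<notin> B" using B(1) f0 by (auto simp: W_def)
  have spV: "span (insert f0 B) = ?V"
  proof
    show "span (insert f0 B) \<subseteq> ?V"
      by (rule span_minimal) (use B(1) P in \<open>auto simp: W_def f0_def\<close>)
    show "?V \<subseteq> span (insert f0 B)"
    proof
      fix v assume v: "v \<in> ?V"
      let ?c = "inner v f0 / inner f0 f0"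
      have "v - ?c *\<^sub>R f0 \<in> W"
        using v P f0 by (auto simp: W_def f0_def[symmetric] span_diff span_scale inner_diff_left)
      then have "v - ?c *\<^sub>R f0 \<in> span (insert f0 B)"
        using B(5) span_mono[of B "insert f0 B"] by auto
      then have "(v - ?c *\<^sub>R f0) + ?c *\<^sub>R f0 \<in> span (insert f0 B)"
        by (rule span_add) (intro span_scale span_base, simp)
      then show "v \<in> span (insert f0 B)" by simp
    qed
  qed
  have "pairwise orthogonal (insert f0 B)"
    using B(1,2) unfolding pairwise_insert by (auto simp: W_def Linear_Algebra.orthogonal_def inner_commute)
  then have indB: "independent (insert f0 B)"
    by (rule pairwise_orthogonal_independent) (use f0(1) B(3) norm_zero zero_neq_one in \<open>metis insertE\<close>)
  have "card (insert f0 B) = Suc e"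
    using dim_eq_card_independent[OF indB] spV dim_eq_card_independent[OF b(2)] b(1) dim_span
    by (metis card_image card_lessThan)
  then have cB: "card B = e" using fB f0B by simp
  obtain h where h: "bij_betw h {..<e} B"
    using ex_bij_betw_nat_finite[OF fB] cB by (auto simp: atLeast0LessThan)
  define f where "f i = (case i of 0 \<Rightarrow> f0 | Suc j \<Rightarrow> h j)" for i
  have hB: "h i \<in> B" if "i < e" for i using h that by (auto simp: bij_betw_def)
  have fimg: "f ` {..<Suc e} = insert f0 B"
    using h unfolding lessThan_Suc_eq_insert_0 by (auto simp: f_def image_image bij_betw_def)
  have "\<exists>C. b i = (\<Sum>j<Suc e. C j *\<^sub>R f j)" if "i < Suc e" for i
    by (rule span_image_lessThan) (use that in \<open>auto simp: fimg spV intro: span_base\<close>)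
  then obtain C where C: "\<And>i. i < Suc e \<Longrightarrow> b i = (\<Sum>j<Suc e. C i j *\<^sub>R f j)" by metis
  let ?D = "(Determinant.det (Matrix.mat (Suc e) (Suc e) (\<lambda>(i, j). C i j)))\<^sup>2"
  have gb: "gram_det (Suc e) b = ?D * gram_det (Suc e) f"
    unfolding gram_det_linear_combination[symmetric] by (rule gram_det_cong) (rule C)
  have "gram_det (Suc e) f = (\<Prod>i<Suc e. (norm (f i))\<^sup>2)"
  proof (rule gram_det_orthogonal)
    fix i j assume ij: "i < j" "j < Suc e"
    then obtain j' where j': "j = Suc j'" "j' < e" by (cases j) auto
    show "inner (f i) (f j) = 0"
    proof (cases i)
      case 0
      then show ?thesis using B(1) hB[OF j'(2)] j' by (auto simp: f_def W_def inner_commute)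
    next
      case (Suc i')
      then have "h i' \<noteq> h j'" using h ij j' by (auto simp: bij_betw_def inj_on_def)
      then show ?thesis using B(2) hB[of i'] hB[of j'] ij j' Suc
        by (auto simp: f_def pairwise_def Linear_Algebra.orthogonal_def)
    qed
  qed
  also have "\<dots> = (norm f0)\<^sup>2 * (\<Prod>i<e. (norm (h i))\<^sup>2)"
    by (simp only: prod.lessThan_Suc_shift) (simp add: f_def)
  also have "(\<Prod>i<e. (norm (h i))\<^sup>2) = 1" using B(3) hB by (intro prod.neutral) auto
  finally have "1 \<le> gram_det (Suc e) f" using f0 by simp
  \<comment> \<open>The orthogonal frame has volume at least 1, because \<open>f0\<close> has norm
    at least 1; so the factor between the two systems is at most the squared volume of b.\<close>
  then have D: "?D \<le> gram_det (Suc e) b" unfolding gb by (simp add: mult_le_cancel_left1)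
  have "flow t \<theta> (b i) = (\<Sum>j<Suc e. C i j *\<^sub>R flow t \<theta> (f j))" if "i < Suc e" for i
    unfolding C[OF that] by (simp only: flow_sum flow_scaleR)
  then have "gram_det (Suc e) (\<lambda>i. flow t \<theta> (b i)) = ?D * gram_det (Suc e) (\<lambda>i. flow t \<theta> (f i))"
    unfolding gram_det_linear_combination[symmetric] by (intro gram_det_cong)
  also have "\<dots> \<le> gram_det (Suc e) b * gram_det (Suc e) (\<lambda>i. flow t \<theta> (f i))"
    using D gram_det_nonneg by (rule mult_right_mono)
  also have "gram_det (Suc e) (\<lambda>i. flow t \<theta> (f i)) \<le> (\<Prod>i<Suc e. (norm (flow t \<theta> (f i)))\<^sup>2)"
    using gram_det_le_prod[of 0 "Suc e" "\<lambda>i. flow t \<theta> (f i)"] by simp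
  also have "\<dots> = (norm (flow t \<theta> f0))\<^sup>2 * (\<Prod>i<e. (norm (flow t \<theta> (h i)))\<^sup>2)"
    by (simp only: prod.lessThan_Suc_shift) (simp add: f_def)
  also have "\<dots> \<le> (exp (- real CARD('n) * t) + exp t * dist \<theta> P)\<^sup>2 * (\<Prod>i<e. ((2 + norm \<theta>) * exp t)\<^sup>2)"
  proof (intro mult_mono power_mono prod_mono conjI)
    show "norm (flow t \<theta> f0) \<le> exp (- real CARD('n) * t) + exp t * dist \<theta> P"
      using norm_flow_le[of t \<theta> f0] by (simp add: f0_def dist_norm norm_minus_commute)
    show "norm (flow t \<theta> (h i)) \<le> (2 + norm \<theta>) * exp t" if "i \<in> {..<e}" for i
      using norm_flow_le_operator[OF t, of \<theta> "h i"] B(3)[OF hB[of i]] that by simp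
  qed (auto intro: prod_nonneg)
  also have "\<dots> = ((exp (- real CARD('n) * t) + exp t * dist \<theta> P) * ((2 + norm \<theta>) * exp t) ^ e)\<^sup>2"
    by (simp add: power_mult_distrib flip: power_mult) (simp add: mult.commute)
  finally show ?thesis by (simp add: mult_left_mono gram_det_nonneg)
qed

text \<open>Two blocks of vectors of sizes \<open>exp (-(n-d)/(d+1) h)\<close> and \<open>exp h\<close>: the product of all
  sizes is about 1, which makes the system a reduced basis up to the loss \<open>exp (\<epsilon> t)\<close>.\<close>

definition split_basis :: "real \<Rightarrow> real ^ 'n \<Rightarrow> nat \<Rightarrow> real \<Rightarrow> real \<Rightarrow> bool" where
  "split_basis t \<theta> d h \<epsilon> \<longleftrightarrow> (\<exists>X1 X2. finite X1 \<and> finite X2 \<and> card X1 \<le> Suc d \<and> card X2 \<le> CARD('n) - d \<and>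
     span (X1 \<union> X2) = UNIV \<and> (\<forall>x\<in>X1 \<union> X2. integer_point x) \<and>
     (\<forall>x\<in>X1. norm (flow t \<theta> x) \<le> exp (- (real CARD('n) - real d) / (real d + 1) * h + \<epsilon> * t)) \<and>
     (\<forall>x\<in>X2. norm (flow t \<theta> x) \<le> exp (h + \<epsilon> * t)))"

text \<open>To make a product of n - e sizes large, one takes as many long vectors as there are. If
  d \<le> e, all of them may be long; otherwise n - d are long and d - e are short. The hypotheses
  on S are these two values.\<close>

lemma split_product_le:
  fixes f :: "'a \<Rightarrow> real"
  assumes fin: "finite X1" "finite X2" and cX2: "card X2 \<le> n - d" and d: "d < n" and e: "e < n"
    and Y: "Y \<subseteq> X1 \<union> X2" "card Y = n - e" and h: "0 \<le> h"
    and f: "\<And>x. x \<in> Y \<Longrightarrow> 0 \<le> f x"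
    and f1: "\<And>x. x \<in> X1 \<Longrightarrow> f x \<le> exp (- (real n - real d) / (real d + 1) * h + c)"
    and f2: "\<And>x. x \<in> X2 \<Longrightarrow> f x \<le> exp (h + c)"
    and S1: "d \<le> e \<Longrightarrow> (real n - real e) * h \<le> S"
    and S2: "e < d \<Longrightarrow> (real n - real d) * (real e + 1) / (real d + 1) * h \<le> S"
  shows "prod f Y \<le> exp (S + (real n - real e) * c)"
proof -
  define \<alpha> where "\<alpha> = - (real n - real d) / (real d + 1) * h"
  have fY: "finite Y" using Y(1) fin finite_subset by blast
  define i j where "i = card (Y \<inter> X1)" and "j = card (Y - X1)"
  have ij: "i + j = n - e" unfolding i_def j_def Y(2)[symmetric]
    using card_Int_Diff[OF fY, of X1] by simp
  have "j \<le> card X2" unfolding j_def using Y(1) fin by (intro card_mono) auto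
  then have j: "j \<le> n - d" using cX2 by simp
  have "prod f Y = prod f (Y \<inter> X1) * prod f (Y - X1)"
    using prod.Int_Diff[OF fY, of f X1] .
  also have "\<dots> \<le> (\<Prod>x\<in>Y \<inter> X1. exp (\<alpha> + c)) * (\<Prod>x\<in>Y - X1. exp (h + c))"
    unfolding \<alpha>_def using f f1 f2 Y(1) by (intro mult_mono prod_mono prod_nonneg conjI) auto
  also have "\<dots> = exp (real i * (\<alpha> + c) + real j * (h + c))"
    by (simp only: i_def j_def prod_constant exp_of_nat_mult exp_add)
  also have "real i * (\<alpha> + c) + real j * (h + c) = (real i * \<alpha> + real j * h) + (real n - real e) * c"
  proof -
    have "real n - real e = real i + real j" using ij e by simp
    then show ?thesis by (simp add: algebra_simps)
  qed
  also have "real i * \<alpha> + real j * h \<le> S"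
  proof (cases "d \<le> e")
    case True
    have "real i * \<alpha> \<le> 0" using h d by (auto simp: \<alpha>_def mult_nonneg_nonpos divide_nonpos_pos mult_nonpos_nonneg)
    moreover have "real j * h \<le> (real n - real e) * h" using ij e h by (intro mult_right_mono) auto
    ultimately show ?thesis using S1[OF True] by linarith
  next
    case False
    \<comment> \<open>r counts the long vectors that were left out. Each is replaced by a short one,
      which lowers the exponent by \<open>(n + 1) / (d + 1) * h\<close>.\<close>
    define r where "r = n - d - j"
    have r: "real j = real n - real d - real r" "real i = real d - real e + real r"
      using ij j False d e by (auto simp: r_def)
    have "real i * \<alpha> + real j * h = (real n - real d) * (real e + 1) / (real d + 1) * h - real r * ((real n + 1) / (real d + 1) * h)"
      unfolding r \<alpha>_def by (simp add: divide_simps) (simp add: algebra_simps)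
    moreover have "0 \<le> real r * ((real n + 1) / (real d + 1) * h)" using h by simp
    ultimately show ?thesis using S2 False by linarith
  qed
  finally show ?thesis by simp
qed

text \<open>The two estimates for the covolume of L at time t, joined. The upper one is applied to
  the point of L nearest to \<theta>, which turns its distance into
  \<open>infdist \<theta> L\<close>.\<close>

lemma height_dist_lower_bound:
  fixes \<theta> :: "real ^ 'n"
  assumes L: "rat_affine_subspace e L" and e: "e < CARD('n)" and d: "d < CARD('n)"
    and sb: "split_basis t \<theta> d h \<epsilon>" and t: "0 \<le> t" and h: "0 \<le> h"
    and S1: "d \<le> e \<Longrightarrow> (real CARD('n) - real e) * h \<le> S"
    and S2: "e < d \<Longrightarrow> (real CARD('n) - real d) * (real e + 1) / (real d + 1) * h \<le> S"
  shows "1 \<le> height L * (exp (- real CARD('n) * t) + exp t * infdist \<theta> L) *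
    ((2 + norm \<theta>) * exp t) ^ e * exp (S + (real CARD('n) - real e) * (\<epsilon> * t))"
proof -
  obtain b0 where b0: "\<And>i. i < Suc e \<Longrightarrow> integer_point (b0 i)" "inj_on b0 {..<Suc e}"
    "independent (b0 ` {..<Suc e})" "span (b0 ` {..<Suc e}) = lift_space L"
    using rat_affine_subspace_lattice[OF L] by metis
  obtain b where b: "\<And>i. i < Suc e \<Longrightarrow> integer_point (b i)" "inj_on b {..<Suc e}"
    "independent (b ` {..<Suc e})" "span (b ` {..<Suc e}) = lift_space L"
    "height L = sqrt (gram_det (Suc e) b)"
    using height_lattice_basis[OF b0] by metis
  have "closed L" "L \<noteq> {}"
    using L unfolding rat_affine_subspace_def by (auto simp: aff_dim_empty[symmetric])
  then obtain P where P: "P \<in> L" "infdist \<theta> L = dist \<theta> P"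
    using infdist_attains_inf[of L \<theta>] by metis
  then have PV: "(1, P) \<in> span (b ` {..<Suc e})"
    unfolding b(4) lift_space_def by (intro span_base) auto
  obtain X1 X2 where X: "finite X1" "finite X2" "card X2 \<le> CARD('n) - d"
    "span (X1 \<union> X2) = UNIV" "\<forall>x\<in>X1 \<union> X2. integer_point x"
    "\<forall>x\<in>X1. norm (flow t \<theta> x) \<le> exp (- (real CARD('n) - real d) / (real d + 1) * h + \<epsilon> * t)"
    "\<forall>x\<in>X2. norm (flow t \<theta> x) \<le> exp (h + \<epsilon> * t)"
    using sb unfolding split_basis_def by metis
  have "finite (X1 \<union> X2)" using X by simp
  obtain Y where Y: "Y \<subseteq> X1 \<union> X2" "card Y = Suc CARD('n) - Suc e"
    "1 \<le> gram_det (Suc e) (\<lambda>i. flow t \<theta> (b i)) * (\<Prod>y\<in>Y. norm (flow t \<theta> y))\<^sup>2"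
    using covolume_lower_bound[OF b(1-3) \<open>finite (X1 \<union> X2)\<close> X(4), of t \<theta>] X(5) by metis
  let ?A = "(exp (- real CARD('n) * t) + exp t * infdist \<theta> L) * ((2 + norm \<theta>) * exp t) ^ e"
  let ?E = "exp (S + (real CARD('n) - real e) * (\<epsilon> * t))"
  have A0: "0 \<le> ?A" by (intro mult_nonneg_nonneg add_nonneg_nonneg zero_le_power) (auto simp: infdist_nonneg)
  have "(\<Prod>y\<in>Y. norm (flow t \<theta> y)) \<le> ?E"
    by (rule split_product_le[OF X(1-3) d e Y(1) _ h]) (use Y(2) X(6,7) S1 S2 in auto)
  then have "(\<Prod>y\<in>Y. norm (flow t \<theta> y))\<^sup>2 \<le> ?E\<^sup>2" by (intro power_mono prod_nonneg) auto
  with Y(3) have "1 \<le> (gram_det (Suc e) b * ?A\<^sup>2) * ?E\<^sup>2"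
    using covolume_flow_upper_bound[OF b(2,3) PV t, of \<theta>] P(2)
    by (elim order_trans) (intro mult_mono, auto intro!: gram_det_nonneg mult_nonneg_nonneg)
  also have "\<dots> = (height L * ?A * ?E)\<^sup>2"
    unfolding b(5) by (simp add: power_mult_distrib gram_det_nonneg)
  finally have "1 \<le> (height L * ?A * ?E)\<^sup>2" .
  moreover have "0 \<le> height L * ?A * ?E" using A0 by (simp add: b(5) gram_det_nonneg)
  ultimately have "1 \<le> height L * ?A * ?E" by (metis one_power2 power2_le_imp_le)
  then show ?thesis by (simp add: mult_ac)
qed

section \<open>From reduced bases to exponents\<close>

text \<open>A subspace that witnesses an exponent w > \<omega> would contradict the lower bound at
  the time when its covolume is smallest. The number s is the critical rate: where the worst
  completion costs \<open>exp (s t)\<close>, subspaces of exponent exactly \<omega> just remain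
  possible.\<close>

lemma omega_exp_le:
  fixes \<theta> :: "real ^ 'n"
  assumes e: "e < CARD('n)" and \<omega>: "0 \<le> \<omega>"
    and s: "s = (real CARD('n) - real e) - (real CARD('n) + 1) / (1 + \<omega>)"
    and H: "\<And>\<epsilon>. 0 < \<epsilon> \<Longrightarrow> \<exists>t0. \<forall>t\<ge>t0. \<exists>d h. d < CARD('n) \<and> 0 \<le> h \<and> split_basis t \<theta> d h \<epsilon> \<and>
       (d \<le> e \<longrightarrow> (real CARD('n) - real e) * h \<le> (s + \<epsilon>) * t) \<and>
       (e < d \<longrightarrow> (real CARD('n) - real d) * (real e + 1) / (real d + 1) * h \<le> (s + \<epsilon>) * t)"
  shows "omega_exp e \<theta> \<le> ereal \<omega>"
  unfolding omega_exp_def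
proof (rule Sup_least, clarify)
  fix w
  assume w: "\<forall>H0. \<exists>H\<ge>H0. \<exists>L. rat_affine_subspace e L \<and> height L \<le> H \<and> height L * infdist \<theta> L \<le> H powr - w"
  let ?n = "real CARD('n)"
  show "ereal w \<le> ereal \<omega>"
  proof (rule ccontr)
    assume "\<not> ?thesis"
    then have w\<omega>: "\<omega> < w" by simp
    define \<Delta> where "\<Delta> = (?n + 1) / (1 + \<omega>) - (?n + 1) / (1 + w)"
    have \<Delta>: "0 < \<Delta>" unfolding \<Delta>_def using w\<omega> \<omega> by (simp add: frac_less2)
    define \<epsilon> where "\<epsilon> = \<Delta> / (2 * (?n + 1))"
    have \<epsilon>: "0 < \<epsilon>" "(?n + 1) * \<epsilon> = \<Delta> / 2" using \<Delta> by (auto simp: \<epsilon>_def field_simps)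
    obtain t0 where t0: "\<And>t. t0 \<le> t \<Longrightarrow> \<exists>d h. d < CARD('n) \<and> 0 \<le> h \<and> split_basis t \<theta> d h \<epsilon> \<and>
       (d \<le> e \<longrightarrow> (?n - real e) * h \<le> (s + \<epsilon>) * t) \<and>
       (e < d \<longrightarrow> (?n - real d) * (real e + 1) / (real d + 1) * h \<le> (s + \<epsilon>) * t)"
      using H[OF \<epsilon>(1)] by blast
    define K where "K = 2 * (2 + norm \<theta>) ^ e"
    have K: "0 < K" by (auto simp: K_def intro!: mult_pos_pos zero_less_power add_pos_nonneg)
    \<comment> \<open>From this time on \<open>exp (- \<Delta> / 2 * t)\<close> beats the constant
      K, and the product in the lower bound falls below 1.\<close>
    define t1 where "t1 = max 0 (max t0 (2 * (ln K + 1) / \<Delta>))"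
    define H0 where "H0 = exp ((?n + 1) * t1 / (1 + w))"
    obtain Hh L where L: "H0 \<le> Hh" "rat_affine_subspace e L" "height L \<le> Hh"
      "height L * infdist \<theta> L \<le> Hh powr - w" using w by blast
    have Hpos: "0 < Hh" using L(1) by (simp add: H0_def less_le_trans[OF exp_gt_zero])
    \<comment> \<open>At this time the bounds \<open>exp (-n t) * H\<close> and
      \<open>exp t * H powr -w\<close> for the two terms of the covolume coincide.\<close>
    define t where "t = (1 + w) * ln Hh / (?n + 1)"
    have lnH: "ln Hh = (?n + 1) * t / (1 + w)" using w\<omega> \<omega> by (simp add: t_def)
    have "(?n + 1) * t1 / (1 + w) \<le> ln Hh" using L(1) Hpos by (simp add: H0_def ln_ge_iff)
    then have tt1: "t1 \<le> t" unfolding lnH using w\<omega> \<omega> by (simp add: divide_le_cancel)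
    then have t: "0 \<le> t" "t0 \<le> t" "2 * (ln K + 1) / \<Delta> \<le> t" by (auto simp: t1_def)
    obtain d h where dh: "d < CARD('n)" "0 \<le> h" "split_basis t \<theta> d h \<epsilon>"
       "d \<le> e \<Longrightarrow> (?n - real e) * h \<le> (s + \<epsilon>) * t"
       "e < d \<Longrightarrow> (?n - real d) * (real e + 1) / (real d + 1) * h \<le> (s + \<epsilon>) * t"
      using t0[OF t(2)] by blast
    define lam where "lam = (?n + 1) / (1 + w)"
    have "lam * (1 + w) = ?n + 1" using w\<omega> \<omega> by (simp add: lam_def)
    then have lam: "1 - w * lam = lam - ?n" by (simp add: algebra_simps)
    have "ln Hh = lam * t" by (simp add: lnH lam_def)
    then have Hexp: "Hh = exp (lam * t)" using Hpos by (metis exp_ln)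
    have "height L * (exp (- ?n * t) + exp t * infdist \<theta> L)
        = exp (- ?n * t) * height L + exp t * (height L * infdist \<theta> L)"
      by (simp add: algebra_simps)
    also have "\<dots> \<le> exp (- ?n * t) * Hh + exp t * (Hh powr - w)"
      using L by (intro add_mono mult_left_mono) auto
    also have "\<dots> = exp ((lam - ?n) * t) + exp ((1 - w * lam) * t)"
      unfolding Hexp by (simp add: powr_def algebra_simps flip: exp_add)
    also have "\<dots> = 2 * exp ((lam - ?n) * t)" unfolding lam by simp
    finally have A: "height L * (exp (- ?n * t) + exp t * infdist \<theta> L) \<le> 2 * exp ((lam - ?n) * t)" .
    have "1 \<le> height L * (exp (- ?n * t) + exp t * infdist \<theta> L) * ((2 + norm \<theta>) * exp t) ^ e
      * exp ((s + \<epsilon>) * t + (?n - real e) * (\<epsilon> * t))"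
      by (rule height_dist_lower_bound[OF L(2) e dh(1) dh(3) t(1) dh(2)]) (use dh in auto)
    also have "\<dots> \<le> 2 * exp ((lam - ?n) * t) * ((2 + norm \<theta>) * exp t) ^ e
      * exp ((s + \<epsilon>) * t + (?n - real e) * (\<epsilon> * t))"
      by (intro mult_right_mono A) auto
    also have "\<dots> = K * exp ((lam - ?n + real e + s + \<epsilon> + (?n - real e) * \<epsilon>) * t)"
    proof -
      have "(lam - ?n + real e + s + \<epsilon> + (?n - real e) * \<epsilon>) * t
        = (lam - ?n) * t + real e * t + ((s + \<epsilon>) * t + (?n - real e) * (\<epsilon> * t))"
        by (simp add: algebra_simps)
      then show ?thesis
        by (simp only: K_def power_mult_distrib exp_add exp_of_nat_mult exp_of_nat2_mult mult_ac)
    qed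
    also have "lam - ?n + real e + s + \<epsilon> + (?n - real e) * \<epsilon> \<le> - \<Delta> / 2"
    proof -
      have "lam - ?n + real e + s = - \<Delta>" by (simp add: s lam_def \<Delta>_def)
      moreover have "\<epsilon> + (?n - real e) * \<epsilon> \<le> (?n + 1) * \<epsilon>" using \<epsilon>(1) by (simp add: algebra_simps)
      ultimately show ?thesis using \<epsilon>(2) by linarith
    qed
    then have "K * exp ((lam - ?n + real e + s + \<epsilon> + (?n - real e) * \<epsilon>) * t) \<le> K * exp (- \<Delta> / 2 * t)"
      using K t(1) by (intro mult_left_mono exp_le_cancel_iff[THEN iffD2] mult_right_mono) auto
    also have "- \<Delta> / 2 * t \<le> - (ln K + 1)" using t(3) \<Delta> by (simp add: field_simps)
    then have "K * exp (- \<Delta> / 2 * t) \<le> K * exp (- (ln K + 1))" using K by simp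
    also have "\<dots> = exp (- 1)" using K by (simp add: exp_add exp_diff exp_minus inverse_eq_divide)
    also have "\<dots> < 1" by simp
    finally show False by simp
  qed
qed

text \<open>An integral relation is an integer vector a orthogonal to (1, \<theta>). Its inner
  products with integer points are integers, and on points of norm at most
  \<open>exp (t / 2)\<close> at a large time t they are smaller than 1, hence 0. As such points span
  the space, a vanishes.\<close>

lemma Q_lin_indep_of_balanced:
  fixes \<theta> :: "real ^ 'n"
  assumes "\<And>T. \<exists>t\<ge>T. \<exists>d. split_basis t \<theta> d 0 (1/2)"
  shows "Q_lin_indep \<theta>"
  unfolding Q_lin_indep_def
proof (intro allI impI)
  fix c0 :: int and c :: "'n \<Rightarrow> int"
  assume rel: "real_of_int c0 + (\<Sum>i\<in>UNIV. real_of_int (c i) * \<theta> $ i) = 0"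
  define v where "v = (\<chi> i. real_of_int (c i))"
  define a where "a = (real_of_int c0, v)"
  have rel': "real_of_int c0 = - inner v \<theta>" using rel by (simp add: v_def inner_vec_def)
  have inn: "inner a x = inner v (snd x - fst x *\<^sub>R \<theta>)" for x
    by (simp add: a_def inner_prod_def inner_diff_right rel')
  \<comment> \<open>Makes \<open>norm v * exp (- t / 2)\<close> smaller than 1 for all t from T
    on.\<close>
  define T where "T = 2 * ln (norm v + 1) + 1"
  obtain t d where t: "T \<le> t" "split_basis t \<theta> d 0 (1/2)" using assms by blast
  then obtain X1 X2 where X: "span (X1 \<union> X2) = UNIV" "\<forall>x\<in>X1 \<union> X2. integer_point x"
    "\<forall>x\<in>X1 \<union> X2. norm (flow t \<theta> x) \<le> exp (t / 2)"
    unfolding split_basis_def by (auto simp: ball_Un)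
  have ip: "integer_point a" by (simp add: a_def integer_point_def v_def)
  have zero: "inner a x = 0" if x: "x \<in> X1 \<union> X2" for x
  proof -
    obtain m where m: "inner a x = of_int m"
      using inner_integer_points[OF ip, of x] x X(2) Ints_cases by metis
    have "\<bar>inner a x\<bar> \<le> norm v * norm (snd x - fst x *\<^sub>R \<theta>)"
      unfolding inn by (rule Cauchy_Schwarz_ineq2)
    also have "\<dots> \<le> norm v * (exp (- t) * norm (flow t \<theta> x))"
      by (intro mult_left_mono flow_snd_le) auto
    also have "\<dots> \<le> norm v * (exp (- t) * exp (t / 2))"
      using X(3) x by (intro mult_left_mono) auto
    also have "\<dots> = norm v * exp (- t / 2)" by (simp flip: exp_add)
    also have "exp (- t / 2) \<le> exp (- ln (norm v + 1))"
      using t(1) by (simp add: T_def field_simps)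
    also have "exp (- ln (norm v + 1)) = 1 / (norm v + 1)"
      by (simp add: exp_minus inverse_eq_divide add_nonneg_pos)
    finally have "\<bar>inner a x\<bar> \<le> norm v * (1 / (norm v + 1))" by (simp add: mult_left_mono)
    also have "\<dots> < 1" by (simp add: divide_less_eq add_nonneg_pos)
    finally have "real_of_int \<bar>m\<bar> < 1" unfolding m by simp
    then show ?thesis unfolding m by simp
  qed
  have "inner a a = 0"
  proof -
    have "a \<in> span (X1 \<union> X2)" using X(1) by simp
    then show ?thesis
      by (rule span_induct) (use zero in \<open>auto simp: subspace_def inner_add_right\<close>)
  qed
  then have "a = 0" by (simp only: inner_eq_zero_iff)
  then show "c0 = 0 \<and> (\<forall>i. c i = 0)"
    by (auto simp: a_def prod_eq_iff v_def Finite_Cartesian_Product.vec_eq_iff)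
qed

hide_const (open) Order.top Polynomial.content

section \<open>Simultaneous approximation of generic points\<close>

text \<open>The loss \<epsilon> in Dirichlet's exponent \<open>- 1 / card J\<close> lets the
  condition hold on a set of positive measure for a fixed c; for \<epsilon> = 0 that set would be
  null. Several sets J are considered because an excursion approximates the coordinates inside and
  outside a given set separately.\<close>

definition badly_approx :: "real \<Rightarrow> real \<Rightarrow> 'n set \<Rightarrow> real ^ 'n \<Rightarrow> bool" where
  "badly_approx c \<epsilon> J z \<longleftrightarrow> (\<forall>q::nat. \<forall>p::'n \<Rightarrow> int. 0 < q \<longrightarrow>
     (\<exists>i\<in>J. c * real q powr (- 1 / real (card J) - \<epsilon>) \<le> \<bar>real q * z $ i - of_int (p i)\<bar>))"

text \<open>The convergence half of Borel-Cantelli with explicit constants. A denominator q has at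
  most (4 q)^k numerators, each of which excludes a box of volume (2 r / q)^k, and \<epsilon> makes
  the sum over q converge. The total is bounded by a multiple of c.\<close>

lemma emeasure_badly_approx_exceptions:
  fixes J :: "'n::finite set"
  assumes J: "J \<noteq> {}" and c: "0 < c" "c \<le> 1/8" and \<epsilon>: "0 < \<epsilon>"
  obtains N :: "(real ^ 'n) set" where "N \<in> sets lborel"
    "emeasure lborel N \<le> ennreal (8 * c * (\<Sum>q. real (Suc q) powr (- 1 - \<epsilon>)))"
    "\<And>z. \<forall>i. 1 \<le> z $ i \<and> z $ i \<le> 2 \<Longrightarrow> z \<notin> N \<Longrightarrow> badly_approx c \<epsilon> J z"
proof -
  define k where "k = card J"
  have k: "1 \<le> k" using J by (simp add: k_def Suc_le_eq card_gt_0_iff)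
  define r where "r q = c * real q powr (- 1 / real k - \<epsilon>)" for q :: nat
  \<comment> \<open>The numerators that can come within distance 1 of the coordinates of q z when z
    lies in the cube with sides [1, 2].\<close>
  define A where "A q = PiE J (\<lambda>_. {int q - 1..2 * int q + 1})" for q :: nat
  define box where "box q p = cbox (\<chi> i. if i \<in> J then (of_int (p i) - r q) / real q else 1)
     (\<chi> i. if i \<in> J then (of_int (p i) + r q) / real q else 2)" for q :: nat and p :: "'n \<Rightarrow> int"
  define U where "U q = (\<Union>p\<in>A q. box q p)" for q
  define N where "N = (\<Union>q. U (Suc q))"
  have finA: "finite (A q)" for q unfolding A_def by (intro finite_PiE) auto
  have Uset: "U q \<in> sets lborel" for q
    unfolding U_def box_def using finA by (intro sets.finite_UN) auto
  have r0: "0 \<le> r q" for q using c by (simp add: r_def)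
  have ebox: "emeasure lborel (box q p) = ennreal ((2 * r q / real q) ^ k)" if q: "0 < q" for q p
  proof -
    have "(\<Prod>i\<in>UNIV. (if i \<in> J then (of_int (p i) + r q) / real q else 2) -
        (if i \<in> J then (of_int (p i) - r q) / real q else 1)) = (\<Prod>i\<in>UNIV. if i \<in> J then 2 * r q / real q else 1)"
      by (intro prod.cong refl) (auto simp: diff_divide_distrib add_divide_distrib)
    also have "\<dots> = (2 * r q / real q) ^ k" by (simp add: k_def prod.If_cases)
    finally have *: "(\<Prod>i\<in>UNIV. (if i \<in> J then (of_int (p i) + r q) / real q else 2) -
        (if i \<in> J then (of_int (p i) - r q) / real q else 1)) = (2 * r q / real q) ^ k" .
    have "measure lborel (box q p) = (2 * r q / real q) ^ k"
      unfolding box_def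
      by (subst content_cbox_cart)
        (use r0[of q] * in \<open>auto simp: interval_ne_empty_cart intro: divide_right_mono\<close>)
    moreover have "emeasure lborel (box q p) < \<infinity>"
      unfolding box_def by (rule emeasure_lborel_cbox_finite)
    ultimately show ?thesis by (simp add: emeasure_eq_ennreal_measure)
  qed
  have cardA: "real (card (A q)) \<le> (4 * real q) ^ k" if q: "0 < q" for q
  proof -
    have "card (A q) = (nat (3 + int q)) ^ k"
      unfolding A_def by (subst card_PiE) (auto simp: k_def)
    also have "real \<dots> \<le> (4 * real q) ^ k"
      unfolding of_nat_power using q by (intro power_mono) auto
    finally show ?thesis .
  qed
  have eU: "emeasure lborel (U q) \<le> ennreal (8 * c * real q powr (- 1 - \<epsilon>))" if q: "0 < q" for q
  proof -
    have "emeasure lborel (U q) \<le> (\<Sum>p\<in>A q. emeasure lborel (box q p))"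
      unfolding U_def using finA by (intro emeasure_subadditive_finite) (auto simp: box_def)
    also have "\<dots> = ennreal (real (card (A q)) * (2 * r q / real q) ^ k)"
      using r0[of q] by (simp add: ebox[OF q] ennreal_mult ennreal_of_nat_eq_real_of_nat)
    also have "\<dots> \<le> ennreal ((4 * real q) ^ k * (2 * r q / real q) ^ k)"
      using r0[of q] q by (intro ennreal_leI mult_right_mono cardA) auto
    also have "(4 * real q) ^ k * (2 * r q / real q) ^ k = (8 * r q) ^ k"
      unfolding power_mult_distrib[symmetric] using q by simp
    also have "\<dots> = (8 * c) ^ k * (real q powr (- 1 / real k - \<epsilon>)) ^ k"
      by (simp add: r_def power_mult_distrib)
    also have "(real q powr (- 1 / real k - \<epsilon>)) ^ k = real q powr (- 1 - \<epsilon> * real k)"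
    proof -
      have "real k * (- 1 / real k - \<epsilon>) = - 1 - \<epsilon> * real k" using k by (simp add: right_diff_distrib)
      then show ?thesis using q by (simp only: powr_power)
    qed
    \<comment> \<open>Both the k-th power and the factor k in the exponent are dropped; the first of
      these uses 8 c \<le> 1.\<close>
    also have "(8 * c) ^ k * real q powr (- 1 - \<epsilon> * real k) \<le> (8 * c) * real q powr (- 1 - \<epsilon>)"
    proof (intro mult_mono powr_mono)
      show "(8 * c) ^ k \<le> 8 * c" using power_decreasing[of 1 k "8 * c"] k c by simp
      show "- 1 - \<epsilon> * real k \<le> - 1 - \<epsilon>" using k \<epsilon> by simp
    qed (use c q in auto)
    finally show ?thesis by (simp add: ennreal_leI)
  qed
  have summ: "summable (\<lambda>q. real (Suc q) powr (- 1 - \<epsilon>))"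
    using summable_real_powr_iff[of "- 1 - \<epsilon>"] \<epsilon> by (subst summable_Suc_iff) simp
  have "emeasure lborel N \<le> (\<Sum>q. emeasure lborel (U (Suc q)))"
    unfolding N_def using Uset by (intro emeasure_subadditive_countably) auto
  also have "\<dots> \<le> (\<Sum>q. ennreal (8 * c * real (Suc q) powr (- 1 - \<epsilon>)))"
    by (intro suminf_le eU) auto
  also have "\<dots> = ennreal (\<Sum>q. 8 * c * real (Suc q) powr (- 1 - \<epsilon>))"
    using c summ by (intro suminf_ennreal2) (auto intro: summable_mult)
  also have "(\<Sum>q. 8 * c * real (Suc q) powr (- 1 - \<epsilon>)) = 8 * c * (\<Sum>q. real (Suc q) powr (- 1 - \<epsilon>))"
    using summ by (rule suminf_mult)
  finally have eN: "emeasure lborel N \<le> ennreal (8 * c * (\<Sum>q. real (Suc q) powr (- 1 - \<epsilon>)))" .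
  have good: "badly_approx c \<epsilon> J z" if z: "\<forall>i. 1 \<le> z $ i \<and> z $ i \<le> 2" "z \<notin> N" for z
    unfolding badly_approx_def
  proof (intro allI impI, rule ccontr)
    fix q :: nat and p :: "'n \<Rightarrow> int"
    assume q: "0 < q" and "\<not> (\<exists>i\<in>J. c * real q powr (- 1 / real (card J) - \<epsilon>) \<le> \<bar>real q * z $ i - of_int (p i)\<bar>)"
    then have p: "\<bar>real q * z $ i - of_int (p i)\<bar> < r q" if "i \<in> J" for i
      using that by (auto simp: r_def k_def not_le)
    have "- 1 / real k \<le> 0" by (rule divide_nonpos_nonneg) auto
    then have "- 1 / real k - \<epsilon> \<le> 0" using \<epsilon> by linarith
    then have "real q powr (- 1 / real k - \<epsilon>) \<le> real q powr 0"
      using q by (intro powr_mono) auto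
    then have "c * real q powr (- 1 / real k - \<epsilon>) \<le> 1 * 1"
      using c q by (intro mult_mono) auto
    then have r1: "r q \<le> 1" by (simp add: r_def)
    have "int q - 1 \<le> p i \<and> p i \<le> 2 * int q + 1" if i: "i \<in> J" for i
    proof -
      have "real q \<le> real q * z $ i" "real q * z $ i \<le> 2 * real q"
        using z(1) q mult_left_mono[of 1 "z $ i" "real q"] mult_left_mono[of "z $ i" 2 "real q"] by auto
      then have "of_int (int q - 1) \<le> real_of_int (p i) \<and> real_of_int (p i) \<le> of_int (2 * int q + 1)"
        using p[OF i] r1 by auto
      then show ?thesis by (simp only: of_int_le_iff)
    qed
    then have "restrict p J \<in> A q" by (auto simp: A_def)
    moreover have "z \<in> box q (restrict p J)"
      unfolding box_def mem_box_cart
    proof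
      fix i
      show "(\<chi> i. if i \<in> J then (of_int (restrict p J i) - r q) / real q else 1) $ i \<le> z $ i \<and>
         z $ i \<le> (\<chi> i. if i \<in> J then (of_int (restrict p J i) + r q) / real q else 2) $ i"
        using z(1) p[of i] q by (auto simp: divide_le_eq le_divide_eq abs_less_iff mult.commute)
    qed
    ultimately have "z \<in> U q" by (auto simp: U_def)
    then have "z \<in> N" using q unfolding N_def by (metis UN_I UNIV_I gr0_conv_Suc)
    then show False using z(2) by simp
  qed
  show ?thesis
    by (rule that[OF _ eN good]) (use Uset in \<open>auto simp: N_def\<close>)
qed

text \<open>Only finitely many sets J occur, so a small c keeps their exceptional sets together
  below the volume 1 of the cube. The coordinates lie in [1, 2] because they become coefficients of
  points of a cone, which have to be nonnegative and bounded.\<close>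

lemma badly_approx_positive_measure:
  assumes \<epsilon>: "0 < \<epsilon>"
  obtains c and Z :: "(real ^ 'n) set" where "0 < c" "c \<le> 1" "Z \<in> sets lborel" "0 < emeasure lborel Z"
    "\<And>z i. z \<in> Z \<Longrightarrow> 1 \<le> z $ i \<and> z $ i \<le> 2"
    "\<And>z J. z \<in> Z \<Longrightarrow> J \<noteq> {} \<Longrightarrow> badly_approx c \<epsilon> J z"
proof -
  define S where "S = (\<Sum>q. real (Suc q) powr (- 1 - \<epsilon>))"
  have S0: "0 \<le> S" unfolding S_def
    using summable_real_powr_iff[of "- 1 - \<epsilon>"] \<epsilon> by (intro suminf_nonneg) (subst summable_Suc_iff, auto)
  define m where "m = real (card (UNIV :: 'n set set))"
  have m1: "1 \<le> m" unfolding m_def by (simp add: Suc_le_eq card_gt_0_iff)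
  define c where "c = 1 / (16 * m * (S + 1))"
  have c: "0 < c" using m1 S0 by (simp add: c_def)
  have "16 * m * (S + 1) \<ge> 16 * 1 * 1" using m1 S0 by (intro mult_mono) auto
  then have c8: "c \<le> 1/8" unfolding c_def by (simp add: divide_le_eq)
  have mcS: "m * (8 * c * S) < 1"
  proof -
    have "m * (8 * c * S) \<le> m * (8 * c * (S + 1))" using m1 c by (intro mult_left_mono) auto
    also have "\<dots> = 8 * (c * (m * (S + 1)))" by simp
    also have "c * (m * (S + 1)) = 1 / 16" using m1 S0 by (simp add: c_def)
    finally show ?thesis by simp
  qed
  have "\<exists>N :: (real ^ 'n) set. N \<in> sets lborel \<and> emeasure lborel N \<le> ennreal (8 * c * S) \<and>
    (\<forall>z. (\<forall>i. 1 \<le> z $ i \<and> z $ i \<le> 2) \<longrightarrow> z \<notin> N \<longrightarrow> J \<noteq> {} \<longrightarrow> badly_approx c \<epsilon> J z)" for J :: "'n set"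
  proof (cases "J = {}")
    case True
    then show ?thesis by (intro exI[of _ "{}"]) auto
  next
    case False
    obtain N :: "(real ^ 'n) set" where "N \<in> sets lborel"
      "emeasure lborel N \<le> ennreal (8 * c * (\<Sum>q. real (Suc q) powr (- 1 - \<epsilon>)))"
      "\<And>z. \<forall>i. 1 \<le> z $ i \<and> z $ i \<le> 2 \<Longrightarrow> z \<notin> N \<Longrightarrow> badly_approx c \<epsilon> J z"
      by (rule emeasure_badly_approx_exceptions[OF False c c8 \<epsilon>]) (rule that)
    then show ?thesis unfolding S_def by (intro exI[of _ N]) simp
  qed
  then have "\<forall>J. \<exists>N :: (real ^ 'n) set. N \<in> sets lborel \<and> emeasure lborel N \<le> ennreal (8 * c * S) \<and>
    (\<forall>z. (\<forall>i. 1 \<le> z $ i \<and> z $ i \<le> 2) \<longrightarrow> z \<notin> N \<longrightarrow> J \<noteq> {} \<longrightarrow> badly_approx c \<epsilon> J z)" by (rule allI)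
  from choice[OF this] obtain N :: "'n set \<Rightarrow> (real ^ 'n) set" where N0:
    "\<forall>J. N J \<in> sets lborel \<and> emeasure lborel (N J) \<le> ennreal (8 * c * S) \<and>
    (\<forall>z. (\<forall>i. 1 \<le> z $ i \<and> z $ i \<le> 2) \<longrightarrow> z \<notin> N J \<longrightarrow> J \<noteq> {} \<longrightarrow> badly_approx c \<epsilon> J z)"
    by (rule exE)
  have N: "N J \<in> sets lborel" "emeasure lborel (N J) \<le> ennreal (8 * c * S)"
    "(\<forall>i. 1 \<le> z $ i \<and> z $ i \<le> 2) \<Longrightarrow> z \<notin> N J \<Longrightarrow> J \<noteq> {} \<Longrightarrow> badly_approx c \<epsilon> J z" for J z
    using N0 by simp_all
  define Q :: "(real ^ 'n) set" where "Q = cbox (\<chi> i. 1) (\<chi> i. 2)"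
  define Z :: "(real ^ 'n) set" where "Z = Q - (\<Union>J. N J)"
  have eQ: "emeasure lborel (Q :: (real ^ 'n) set) = 1"
  proof -
    have "measure lborel (Q :: (real ^ 'n) set) = 1"
      unfolding Q_def by (subst content_cbox_cart) (auto simp: interval_ne_empty_cart)
    moreover have "emeasure lborel (Q :: (real ^ 'n) set) < \<infinity>"
      unfolding Q_def by (rule emeasure_lborel_cbox_finite)
    ultimately show ?thesis by (simp add: emeasure_eq_ennreal_measure)
  qed
  have "emeasure lborel (\<Union>J. N J) \<le> (\<Sum>J\<in>UNIV. emeasure lborel (N J))"
    using N(1) by (intro emeasure_subadditive_finite) auto
  also have "\<dots> \<le> (\<Sum>J\<in>(UNIV::'n set set). ennreal (8 * c * S))" by (intro sum_mono N(2))
  also have "\<dots> = ennreal (m * (8 * c * S))"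
    using c S0 by (simp add: m_def ennreal_mult ennreal_of_nat_eq_real_of_nat)
  also have "\<dots> < 1" using mcS c S0 m1 by (simp add: ennreal_less_one_iff)
  finally have lt: "emeasure lborel (\<Union>J. N J) < emeasure lborel Q" unfolding eQ .
  have sets: "Z \<in> sets lborel" unfolding Z_def Q_def using N(1) by auto
  have "emeasure lborel Z \<noteq> 0"
  proof
    assume "emeasure lborel Z = 0"
    moreover have U: "(\<Union>J. N J) \<in> sets lborel" using N(1) by (intro sets.finite_UN) auto
    have "emeasure lborel Q \<le> emeasure lborel (Z \<union> (\<Union>J. N J))"
      by (rule emeasure_mono[OF _ sets.Un[OF sets U]]) (auto simp: Z_def)
    moreover have "emeasure lborel (Z \<union> (\<Union>J. N J)) \<le> emeasure lborel Z + emeasure lborel (\<Union>J. N J)"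
      using sets U by (rule emeasure_subadditive)
    ultimately have "emeasure lborel Q \<le> emeasure lborel (\<Union>J. N J)"
      using \<open>emeasure lborel Q \<le> emeasure lborel (Z \<union> (\<Union>J. N J))\<close> by simp
    then show False using lt by simp
  qed
  then show ?thesis
    using c c8 N(3) by (intro that[of c Z] sets)
      (auto simp: Z_def Q_def mem_box_cart zero_less_iff_neq_zero)
qed

text \<open>Its integer points form a copy of Z^(k + 1) with k = \<open>card J\<close>;
  approximation of fewer coordinates thus takes place in the same type.\<close>

definition coord_subspace :: "'n set \<Rightarrow> (real \<times> (real ^ 'n)) set" where
  "coord_subspace J = {x. \<forall>i. i \<notin> J \<longrightarrow> snd x $ i = 0}"

lemma subspace_coord_subspace: "subspace (coord_subspace J)"
  by (rule subspaceI) (auto simp: coord_subspace_def)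

lemma coord_subspace_spanning:
  "coord_subspace (J :: 'n::finite set) = span (insert (1, 0) ((\<lambda>i. (0, axis i 1)) ` J))"
proof
  show "span (insert (1, 0) ((\<lambda>i. (0, axis i 1)) ` J)) \<subseteq> coord_subspace J"
    by (rule span_minimal[OF _ subspace_coord_subspace]) (auto simp: coord_subspace_def axis_def)
  show "coord_subspace J \<subseteq> span (insert (1, 0) ((\<lambda>i. (0, axis i 1)) ` J))"
  proof
    fix x :: "real \<times> (real ^ 'n)" assume x: "x \<in> coord_subspace J"
    have "(\<Sum>i\<in>J. snd x $ i *\<^sub>R axis i 1) $ j = snd x $ j" for j
    proof -
      have "(\<Sum>i\<in>J. snd x $ i *\<^sub>R axis i 1) $ j = (\<Sum>i\<in>J. if i = j then snd x $ j else 0)"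
        unfolding sum_component by (intro sum.cong) (auto simp: axis_def)
      also have "\<dots> = snd x $ j" using x by (simp add: sum.delta coord_subspace_def)
      finally show ?thesis .
    qed
    then have "(\<Sum>i\<in>J. snd x $ i *\<^sub>R axis i 1) = snd x"
      by (simp only: Finite_Cartesian_Product.vec_eq_iff) simp
    then have eq: "x = fst x *\<^sub>R (1, 0) + (\<Sum>i\<in>J. snd x $ i *\<^sub>R (0, axis i 1))"
      by (simp add: prod_eq_iff fst_sum snd_sum)
    have "fst x *\<^sub>R (1::real, 0::real ^ 'n) + (\<Sum>i\<in>J. snd x $ i *\<^sub>R (0, axis i 1))
       \<in> span (insert (1, 0) ((\<lambda>i. (0, axis i 1)) ` J))"
      by (intro span_add span_scale span_sum span_base) auto
    then show "x \<in> span (insert (1, 0) ((\<lambda>i. (0, axis i 1)) ` J))"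
      unfolding eq[symmetric] .
  qed
qed

lemma dim_coord_subspace: "dim (coord_subspace (J :: 'n::finite set)) \<le> Suc (card J)"
proof -
  have "dim (coord_subspace J) \<le> card (insert (1::real, 0::real ^ 'n) ((\<lambda>i. (0, axis i 1)) ` J))"
    unfolding coord_subspace_spanning dim_span by (rule dim_le_card') auto
  also have "\<dots> \<le> Suc (card ((\<lambda>i. (0::real, axis i 1 :: real ^ 'n)) ` J))"
    by (rule card_insert_le_m1) auto
  also have "\<dots> \<le> Suc (card J)" by (simp add: card_image_le)
  finally show ?thesis .
qed

text \<open>The diagonal flow for simultaneous approximation of the coordinates in J only, with the
  weights -k and 1 for k = \<open>card J\<close>. \<open>None\<close> stands for the
  denominator.\<close>

definition scaled_coord :: "real \<Rightarrow> 'n set \<Rightarrow> real ^ 'n \<Rightarrow> real \<times> (real ^ 'n) \<Rightarrow> 'n option \<Rightarrow> real" where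
  "scaled_coord \<tau> J z x a = (case a of None \<Rightarrow> exp (- real (card J) * \<tau>) * fst x
     | Some i \<Rightarrow> exp \<tau> * (snd x $ i - fst x * z $ i))"

lemma scaled_coord_diff:
  "scaled_coord \<tau> J z (x - y) a = scaled_coord \<tau> J z x a - scaled_coord \<tau> J z y a"
  by (simp add: scaled_coord_def algebra_simps split: option.split)

text \<open>A denominator beyond \<open>exp (k \<tau>)\<close> is large by itself, and denominator 0
  leaves a nonzero integer. In between \<open>badly_approx\<close> applies; its bound is smallest at
  q = \<open>exp (k \<tau>)\<close>, where the exponents add up to
  \<open>- \<epsilon> k \<tau>\<close>.\<close>

lemma scaled_coord_lower_bound:
  fixes J :: "'n::finite set"
  assumes z: "badly_approx c \<epsilon> J z" and J: "J \<noteq> {}" and c: "0 < c" "c \<le> 1" and \<epsilon>: "0 \<le> \<epsilon>" and \<tau>: "0 \<le> \<tau>"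
    and x: "x \<in> coord_subspace J" "integer_point x" "x \<noteq> 0"
  shows "\<exists>a\<in>insert None (Some ` J). c * exp (- \<epsilon> * real (card J) * \<tau>) \<le> \<bar>scaled_coord \<tau> J z x a\<bar>"
proof -
  let ?k = "real (card J)"
  have k: "1 \<le> ?k" using J by (simp add: Suc_le_eq card_gt_0_iff)
  have "c * exp (- \<epsilon> * ?k * \<tau>) \<le> 1 * 1"
    using c \<epsilon> \<tau> k by (intro mult_mono) (auto simp: mult_nonneg_nonneg)
  then have le1: "c * exp (- \<epsilon> * ?k * \<tau>) \<le> 1" by simp
  consider "exp (?k * \<tau>) < \<bar>fst x\<bar>" | "fst x = 0" | "fst x \<noteq> 0" "\<bar>fst x\<bar> \<le> exp (?k * \<tau>)" by linarith
  then show ?thesis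
  proof cases
    case 1
    then have "1 \<le> exp (- ?k * \<tau>) * \<bar>fst x\<bar>" by (simp add: exp_minus field_simps)
    then show ?thesis using le1 by (intro bexI[of _ None]) (auto simp: scaled_coord_def abs_mult)
  next
    case 2
    then have "snd x \<noteq> 0" using x(3) by (simp add: prod_eq_iff)
    then obtain i where i: "snd x $ i \<noteq> 0" by (auto simp: Finite_Cartesian_Product.vec_eq_iff)
    then have "i \<in> J" using x(1) by (auto simp: coord_subspace_def)
    have "snd x $ i \<in> \<int>" using x(2) by (simp add: integer_point_def)
    then have "1 \<le> \<bar>snd x $ i\<bar>" using i Ints_nonzero_abs_ge1 by blast
    moreover have "1 \<le> exp \<tau>" using \<tau> by simp
    ultimately have "1 * 1 \<le> exp \<tau> * \<bar>snd x $ i\<bar>" by (intro mult_mono) auto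
    then show ?thesis using le1 2 \<open>i \<in> J\<close> by (intro bexI[of _ "Some i"]) (auto simp: scaled_coord_def abs_mult)
  next
    case 3
    have "fst x \<in> \<int>" using x(2) by (simp add: integer_point_def)
    then obtain m where m: "fst x = of_int m" by (rule Ints_cases)
    define n where "n i = \<lfloor>snd x $ i\<rfloor>" for i
    have n: "snd x $ i = of_int (n i)" for i
    proof -
      have "snd x $ i \<in> \<int>" using x(2) by (simp add: integer_point_def)
      then show ?thesis unfolding n_def by (rule Ints_cases) simp
    qed
    \<comment> \<open>The first coordinate may be negative, whereas denominators are positive; the
      sign moves to the numerators.\<close>
    define q where "q = nat \<bar>m\<bar>"
    have q: "0 < q" "real q = \<bar>fst x\<bar>" using 3 m by (auto simp: q_def)
    obtain i where i: "i \<in> J" "c * real q powr (- 1 / ?k - \<epsilon>) \<le> \<bar>real q * z $ i - of_int (sgn m * n i)\<bar>"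
      using z[unfolded badly_approx_def, rule_format, OF q(1), of "\<lambda>i. sgn m * n i"] by (elim bexE) (rule that)
    have eq: "\<bar>snd x $ i - fst x * z $ i\<bar> = \<bar>real q * z $ i - of_int (sgn m * n i)\<bar>"
    proof (cases "0 < m")
      case True
      then have "real q = of_int m" "sgn m = 1" by (auto simp: q_def)
      then show ?thesis by (simp add: m n abs_minus_commute)
    next
      case False
      then have "real q = - of_int m" "sgn m = - 1" using 3 m by (auto simp: q_def)
      then show ?thesis by (simp add: m n)
    qed
    have "- \<epsilon> * ?k * \<tau> = \<tau> + (- 1 / ?k - \<epsilon>) * (?k * \<tau>)"
      using J by (simp add: left_diff_distrib)
    then have "c * exp (- \<epsilon> * ?k * \<tau>) = exp \<tau> * (c * (exp (?k * \<tau>)) powr (- 1 / ?k - \<epsilon>))"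
      by (simp only: powr_def exp_add ln_exp) simp
    also have "\<dots> \<le> exp \<tau> * (c * real q powr (- 1 / ?k - \<epsilon>))"
    proof (intro mult_left_mono powr_mono2')
      have "- 1 / ?k \<le> 0" by (rule divide_nonpos_nonneg) auto
      then show "- 1 / ?k - \<epsilon> \<le> 0" using \<epsilon> by linarith
    qed (use q 3 c in auto)
    also have "\<dots> \<le> exp \<tau> * \<bar>real q * z $ i - of_int (sgn m * n i)\<bar>"
      using i(2) by (intro mult_left_mono) auto
    finally have "c * exp (- \<epsilon> * ?k * \<tau>) \<le> \<bar>scaled_coord \<tau> J z x (Some i)\<bar>"
      by (simp add: scaled_coord_def abs_mult eq)
    then show ?thesis using i(1) by blast
  qed
qed

text \<open>If all small vectors lay in a hyperplane, then the pigeonhole principle would put more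
  of them in a box than the separation of lattice points allows.\<close>

lemma span_small_vectors:
  fixes J :: "'n::finite set" and z :: "real ^ 'n"
  assumes z: "badly_approx c \<epsilon> J z" and J: "J \<noteq> {}" and c: "0 < c" "c \<le> 1" and \<epsilon>: "0 \<le> \<epsilon>" and \<tau>: "0 \<le> \<tau>"
    and \<rho>: "(8 * (real (card J) + 1) / c) ^ card J * exp (\<epsilon> * (real (card J))\<^sup>2 * \<tau>) < \<rho>" "2 \<le> \<rho>"
  shows "span {x \<in> coord_subspace J. integer_point x \<and> \<bar>fst x\<bar> \<le> \<rho> * exp (real (card J) * \<tau>) \<and>
      (\<forall>i\<in>J. \<bar>snd x $ i - fst x * z $ i\<bar> \<le> \<rho> * exp (- \<tau>))} = coord_subspace J"
    (is "span ?\<Omega> = _")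
proof (rule ccontr)
  assume neq: "span ?\<Omega> \<noteq> coord_subspace J"
  define k where "k = card J"
  have k: "1 \<le> k" using J by (simp add: k_def Suc_le_eq card_gt_0_iff)
  define R where "R = exp \<tau>"
  have R: "1 \<le> R" using \<tau> by (simp add: R_def)
  have Rk: "exp (real k * \<tau>) = R ^ k" by (simp add: R_def exp_of_nat_mult)
  define \<Omega> where "\<Omega> = ?\<Omega>"
  let ?S = "scaled_coord \<tau> J z"
  define I where "I = insert None (Some ` J)"
  have finI: "finite I" and cardI: "card I = Suc k"
    by (auto simp: I_def k_def card_image)
  have \<Omega>I: "x \<in> \<Omega>" if "x \<in> coord_subspace J" "integer_point x" "\<forall>a\<in>I. \<bar>?S x a\<bar> \<le> \<rho>" for x
  proof -
    have "exp (- (real k * \<tau>)) * \<bar>fst x\<bar> \<le> \<rho>"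
      using that(3) by (auto simp: I_def scaled_coord_def abs_mult k_def)
    then have "\<bar>fst x\<bar> \<le> \<rho> * exp (real k * \<tau>)" by (simp add: exp_minus field_simps)
    moreover have "\<bar>snd x $ i - fst x * z $ i\<bar> \<le> \<rho> * exp (- \<tau>)" if "i \<in> J" for i
    proof -
      have "exp \<tau> * \<bar>snd x $ i - fst x * z $ i\<bar> \<le> \<rho>"
        using \<open>\<forall>a\<in>I. \<bar>?S x a\<bar> \<le> \<rho>\<close> that by (auto simp: I_def scaled_coord_def abs_mult)
      then show ?thesis by (simp add: exp_minus field_simps)
    qed
    ultimately show ?thesis using that(1,2) by (simp add: \<Omega>_def k_def)
  qed
  have "span \<Omega> \<subset> span (coord_subspace J)"
  proof -
    have A: "span \<Omega> \<subseteq> coord_subspace J"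
      by (rule span_minimal[OF _ subspace_coord_subspace]) (auto simp: \<Omega>_def)
    have B: "span (coord_subspace J) = coord_subspace J"
      using subspace_coord_subspace[of J] by (simp only: span_eq_iff)
    have "span \<Omega> \<noteq> coord_subspace J" using neq unfolding \<Omega>_def .
    with A show ?thesis unfolding B psubset_eq by (rule conjI)
  qed
  then obtain h where h: "h \<noteq> 0" "h \<in> span (coord_subspace J)"
    "\<And>y. y \<in> span \<Omega> \<Longrightarrow> Linear_Algebra.orthogonal h y"
    by (rule orthogonal_to_subspace_exists_gen) (rule that)
  have hU: "h \<in> coord_subspace J"
    using h(2) subspace_coord_subspace[of J] by (simp only: span_eq_iff[THEN iffD2])
  \<comment> \<open>The functional \<open>inner h\<close> expressed in scaled coordinates.\<close>
  define g where "g a = (case a of None \<Rightarrow> exp (real k * \<tau>) * (fst h + (\<Sum>i\<in>J. snd h $ i * z $ i))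
      | Some i \<Rightarrow> exp (- \<tau>) * snd h $ i)" for a
  have inner_eq: "inner h x = (\<Sum>a\<in>I. g a * ?S x a)" for x
  proof -
    have "inner h x = fst h * fst x + (\<Sum>i\<in>UNIV. snd h $ i * snd x $ i)"
      by (simp add: inner_prod_def inner_vec_def)
    also have "(\<Sum>i\<in>UNIV. snd h $ i * snd x $ i) = (\<Sum>i\<in>J. snd h $ i * snd x $ i)"
      using hU by (intro sum.mono_neutral_right) (auto simp: coord_subspace_def)
    also have "\<dots> = (\<Sum>i\<in>J. snd h $ i * (snd x $ i - fst x * z $ i)) + fst x * (\<Sum>i\<in>J. snd h $ i * z $ i)"
      by (simp add: algebra_simps sum_distrib_left sum.distrib[symmetric])
    finally have 1: "inner h x = (fst h + (\<Sum>i\<in>J. snd h $ i * z $ i)) * fst x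
        + (\<Sum>i\<in>J. snd h $ i * (snd x $ i - fst x * z $ i))"
      by (simp add: algebra_simps)
    have "g None * ?S x None = (fst h + (\<Sum>i\<in>J. snd h $ i * z $ i)) * fst x"
      by (simp add: g_def scaled_coord_def exp_minus k_def field_simps)
    moreover have "g (Some i) * ?S x (Some i) = snd h $ i * (snd x $ i - fst x * z $ i)" for i
      by (simp add: g_def scaled_coord_def exp_minus field_simps)
    ultimately show ?thesis unfolding 1 I_def by (simp add: sum.reindex)
  qed
  have "\<exists>a\<in>I. g a \<noteq> 0"
  proof (rule ccontr)
    assume "\<not> ?thesis"
    then have "inner h h = 0" unfolding inner_eq[of h] by (intro sum.neutral) auto
    then show False using h(1) by simp
  qed
  \<comment> \<open>Solving the equation of the hyperplane for the coordinate with the largest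
    coefficient bounds that coordinate by the sum of the others. So the k remaining coordinates
    already separate the small lattice points.\<close>
  moreover obtain a0 where a0: "a0 \<in> I" "\<And>a. a \<in> I \<Longrightarrow> \<bar>g a\<bar> \<le> \<bar>g a0\<bar>"
  proof -
    have "Max ((\<lambda>a. \<bar>g a\<bar>) ` I) \<in> (\<lambda>a. \<bar>g a\<bar>) ` I" using finI by (intro Max_in) (auto simp: I_def)
    then obtain a0 where "a0 \<in> I" "\<bar>g a0\<bar> = Max ((\<lambda>a. \<bar>g a\<bar>) ` I)" by auto
    then show ?thesis using finI by (intro that[of a0]) auto
  qed
  ultimately have g0: "0 < \<bar>g a0\<bar>" by force
  have dominated: "\<bar>?S x a0\<bar> \<le> (\<Sum>a\<in>I - {a0}. \<bar>?S x a\<bar>)" if x: "x \<in> \<Omega>" for x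
  proof -
    have "inner h x = 0" using h(3)[OF span_base[OF x]] by (simp add: Linear_Algebra.orthogonal_def)
    then have "g a0 * ?S x a0 = - (\<Sum>a\<in>I - {a0}. g a * ?S x a)"
      unfolding inner_eq using sum.remove[OF finI a0(1), of "\<lambda>a. g a * ?S x a"] by simp
    then have "\<bar>g a0\<bar> * \<bar>?S x a0\<bar> = \<bar>\<Sum>a\<in>I - {a0}. g a * ?S x a\<bar>"
      by (metis abs_minus_cancel abs_mult)
    also have "\<dots> \<le> (\<Sum>a\<in>I - {a0}. \<bar>g a * ?S x a\<bar>)" by (rule sum_abs)
    also have "\<dots> \<le> (\<Sum>a\<in>I - {a0}. \<bar>g a0\<bar> * \<bar>?S x a\<bar>)"
      using a0(2) by (intro sum_mono) (auto simp: abs_mult intro: mult_right_mono)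
    also have "\<dots> = \<bar>g a0\<bar> * (\<Sum>a\<in>I - {a0}. \<bar>?S x a\<bar>)" by (simp add: sum_distrib_left)
    finally show ?thesis using g0 by simp
  qed
  define l where "l = c * exp (- \<epsilon> * real k * \<tau>)"
  have l: "0 < l" "l \<le> 1"
  proof -
    have "c * exp (- \<epsilon> * real k * \<tau>) \<le> 1 * 1"
      using c \<epsilon> \<tau> by (intro mult_mono) (auto simp: mult_nonneg_nonneg)
    then show "l \<le> 1" by (simp add: l_def)
  qed (use c in \<open>simp add: l_def\<close>)
  have sep: "\<exists>a\<in>I - {a0}. l / (real k + 1) \<le> \<bar>?S x a\<bar>" if x: "x \<in> \<Omega>" "x \<noteq> 0" for x
  proof (rule ccontr)
    assume "\<not> ?thesis"
    then have small: "\<bar>?S x a\<bar> < l / (real k + 1)" if "a \<in> I - {a0}" for a using that by force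
    have "(\<Sum>a\<in>I - {a0}. \<bar>?S x a\<bar>) \<le> (\<Sum>a\<in>I - {a0}. l / (real k + 1))"
      using small by (intro sum_mono) (simp add: less_imp_le)
    also have "\<dots> = real k * (l / (real k + 1))" using finI cardI a0(1) by simp
    also have "\<dots> < l" using l by (simp add: field_simps)
    finally have "\<bar>?S x a0\<bar> < l" using dominated[OF x(1)] by linarith
    moreover have "l / (real k + 1) \<le> l" using l by (simp add: field_simps)
    ultimately have "\<bar>?S x a\<bar> < l" if "a \<in> I" for a using small[of a] that by (cases "a = a0") force+
    moreover have "\<exists>a\<in>I. l \<le> \<bar>?S x a\<bar>"
      using scaled_coord_lower_bound[OF z J c \<epsilon> \<tau>, of x] x by (auto simp: \<Omega>_def l_def I_def k_def)
    ultimately show False by force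
  qed
  have \<rho>0: "0 < \<rho>" using \<rho>(2) by simp
  show False
  proof (cases "\<rho> \<le> R")
    case False
    \<comment> \<open>If \<rho> exceeds \<open>exp \<tau>\<close>, the box is wide enough to contain
      (1, z) rounded down and the unit vectors, and these span the space.\<close>
    have "(1, \<chi> i. if i \<in> J then of_int \<lfloor>z $ i\<rfloor> else 0) \<in> \<Omega>" (is "?v \<in> _")
    proof (rule \<Omega>I)
      have "exp (- (real (card J) * \<tau>)) \<le> 1" using \<tau> by simp
      then have "exp (- (real (card J) * \<tau>)) \<le> \<rho>" using \<rho>(2) by linarith
      moreover have "\<bar>exp \<tau> * (of_int \<lfloor>z $ i\<rfloor> - z $ i)\<bar> \<le> \<rho>" for i
      proof -
        have "\<bar>of_int \<lfloor>z $ i\<rfloor> - z $ i\<bar> \<le> 1" by linarith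
        then have "exp \<tau> * \<bar>of_int \<lfloor>z $ i\<rfloor> - z $ i\<bar> \<le> exp \<tau> * 1" by (rule mult_left_mono) simp
        moreover have "\<bar>exp \<tau> * (of_int \<lfloor>z $ i\<rfloor> - z $ i)\<bar> = exp \<tau> * \<bar>of_int \<lfloor>z $ i\<rfloor> - z $ i\<bar>"
          by (simp only: abs_mult abs_exp_cancel)
        ultimately show ?thesis using False unfolding R_def by linarith
      qed
      ultimately show "\<forall>a\<in>I. \<bar>?S ?v a\<bar> \<le> \<rho>"
        using \<rho>(2) by (auto simp: I_def scaled_coord_def k_def)
    qed (auto simp: coord_subspace_def integer_point_def)
    then have v: "?v \<in> span \<Omega>" by (rule span_base)
    have "(0, axis i 1) \<in> \<Omega>" if "i \<in> J" for i
    proof (rule \<Omega>I)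
      show "\<forall>a\<in>I. \<bar>?S (0, axis i 1) a\<bar> \<le> \<rho>"
        using False \<rho>0 by (auto simp: I_def scaled_coord_def axis_def R_def)
    qed (use that in \<open>auto simp: coord_subspace_def integer_point_def axis_def\<close>)
    then have ax: "(0, axis i 1) \<in> span \<Omega>" if "i \<in> J" for i using that by (intro span_base)
    have "(1, 0) = ?v - (\<Sum>i\<in>J. of_int \<lfloor>z $ i\<rfloor> *\<^sub>R (0, axis i 1))"
    proof -
      have "(\<Sum>i\<in>J. of_int \<lfloor>z $ i\<rfloor> *\<^sub>R axis i 1) $ j = (if j \<in> J then of_int \<lfloor>z $ j\<rfloor> else 0 :: real)" for j
      proof -
        have "(\<Sum>i\<in>J. of_int \<lfloor>z $ i\<rfloor> *\<^sub>R axis i 1) $ j = (\<Sum>i\<in>J. if i = j then of_int \<lfloor>z $ j\<rfloor> else 0 :: real)"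
          unfolding sum_component by (intro sum.cong) (auto simp: axis_def)
        then show ?thesis by (simp add: sum.delta)
      qed
      then show ?thesis
        by (simp add: prod_eq_iff fst_sum snd_sum Finite_Cartesian_Product.vec_eq_iff)
    qed
    then have "(1, 0) \<in> span \<Omega>"
      using v ax by (metis (no_types, lifting) span_diff span_sum span_scale)
    then have "coord_subspace J \<subseteq> span \<Omega>"
      unfolding coord_subspace_spanning using ax by (intro span_minimal) auto
    then show False
      using \<open>span \<Omega> \<subset> span (coord_subspace J)\<close> span_minimal[OF _ subspace_span] by blast
  next
    case True
    \<comment> \<open>About \<rho> R^k denominators compete for M^k cubes of side about \<rho> / R,
      so some cube receives about \<rho>^(k + 1) of them, while separation in k coordinates admits
      only a multiple of \<rho>^k.\<close>
    define Q where "Q = nat \<lfloor>\<rho> * R ^ k\<rfloor>"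
    define M where "M = nat \<lceil>R / \<rho>\<rceil>"
    have Rr: "1 \<le> R / \<rho>" using True \<rho>0 by simp
    have M: "R / \<rho> \<le> real M" "real M \<le> 2 * (R / \<rho>)" unfolding M_def using Rr by linarith+
    have M0: "0 < M" using M(1) Rr by (cases M) auto
    have Q: "\<rho> * R ^ k < real Q + 1" "real Q \<le> \<rho> * R ^ k"
      unfolding Q_def using \<rho>0 R by auto
    define y :: "nat \<Rightarrow> real \<times> (real ^ 'n)"
      where "y q = (real q, \<chi> i. if i \<in> J then of_int \<lfloor>real q * z $ i\<rfloor> else 0)" for q
    define f where "f q = (\<lambda>i\<in>J. nat \<lfloor>real M * frac (real q * z $ i)\<rfloor>)" for q :: nat
    define F where "F = PiE J (\<lambda>_. {0..<M})"
    have fF: "f q \<in> F" for q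
    proof -
      have "nat \<lfloor>real M * frac (real q * z $ i)\<rfloor> < M" for i
      proof -
        have "real M * frac (real q * z $ i) < real M * 1"
          using M0 frac_lt_1[of "real q * z $ i"] by (intro mult_strict_left_mono) auto
        then have "\<lfloor>real M * frac (real q * z $ i)\<rfloor> < int M" by linarith
        then show ?thesis using M0 by simp
      qed
      then show ?thesis by (auto simp: F_def f_def)
    qed
    have finF: "finite F" unfolding F_def by (intro finite_PiE) auto
    have cardF: "card F = M ^ k" unfolding F_def by (subst card_PiE) (auto simp: k_def)
    define w where "w = \<rho> * (real k + 1) / l"
    have w: "2 \<le> w"
    proof -
      have "2 * 1 \<le> \<rho> * ((real k + 1) / l)" using \<rho>(2) l k by (intro mult_mono) (auto simp: le_divide_eq)
      then show ?thesis by (simp add: w_def)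
    qed
    define V where "V = \<lceil>w\<rceil>"
    have y_\<Omega>: "y q - y q' \<in> \<Omega>" "\<forall>a\<in>I. \<bar>?S (y q - y q') a\<bar> \<le> \<rho>"
      if q: "q \<le> Q" "q' \<le> Q" "f q = f q'" for q q'
    proof -
      have 1: "\<bar>?S (y q - y q') None\<bar> \<le> \<rho>"
      proof -
        have "\<bar>real q - real q'\<bar> \<le> \<rho> * R ^ k" using q Q(2) by linarith
        then have "exp (- (real k * \<tau>)) * \<bar>real q - real q'\<bar> \<le> exp (- (real k * \<tau>)) * (\<rho> * R ^ k)"
          by (intro mult_left_mono) auto
        also have "\<dots> = \<rho>" by (simp add: Rk[symmetric] exp_minus)
        finally show ?thesis by (simp add: scaled_coord_def y_def abs_mult k_def)
      qed
      have 2: "\<bar>?S (y q - y q') (Some i)\<bar> \<le> \<rho>" if i: "i \<in> J" for i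
      proof -
        let ?a = "real M * frac (real q * z $ i)" and ?b = "real M * frac (real q' * z $ i)"
        have "nat \<lfloor>?a\<rfloor> = nat \<lfloor>?b\<rfloor>" using fun_cong[OF q(3), of i] i by (simp add: f_def)
        moreover have "0 \<le> ?a" "0 \<le> ?b" by (auto simp: frac_ge_0)
        ultimately have "\<lfloor>?a\<rfloor> = \<lfloor>?b\<rfloor>" by (simp add: nat_eq_iff)
        then have "\<bar>?a - ?b\<bar> \<le> 1" by linarith
        then have "real M * \<bar>frac (real q * z $ i) - frac (real q' * z $ i)\<bar> \<le> 1"
          by (simp add: abs_mult flip: right_diff_distrib)
        moreover have "R / \<rho> * \<bar>frac (real q * z $ i) - frac (real q' * z $ i)\<bar>
           \<le> real M * \<bar>frac (real q * z $ i) - frac (real q' * z $ i)\<bar>"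
          using M(1) by (rule mult_right_mono) simp
        ultimately have "R / \<rho> * \<bar>frac (real q * z $ i) - frac (real q' * z $ i)\<bar> \<le> 1" by linarith
        then have "R * \<bar>frac (real q * z $ i) - frac (real q' * z $ i)\<bar> \<le> \<rho>"
          using \<rho>0 by (simp add: pos_divide_le_eq)
        moreover have "?S (y q - y q') (Some i) = R * (frac (real q' * z $ i) - frac (real q * z $ i))"
          using i by (simp add: scaled_coord_def y_def R_def frac_def algebra_simps)
        ultimately show ?thesis using R by (simp add: abs_mult abs_minus_commute)
      qed
      show *: "\<forall>a\<in>I. \<bar>?S (y q - y q') a\<bar> \<le> \<rho>" using 1 2 by (auto simp: I_def)
      show "y q - y q' \<in> \<Omega>"
        by (rule \<Omega>I[OF _ _ *]) (auto simp: y_def coord_subspace_def integer_point_def)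
    qed
    \<comment> \<open>Points of one fibre differ by small vectors, so rounding the k separating
      coordinates to multiples of \<open>l / (k + 1)\<close> is injective on it; each coordinate
      then takes at most 2 V + 1 values.\<close>
    have fiber: "card {q \<in> {..Q}. f q = u} \<le> (nat (2 * V + 1)) ^ k" for u
    proof (cases "{q \<in> {..Q}. f q = u} = {}")
      case False
      then obtain q0 where q0: "q0 \<le> Q" "f q0 = u" by auto
      define \<phi> where "\<phi> q = (\<lambda>a\<in>I - {a0}. \<lfloor>?S (y q - y q0) a * (real k + 1) / l\<rfloor>)" for q
      define T where "T = PiE (I - {a0}) (\<lambda>_. {- V..V})"
      have "\<phi> q \<in> T" if q: "q \<le> Q" "f q = u" for q
      proof -
        have "- V \<le> \<lfloor>?S (y q - y q0) a * (real k + 1) / l\<rfloor> \<and> \<lfloor>?S (y q - y q0) a * (real k + 1) / l\<rfloor> \<le> V"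
          if a: "a \<in> I" for a
        proof -
          have "\<bar>?S (y q - y q0) a\<bar> \<le> \<rho>" using y_\<Omega>(2)[of q q0] q q0 a by auto
          then have "\<bar>?S (y q - y q0) a\<bar> * ((real k + 1) / l) \<le> \<rho> * ((real k + 1) / l)"
            using l by (intro mult_right_mono) auto
          then have "\<bar>?S (y q - y q0) a * (real k + 1) / l\<bar> \<le> w"
            using l by (simp add: abs_mult w_def)
          then show ?thesis unfolding V_def by linarith
        qed
        then show ?thesis by (auto simp: \<phi>_def T_def)
      qed
      then have sub: "\<phi> ` {q \<in> {..Q}. f q = u} \<subseteq> T" by auto
      have inj: "inj_on \<phi> {q \<in> {..Q}. f q = u}"
      proof (rule inj_onI, rule ccontr)
        fix q q' assume q: "q \<in> {q \<in> {..Q}. f q = u}" "q' \<in> {q \<in> {..Q}. f q = u}"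
          and eq: "\<phi> q = \<phi> q'" and ne: "q \<noteq> q'"
        have "y q - y q' \<in> \<Omega>" using y_\<Omega>(1)[of q q'] q by auto
        moreover have "y q - y q' \<noteq> 0" using ne by (simp add: y_def prod_eq_iff)
        ultimately obtain a where a: "a \<in> I - {a0}" "l / (real k + 1) \<le> \<bar>?S (y q - y q') a\<bar>"
          using sep by blast
        let ?A = "?S (y q - y q0) a * (real k + 1) / l" and ?B = "?S (y q' - y q0) a * (real k + 1) / l"
        have "\<lfloor>?A\<rfloor> = \<lfloor>?B\<rfloor>" using fun_cong[OF eq, of a] a(1) by (simp add: \<phi>_def)
        then have "\<bar>?A - ?B\<bar> < 1" by linarith
        moreover have "?A - ?B = ?S (y q - y q') a * ((real k + 1) / l)"
          by (simp add: scaled_coord_diff left_diff_distrib diff_divide_distrib)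
        ultimately have "\<bar>?S (y q - y q') a\<bar> * ((real k + 1) / l) < 1"
          using l by (simp add: abs_mult)
        then have "\<bar>?S (y q - y q') a\<bar> < l / (real k + 1)" using l by (simp add: field_simps)
        then show False using a(2) by simp
      qed
      have "finite T" unfolding T_def using finI by (intro finite_PiE) auto
      then have "card {q \<in> {..Q}. f q = u} \<le> card T" using card_inj_on_le[OF inj sub] by blast
      also have "card T = (nat (2 * V + 1)) ^ k"
        unfolding T_def using finI cardI a0(1) by (subst card_PiE) (auto simp: algebra_simps)
      finally show ?thesis .
    next
      case True
      show ?thesis unfolding True by simp
    qed
    have "Suc Q = card (\<Union>u\<in>F. {q \<in> {..Q}. f q = u})"
    proof -
      have "(\<Union>u\<in>F. {q \<in> {..Q}. f q = u}) = {..Q}" using fF by auto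
      then show ?thesis by simp
    qed
    also have "\<dots> \<le> (\<Sum>u\<in>F. card {q \<in> {..Q}. f q = u})" by (rule card_UN_le[OF finF])
    also have "\<dots> \<le> (\<Sum>u\<in>F. (nat (2 * V + 1)) ^ k)" by (intro sum_mono fiber)
    also have "\<dots> = (M * nat (2 * V + 1)) ^ k" by (simp add: cardF power_mult_distrib)
    finally have "real (Suc Q) \<le> (real M * real (nat (2 * V + 1))) ^ k"
      by (metis of_nat_le_iff of_nat_mult of_nat_power)
    also have "\<dots> \<le> (2 * (R / \<rho>) * (4 * w)) ^ k"
    proof (intro power_mono mult_mono)
      have "real (nat (2 * V + 1)) = 2 * of_int V + 1" using w unfolding V_def by simp
      also have "\<dots> \<le> 2 * (w + 1) + 1"
      proof -
        have "of_int V \<le> w + 1" unfolding V_def by (rule of_int_ceiling_le_add_one)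
        then show ?thesis by (intro add_right_mono mult_left_mono) auto
      qed
      finally show "real (nat (2 * V + 1)) \<le> 4 * w" using w by simp
    qed (use M R \<rho>0 in auto)
    \<comment> \<open>Here \<rho> cancels, while Q + 1 still exceeds \<rho> R^k. This bounds \<rho>
      and contradicts its choice.\<close>
    also have "2 * (R / \<rho>) * (4 * w) = R * (8 * (real k + 1) / l)"
      using \<rho>0 l(1) by (simp add: w_def field_simps)
    also have "(R * (8 * (real k + 1) / l)) ^ k = R ^ k * (8 * (real k + 1) / l) ^ k"
      by (rule power_mult_distrib)
    finally have "R ^ k * \<rho> < R ^ k * (8 * (real k + 1) / l) ^ k" using Q(1) by (simp add: mult.commute)
    then have "\<rho> < (8 * (real k + 1) / l) ^ k" using R by simp
    also have "8 * (real k + 1) / l = (8 * (real k + 1) / c) * exp (\<epsilon> * real k * \<tau>)"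
      using c(1) by (simp add: l_def exp_minus field_simps)
    also have "\<dots> ^ k = (8 * (real k + 1) / c) ^ k * exp (\<epsilon> * (real k)\<^sup>2 * \<tau>)"
    proof -
      have "real k * (\<epsilon> * real k * \<tau>) = \<epsilon> * (real k)\<^sup>2 * \<tau>" by (simp add: power2_eq_square)
      then show ?thesis unfolding power_mult_distrib exp_of_nat_mult[symmetric] by simp
    qed
    finally show False using \<rho>(1) by (simp add: k_def)
  qed
qed

text \<open>A basis of nearly optimal sizes, with one constant \<rho> that serves all sets J; the
  factor 2 in \<rho> gives the strict inequality asked for by \<open>span_small_vectors\<close>. For
  empty J the space is the line through (1, 0), and nothing has to be approximated.\<close>

lemma approximation_basis:
  fixes J :: "'n::finite set" and z :: "real ^ 'n"
  assumes z: "J \<noteq> {} \<Longrightarrow> badly_approx c \<epsilon> J z" and c: "0 < c" "c \<le> 1" and \<epsilon>: "0 \<le> \<epsilon>" and \<tau>: "0 \<le> \<tau>"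
  defines "\<rho> \<equiv> 2 * (8 * (real CARD('n) + 1) / c) ^ CARD('n) * exp (\<epsilon> * (real CARD('n))\<^sup>2 * \<tau>)"
  obtains X where "finite X" "card X \<le> Suc (card J)" "span X = coord_subspace J"
    "\<And>x. x \<in> X \<Longrightarrow> integer_point x"
    "\<And>x. x \<in> X \<Longrightarrow> \<bar>fst x\<bar> \<le> \<rho> * exp (real (card J) * \<tau>)"
    "\<And>x i. x \<in> X \<Longrightarrow> i \<in> J \<Longrightarrow> \<bar>snd x $ i - fst x * z $ i\<bar> \<le> \<rho> * exp (- \<tau>)"
proof -
  have base: "1 \<le> 8 * (real m + 1) / c" for m :: nat
  proof -
    have "1 \<le> 8 * (real m + 1)" by simp
    then have "1 * c \<le> 8 * (real m + 1) * 1" using c by (intro mult_mono) auto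
    then show ?thesis using c by (simp add: pos_le_divide_eq)
  qed
  have p1: "1 \<le> (8 * (real CARD('n) + 1) / c) ^ CARD('n)" by (rule one_le_power[OF base])
  have e1: "1 \<le> exp (\<epsilon> * (real CARD('n))\<^sup>2 * \<tau>)" using \<epsilon> \<tau> by simp
  have "2 * 1 * 1 \<le> \<rho>" unfolding \<rho>_def using p1 e1 by (intro mult_mono) auto
  then have \<rho>2: "2 \<le> \<rho>" by simp
  show ?thesis
  proof (cases "J = {}")
    case True
    have "coord_subspace ({} :: 'n set) = span {(1, 0)}" unfolding coord_subspace_spanning by simp
    then show ?thesis
      using \<rho>2 True by (intro that[of "{(1, 0)}"]) (auto simp: integer_point_def)
  next
    case False
    define k where "k = card J"
    have kn: "k \<le> CARD('n)" unfolding k_def by (rule card_mono) auto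
    have "(8 * (real k + 1) / c) ^ k \<le> (8 * (real CARD('n) + 1) / c) ^ k"
      using kn c by (intro power_mono divide_right_mono) auto
    also have "\<dots> \<le> (8 * (real CARD('n) + 1) / c) ^ CARD('n)"
      using kn base by (rule power_increasing)
    finally have A: "(8 * (real k + 1) / c) ^ k \<le> (8 * (real CARD('n) + 1) / c) ^ CARD('n)" .
    have "(real k)\<^sup>2 \<le> (real CARD('n))\<^sup>2" using kn by (intro power_mono) auto
    then have B: "exp (\<epsilon> * (real k)\<^sup>2 * \<tau>) \<le> exp (\<epsilon> * (real CARD('n))\<^sup>2 * \<tau>)"
      using \<epsilon> \<tau> by (simp add: mult_left_mono mult_right_mono)
    have "(8 * (real k + 1) / c) ^ k * exp (\<epsilon> * (real k)\<^sup>2 * \<tau>)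
       \<le> (8 * (real CARD('n) + 1) / c) ^ CARD('n) * exp (\<epsilon> * (real CARD('n))\<^sup>2 * \<tau>)"
      using A B p1 by (intro mult_mono) auto
    also have "\<dots> < \<rho>" unfolding \<rho>_def using p1 by (simp add: zero_less_mult_iff)
    finally have lt: "(8 * (real (card J) + 1) / c) ^ card J * exp (\<epsilon> * (real (card J))\<^sup>2 * \<tau>) < \<rho>"
      by (simp add: k_def)
    define \<Omega> where "\<Omega> = {x \<in> coord_subspace J. integer_point x \<and> \<bar>fst x\<bar> \<le> \<rho> * exp (real (card J) * \<tau>) \<and>
      (\<forall>i\<in>J. \<bar>snd x $ i - fst x * z $ i\<bar> \<le> \<rho> * exp (- \<tau>))}"
    have sp: "span \<Omega> = coord_subspace J"
      unfolding \<Omega>_def by (rule span_small_vectors[OF z[OF False] False c \<epsilon> \<tau> lt \<rho>2])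
    obtain B where B: "B \<subseteq> \<Omega>" "independent B" "\<Omega> \<subseteq> span B" "card B = dim \<Omega>"
      using basis_exists[of \<Omega>] by metis
    have "span B = coord_subspace J"
      using B(1,3) sp span_mono[of B \<Omega>] span_minimal[OF B(3)] by auto
    moreover have "card B \<le> Suc (card J)"
      using B(4) dim_span[of \<Omega>] sp dim_coord_subspace[of J] by simp
    ultimately show ?thesis
      using B(1) independent_imp_finite[OF B(2)] by (intro that[of B]) (auto simp: \<Omega>_def)
  qed
qed

section \<open>Lattice states\<close>

text \<open>Coordinates with respect to the vectors of a state. The standard integer lattice is
  carried into integer points, so results on the approximation of a parameter z become results on
  the lattice of a point near y.\<close>

definition comb :: "real \<times> (real ^ 'n) \<Rightarrow> ('n \<Rightarrow> real \<times> (real ^ 'n)) \<Rightarrow> real \<times> (real ^ 'n) \<Rightarrow> real \<times> (real ^ 'n)" where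
  "comb v0 v x = fst x *\<^sub>R v0 + (\<Sum>i\<in>UNIV. snd x $ i *\<^sub>R v i)"

lemma linear_comb: "linear (comb v0 v)"
  by (rule linearI)
    (auto simp: comb_def scaleR_add_left sum.distrib scaleR_sum_right scaleR_add_right algebra_simps)

lemmas comb_add = linear_add[OF linear_comb]
  and comb_scaleR = linear_scale[OF linear_comb]

lemma comb_fst_unit: "comb v0 v (1, 0) = v0"
  by (simp add: comb_def)

lemma comb_snd_unit:
  fixes v :: "'n::finite \<Rightarrow> real \<times> (real ^ 'n)"
  shows "comb v0 v (0, axis i 1) = v i"
proof -
  have "(\<Sum>j\<in>UNIV. (axis i 1 :: real ^ 'n) $ j *\<^sub>R v j) = (\<Sum>j\<in>UNIV. if j = i then v j else 0)"
    by (intro sum.cong) (auto simp: axis_def)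
  then show ?thesis by (simp add: comb_def)
qed

lemma integer_point_comb:
  assumes "integer_point v0" "\<And>i. integer_point (v i)" "integer_point x"
  shows "integer_point (comb v0 v x)"
  unfolding comb_def using assms(3)
  by (intro integer_point_add integer_point_sum integer_point_scale assms(1,2))
    (auto simp: integer_point_def)

lemma comb_image_coord_subspace:
  "comb v0 v ` coord_subspace J = span (insert v0 (v ` J))"
  unfolding coord_subspace_spanning linear_span_image[OF linear_comb, symmetric] image_insert
    image_image comb_fst_unit comb_snd_unit ..

lemma coord_subspace_UNIV: "coord_subspace UNIV = UNIV"
  by (auto simp: coord_subspace_def)

lemma fst_comb: "fst (comb v0 v x) = fst x * fst v0 + (\<Sum>i\<in>UNIV. snd x $ i * fst (v i))"
  by (simp add: comb_def fst_sum)

lemma sum_abs_coord_le: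
  fixes r :: "real ^ 'n"
  assumes "\<And>i. \<bar>r $ i\<bar> \<le> m"
  shows "(\<Sum>i\<in>UNIV. \<bar>r $ i\<bar>) \<le> real CARD('n) * m"
  using sum_bounded_above[of UNIV "\<lambda>i. \<bar>r $ i\<bar>" m] assms by simp

lemma norm_flow_comb_le:
  fixes v :: "'n::finite \<Rightarrow> real \<times> (real ^ 'n)"
  assumes "\<And>i. norm (flow u \<theta> (v i)) \<le> G" "\<And>i. \<bar>r $ i\<bar> \<le> m" "0 \<le> G"
  shows "norm (flow u \<theta> (comb v0 v (0, r))) \<le> real CARD('n) * m * G"
proof -
  have "flow u \<theta> (comb v0 v (0, r)) = (\<Sum>i\<in>UNIV. r $ i *\<^sub>R flow u \<theta> (v i))"
    by (simp add: comb_def flow_sum flow_scaleR)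
  also have "norm \<dots> \<le> (\<Sum>i\<in>UNIV. \<bar>r $ i\<bar> * G)"
    using assms(1) by (intro sum_norm_le) (simp add: mult_left_mono)
  also have "\<dots> = (\<Sum>i\<in>UNIV. \<bar>r $ i\<bar>) * G" by (simp add: sum_distrib_right)
  also have "\<dots> \<le> real CARD('n) * m * G"
    using sum_abs_coord_le[OF assms(2)] assms(3) by (rule mult_right_mono)
  finally show ?thesis .
qed

text \<open>At time \<open>t\<close> the lattice of \<open>y\<close> is balanced up to the factor \<open>\<Lambda>\<close>. The sign condition on the first
  coordinates makes every rational point in the cone over these vectors a point close to \<open>y\<close>.\<close>

definition lat_state :: "real \<times> (real ^ 'n) \<Rightarrow> ('n \<Rightarrow> real \<times> (real ^ 'n)) \<Rightarrow> real ^ 'n \<Rightarrow> real \<Rightarrow> real \<Rightarrow> bool" where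
  "lat_state v0 v y t \<Lambda> \<longleftrightarrow> integer_point v0 \<and> (\<forall>i. integer_point (v i)) \<and>
     span (insert v0 (range v)) = UNIV \<and>
     norm (flow t y v0) \<le> \<Lambda> \<and> (\<forall>i. norm (flow t y (v i)) \<le> \<Lambda>) \<and>
     (\<forall>i. 0 \<le> fst (v i) \<and> fst (v i) \<le> fst v0) \<and> exp (real CARD('n) * t) \<le> \<Lambda> * fst v0"

text \<open>The projective map induced by \<open>comb\<close>, read in the affine chart. The
  coefficients are real, so the points obtained fill a region near y.\<close>

definition cone_point :: "real \<times> (real ^ 'n) \<Rightarrow> ('n \<Rightarrow> real \<times> (real ^ 'n)) \<Rightarrow> real \<times> (real ^ 'n) \<Rightarrow> real ^ 'n" where
  "cone_point v0 v c = (1 / fst (comb v0 v c)) *\<^sub>R snd (comb v0 v c)"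

lemma lat_state_standard: "lat_state (1, 0) (\<lambda>i. (0, axis i 1)) 0 0 1"
proof -
  have "span (insert (1, 0) (range (\<lambda>i. (0, axis i 1)))) = (UNIV :: (real \<times> (real ^ 'n)) set)"
    using coord_subspace_spanning[of "UNIV :: 'n set"] coord_subspace_UNIV by auto
  then show ?thesis
    unfolding lat_state_def by (auto simp: integer_point_def flow_def axis_def[of _ "1::real"] norm_Pair)
       (auto simp flip: axis_def)
qed

lemma lat_state_inj:
  assumes "lat_state v0 v y t \<Lambda>"
  shows "inj (comb v0 v)"
proof -
  have "surj (comb v0 v)"
    using comb_image_coord_subspace[of v0 v UNIV] assms unfolding lat_state_def coord_subspace_UNIV by simp
  then show ?thesis using linear_surjective_imp_injective[OF linear_comb] by blast
qed

text \<open>Subtracting the multiple of v0 with the same first coordinate cancels the long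
  direction. What is left are the deviations of v and v0 from multiples of (1, y), each at most
  \<open>\<Lambda> * exp (- t)\<close>; the quotient in front of v0 is at most 1.\<close>

lemma norm_reduced_vector_le:
  fixes v v0 :: "real \<times> (real ^ 'n)"
  assumes "0 \<le> fst v" "fst v \<le> fst v0" and \<Lambda>: "norm (flow t y v) \<le> \<Lambda>" "norm (flow t y v0) \<le> \<Lambda>"
  shows "norm (v - (fst v / fst v0) *\<^sub>R v0) \<le> 2 * \<Lambda> * exp (- t)"
    and "norm (flow 0 y v - (fst v / fst v0) *\<^sub>R flow 0 y v0) \<le> 2 * \<Lambda> * exp (- t)"
proof -
  let ?c = "fst v / fst v0"
  have f0: "fst v - ?c * fst v0 = 0" using assms(1,2) by (cases "fst v0 = 0") auto
  have c: "0 \<le> ?c" "?c \<le> 1" using assms(1,2) by (auto simp: divide_le_eq)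
  have e: "norm (snd x - fst x *\<^sub>R y) \<le> \<Lambda> * exp (- t)" if "norm (flow t y x) \<le> \<Lambda>" for x :: "real \<times> (real ^ 'n)"
    using order_trans[OF flow_snd_le mult_left_mono[OF that, of "exp (- t)"]]
    by (simp add: mult.commute)
  have s: "snd v - ?c *\<^sub>R snd v0 = (snd v - fst v *\<^sub>R y) - ?c *\<^sub>R (snd v0 - fst v0 *\<^sub>R y)"
  proof -
    have "(snd v - fst v *\<^sub>R y) - ?c *\<^sub>R (snd v0 - fst v0 *\<^sub>R y)
       = (snd v - ?c *\<^sub>R snd v0) - (fst v - ?c * fst v0) *\<^sub>R y" by (simp add: algebra_simps)
    then show ?thesis unfolding f0 by simp
  qed
  have "?c * norm (snd v0 - fst v0 *\<^sub>R y) \<le> 1 * norm (snd v0 - fst v0 *\<^sub>R y)"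
    using c by (intro mult_right_mono) auto
  then have le: "norm ((snd v - fst v *\<^sub>R y) - ?c *\<^sub>R (snd v0 - fst v0 *\<^sub>R y)) \<le> 2 * \<Lambda> * exp (- t)"
    using norm_triangle_ineq4[of "snd v - fst v *\<^sub>R y" "?c *\<^sub>R (snd v0 - fst v0 *\<^sub>R y)"] e[OF \<Lambda>(1)] e[OF \<Lambda>(2)]
    unfolding norm_scaleR abs_of_nonneg[OF c(1)] by linarith
  have "v - ?c *\<^sub>R v0 = (0, snd v - ?c *\<^sub>R snd v0)" using f0 by (simp add: prod_eq_iff)
  then show "norm (v - ?c *\<^sub>R v0) \<le> 2 * \<Lambda> * exp (- t)" using le unfolding s[symmetric] by (simp add: norm_Pair)
  have "flow 0 y v - ?c *\<^sub>R flow 0 y v0 = (0, (snd v - fst v *\<^sub>R y) - ?c *\<^sub>R (snd v0 - fst v0 *\<^sub>R y))"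
    using f0 by (simp add: flow_def prod_eq_iff)
  then show "norm (flow 0 y v - ?c *\<^sub>R flow 0 y v0) \<le> 2 * \<Lambda> * exp (- t)" using le by (simp add: norm_Pair)
qed

text \<open>Signs are changed to make first coordinates nonnegative, and v0 is a vector for which
  this coordinate is largest. It cannot be small: once v0 is removed from the others, vectors of
  size about \<open>exp (- t)\<close> remain, so a volume of at least 1 forces the first coordinate
  of v0 to be of order \<open>exp (n t)\<close>. The price is the n-th power of \<Lambda>.\<close>

lemma lat_state_exists:
  fixes X :: "(real \<times> (real ^ 'n)) set"
  assumes X: "finite X" "card X \<le> Suc CARD('n)" "span X = UNIV" "\<And>x. x \<in> X \<Longrightarrow> integer_point x"
    and \<Lambda>: "\<And>x. x \<in> X \<Longrightarrow> norm (flow t y x) \<le> \<Lambda>" "1 \<le> \<Lambda>"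
    and t: "(2 * \<Lambda>) ^ Suc CARD('n) \<le> exp (real (Suc CARD('n)) * t)"
  obtains v0 v where "lat_state v0 v y t (2 * (2 * \<Lambda>) ^ CARD('n))"
proof -
  let ?n = "CARD('n)"
  define s :: "real \<times> (real ^ 'n) \<Rightarrow> real \<times> (real ^ 'n)" where "s x = (if fst x < 0 then - x else x)" for x
  define X' where "X' = s ` X"
  have X': "finite X'" "card X' \<le> Suc ?n" "\<And>x. x \<in> X' \<Longrightarrow> integer_point x"
    "\<And>x. x \<in> X' \<Longrightarrow> norm (flow t y x) \<le> \<Lambda>" "\<And>x. x \<in> X' \<Longrightarrow> 0 \<le> fst x"
    using X \<Lambda>(1) card_image_le[OF X(1), of s] linear_neg[OF linear_flow, of t y]
    by (auto simp: X'_def s_def integer_point_def)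
  have "x \<in> span X'" if "x \<in> X" for x
  proof -
    have "s x \<in> span X'" using that by (auto simp: X'_def intro: span_base)
    moreover have "x = s x \<or> x = - s x" by (auto simp: s_def)
    ultimately show ?thesis using span_neg by metis
  qed
  then have "X \<subseteq> span X'" by blast
  then have "span X \<subseteq> span X'" by (simp add: span_minimal)
  then have spX': "span X' = UNIV" using X(3) by blast
  have indX': "independent X'"
    by (rule independent_of_card_le_dim[OF spX' X'(1)]) (use X'(2) in \<open>simp add: dim_UNIV\<close>)
  have cX': "card X' = Suc ?n"
    using dim_eq_card_independent[OF indX'] dim_span[of X'] spX' by (simp add: dim_UNIV)
  have ne: "X' \<noteq> {}" using cX' by auto
  have "Max (fst ` X') \<in> fst ` X'" using X'(1) ne by (intro Max_in) auto
  then obtain x0 where x0: "x0 \<in> X'" "fst x0 = Max (fst ` X')" by auto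
  have x0m: "fst x \<le> fst x0" if "x \<in> X'" for x using x0(2) X'(1) that by simp
  have "card (X' - {x0}) = card (UNIV :: 'n set)" using cX' x0(1) X'(1) by simp
  then obtain g where g: "bij_betw g (UNIV :: 'n set) (X' - {x0})"
    using finite_same_card_bij[of "UNIV :: 'n set" "X' - {x0}"] X'(1) by auto
  have ins: "insert x0 (range g) = X'" using g x0(1) by (auto simp: bij_betw_def)
  obtain f where f: "bij_betw f {..<?n} (UNIV :: 'n set)"
    using ex_bij_betw_nat_finite[of "UNIV :: 'n set"] by (auto simp: atLeast0LessThan)
  define b where "b i = (case i of 0 \<Rightarrow> x0 | Suc j \<Rightarrow> g (f j))" for i
  have bimg: "b ` {..<Suc ?n} = X'"
  proof -
    have "b ` {..<Suc ?n} = insert x0 (g ` f ` {..<?n})"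
      unfolding lessThan_Suc_eq_insert_0 by (auto simp: b_def image_image)
    then show ?thesis using f ins by (simp add: bij_betw_def)
  qed
  have "1 \<le> gram_det (Suc ?n) b"
  proof (rule gram_det_integer_points_ge_1)
    show "integer_point (b i)" if "i < Suc ?n" for i using bimg X'(3) that by blast
    show "inj_on b {..<Suc ?n}" using bimg cX' by (intro eq_card_imp_inj_on) auto
    show "independent (b ` {..<Suc ?n})" using bimg indX' by simp
  qed
  also have "\<dots> = gram_det (Suc ?n) (\<lambda>i. flow 0 y (b i))" by (simp only: gram_det_flow)
  also have "\<dots> \<le> (norm (flow 0 y (b 0)))\<^sup>2 *
      (\<Prod>i<?n. (norm (flow 0 y (b (Suc i)) - (fst (b (Suc i)) / fst x0) *\<^sub>R flow 0 y (b 0)))\<^sup>2)"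
    by (rule gram_det_le_prod_reduced)
  also have "\<dots> \<le> (fst x0 + \<Lambda> * exp (- t))\<^sup>2 * (\<Prod>i<?n. (2 * \<Lambda> * exp (- t))\<^sup>2)"
  proof (intro mult_mono prod_mono conjI power_mono)
    have "norm (flow 0 y x0) \<le> fst x0 + norm (snd x0 - fst x0 *\<^sub>R y)"
      using norm_flow_le[of 0 y x0] X'(5)[OF x0(1)] by simp
    also have "norm (snd x0 - fst x0 *\<^sub>R y) \<le> exp (- t) * \<Lambda>"
      by (rule order_trans[OF flow_snd_le mult_left_mono[OF X'(4)[OF x0(1)]]]) simp
    finally show "norm (flow 0 y (b 0)) \<le> fst x0 + \<Lambda> * exp (- t)" by (simp add: b_def mult.commute)
    fix i assume "i \<in> {..<?n}"
    then have "b (Suc i) \<in> X'" using bimg by blast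
    then show "norm (flow 0 y (b (Suc i)) - (fst (b (Suc i)) / fst x0) *\<^sub>R flow 0 y (b 0)) \<le> 2 * \<Lambda> * exp (- t)"
      using norm_reduced_vector_le(2)[of "b (Suc i)" x0 t y \<Lambda>] X'(4,5) x0(1) x0m by (simp add: b_def)
  qed (auto intro!: prod_nonneg)
  also have "\<dots> = ((fst x0 + \<Lambda> * exp (- t)) * (2 * \<Lambda> * exp (- t)) ^ ?n)\<^sup>2"
    by (simp only: prod_constant card_lessThan power_mult_distrib[of "fst x0 + \<Lambda> * exp (- t)"]
        power_mult[symmetric] mult.commute[of 2])
  finally have "1 \<le> ((fst x0 + \<Lambda> * exp (- t)) * (2 * \<Lambda> * exp (- t)) ^ ?n)\<^sup>2" .
  moreover have "0 \<le> (fst x0 + \<Lambda> * exp (- t)) * (2 * \<Lambda> * exp (- t)) ^ ?n"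
    using X'(5)[OF x0(1)] \<Lambda>(2) by (intro mult_nonneg_nonneg zero_le_power add_nonneg_nonneg) auto
  ultimately have "1 \<le> (fst x0 + \<Lambda> * exp (- t)) * (2 * \<Lambda> * exp (- t)) ^ ?n"
    by (metis one_power2 power2_le_imp_le)
  then have ge: "exp (real ?n * t) \<le> (fst x0 + \<Lambda> * exp (- t)) * (2 * \<Lambda>) ^ ?n"
    by (simp add: power_mult_distrib exp_minus field_simps flip: exp_of_nat_mult)
  \<comment> \<open>The deviation of x0 from a multiple of (1, y) accounts for at most half of the
    bound; this is the purpose of the hypothesis on t.\<close>
  have "\<Lambda> * exp (- t) * (2 * \<Lambda>) ^ ?n \<le> exp (real ?n * t) / 2"
  proof -
    have "2 * \<Lambda> * (2 * \<Lambda>) ^ ?n * exp (- t) \<le> exp (real (Suc ?n) * t) * exp (- t)"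
      using t by (intro mult_right_mono) auto
    also have "\<dots> = exp (real ?n * t)" by (simp flip: exp_add add: algebra_simps)
    finally show ?thesis by (simp add: mult_ac)
  qed
  with ge have low: "exp (real ?n * t) \<le> 2 * (2 * \<Lambda>) ^ ?n * fst x0" by (simp add: algebra_simps)
  have "\<Lambda> \<le> 2 * (2 * \<Lambda>) ^ ?n"
  proof -
    have "2 * \<Lambda> \<le> (2 * \<Lambda>) ^ ?n" using power_increasing[of 1 ?n "2 * \<Lambda>"] \<Lambda>(2) by (simp add: Suc_le_eq)
    then show ?thesis using \<Lambda>(2) by linarith
  qed
  then have "norm (flow t y x) \<le> 2 * (2 * \<Lambda>) ^ ?n" if "x \<in> X'" for x using X'(4)[OF that] by linarith
  moreover have "g i \<in> X'" for i using ins by auto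
  ultimately have "lat_state x0 g y t (2 * (2 * \<Lambda>) ^ ?n)"
    unfolding lat_state_def ins using X' x0 x0m spX' low by auto
  then show ?thesis by (rule that)
qed

context
  fixes v0 :: "real \<times> (real ^ 'n)" and v y t \<Lambda>
  assumes st: "lat_state v0 v y t \<Lambda>" and \<Lambda>1: "1 \<le> \<Lambda>"
begin

lemma state_fst_pos: "0 < fst v0" and state_fst_ge: "exp (real CARD('n) * t) / \<Lambda> \<le> fst v0"
  and state_fst_le: "fst v0 \<le> \<Lambda> * exp (real CARD('n) * t)"
proof -
  have "exp (real CARD('n) * t) \<le> \<Lambda> * fst v0" using st unfolding lat_state_def by blast
  then show ge: "exp (real CARD('n) * t) / \<Lambda> \<le> fst v0" using \<Lambda>1 by (simp add: field_simps)
  have "0 < exp (real CARD('n) * t) / \<Lambda>" using \<Lambda>1 by simp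
  then show "0 < fst v0" using ge by linarith
  have "\<bar>fst v0\<bar> \<le> exp (real CARD('n) * t) * norm (flow t y v0)" by (rule flow_fst_le)
  also have "\<dots> \<le> exp (real CARD('n) * t) * \<Lambda>"
    using st unfolding lat_state_def by (intro mult_left_mono) auto
  finally show "fst v0 \<le> \<Lambda> * exp (real CARD('n) * t)" by (simp add: mult.commute)
qed

lemma fst_comb_bounds:
  assumes c: "0 \<le> fst c" "\<And>i. 0 \<le> snd c $ i \<and> snd c $ i \<le> m"
  shows "fst c * fst v0 \<le> fst (comb v0 v c)"
    "fst (comb v0 v c) \<le> (fst c + real CARD('n) * m) * fst v0"
proof -
  have v: "0 \<le> fst (v i)" "fst (v i) \<le> fst v0" for i using st unfolding lat_state_def by auto
  have "0 \<le> (\<Sum>i\<in>UNIV. snd c $ i * fst (v i))" using c v by (intro sum_nonneg) auto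
  then show "fst c * fst v0 \<le> fst (comb v0 v c)" unfolding fst_comb by simp
  have "(\<Sum>i\<in>UNIV. snd c $ i * fst (v i)) \<le> (\<Sum>i\<in>(UNIV::'n set). m * fst v0)"
    using c v by (intro sum_mono mult_mono) (auto intro: order_trans)
  then show "fst (comb v0 v c) \<le> (fst c + real CARD('n) * m) * fst v0"
    unfolding fst_comb by (simp add: algebra_simps)
qed

text \<open>Relative to \<open>fst c\<close>, the vector of the cone has first coordinate at least
  about \<open>exp (n t)\<close> and norm at most about \<Lambda> at time t. So its direction
  \<theta> is within about \<open>exp (-(n + 1) t)\<close> of y, and the lattice of \<theta> at time
  t is balanced as well; \<Lambda>^3 is \<Lambda>^2 from the displacement times \<Lambda> from the
  state. The vector has no component transverse to \<theta>, so the flow acts on it through the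
  weight -n alone.\<close>

lemma cone_point_bounds:
  assumes c: "0 < fst c" "\<And>i. 0 \<le> snd c $ i \<and> snd c $ i \<le> 2 * fst c"
  defines "\<theta> \<equiv> cone_point v0 v c"
  shows "norm (\<theta> - y) \<le> (2 * real CARD('n) + 1) * \<Lambda>\<^sup>2 * exp (- real (Suc CARD('n)) * t)"
    and "norm (flow t \<theta> v0) \<le> (2 * real CARD('n) + 2) * \<Lambda> ^ 3"
    and "norm (flow t \<theta> (v i)) \<le> (2 * real CARD('n) + 2) * \<Lambda> ^ 3"
    and "flow u \<theta> (comb v0 v c) = (exp (- real CARD('n) * u) * fst (comb v0 v c), 0)"
    and "snd (comb v0 v c) = fst (comb v0 v c) *\<^sub>R \<theta>"
    and "0 < fst (comb v0 v c)"
proof -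
  let ?n = "real CARD('n)"
  let ?w = "comb v0 v c"
  have lo: "fst c * fst v0 \<le> fst ?w" using c by (intro fst_comb_bounds(1)) auto
  then show Q: "0 < fst ?w" using mult_pos_pos[OF c(1) state_fst_pos] by linarith
  then show sw: "snd ?w = fst ?w *\<^sub>R \<theta>" by (simp add: \<theta>_def cone_point_def)
  then show "flow u \<theta> ?w = (exp (- ?n * u) * fst ?w, 0)" for u by (simp add: flow_def)
  have n0: "norm (flow t y v0) \<le> \<Lambda>" and n1: "norm (flow t y (v i)) \<le> \<Lambda>" for i
    using st unfolding lat_state_def by auto
  have "flow t y ?w = fst c *\<^sub>R flow t y v0 + (\<Sum>i\<in>UNIV. snd c $ i *\<^sub>R flow t y (v i))"
    by (simp add: comb_def flow_add flow_sum flow_scaleR)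
  also have "norm \<dots> \<le> fst c * \<Lambda> + (\<Sum>i\<in>(UNIV::'n set). (2 * fst c) * \<Lambda>)"
  proof (intro order_trans[OF norm_triangle_ineq] add_mono sum_norm_le)
    show "norm (fst c *\<^sub>R flow t y v0) \<le> fst c * \<Lambda>" using c(1) n0 by (simp add: mult_left_mono)
    show "norm (snd c $ i *\<^sub>R flow t y (v i)) \<le> 2 * fst c * \<Lambda>" for i
      using c(2)[of i] n1[of i] \<Lambda>1 by (simp add: mult_mono)
  qed
  also have "\<dots> = fst c * ((2 * ?n + 1) * \<Lambda>)" by (simp add: algebra_simps)
  finally have nf: "norm (flow t y ?w) \<le> fst c * ((2 * ?n + 1) * \<Lambda>)" .
  have "fst ?w *\<^sub>R (\<theta> - y) = snd ?w - fst ?w *\<^sub>R y" by (simp add: sw algebra_simps)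
  then have "fst ?w * norm (\<theta> - y) = norm (snd ?w - fst ?w *\<^sub>R y)" using Q by (metis abs_of_pos norm_scaleR)
  also have "\<dots> \<le> exp (- t) * norm (flow t y ?w)" by (rule flow_snd_le)
  also have "\<dots> \<le> exp (- t) * (fst c * ((2 * ?n + 1) * \<Lambda>))" using nf by (rule mult_left_mono) simp
  finally have "fst ?w * norm (\<theta> - y) \<le> exp (- t) * (fst c * ((2 * ?n + 1) * \<Lambda>))" .
  moreover have "fst c * (exp (?n * t) / \<Lambda>) * norm (\<theta> - y) \<le> fst ?w * norm (\<theta> - y)"
    using lo mult_left_mono[OF state_fst_ge, of "fst c"] c(1) by (intro mult_right_mono) auto
  ultimately have "fst c * ((exp (?n * t) / \<Lambda>) * norm (\<theta> - y)) \<le> fst c * (exp (- t) * ((2 * ?n + 1) * \<Lambda>))"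
    by (simp add: mult_ac)
  then have "(exp (?n * t) / \<Lambda>) * norm (\<theta> - y) \<le> exp (- t) * ((2 * ?n + 1) * \<Lambda>)"
    using c(1) by (simp only: mult_le_cancel_left_pos)
  then have "norm (\<theta> - y) \<le> exp (- t) * ((2 * ?n + 1) * \<Lambda>) * (\<Lambda> / exp (?n * t))"
    using \<Lambda>1 by (simp add: field_simps)
  also have "\<dots> = (2 * ?n + 1) * \<Lambda>\<^sup>2 * (exp (- t) * exp (- (?n * t)))"
    by (simp add: power2_eq_square exp_minus field_simps)
  also have "exp (- t) * exp (- (?n * t)) = exp (- real (Suc CARD('n)) * t)"
    by (simp add: algebra_simps flip: exp_add)
  finally show d: "norm (\<theta> - y) \<le> (2 * ?n + 1) * \<Lambda>\<^sup>2 * exp (- real (Suc CARD('n)) * t)" .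
  have "exp (real (Suc CARD('n)) * t) * norm (y - \<theta>) \<le> exp (real (Suc CARD('n)) * t) * ((2 * ?n + 1) * \<Lambda>\<^sup>2 * exp (- real (Suc CARD('n)) * t))"
    using d by (intro mult_left_mono) (auto simp: norm_minus_commute)
  also have "\<dots> = (2 * ?n + 1) * \<Lambda>\<^sup>2 * (exp (real (Suc CARD('n)) * t) * exp (- real (Suc CARD('n)) * t))"
    by (simp only: mult_ac)
  also have "exp (real (Suc CARD('n)) * t) * exp (- real (Suc CARD('n)) * t) = 1"
    unfolding exp_add[symmetric] by (simp del: of_nat_Suc)
  finally have "1 + exp (real (Suc CARD('n)) * t) * norm (y - \<theta>) \<le> 1 + (2 * ?n + 1) * \<Lambda>\<^sup>2"
    unfolding mult_1_right by (rule add_left_mono)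
  also have "\<dots> \<le> (2 * ?n + 2) * \<Lambda>\<^sup>2" using one_le_power[OF \<Lambda>1, of 2] by (simp add: algebra_simps)
  finally have f: "1 + exp (real (Suc CARD('n)) * t) * norm (y - \<theta>) \<le> (2 * ?n + 2) * \<Lambda>\<^sup>2" .
  have tr: "norm (flow t \<theta> x) \<le> (2 * ?n + 2) * \<Lambda> ^ 3" if "norm (flow t y x) \<le> \<Lambda>" for x
  proof -
    have "norm (flow t \<theta> x) \<le> (1 + exp (real (Suc CARD('n)) * t) * norm (y - \<theta>)) * norm (flow t y x)"
      by (rule norm_flow_perturb)
    also have "\<dots> \<le> ((2 * ?n + 2) * \<Lambda>\<^sup>2) * \<Lambda>" using f that by (intro mult_mono) auto
    finally show ?thesis by (simp add: power2_eq_square power3_eq_cube)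
  qed
  show "norm (flow t \<theta> v0) \<le> (2 * ?n + 2) * \<Lambda> ^ 3" "norm (flow t \<theta> (v i)) \<le> (2 * ?n + 2) * \<Lambda> ^ 3"
    using tr n0 n1 by blast+
qed

end

text \<open>The shape of \<open>split_basis\<close> with a factor B in place of
  \<open>exp (\<epsilon> * t)\<close>: the estimates produce such factors, and their constants are
  absorbed only at the end.\<close>

definition split_lattice :: "real \<Rightarrow> real ^ 'n \<Rightarrow> nat \<Rightarrow> real \<Rightarrow> real \<Rightarrow> bool" where
  "split_lattice u \<theta> d h B \<longleftrightarrow> (\<exists>X1 X2. finite X1 \<and> finite X2 \<and> card X1 \<le> Suc d \<and> card X2 \<le> CARD('n) - d \<and>
     span (X1 \<union> X2) = UNIV \<and> (\<forall>x\<in>X1 \<union> X2. integer_point x) \<and>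
     (\<forall>x\<in>X1. norm (flow u \<theta> x) \<le> B * exp (- (real CARD('n) - real d) / (real d + 1) * h)) \<and>
     (\<forall>x\<in>X2. norm (flow u \<theta> x) \<le> B * exp h))"

lemma split_latticeI:
  fixes \<theta> :: "real ^ 'n"
  assumes "finite X1" "finite X2" "card X1 \<le> Suc d" "card X2 \<le> CARD('n) - d"
    "span (X1 \<union> X2) = UNIV" "\<And>x. x \<in> X1 \<Longrightarrow> integer_point x" "\<And>x. x \<in> X2 \<Longrightarrow> integer_point x"
    "\<And>x. x \<in> X1 \<Longrightarrow> norm (flow u \<theta> x) \<le> B * exp (- (real CARD('n) - real d) / (real d + 1) * h)"
    "\<And>x. x \<in> X2 \<Longrightarrow> norm (flow u \<theta> x) \<le> B * exp h"
  shows "split_lattice u \<theta> d h B"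
  unfolding split_lattice_def
  by (rule exI[of _ X1], rule exI[of _ X2]) (use assms in blast)

lemma split_lattice_perturb:
  fixes \<theta> :: "real ^ 'n"
  assumes "split_lattice u \<theta> d h B" "0 \<le> B" "(1 + exp (real (Suc CARD('n)) * u) * norm (\<theta> - \<theta>')) * B \<le> B'"
  shows "split_lattice u \<theta>' d h B'"
proof -
  have *: "norm (flow u \<theta>' x) \<le> B' * E" if "norm (flow u \<theta> x) \<le> B * E" "0 < E" for x E
  proof -
    have "norm (flow u \<theta>' x) \<le> (1 + exp (real (Suc CARD('n)) * u) * norm (\<theta> - \<theta>')) * norm (flow u \<theta> x)"
      by (rule norm_flow_perturb)
    also have "\<dots> \<le> (1 + exp (real (Suc CARD('n)) * u) * norm (\<theta> - \<theta>')) * (B * E)"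
      using that(1) by (rule mult_left_mono) (simp add: add_nonneg_nonneg)
    also have "\<dots> \<le> B' * E"
      using mult_right_mono[OF assms(3), of E] that(2) by (simp add: mult_ac)
    finally show ?thesis .
  qed
  obtain X1 X2 where X: "finite X1" "finite X2" "card X1 \<le> Suc d" "card X2 \<le> CARD('n) - d"
    "span (X1 \<union> X2) = UNIV" "\<forall>x\<in>X1 \<union> X2. integer_point x"
    "\<forall>x\<in>X1. norm (flow u \<theta> x) \<le> B * exp (- (real CARD('n) - real d) / (real d + 1) * h)"
    "\<forall>x\<in>X2. norm (flow u \<theta> x) \<le> B * exp h"
    using assms(1) unfolding split_lattice_def by (elim exE conjE) (rule that)
  show ?thesis
    using X * by (intro split_latticeI[of X1 X2]) auto
qed

lemma split_lattice_imp_split_basis: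
  fixes \<theta> :: "real ^ 'n"
  assumes "split_lattice u \<theta> d h B" "B \<le> exp (\<epsilon> * u)"
  shows "split_basis u \<theta> d h \<epsilon>"
proof -
  have *: "norm (flow u \<theta> x) \<le> exp (a + \<epsilon> * u)" if "norm (flow u \<theta> x) \<le> B * exp a" for x a
    using order_trans[OF that mult_right_mono[OF assms(2)]] by (simp add: exp_add mult.commute)
  obtain X1 X2 where X: "finite X1 \<and> finite X2 \<and> card X1 \<le> Suc d \<and> card X2 \<le> CARD('n) - d \<and>
     span (X1 \<union> X2) = UNIV \<and> (\<forall>x\<in>X1 \<union> X2. integer_point x)"
    and n: "\<forall>x\<in>X1. norm (flow u \<theta> x) \<le> B * exp (- (real CARD('n) - real d) / (real d + 1) * h)"
    "\<forall>x\<in>X2. norm (flow u \<theta> x) \<le> B * exp h"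
    using assms(1) unfolding split_lattice_def by blast
  show ?thesis unfolding split_basis_def
    by (rule exI[of _ X1], rule exI[of _ X2]) (use X n * in blast)
qed

text \<open>For h = 0 both blocks have the same bound, so any division will do; d = 0 is the
  convention for balanced lattices.\<close>

lemma split_lattice_balanced:
  fixes \<theta> :: "real ^ 'n"
  assumes X: "finite X" "card X \<le> Suc CARD('n)" "span X = UNIV" "\<And>x. x \<in> X \<Longrightarrow> integer_point x"
    "\<And>x. x \<in> X \<Longrightarrow> norm (flow u \<theta> x) \<le> B"
  shows "split_lattice u \<theta> 0 0 B"
proof (cases "X = {}")
  case True
  then show ?thesis using X by (intro split_latticeI[of "{}" "{}"]) auto
next
  case False
  then obtain x0 where "x0 \<in> X" by blast
  then show ?thesis
    using X by (intro split_latticeI[of "{x0}" "X - {x0}"]) (auto simp: insert_absorb)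
qed

text \<open>The factor \<rho> of \<open>approximation_basis\<close> without its exponential
  part.\<close>

definition loss :: "real \<Rightarrow> nat \<Rightarrow> real" where
  "loss c n = 2 * (8 * (real n + 1) / c) ^ n"

lemma loss_ge_1: "0 < c \<Longrightarrow> c \<le> 1 \<Longrightarrow> 1 \<le> loss c n"
proof -
  assume c: "0 < c" "c \<le> 1"
  have "1 * c \<le> 8 * (real n + 1) * 1" using c by (intro mult_mono) auto
  then have "1 \<le> 8 * (real n + 1) / c" using c by (simp add: pos_le_divide_eq)
  then have "1 \<le> (8 * (real n + 1) / c) ^ n" by (rule one_le_power)
  then show ?thesis by (simp add: loss_def)
qed

text \<open>In the coordinates of the state, the lattice of the point with parameter z evolves from
  t to u as the lattice of z itself does during the time u - t. A nearly badly approximable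
  parameter therefore keeps the lattice balanced for as long as desired.\<close>

lemma generic_point_vectors:
  fixes v0 :: "real \<times> (real ^ 'n)" and z :: "real ^ 'n"
  assumes st: "lat_state v0 v y t \<Lambda>" and \<Lambda>1: "1 \<le> \<Lambda>"
    and z: "\<And>i. 1 \<le> z $ i \<and> z $ i \<le> 2" "badly_approx c \<epsilon> UNIV z" and c: "0 < c" "c \<le> 1" and \<epsilon>: "0 \<le> \<epsilon>"
    and u: "t \<le> u"
  defines "P \<equiv> 2 * real CARD('n) + 2"
  obtains X where "finite X" "card X \<le> Suc CARD('n)" "span X = UNIV" "\<And>x. x \<in> X \<Longrightarrow> integer_point x"
    "\<And>x. x \<in> X \<Longrightarrow> norm (flow u (cone_point v0 v (1, z)) x)
       \<le> loss c CARD('n) * exp (\<epsilon> * (real CARD('n))\<^sup>2 * (u - t)) * (P\<^sup>2 * \<Lambda> ^ 3)"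
proof -
  let ?n = "real CARD('n)"
  let ?\<theta> = "cone_point v0 v (1, z)"
  let ?w = "comb v0 v (1, z)"
  define \<rho> where "\<rho> = loss c CARD('n) * exp (\<epsilon> * ?n\<^sup>2 * (u - t))"
  have \<rho>0: "0 \<le> \<rho>" using loss_ge_1[OF c, of "CARD('n)"] by (simp add: \<rho>_def)
  have P: "2 * ?n + 1 \<le> P" "?n * P + P \<le> P\<^sup>2" "0 \<le> P" "1 \<le> P" by (auto simp: P_def power2_eq_square algebra_simps)
  have ut: "0 \<le> u - t" using u by simp
  obtain X0 where X0: "finite X0" "card X0 \<le> Suc CARD('n)" "span X0 = (UNIV :: (real \<times> (real ^ 'n)) set)"
    "\<And>x. x \<in> X0 \<Longrightarrow> integer_point x"
    "\<And>x. x \<in> X0 \<Longrightarrow> \<bar>fst x\<bar> \<le> \<rho> * exp (?n * (u - t))"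
    "\<And>x i. x \<in> X0 \<Longrightarrow> \<bar>snd x $ i - fst x * z $ i\<bar> \<le> \<rho> * exp (- (u - t))"
    by (rule approximation_basis[OF z(2) c \<epsilon> ut, folded loss_def \<rho>_def, unfolded coord_subspace_UNIV])
       (rule that, auto)
  have z0: "0 \<le> z $ i" for i using z(1)[of i] by linarith
  have cz: "0 < fst (1::real, z)" "\<And>i. 0 \<le> snd (1::real, z) $ i \<and> snd (1::real, z) $ i \<le> 2 * fst (1::real, z)"
    using z(1) by (auto intro: order_trans[of 0 1])
  note cp = cone_point_bounds[OF st \<Lambda>1 cz]
  have int: "integer_point v0" "\<And>i. integer_point (v i)" using st unfolding lat_state_def by auto
  have bound: "norm (flow u ?\<theta> (comb v0 v m)) \<le> \<rho> * (P\<^sup>2 * \<Lambda> ^ 3)" if m: "m \<in> X0" for m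
  proof -
    \<comment> \<open>The multiple of (1, z) is mapped to a multiple of the direction of the point,
      which is contracted; the error r of the approximation is small and meets vectors that grow by
      at most \<open>exp (u - t)\<close>.\<close>
    define r where "r = snd m - fst m *\<^sub>R z"
    have "m = fst m *\<^sub>R (1, z) + (0, r)" by (simp add: r_def prod_eq_iff)
    then have "comb v0 v m = fst m *\<^sub>R ?w + comb v0 v (0, r)" by (metis comb_add comb_scaleR)
    then have "norm (flow u ?\<theta> (comb v0 v m)) \<le> \<bar>fst m\<bar> * norm (flow u ?\<theta> ?w) + norm (flow u ?\<theta> (comb v0 v (0, r)))"
      by (simp only: flow_add flow_scaleR) (metis norm_scaleR norm_triangle_ineq)
    also have "\<bar>fst m\<bar> * norm (flow u ?\<theta> ?w) \<le> \<rho> * (P * \<Lambda> ^ 3)"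
    proof -
      have "fst ?w \<le> (1 + ?n * 2) * fst v0"
        using fst_comb_bounds(2)[OF st \<Lambda>1, of "(1, z)" 2] z(1) z0 by simp
      also have "\<dots> \<le> P * (\<Lambda> * exp (?n * t))"
        using P state_fst_le[OF st \<Lambda>1] state_fst_pos[OF st \<Lambda>1] by (intro mult_mono) auto
      finally have w: "fst ?w \<le> P * \<Lambda> * exp (?n * t)" by simp
      have "\<bar>fst m\<bar> * norm (flow u ?\<theta> ?w) = \<bar>fst m\<bar> * (exp (- ?n * u) * fst ?w)"
        unfolding cp(4) using cp(6) by (simp add: norm_Pair)
      also have "\<dots> \<le> (\<rho> * exp (?n * (u - t))) * (exp (- ?n * u) * (P * \<Lambda> * exp (?n * t)))"
        using X0(5)[OF m] w cp(6) \<rho>0 by (intro mult_mono) auto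
      also have "\<dots> = \<rho> * (P * \<Lambda>) * (exp (?n * (u - t)) * exp (- ?n * u) * exp (?n * t))" by simp
      also have "exp (?n * (u - t)) * exp (- ?n * u) * exp (?n * t) = 1"
        by (simp add: algebra_simps flip: exp_add)
      also have "\<rho> * (P * \<Lambda>) * 1 \<le> \<rho> * (P * \<Lambda> ^ 3)"
        using \<rho>0 P \<Lambda>1 power_increasing[of 1 3 \<Lambda>] by (auto intro!: mult_left_mono)
      finally show ?thesis .
    qed
    also have "norm (flow u ?\<theta> (comb v0 v (0, r))) \<le> ?n * (\<rho> * exp (- (u - t))) * (exp (u - t) * (P * \<Lambda> ^ 3))"
    proof (rule norm_flow_comb_le)
      show "norm (flow u ?\<theta> (v i)) \<le> exp (u - t) * (P * \<Lambda> ^ 3)" for i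
        unfolding P_def by (rule order_trans[OF norm_flow_later[OF u] mult_left_mono[OF cp(3)]]) simp
      show "\<bar>r $ i\<bar> \<le> \<rho> * exp (- (u - t))" for i using X0(6)[OF m, of i] by (simp add: r_def)
    qed (use P \<Lambda>1 in auto)
    also have "\<dots> = \<rho> * (?n * P * \<Lambda> ^ 3) * (exp (- (u - t)) * exp (u - t))"
      by (simp only: mult_ac)
    also have "exp (- (u - t)) * exp (u - t) = 1" unfolding exp_add[symmetric] by simp
    also have "\<rho> * (P * \<Lambda> ^ 3) + \<rho> * (?n * P * \<Lambda> ^ 3) * 1 = \<rho> * ((?n * P + P) * \<Lambda> ^ 3)" by (simp add: algebra_simps)
    also have "\<dots> \<le> \<rho> * (P\<^sup>2 * \<Lambda> ^ 3)" using P \<Lambda>1 \<rho>0 by (intro mult_left_mono mult_right_mono) auto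
    finally show ?thesis by simp
  qed
  show ?thesis
  proof (rule that[of "comb v0 v ` X0"])
    show "card (comb v0 v ` X0) \<le> Suc CARD('n)" using card_image_le[OF X0(1)] X0(2) by (rule order_trans)
    show "span (comb v0 v ` X0) = UNIV"
      unfolding linear_span_image[OF linear_comb] X0(3)
      using comb_image_coord_subspace[of v0 v UNIV] st unfolding lat_state_def coord_subspace_UNIV by simp
  qed (use X0(1,4) bound integer_point_comb[OF int] in \<open>auto simp: \<rho>_def\<close>)
qed

section \<open>Excursions near a rational subspace\<close>

text \<open>The lattice vectors \<open>v0\<close> and \<open>v i\<close> with \<open>i \<in> J\<close> span the rational subspace approached by
  \<open>\<theta>\<close>: the time at which the product of the sizes of these vectors is smallest is
  \<open>t + (d + 1) \<tau>\<close>, and at time \<open>t + (n + 1) \<tau>\<close> the lattice is balanced again.\<close>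

locale excursion =
  fixes v0 :: "real \<times> (real ^ 'n)" and v :: "'n \<Rightarrow> real \<times> (real ^ 'n)" and y :: "real ^ 'n"
    and t \<Lambda> :: real and J :: "'n set" and j0 :: 'n and z :: "real ^ 'n" and c \<epsilon> \<tau> P :: real
  assumes st: "lat_state v0 v y t \<Lambda>" and \<Lambda>1: "1 \<le> \<Lambda>" and j0: "j0 \<notin> J"
    and z: "\<And>i. 1 \<le> z $ i \<and> z $ i \<le> 2" "\<And>J. J \<noteq> {} \<Longrightarrow> badly_approx c \<epsilon> J z"
    and c: "0 < c" "c \<le> 1" and \<epsilon>: "0 \<le> \<epsilon>" and \<tau>: "0 \<le> \<tau>"
    and P_def: "P = 2 * real CARD('n) + 2"
begin

definition "d = card J"
text \<open>K is the weight of the chosen subspace in \<open>w = K w1 + w2\<close>, where w1 lies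
  over the subspace and w2 is transverse. So \<theta> is within about
  \<open>exp (-(n + 1) t) / K\<close> of the subspace, and this K makes the distance
  \<open>exp (-(n + 1) (t + (d + 1) \<tau>))\<close> up to the losses.\<close>

definition "K = exp ((real CARD('n) + 1) * (real d + 1) * \<tau>)"
definition "zJ = (\<chi> i. if i \<in> J then z $ i else 0)"
text \<open>The transverse directions form a lattice of rank n - d. The index j0 plays the part of
  its denominator, hence the coordinate 1 there and those of z at the other indices outside
  J.\<close>

definition "b = (\<chi> i. if i \<in> J then 0 else if i = j0 then 1 else z $ i)"
definition "w1 = comb v0 v (1, zJ)"
definition "w2 = comb v0 v (0, b)"
definition "w = comb v0 v (K, K *\<^sub>R zJ + b)"
definition "\<theta> = cone_point v0 v (K, K *\<^sub>R zJ + b)"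
text \<open>\<open>(n + 1) \<tau>\<close> is the longest time for which a part of z is approximated
  in either half of the excursion.\<close>

definition "\<rho> = loss c CARD('n) * exp (\<epsilon> * (real CARD('n))\<^sup>2 * ((real CARD('n) + 1) * \<tau>))"

lemma d_less: "d < CARD('n)" and d_real: "real d + 1 \<le> real CARD('n)"
proof -
  have "card J < card (UNIV :: 'n set)" using j0 by (intro psubset_card_mono) auto
  then show "d < CARD('n)" by (simp add: d_def)
  then show "real d + 1 \<le> real CARD('n)" by linarith
qed

lemma K1: "1 \<le> K" using \<tau> by (simp add: K_def)

lemma P_facts: "2 * real CARD('n) + 1 \<le> P" "real CARD('n) + 1 \<le> P" "2 \<le> P" "real CARD('n) * P + P \<le> P\<^sup>2" "0 \<le> P"
  by (auto simp: P_def power2_eq_square algebra_simps)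

lemma \<rho>1: "1 \<le> \<rho>"
proof -
  have "1 \<le> exp (\<epsilon> * (real CARD('n))\<^sup>2 * ((real CARD('n) + 1) * \<tau>))" using \<epsilon> \<tau> by simp
  then have "1 * 1 \<le> \<rho>" unfolding \<rho>_def using loss_ge_1[OF c] by (intro mult_mono) (auto intro: order_trans[of 0 1])
  then show ?thesis by simp
qed

lemma z0: "0 \<le> z $ i" using z(1)[of i] by linarith

lemma coord_bounds: "0 < fst (K, K *\<^sub>R zJ + b)"
  "0 \<le> snd (K, K *\<^sub>R zJ + b) $ i \<and> snd (K, K *\<^sub>R zJ + b) $ i \<le> 2 * fst (K, K *\<^sub>R zJ + b)"
proof -
  have "K * z $ i \<le> K * 2" using K1 z(1) by (intro mult_left_mono) auto
  moreover have "z $ i \<le> 2 * K" using z(1)[of i] K1 by linarith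
  ultimately show "0 \<le> snd (K, K *\<^sub>R zJ + b) $ i \<and> snd (K, K *\<^sub>R zJ + b) $ i \<le> 2 * fst (K, K *\<^sub>R zJ + b)"
    using K1 z0[of i] by (auto simp: zJ_def b_def)
qed (use K1 in simp)

lemmas cone = cone_point_bounds[OF st \<Lambda>1 coord_bounds, folded \<theta>_def w_def P_def]

lemma w_eq: "w = K *\<^sub>R w1 + w2"
proof -
  have "(K, K *\<^sub>R zJ + b) = K *\<^sub>R (1, zJ) + (0, b)" by simp
  then show ?thesis unfolding w_def w1_def w2_def by (metis comb_add comb_scaleR)
qed

lemma w1_eq: "w1 = (1 / K) *\<^sub>R (w - w2)"
  using K1 by (simp add: w_eq)

lemma norm_flow_v: "t \<le> u \<Longrightarrow> norm (flow u \<theta> (v i)) \<le> exp (u - t) * (P * \<Lambda> ^ 3)"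
  by (rule order_trans[OF norm_flow_later mult_left_mono[OF cone(3)]]) auto

lemma norm_flow_w2: "t \<le> u \<Longrightarrow> norm (flow u \<theta> w2) \<le> exp (u - t) * (P\<^sup>2 * \<Lambda> ^ 3)"
proof -
  assume u: "t \<le> u"
  have "norm (flow u \<theta> w2) \<le> real CARD('n) * 2 * (exp (u - t) * (P * \<Lambda> ^ 3))"
    unfolding w2_def
  proof (rule norm_flow_comb_le)
    show "\<bar>b $ i\<bar> \<le> 2" for i using z(1)[of i] by (auto simp: b_def)
  qed (use norm_flow_v[OF u] P_facts \<Lambda>1 in auto)
  also have "\<dots> = (real CARD('n) * 2 * P) * (exp (u - t) * \<Lambda> ^ 3)" by simp
  also have "\<dots> \<le> P\<^sup>2 * (exp (u - t) * \<Lambda> ^ 3)"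
    using \<Lambda>1 by (intro mult_right_mono) (auto simp: P_def power2_eq_square algebra_simps)
  finally show ?thesis by (simp add: mult_ac)
qed

lemma norm_flow_w: "norm (flow u \<theta> w) \<le> K * (P * \<Lambda>) * exp (real CARD('n) * t - real CARD('n) * u)"
proof -
  have "fst w \<le> (K + real CARD('n) * (2 * K)) * fst v0"
    unfolding w_def using fst_comb_bounds(2)[OF st \<Lambda>1, of "(K, K *\<^sub>R zJ + b)" "2 * K"] coord_bounds by simp
  also have "\<dots> = K * ((2 * real CARD('n) + 1) * fst v0)" by (simp add: algebra_simps)
  also have "\<dots> \<le> K * (P * (\<Lambda> * exp (real CARD('n) * t)))"
    using K1 P_facts state_fst_le[OF st \<Lambda>1] state_fst_pos[OF st \<Lambda>1] by (intro mult_left_mono mult_mono) auto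
  finally have "exp (- real CARD('n) * u) * fst w \<le> exp (- real CARD('n) * u) * (K * (P * (\<Lambda> * exp (real CARD('n) * t))))"
    by (rule mult_left_mono) simp
  also have "\<dots> = K * (P * \<Lambda>) * (exp (real CARD('n) * t) * exp (- real CARD('n) * u))" by simp
  also have "exp (real CARD('n) * t) * exp (- real CARD('n) * u) = exp (real CARD('n) * t - real CARD('n) * u)" by (simp flip: exp_add)
  finally show ?thesis unfolding cone(4) using cone(6) by (simp add: norm_Pair)
qed

lemma \<rho>_ge: "0 \<le> s \<Longrightarrow> s \<le> (real CARD('n) + 1) * \<tau> \<Longrightarrow> loss c CARD('n) * exp (\<epsilon> * (real CARD('n))\<^sup>2 * s) \<le> \<rho>"
  unfolding \<rho>_def using loss_ge_1[OF c] \<epsilon>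
  by (intro mult_left_mono exp_le_cancel_iff[THEN iffD2]) (auto intro: order_trans[of 0 1])

lemma integer_v: "integer_point v0" "integer_point (v i)"
  using st unfolding lat_state_def by auto

text \<open>Inside the subspace, the part of z over J is approximated for the time s, chosen to make
  the two sizes \<open>exp (d s - n \<sigma>)\<close> and \<open>exp (\<sigma> - s)\<close> equal.
  The vector w1 is not exactly in the direction of \<theta>: its deviation w2 / K grows as well, and
  the bound \<sigma> \<le> (d + 1) \<tau> keeps it below these two sizes.\<close>

lemma lower_block:
  assumes \<sigma>: "0 \<le> \<sigma>" "\<sigma> \<le> (real d + 1) * \<tau>"
  obtains X where "finite X" "card X \<le> Suc d" "span X = comb v0 v ` coord_subspace J"
    "\<And>x. x \<in> X \<Longrightarrow> integer_point x"
    "\<And>x. x \<in> X \<Longrightarrow> norm (flow (t + \<sigma>) \<theta> x) \<le> \<rho> * (4 * P\<^sup>2 * \<Lambda> ^ 3) * exp (- (real CARD('n) - real d) / (real d + 1) * \<sigma>)"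
proof -
  define s where "s = (real CARD('n) + 1) * \<sigma> / (real d + 1)"
  have s: "0 \<le> s" "s \<le> (real CARD('n) + 1) * \<tau>"
  proof -
    show "0 \<le> s" using \<sigma> by (simp add: s_def)
    have "(real CARD('n) + 1) * \<sigma> \<le> (real CARD('n) + 1) * ((real d + 1) * \<tau>)" using \<sigma> by (intro mult_left_mono) auto
    then show "s \<le> (real CARD('n) + 1) * \<tau>" by (simp add: s_def pos_divide_le_eq mult_ac)
  qed
  define \<alpha> where "\<alpha> = - (real CARD('n) - real d) / (real d + 1) * \<sigma>"
  have e1: "real d * s - real CARD('n) * \<sigma> = \<alpha>" unfolding s_def \<alpha>_def by (simp add: field_simps)
  have e2: "\<sigma> - s = \<alpha>" unfolding s_def \<alpha>_def by (simp add: field_simps)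
  define r where "r = loss c CARD('n) * exp (\<epsilon> * (real CARD('n))\<^sup>2 * s)"
  have r: "0 \<le> r" "r \<le> \<rho>"
    using loss_ge_1[OF c, of "CARD('n)"] \<rho>_ge[OF s] by (auto simp: r_def)
  obtain X0 where X0: "finite X0" "card X0 \<le> Suc d" "span X0 = coord_subspace J"
    "\<And>x. x \<in> X0 \<Longrightarrow> integer_point x"
    "\<And>x. x \<in> X0 \<Longrightarrow> \<bar>fst x\<bar> \<le> r * exp (real d * s)"
    "\<And>x i. x \<in> X0 \<Longrightarrow> i \<in> J \<Longrightarrow> \<bar>snd x $ i - fst x * z $ i\<bar> \<le> r * exp (- s)"
    by (rule approximation_basis[OF z(2) c \<epsilon> s(1), of J, folded loss_def r_def d_def]) (assumption, rule that, auto)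
  have bound: "norm (flow (t + \<sigma>) \<theta> (comb v0 v m)) \<le> \<rho> * (4 * P\<^sup>2 * \<Lambda> ^ 3) * exp \<alpha>" if m: "m \<in> X0" for m
  proof -
    have mJ: "m \<in> coord_subspace J" using m X0(3) span_base by blast
    define q where "q = snd m - fst m *\<^sub>R zJ"
    have qb: "\<bar>q $ i\<bar> \<le> r * exp (- s)" for i
      using X0(6)[OF m, of i] mJ r by (auto simp: q_def zJ_def coord_subspace_def)
    have "m = fst m *\<^sub>R (1, zJ) + (0, q)" by (simp add: q_def prod_eq_iff)
    then have "comb v0 v m = fst m *\<^sub>R w1 + comb v0 v (0, q)" unfolding w1_def by (metis comb_add comb_scaleR)
    also have "fst m *\<^sub>R w1 = (fst m / K) *\<^sub>R w - (fst m / K) *\<^sub>R w2"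
      by (simp add: w1_eq scaleR_diff_right)
    finally have "flow (t + \<sigma>) \<theta> (comb v0 v m) = (fst m / K) *\<^sub>R flow (t + \<sigma>) \<theta> w
        - (fst m / K) *\<^sub>R flow (t + \<sigma>) \<theta> w2 + flow (t + \<sigma>) \<theta> (comb v0 v (0, q))"
      by (simp only: flow_add flow_diff flow_scaleR)
    then have "norm (flow (t + \<sigma>) \<theta> (comb v0 v m)) \<le> \<bar>fst m / K\<bar> * norm (flow (t + \<sigma>) \<theta> w)
        + \<bar>fst m / K\<bar> * norm (flow (t + \<sigma>) \<theta> w2) + norm (flow (t + \<sigma>) \<theta> (comb v0 v (0, q)))"
      by (metis (no_types) norm_scaleR norm_triangle_le norm_triangle_ineq4 add_right_mono)
    also have "\<bar>fst m / K\<bar> * norm (flow (t + \<sigma>) \<theta> w) \<le> \<rho> * (P\<^sup>2 * \<Lambda> ^ 3) * exp \<alpha>"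
    proof -
      have "\<bar>fst m / K\<bar> * norm (flow (t + \<sigma>) \<theta> w)
          \<le> (r * exp (real d * s) / K) * (K * (P * \<Lambda>) * exp (real CARD('n) * t - real CARD('n) * (t + \<sigma>)))"
        using X0(5)[OF m] K1 r norm_flow_w by (intro mult_mono) (auto simp: divide_right_mono)
      also have "\<dots> = r * (P * \<Lambda>) * (exp (real d * s) * exp (real CARD('n) * t - real CARD('n) * (t + \<sigma>)))" using K1 by simp
      also have "exp (real d * s) * exp (real CARD('n) * t - real CARD('n) * (t + \<sigma>)) = exp \<alpha>"
        unfolding exp_add[symmetric] e1[symmetric] by (simp add: algebra_simps)
      also have "r * (P * \<Lambda>) * exp \<alpha> \<le> \<rho> * (P\<^sup>2 * \<Lambda> ^ 3) * exp \<alpha>"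
        using r P_facts \<Lambda>1 power_increasing[of 1 2 P] power_increasing[of 1 3 \<Lambda>]
        by (intro mult_right_mono mult_mono) auto
      finally show ?thesis .
    qed
    also have "\<bar>fst m / K\<bar> * norm (flow (t + \<sigma>) \<theta> w2) \<le> \<rho> * (P\<^sup>2 * \<Lambda> ^ 3) * exp \<alpha>"
    proof -
      have "\<bar>fst m / K\<bar> * norm (flow (t + \<sigma>) \<theta> w2)
          \<le> (r * exp (real d * s) / K) * (exp (t + \<sigma> - t) * (P\<^sup>2 * \<Lambda> ^ 3))"
        using X0(5)[OF m] K1 r norm_flow_w2[of "t + \<sigma>"] \<sigma> by (intro mult_mono) (auto simp: divide_right_mono)
      also have "\<dots> = r * (P\<^sup>2 * \<Lambda> ^ 3) * (exp (real d * s + \<sigma>) / K)" by (simp add: exp_add)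
      also have "exp (real d * s + \<sigma>) / K = exp (real d * s + \<sigma> - (real CARD('n) + 1) * ((real d + 1) * \<tau>))"
        by (simp add: K_def exp_diff mult.assoc)
      also have "\<dots> \<le> exp \<alpha>"
        using mult_left_mono[OF \<sigma>(2), of "real CARD('n) + 1"] by (simp add: e1[symmetric] algebra_simps)
      also have "r * (P\<^sup>2 * \<Lambda> ^ 3) * exp \<alpha> \<le> \<rho> * (P\<^sup>2 * \<Lambda> ^ 3) * exp \<alpha>"
        using r \<Lambda>1 by (intro mult_right_mono) auto
      finally show ?thesis using r \<Lambda>1 by (simp add: mult_left_mono)
    qed
    also have "norm (flow (t + \<sigma>) \<theta> (comb v0 v (0, q))) \<le> \<rho> * (P\<^sup>2 * \<Lambda> ^ 3) * exp \<alpha>"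
    proof -
      have "norm (flow (t + \<sigma>) \<theta> (comb v0 v (0, q))) \<le> real CARD('n) * (r * exp (- s)) * (exp (t + \<sigma> - t) * (P * \<Lambda> ^ 3))"
        by (rule norm_flow_comb_le[OF norm_flow_v qb]) (use \<sigma> P_facts \<Lambda>1 in auto)
      also have "\<dots> = r * (real CARD('n) * P * \<Lambda> ^ 3) * exp (\<sigma> - s)" by (simp add: exp_diff exp_minus divide_inverse)
      also have "\<dots> \<le> \<rho> * (P\<^sup>2 * \<Lambda> ^ 3) * exp \<alpha>"
        unfolding e2 using r P_facts \<Lambda>1 by (intro mult_mono) auto
      finally show ?thesis .
    qed
    finally have f: "norm (flow (t + \<sigma>) \<theta> (comb v0 v m)) \<le> \<rho> * (P\<^sup>2 * \<Lambda> ^ 3) * exp \<alpha>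
        + \<rho> * (P\<^sup>2 * \<Lambda> ^ 3) * exp \<alpha> + \<rho> * (P\<^sup>2 * \<Lambda> ^ 3) * exp \<alpha>" by (simp add: add_right_mono)
    have "0 \<le> \<rho> * (P\<^sup>2 * \<Lambda> ^ 3) * exp \<alpha>" using \<rho>1 \<Lambda>1 by simp
    moreover have "\<rho> * (4 * P\<^sup>2 * \<Lambda> ^ 3) * exp \<alpha> = 4 * (\<rho> * (P\<^sup>2 * \<Lambda> ^ 3) * exp \<alpha>)" by simp
    ultimately show ?thesis using f by linarith
  qed
  show ?thesis
  proof (rule that[of "comb v0 v ` X0"])
    show "card (comb v0 v ` X0) \<le> Suc d" using card_image_le[OF X0(1)] X0(2) by (rule order_trans)
    show "span (comb v0 v ` X0) = comb v0 v ` coord_subspace J"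
      unfolding linear_span_image[OF linear_comb] X0(3) ..
  qed (use X0(1,4) bound integer_point_comb[OF integer_v] in \<open>auto simp: \<alpha>_def\<close>)
qed

lemma span_UNIV_of_blocks:
  assumes "comb v0 v ` coord_subspace J \<subseteq> span X" "\<And>i. i \<notin> J \<Longrightarrow> v i \<in> span X"
  shows "span X = UNIV"
proof -
  have "(1, 0) \<in> coord_subspace J" by (simp add: coord_subspace_def)
  then have "v0 \<in> span X" using assms(1) comb_fst_unit[of v0 v] by (metis image_subset_iff)
  moreover have "v i \<in> span X" for i
  proof (cases "i \<in> J")
    case True
    then have "(0, axis i 1) \<in> coord_subspace J" by (auto simp: coord_subspace_def axis_def)
    then show ?thesis using assms(1) comb_snd_unit[of v0 v i] by (metis image_subset_iff)
  qed (rule assms(2))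
  ultimately have "insert v0 (range v) \<subseteq> span X" by auto
  then have "span (insert v0 (range v)) \<subseteq> span X" by (simp add: span_minimal)
  then show ?thesis using st unfolding lat_state_def by blast
qed

definition "B = \<rho> * (8 * P ^ 3 * \<Lambda> ^ 3)"

lemma B_ge: "\<rho> * (4 * P\<^sup>2 * \<Lambda> ^ 3) \<le> B" "P * \<Lambda> ^ 3 \<le> B"
proof -
  have "P\<^sup>2 \<le> P ^ 3" "P \<le> P ^ 3" using P_facts power_increasing[of 2 3 P] power_increasing[of 1 3 P] by auto
  then show "\<rho> * (4 * P\<^sup>2 * \<Lambda> ^ 3) \<le> B"
    unfolding B_def using \<rho>1 \<Lambda>1 P_facts by (intro mult_left_mono mult_right_mono mult_mono) auto
  have "1 * (P * \<Lambda> ^ 3) \<le> \<rho> * (8 * P ^ 3 * \<Lambda> ^ 3)"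
    using \<rho>1 \<Lambda>1 P_facts \<open>P \<le> P ^ 3\<close> by (intro mult_mono mult_right_mono) auto
  then show "P * \<Lambda> ^ 3 \<le> B" by (simp add: B_def)
qed

text \<open>The long block needs no search during the descent: the vectors of the state outside J
  have grown by at most \<open>exp \<sigma>\<close> since the time t.\<close>

lemma split_descent:
  assumes \<sigma>: "0 \<le> \<sigma>" "\<sigma> \<le> (real d + 1) * \<tau>"
  shows "split_lattice (t + \<sigma>) \<theta> d \<sigma> B"
proof -
  obtain X where X: "finite X" "card X \<le> Suc d" "span X = comb v0 v ` coord_subspace J"
    "\<And>x. x \<in> X \<Longrightarrow> integer_point x"
    "\<And>x. x \<in> X \<Longrightarrow> norm (flow (t + \<sigma>) \<theta> x) \<le> \<rho> * (4 * P\<^sup>2 * \<Lambda> ^ 3) * exp (- (real CARD('n) - real d) / (real d + 1) * \<sigma>)"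
    using lower_block[OF \<sigma>] by blast
  show ?thesis
  proof (rule split_latticeI[of X "v ` (- J)"])
    have "card (v ` (- J)) \<le> card (- J)" by (rule card_image_le) simp
    also have "card (- J) = CARD('n) - d" by (simp add: Compl_eq_Diff_UNIV card_Diff_subset d_def)
    finally show "card (v ` (- J)) \<le> CARD('n) - d" .
    show "span (X \<union> v ` (- J)) = UNIV"
    proof (rule span_UNIV_of_blocks)
      show "comb v0 v ` coord_subspace J \<subseteq> span (X \<union> v ` (- J))"
        unfolding X(3)[symmetric] by (rule span_mono) auto
    qed (auto intro: span_base)
    show "norm (flow (t + \<sigma>) \<theta> x) \<le> B * exp (- (real CARD('n) - real d) / (real d + 1) * \<sigma>)" if "x \<in> X" for x
      using X(5)[OF that] mult_right_mono[OF B_ge(1)] by (meson exp_ge_zero order_trans)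
    show "norm (flow (t + \<sigma>) \<theta> x) \<le> B * exp \<sigma>" if x: "x \<in> v ` (- J)" for x
    proof -
      obtain i where i: "x = v i" using x by blast
      have "norm (flow (t + \<sigma>) \<theta> x) \<le> exp (t + \<sigma> - t) * (P * \<Lambda> ^ 3)"
        unfolding i by (rule norm_flow_v) (use \<sigma> in simp)
      also have "\<dots> \<le> exp (t + \<sigma> - t) * B" using B_ge(2) by (rule mult_left_mono) simp
      finally show ?thesis by (simp add: mult.commute)
    qed
  qed (use X integer_v in auto)
qed

text \<open>Now the roles change: the short vectors found at the lowest time are kept and merely
  grow, while the long block has to shrink. It comes from approximating the transverse coordinates,
  with j0 as denominator, for a time s that again makes both sizes equal, with common value
  \<open>exp h\<close>. Each transverse vector is lifted to the full lattice modulo the short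
  block.\<close>

lemma split_ascent:
  assumes \<sigma>: "0 \<le> \<sigma>" "\<sigma> \<le> (real CARD('n) - real d) * \<tau>"
  shows "split_lattice (t + (real d + 1) * \<tau> + \<sigma>) \<theta> d
    ((real d + 1) / (real CARD('n) - real d) * ((real CARD('n) - real d) * \<tau> - \<sigma>)) B"
proof -
  let ?n = "real CARD('n)" and ?d = "real d"
  let ?tb = "t + (?d + 1) * \<tau>"
  let ?u = "?tb + \<sigma>"
  let ?J = "- insert j0 J"
  have nd: "1 \<le> ?n - ?d" using d_real by simp
  define h where "h = (?d + 1) / (?n - ?d) * ((?n - ?d) * \<tau> - \<sigma>)"
  have h0: "0 \<le> h" using \<sigma> nd by (simp add: h_def)
  define s where "s = (?n + 1) * \<sigma> / (?n - ?d)"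
  have s: "0 \<le> s" "s \<le> (?n + 1) * \<tau>"
  proof -
    show "0 \<le> s" using \<sigma> nd by (simp add: s_def)
    have "(?n + 1) * \<sigma> \<le> (?n + 1) * ((?n - ?d) * \<tau>)" using \<sigma> by (intro mult_left_mono) auto
    then show "s \<le> (?n + 1) * \<tau>" using nd by (simp add: s_def pos_divide_le_eq mult_ac)
  qed
  have hs: "h = (?d + 1) * \<tau> - (?d + 1) / (?n - ?d) * \<sigma>" using nd by (simp add: h_def right_diff_distrib)
  have ns: "s = \<sigma> + (?d + 1) / (?n - ?d) * \<sigma>" using nd by (simp add: s_def field_simps)
  have e2: "(?d + 1) * \<tau> + \<sigma> - s = h" unfolding hs ns by simp
  have nds: "(?n - ?d) * s = (?n + 1) * \<sigma>" using nd by (simp add: s_def)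
  have e1: "(?n - ?d - 1) * s + (?n + 1) * ((?d + 1) * \<tau>) + (?n * t - ?n * ?u) = h"
  proof -
    have "(?n - ?d - 1) * s = (?n + 1) * \<sigma> - s" using nds by (simp add: algebra_simps)
    then show ?thesis unfolding e2[symmetric] by (simp add: algebra_simps)
  qed
  have low: "- (?n - ?d) / (?d + 1) * h = \<sigma> - (?n - ?d) * \<tau>"
  proof -
    have gen: "- a / e * (e / a * x) = - x" if "a \<noteq> 0" "e \<noteq> 0" for a e x :: real
      using that by (simp add: field_simps)
    have "- (?n - ?d) / (?d + 1) * h = - ((?n - ?d) * \<tau> - \<sigma>)"
      unfolding h_def by (rule gen) (use nd in auto)
    then show ?thesis by simp
  qed
  obtain X where X: "finite X" "card X \<le> Suc d" "span X = comb v0 v ` coord_subspace J"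
    "\<And>x. x \<in> X \<Longrightarrow> integer_point x"
    "\<And>x. x \<in> X \<Longrightarrow> norm (flow ?tb \<theta> x) \<le> \<rho> * (4 * P\<^sup>2 * \<Lambda> ^ 3) * exp (- (?n - ?d) / (?d + 1) * ((?d + 1) * \<tau>))"
    using lower_block[of "(?d + 1) * \<tau>"] \<tau> by (metis mult_nonneg_nonneg of_nat_0_le_iff add_nonneg_nonneg zero_le_one order_refl)
  have Xn: "norm (flow ?u \<theta> x) \<le> \<rho> * (4 * P\<^sup>2 * \<Lambda> ^ 3) * exp (\<sigma> - (?n - ?d) * \<tau>)" if "x \<in> X" for x
  proof -
    have "- (?n - ?d) / (?d + 1) * ((?d + 1) * \<tau>) = - ((?n - ?d) * \<tau>)" by (simp add: field_simps)
    then have "norm (flow ?tb \<theta> x) \<le> \<rho> * (4 * P\<^sup>2 * \<Lambda> ^ 3) * exp (- ((?n - ?d) * \<tau>))" using X(5)[OF that] by simp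
    then have "exp (?u - ?tb) * norm (flow ?tb \<theta> x) \<le> exp (?u - ?tb) * (\<rho> * (4 * P\<^sup>2 * \<Lambda> ^ 3) * exp (- ((?n - ?d) * \<tau>)))"
      by (rule mult_left_mono) simp
    also have "\<dots> = \<rho> * (4 * P\<^sup>2 * \<Lambda> ^ 3) * (exp (?u - ?tb) * exp (- ((?n - ?d) * \<tau>)))" by (simp only: mult_ac)
    also have "exp (?u - ?tb) * exp (- ((?n - ?d) * \<tau>)) = exp (\<sigma> - (?n - ?d) * \<tau>)" unfolding exp_add[symmetric] by simp
    finally show ?thesis using norm_flow_later[of ?tb ?u \<theta> x] \<sigma> by linarith
  qed
  define r where "r = loss c CARD('n) * exp (\<epsilon> * (real CARD('n))\<^sup>2 * s)"
  have r: "0 \<le> r" "r \<le> \<rho>"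
    using loss_ge_1[OF c, of "CARD('n)"] \<rho>_ge[OF s] by (auto simp: r_def)
  have cJ: "card ?J = CARD('n) - d - 1" using j0 by (simp add: Compl_eq_Diff_UNIV card_Diff_subset d_def)
  have cJr: "real (card ?J) = ?n - ?d - 1" unfolding cJ using d_less by simp
  obtain X0 where X0: "finite X0" "card X0 \<le> Suc (card ?J)" "span X0 = coord_subspace ?J"
    "\<And>x. x \<in> X0 \<Longrightarrow> integer_point x"
    "\<And>x. x \<in> X0 \<Longrightarrow> \<bar>fst x\<bar> \<le> r * exp (real (card ?J) * s)"
    "\<And>x i. x \<in> X0 \<Longrightarrow> i \<in> ?J \<Longrightarrow> \<bar>snd x $ i - fst x * z $ i\<bar> \<le> r * exp (- s)"
    by (rule approximation_basis[OF z(2) c \<epsilon> s(1), of ?J, folded loss_def r_def]) (assumption, rule that, auto)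
  \<comment> \<open>Moves the denominator of the transverse lattice to the index j0, so that (1, z)
    restricted to the transverse coordinates corresponds to b.\<close>
  define \<iota> :: "real \<times> (real ^ 'n) \<Rightarrow> real \<times> (real ^ 'n)"
    where "\<iota> m = (0, \<chi> i. if i = j0 then fst m else snd m $ i)" for m
  have lin: "linear (\<lambda>m. comb v0 v (\<iota> m))"
  proof -
    have "linear \<iota>" by (rule linearI) (auto simp: \<iota>_def Finite_Cartesian_Product.vec_eq_iff)
    then show ?thesis using linear_compose[OF _ linear_comb, of \<iota> v0 v] by (simp add: comp_def)
  qed
  have "\<exists>x. integer_point x \<and> x - comb v0 v (\<iota> m) \<in> span X \<and> norm (flow ?u \<theta> x) \<le> B * exp h" if m: "m \<in> X0" for m
  proof -
    define q where "q = snd (\<iota> m) - fst m *\<^sub>R b"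
    have mJ: "m \<in> coord_subspace ?J" using m X0(3) span_base by blast
    have qb: "\<bar>q $ i\<bar> \<le> r * exp (- s)" for i
      using X0(6)[OF m, of i] mJ r j0 by (auto simp: q_def \<iota>_def b_def coord_subspace_def)
    have "\<iota> m = fst m *\<^sub>R (0, b) + (0, q)" by (simp add: q_def \<iota>_def prod_eq_iff)
    then have "comb v0 v (\<iota> m) = fst m *\<^sub>R w2 + comb v0 v (0, q)" unfolding w2_def by (metis comb_add comb_scaleR)
    also have "fst m *\<^sub>R w2 = fst m *\<^sub>R w - (fst m * K) *\<^sub>R w1"
      by (simp add: w_eq scaleR_add_right)
    finally have comb_\<iota>: "comb v0 v (\<iota> m) = fst m *\<^sub>R w - (fst m * K) *\<^sub>R w1 + comb v0 v (0, q)" .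
    have "(1, zJ) \<in> coord_subspace J" by (auto simp: coord_subspace_def zJ_def)
    then have "w1 \<in> span X" unfolding w1_def X(3) by (rule imageI)
    then have "(fst m * K) *\<^sub>R w1 \<in> span X" by (rule span_scale)
    then obtain a where a: "(fst m * K) *\<^sub>R w1 = (\<Sum>x\<in>X. a x *\<^sub>R x)"
      unfolding span_finite[OF X(1)] by blast
    \<comment> \<open>The multiple of w1 is huge but lies in the span of the short block. Adding the
      integral parts of its coordinates keeps the vector in the lattice and leaves only fractional
      parts, hence an error of at most d + 1 short vectors.\<close>
    define x where "x = comb v0 v (\<iota> m) + (\<Sum>x\<in>X. of_int \<lfloor>a x\<rfloor> *\<^sub>R x)"
    have int\<iota>: "integer_point (\<iota> m)" using X0(4)[OF m] by (simp add: integer_point_def \<iota>_def)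
    have "integer_point x"
      unfolding x_def
      by (rule integer_point_add[OF integer_point_comb[OF integer_v int\<iota>]
          integer_point_sum[OF integer_point_scale[OF X(4)]]]) auto
    moreover have "x - comb v0 v (\<iota> m) \<in> span X"
      unfolding x_def add_diff_cancel_left' by (intro span_sum span_scale span_base)
    moreover have "norm (flow ?u \<theta> x) \<le> B * exp h"
    proof -
      have "x = fst m *\<^sub>R w + comb v0 v (0, q) - (\<Sum>x\<in>X. frac (a x) *\<^sub>R x)"
        unfolding x_def comb_\<iota> a frac_def scaleR_diff_left sum_subtractf by simp
      then have "flow ?u \<theta> x = fst m *\<^sub>R flow ?u \<theta> w + flow ?u \<theta> (comb v0 v (0, q)) - (\<Sum>x\<in>X. frac (a x) *\<^sub>R flow ?u \<theta> x)"
        by (simp only: flow_add flow_diff flow_sum flow_scaleR)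
      then have "norm (flow ?u \<theta> x) \<le> norm (fst m *\<^sub>R flow ?u \<theta> w) + norm (flow ?u \<theta> (comb v0 v (0, q)))
          + norm (\<Sum>x\<in>X. frac (a x) *\<^sub>R flow ?u \<theta> x)"
        by (simp only:) (rule order_trans[OF norm_triangle_ineq4 add_right_mono[OF norm_triangle_ineq]])
      also have "norm (fst m *\<^sub>R flow ?u \<theta> w) \<le> \<rho> * (P ^ 3 * \<Lambda> ^ 3) * exp h"
      proof -
        have "norm (fst m *\<^sub>R flow ?u \<theta> w) \<le> (r * exp ((?n - ?d - 1) * s)) * (K * (P * \<Lambda>) * exp (?n * t - ?n * ?u))"
          unfolding norm_scaleR using X0(5)[OF m, unfolded cJr] r norm_flow_w by (intro mult_mono) auto
        also have "\<dots> = r * (P * \<Lambda>) * (exp ((?n - ?d - 1) * s) * K * exp (?n * t - ?n * ?u))" by (simp only: mult_ac)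
        also have "exp ((?n - ?d - 1) * s) * K * exp (?n * t - ?n * ?u) = exp h"
          unfolding K_def exp_add[symmetric] e1[symmetric] by (simp only: mult.assoc)
        also have "r * (P * \<Lambda>) * exp h \<le> \<rho> * (P ^ 3 * \<Lambda> ^ 3) * exp h"
          using r P_facts \<Lambda>1 power_increasing[of 1 3 P] power_increasing[of 1 3 \<Lambda>]
          by (intro mult_right_mono mult_mono) auto
        finally show ?thesis .
      qed
      also have "norm (flow ?u \<theta> (comb v0 v (0, q))) \<le> \<rho> * (P ^ 3 * \<Lambda> ^ 3) * exp h"
      proof -
        have "norm (flow ?u \<theta> (comb v0 v (0, q))) \<le> ?n * (r * exp (- s)) * (exp (?u - t) * (P * \<Lambda> ^ 3))"
          by (rule norm_flow_comb_le[OF norm_flow_v qb]) (use \<sigma> \<tau> P_facts \<Lambda>1 in auto)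
        also have "\<dots> = r * (?n * P * \<Lambda> ^ 3) * (exp (- s) * exp (?u - t))" by (simp only: mult_ac)
        also have "exp (- s) * exp (?u - t) = exp h" unfolding exp_add[symmetric] e2[symmetric] by simp
        also have "r * (?n * P * \<Lambda> ^ 3) * exp h \<le> \<rho> * (P ^ 3 * \<Lambda> ^ 3) * exp h"
        proof -
          have "?n * P \<le> P ^ 3"
            using P_facts power_increasing[of 2 3 P] by linarith
          then show ?thesis using r \<Lambda>1 P_facts by (intro mult_right_mono mult_mono) auto
        qed
        finally show ?thesis .
      qed
      also have "norm (\<Sum>x\<in>X. frac (a x) *\<^sub>R flow ?u \<theta> x) \<le> \<rho> * (4 * P ^ 3 * \<Lambda> ^ 3) * exp h"
      proof -
        have "norm (\<Sum>x\<in>X. frac (a x) *\<^sub>R flow ?u \<theta> x) \<le> (\<Sum>x\<in>X. \<rho> * (4 * P\<^sup>2 * \<Lambda> ^ 3) * exp h)"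
        proof (rule sum_norm_le)
          fix x assume x: "x \<in> X"
          have "norm (frac (a x) *\<^sub>R flow ?u \<theta> x) = frac (a x) * norm (flow ?u \<theta> x)"
            by (simp add: frac_ge_0)
          also have "\<dots> \<le> 1 * (\<rho> * (4 * P\<^sup>2 * \<Lambda> ^ 3) * exp (\<sigma> - (?n - ?d) * \<tau>))"
            using Xn[OF x] frac_lt_1[of "a x"] by (intro mult_mono) (auto simp: less_imp_le frac_ge_0)
          also have "\<dots> \<le> 1 * (\<rho> * (4 * P\<^sup>2 * \<Lambda> ^ 3) * exp h)"
            using \<rho>1 \<Lambda>1 \<sigma> h0 by (intro mult_left_mono exp_le_cancel_iff[THEN iffD2]) auto
          finally show "norm (frac (a x) *\<^sub>R flow ?u \<theta> x) \<le> \<rho> * (4 * P\<^sup>2 * \<Lambda> ^ 3) * exp h" by simp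
        qed
        also have "\<dots> = real (card X) * (\<rho> * (4 * P\<^sup>2 * \<Lambda> ^ 3) * exp h)" by simp
        also have "\<dots> \<le> P * (\<rho> * (4 * P\<^sup>2 * \<Lambda> ^ 3) * exp h)"
        proof (rule mult_right_mono)
          have "real (card X) \<le> ?d + 1" using X(2) by linarith
          then show "real (card X) \<le> P" using d_real P_facts by linarith
        qed (use \<rho>1 \<Lambda>1 in simp)
        also have "\<dots> = \<rho> * (4 * P ^ 3 * \<Lambda> ^ 3) * exp h" by (simp add: power3_eq_cube power2_eq_square)
        finally show ?thesis .
      qed
      finally have f: "norm (flow ?u \<theta> x) \<le> \<rho> * (P ^ 3 * \<Lambda> ^ 3) * exp h + \<rho> * (P ^ 3 * \<Lambda> ^ 3) * exp h
         + \<rho> * (4 * P ^ 3 * \<Lambda> ^ 3) * exp h" by (simp add: add_right_mono)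
      have "0 \<le> \<rho> * (P ^ 3 * \<Lambda> ^ 3) * exp h" using \<rho>1 \<Lambda>1 P_facts by simp
      moreover have "B * exp h = 8 * (\<rho> * (P ^ 3 * \<Lambda> ^ 3) * exp h)"
        "\<rho> * (4 * P ^ 3 * \<Lambda> ^ 3) * exp h = 4 * (\<rho> * (P ^ 3 * \<Lambda> ^ 3) * exp h)" by (auto simp: B_def)
      ultimately show ?thesis using f by linarith
    qed
    ultimately show ?thesis by blast
  qed
  then have "\<forall>m\<in>X0. \<exists>x. integer_point x \<and> x - comb v0 v (\<iota> m) \<in> span X \<and> norm (flow ?u \<theta> x) \<le> B * exp h" by blast
  from bchoice[OF this] obtain g where g: "\<forall>m\<in>X0. integer_point (g m) \<and> g m - comb v0 v (\<iota> m) \<in> span X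
      \<and> norm (flow ?u \<theta> (g m)) \<le> B * exp h" by (rule exE)
  have spX: "span X \<subseteq> span (X \<union> g ` X0)" by (rule span_mono) auto
  have in_span: "comb v0 v (\<iota> m) \<in> span (X \<union> g ` X0)" if "m \<in> coord_subspace ?J" for m
  proof -
    have "X0 \<subseteq> {m. comb v0 v (\<iota> m) \<in> span (X \<union> g ` X0)}"
    proof clarify
      fix m assume m: "m \<in> X0"
      have "g m \<in> span (X \<union> g ` X0)" using m by (intro span_base) auto
      moreover have "g m - comb v0 v (\<iota> m) \<in> span (X \<union> g ` X0)" using g m spX by blast
      ultimately have "g m - (g m - comb v0 v (\<iota> m)) \<in> span (X \<union> g ` X0)" by (rule span_diff)
      then show "comb v0 v (\<iota> m) \<in> span (X \<union> g ` X0)" by simp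
    qed
    moreover have "subspace {m. comb v0 v (\<iota> m) \<in> span (X \<union> g ` X0)}"
      by (rule linear_subspace_vimage[OF lin subspace_span, unfolded vimage_def])
    ultimately have "span X0 \<subseteq> {m. comb v0 v (\<iota> m) \<in> span (X \<union> g ` X0)}" by (rule span_minimal)
    then show ?thesis using that X0(3) by blast
  qed
  have "split_lattice ?u \<theta> d h B"
  proof (rule split_latticeI[of X "g ` X0"])
    have "card (g ` X0) \<le> card X0" using X0(1) by (rule card_image_le)
    also have "\<dots> \<le> CARD('n) - d" using X0(2) cJ d_less by simp
    finally show "card (g ` X0) \<le> CARD('n) - d" .
    show "span (X \<union> g ` X0) = UNIV"
    proof (rule span_UNIV_of_blocks)
      show "comb v0 v ` coord_subspace J \<subseteq> span (X \<union> g ` X0)" unfolding X(3)[symmetric] by (rule spX)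
      fix i assume i: "i \<notin> J"
      define m :: "real \<times> (real ^ 'n)" where "m = (if i = j0 then (1, 0) else (0, axis i 1))"
      have "m \<in> coord_subspace ?J" using i by (auto simp: m_def coord_subspace_def axis_def)
      moreover have "\<iota> m = (0, axis i 1)"
        by (auto simp: m_def \<iota>_def axis_def Finite_Cartesian_Product.vec_eq_iff)
      ultimately show "v i \<in> span (X \<union> g ` X0)" using in_span[of m] by (simp add: comb_snd_unit)
    qed
    show "norm (flow ?u \<theta> x) \<le> B * exp (- (?n - ?d) / (?d + 1) * h)" if "x \<in> X" for x
      unfolding low by (rule order_trans[OF Xn[OF that] mult_right_mono[OF B_ge(1)]]) simp
  qed (use X X0 g in auto)
  then show ?thesis by (simp only: h_def)
qed

lemma norm_v0_le:
  assumes "0 \<le> t"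
  shows "norm v0 \<le> (2 + norm y) * \<Lambda> * exp (real CARD('n) * t)"
proof -
  let ?E = "exp (real CARD('n) * t)"
  have "norm v0 \<le> \<bar>fst v0\<bar> + norm (snd v0)" using norm_Pair_le[of "fst v0" "snd v0"] by simp
  moreover have "\<bar>fst v0\<bar> \<le> \<Lambda> * ?E" using state_fst_le[OF st \<Lambda>1] state_fst_pos[OF st \<Lambda>1] by simp
  moreover have "norm (snd v0) \<le> \<Lambda> + \<Lambda> * ?E * norm y"
  proof -
    have "norm (snd v0 - fst v0 *\<^sub>R y) \<le> exp (- t) * norm (flow t y v0)" by (rule flow_snd_le)
    also have "\<dots> \<le> 1 * \<Lambda>" using st assms unfolding lat_state_def by (intro mult_mono) auto
    finally have "norm (snd v0 - fst v0 *\<^sub>R y) \<le> \<Lambda>" by simp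
    moreover have "\<bar>fst v0\<bar> * norm y \<le> \<Lambda> * ?E * norm y"
      using \<open>\<bar>fst v0\<bar> \<le> \<Lambda> * ?E\<close> by (rule mult_right_mono) simp
    moreover have "norm (snd v0) \<le> norm (snd v0 - fst v0 *\<^sub>R y) + \<bar>fst v0\<bar> * norm y"
      using norm_triangle_ineq[of "snd v0 - fst v0 *\<^sub>R y" "fst v0 *\<^sub>R y"] by simp
    ultimately show ?thesis by linarith
  qed
  moreover have "\<Lambda> * 1 \<le> \<Lambda> * ?E" using \<Lambda>1 assms by (intro mult_left_mono) auto
  ultimately show ?thesis by (simp add: algebra_simps)
qed

text \<open>The subspace lies below v0 and the \<open>v i\<close> with i in J. Its height is at most
  about \<open>exp (n t)\<close> from v0 times \<open>exp (- t)\<close> from each reduced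
  \<open>v i\<close>. Its point in the direction of w1 differs from \<theta> only through the
  transverse part w2 / K.\<close>

lemma subspace_near:
  assumes t: "0 \<le> t"
  obtains L where "rat_affine_subspace d L"
    "height L \<le> (2 + norm y) * \<Lambda> * (2 * \<Lambda>) ^ d * exp ((real CARD('n) - real d) * t)"
    "infdist \<theta> L \<le> P\<^sup>2 * \<Lambda> ^ 4 * exp (- (real CARD('n) + 1) * (t + (real d + 1) * \<tau>))"
proof -
  let ?n = "real CARD('n)"
  let ?U = "coord_subspace J"
  define E where "E = insert (1::real, 0::real ^ 'n) ((\<lambda>i. (0, axis i 1)) ` J)"
  have "E \<subseteq> Basis" by (auto simp: E_def Basis_prod_def axis_in_Basis_iff)
  then have "independent E" by (rule independent_mono[OF independent_Basis])
  moreover have "card E = Suc d"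
  proof -
    have "inj_on (\<lambda>i. (0::real, axis i 1 :: real ^ 'n)) J" by (auto intro!: inj_onI simp: axis_eq_axis)
    then show ?thesis unfolding E_def by (subst card_insert_disjoint) (auto simp: card_image d_def)
  qed
  moreover have "span E = ?U" unfolding E_def by (rule coord_subspace_spanning[symmetric])
  ultimately have dimU: "dim ?U = Suc d" using dim_eq_card_independent[of E] dim_span[of E] by simp
  define V where "V = comb v0 v ` ?U"
  have "inj_on (comb v0 v) (span ?U)" using lat_state_inj[OF st] by (rule inj_on_subset) simp
  then have dimV: "dim V = Suc d" unfolding V_def using dim_image_eq[OF linear_comb] dimU by metis
  have V: "V = span (insert v0 (v ` J))" unfolding V_def by (rule comb_image_coord_subspace)
  \<comment> \<open>Adding v0 makes all first coordinates positive, as those of the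
    \<open>v i\<close> may be 0; the span stays the same.\<close>
  define T where "T = insert v0 ((\<lambda>i. v0 + v i) ` J)"
  have spT: "span T = V"
  proof
    have "v0 + v i \<in> V" if "i \<in> J" for i
      unfolding V by (intro span_add span_base) (use that in auto)
    moreover have "v0 \<in> V" unfolding V by (rule span_base) simp
    moreover have "subspace V" unfolding V by (rule subspace_span)
    ultimately show "span T \<subseteq> V" unfolding T_def by (intro span_minimal) auto
    have "v i \<in> span T" if "i \<in> J" for i
    proof -
      have "(v0 + v i) - v0 \<in> span T" by (intro span_diff span_base) (use that in \<open>auto simp: T_def\<close>)
      then show ?thesis by simp
    qed
    moreover have "v0 \<in> span T" by (rule span_base) (simp add: T_def)
    ultimately show "V \<subseteq> span T" unfolding V by (intro span_minimal) auto
  qed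
  have finT: "finite T" by (simp add: T_def)
  have "card T \<le> Suc (card ((\<lambda>i. v0 + v i) ` J))" unfolding T_def by (rule card_insert_le_m1) auto
  also have "\<dots> \<le> Suc d" by (simp add: d_def card_image_le)
  finally have cT: "card T \<le> Suc d" .
  have indT: "independent T" by (rule independent_of_card_le_dim[OF spT finT]) (use cT dimV in simp)
  have cardT: "card T = Suc d" using dim_eq_card_independent[OF indT] dim_span[of T] spT dimV by simp
  have intT: "integer_point u" if "u \<in> T" for u using that integer_v by (auto simp: T_def integer_point_add)
  have posT: "0 < fst u" if "u \<in> T" for u
  proof -
    have "0 \<le> fst (v i)" for i using st unfolding lat_state_def by blast
    then show ?thesis using that state_fst_pos[OF st \<Lambda>1] by (auto simp: T_def add_pos_nonneg)
  qed
  obtain L where L: "rat_affine_subspace d L" "lift_space L = span T" "\<And>Q. (1, Q) \<in> span T \<Longrightarrow> Q \<in> L"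
    using rat_affine_subspace_of_lattice[OF finT indT cardT intT posT] by blast
  obtain f where f: "bij_betw f {..<d} J"
    using ex_bij_betw_nat_finite[of J] by (auto simp: atLeast0LessThan d_def)
  \<comment> \<open>For the height the \<open>v i\<close> themselves are used, since subtracting a
    suitable multiple of v0 makes them short.\<close>
  define a where "a i = (case i of 0 \<Rightarrow> v0 | Suc j \<Rightarrow> v (f j))" for i
  have aimg: "a ` {..<Suc d} = insert v0 (v ` J)"
  proof -
    have "a ` {..<Suc d} = insert v0 (v ` f ` {..<d})"
      unfolding lessThan_Suc_eq_insert_0 by (auto simp: a_def image_image)
    then show ?thesis using f by (simp add: bij_betw_def)
  qed
  have spa: "span (a ` {..<Suc d}) = lift_space L" unfolding aimg L(2) spT V ..
  have "card (a ` {..<Suc d}) \<le> Suc d" using card_image_le[of "{..<Suc d}" a] by simp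
  then have inda: "independent (a ` {..<Suc d})"
    by (intro independent_of_card_le_dim[OF spa]) (use dimV L(2) spT in auto)
  then have "card (a ` {..<Suc d}) = Suc d"
    using dim_eq_card_independent dim_span spa L(2) spT dimV by metis
  then have inja: "inj_on a {..<Suc d}" by (intro eq_card_imp_inj_on) auto
  have inta: "integer_point (a i)" for i using integer_v by (auto simp: a_def split: nat.split)
  have "height L \<le> sqrt (gram_det (Suc d) a)"
    by (rule height_le_gram_det[OF inta inja inda spa])
  also have "\<dots> \<le> sqrt ((norm v0)\<^sup>2 * (\<Prod>i<d. (2 * \<Lambda> * exp (- t))\<^sup>2))"
  proof (rule real_sqrt_le_mono)
    have "gram_det (Suc d) a \<le> (norm (a 0))\<^sup>2 * (\<Prod>i<d. (norm (a (Suc i) - (fst (a (Suc i)) / fst v0) *\<^sub>R a 0))\<^sup>2)"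
      by (rule gram_det_le_prod_reduced)
    also have "\<dots> \<le> (norm v0)\<^sup>2 * (\<Prod>i<d. (2 * \<Lambda> * exp (- t))\<^sup>2)"
    proof (intro mult_mono prod_mono conjI power_mono)
      fix i
      show "norm (a (Suc i) - (fst (a (Suc i)) / fst v0) *\<^sub>R a 0) \<le> 2 * \<Lambda> * exp (- t)"
        unfolding a_def nat.case
        by (rule norm_reduced_vector_le(1)) (use st in \<open>auto simp: lat_state_def\<close>)
    qed (auto simp: a_def intro!: prod_nonneg)
    finally show "gram_det (Suc d) a \<le> (norm v0)\<^sup>2 * (\<Prod>i<d. (2 * \<Lambda> * exp (- t))\<^sup>2)" .
  qed
  also have "\<dots> = norm v0 * (2 * \<Lambda> * exp (- t)) ^ d"
  proof -
    have "(norm v0)\<^sup>2 * (\<Prod>i<d. (2 * \<Lambda> * exp (- t))\<^sup>2) = (norm v0 * (2 * \<Lambda> * exp (- t)) ^ d)\<^sup>2"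
      by (simp only: prod_constant card_lessThan power_mult_distrib[of "norm v0"] power_mult[symmetric] mult.commute[of 2])
    then show ?thesis using \<Lambda>1 by simp
  qed
  also have "\<dots> \<le> (2 + norm y) * \<Lambda> * exp (?n * t) * (2 * \<Lambda> * exp (- t)) ^ d"
    using norm_v0_le[OF t] \<Lambda>1 by (intro mult_right_mono) auto
  also have "\<dots> = (2 + norm y) * \<Lambda> * (2 * \<Lambda>) ^ d * (exp (?n * t) * exp (- t) ^ d)"
    by (simp add: power_mult_distrib)
  also have "exp (?n * t) * exp (- t) ^ d = exp ((?n - real d) * t)"
    unfolding exp_of_nat_mult[symmetric] exp_add[symmetric] by (simp add: algebra_simps)
  finally have ht: "height L \<le> (2 + norm y) * \<Lambda> * (2 * \<Lambda>) ^ d * exp ((?n - real d) * t)" .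
  have "fst (1, zJ) * fst v0 \<le> fst w1"
    unfolding w1_def using fst_comb_bounds(1)[OF st \<Lambda>1, of "(1, zJ)" 2] z(1) z0 by (simp add: zJ_def)
  then have w1pos: "exp (?n * t) / \<Lambda> \<le> fst w1" "0 < fst w1"
    using state_fst_ge[OF st \<Lambda>1] state_fst_pos[OF st \<Lambda>1] by auto
  define Q where "Q = (1 / fst w1) *\<^sub>R snd w1"
  have "(1, Q) = (1 / fst w1) *\<^sub>R w1" using w1pos by (simp add: Q_def prod_eq_iff)
  moreover have "w1 \<in> V" unfolding V_def w1_def by (rule imageI) (simp add: coord_subspace_def zJ_def)
  then have "(1 / fst w1) *\<^sub>R w1 \<in> span T" unfolding spT[symmetric] by (rule span_scale)
  ultimately have "Q \<in> L" using L(3) by simp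
  then have "infdist \<theta> L \<le> dist \<theta> Q" by (rule infdist_le)
  also have "\<dots> = norm (Q - \<theta>)" by (simp add: dist_norm norm_minus_commute)
  also have "\<dots> \<le> P\<^sup>2 * \<Lambda> ^ 4 * exp (- (?n + 1) * (t + (real d + 1) * \<tau>))"
  proof -
    have "fst w1 *\<^sub>R (Q - \<theta>) = snd w1 - fst w1 *\<^sub>R \<theta>" using w1pos by (simp add: Q_def algebra_simps)
    then have "fst w1 * norm (Q - \<theta>) = norm (snd w1 - fst w1 *\<^sub>R \<theta>)" using w1pos by (metis abs_of_pos norm_scaleR)
    also have "\<dots> \<le> (1 / K) * (exp (- t) * (P\<^sup>2 * \<Lambda> ^ 3))"
    proof -
      have "snd w1 - fst w1 *\<^sub>R \<theta> = (1 / K) *\<^sub>R ((snd w - fst w *\<^sub>R \<theta>) - (snd w2 - fst w2 *\<^sub>R \<theta>))"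
        by (simp add: w1_eq algebra_simps)
      also have "snd w - fst w *\<^sub>R \<theta> = 0" using cone(5) by simp
      finally have "norm (snd w1 - fst w1 *\<^sub>R \<theta>) = (1 / K) * norm (snd w2 - fst w2 *\<^sub>R \<theta>)" using K1 by (simp add: norm_minus_commute)
      also have "norm (snd w2 - fst w2 *\<^sub>R \<theta>) \<le> exp (- t) * norm (flow t \<theta> w2)" by (rule flow_snd_le)
      also have "\<dots> \<le> exp (- t) * (P\<^sup>2 * \<Lambda> ^ 3)" using norm_flow_w2[of t] by (intro mult_left_mono) auto
      finally show ?thesis using K1 by (simp add: divide_right_mono)
    qed
    finally have "fst w1 * norm (Q - \<theta>) \<le> (1 / K) * (exp (- t) * (P\<^sup>2 * \<Lambda> ^ 3))" .
    moreover have "(exp (?n * t) / \<Lambda>) * norm (Q - \<theta>) \<le> fst w1 * norm (Q - \<theta>)"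
      using w1pos(1) by (rule mult_right_mono) simp
    ultimately have le: "(exp (?n * t) / \<Lambda>) * norm (Q - \<theta>) \<le> (1 / K) * (exp (- t) * (P\<^sup>2 * \<Lambda> ^ 3))" by linarith
    have gen: "x' \<le> y' * (b' / a')" if "(a' / b') * x' \<le> y'" "0 < a'" "0 < b'" for a' b' x' y' :: real
      using that by (simp add: field_simps)
    have "norm (Q - \<theta>) \<le> (1 / K) * (exp (- t) * (P\<^sup>2 * \<Lambda> ^ 3)) * (\<Lambda> / exp (?n * t))"
      by (rule gen[OF le]) (use \<Lambda>1 in auto)
    also have "\<dots> = P\<^sup>2 * \<Lambda> ^ 4 * (exp (- t) * (1 / K) * (1 / exp (?n * t)))"
      by (simp add: power3_eq_cube power4_eq_xxxx)
    also have "exp (- t) * (1 / K) * (1 / exp (?n * t)) = exp (- (?n + 1) * (t + (real d + 1) * \<tau>))"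
    proof -
      have "1 / K = exp (- ((?n + 1) * (real d + 1) * \<tau>))" "1 / exp (?n * t) = exp (- (?n * t))"
        by (simp_all add: K_def exp_minus inverse_eq_divide)
      then show ?thesis by (simp only: exp_add[symmetric]) (simp add: algebra_simps)
    qed
    finally show ?thesis .
  qed
  finally show ?thesis by (rule that[OF L(1) ht])
qed

end

section \<open>Packing dimension\<close>

lemma packing_measure_mono:
  fixes E :: "'a::real_normed_vector set"
  assumes "E \<subseteq> F"
  shows "packing_measure s E \<le> packing_measure s F"
  unfolding packing_measure_def by (rule INF_superset_mono) (use assms in auto)

text \<open>Above the critical dimension the sum is compared with volumes: the balls are disjoint
  and lie in a bounded region, and each term carries an additional factor of at most
  \<open>(2 * \<delta>) powr (s - n)\<close>, which tends to 0 with \<delta>.\<close>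

lemma packing_premeasure_delta_ball_le:
  assumes s: "real CARD('n) < s" and \<delta>: "0 < \<delta>" "\<delta> \<le> 1"
  shows "packing_premeasure_delta s \<delta> (ball (0 :: real ^ 'n) R) \<le>
    ennreal ((2 * \<delta>) powr (s - real CARD('n)) * 2 ^ CARD('n) * \<bar>R + 1\<bar> ^ CARD('n))"
  unfolding packing_premeasure_delta_def
proof (rule SUP_least, clarify)
  fix I :: "nat set" and x :: "nat \<Rightarrow> real ^ 'n" and r :: "nat \<Rightarrow> real"
  assume I: "\<forall>i\<in>I. x i \<in> ball 0 R \<and> 0 < r i \<and> r i \<le> \<delta>"
    and disj: "\<forall>i\<in>I. \<forall>j\<in>I. i \<noteq> j \<longrightarrow> cball (x i) (r i) \<inter> cball (x j) (r j) = {}"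
  let ?n = "CARD('n)"
  define b where "b = unit_ball_vol (real ?n)"
  have b: "0 < b" unfolding b_def by (rule unit_ball_vol_pos) simp
  define K where "K = (2 * \<delta>) powr (s - real ?n) * 2 ^ ?n / b"
  have K: "0 \<le> K" using b by (simp add: K_def)
  define C where "C i = (if i \<in> I then cball (x i) (r i) else {})" for i
  have summand: "(if i \<in> I then ennreal ((2 * r i) powr s) else 0) \<le> ennreal K * emeasure lborel (C i)" for i
  proof (cases "i \<in> I")
    case True
    have r: "0 < r i" "r i \<le> \<delta>" using I True by auto
    have "(2 * r i) powr s = (2 * r i) powr (s - real ?n) * (2 * r i) powr real ?n"
      by (simp add: powr_add[symmetric])
    also have "(2 * r i) powr real ?n = (2 * r i) ^ ?n" using r by (simp add: powr_realpow)
    also have "(2 * r i) powr (s - real ?n) * (2 * r i) ^ ?n \<le> (2 * \<delta>) powr (s - real ?n) * (2 * r i) ^ ?n"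
      using r s by (intro mult_right_mono powr_mono2) auto
    also have "\<dots> = K * (b * r i ^ ?n)" using b by (simp add: K_def power_mult_distrib)
    finally have "ennreal ((2 * r i) powr s) \<le> ennreal (K * (b * r i ^ ?n))" by (rule ennreal_leI)
    also have "\<dots> = ennreal K * emeasure lborel (cball (x i) (r i))"
      using r b K by (simp add: emeasure_cball b_def ennreal_mult)
    finally show ?thesis using True by (simp add: C_def)
  qed (simp add: C_def)
  have "(\<Sum>i. if i \<in> I then ennreal ((2 * r i) powr s) else 0) \<le> (\<Sum>i. ennreal K * emeasure lborel (C i))"
    using summand by (intro suminf_le) auto
  also have "\<dots> = ennreal K * (\<Sum>i. emeasure lborel (C i))" by (rule ennreal_suminf_cmult)
  also have "(\<Sum>i. emeasure lborel (C i)) = emeasure lborel (\<Union>i. C i)"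
    using disj by (intro suminf_emeasure) (auto simp: C_def disjoint_family_on_def)
  also have "\<dots> \<le> emeasure lborel (cball (0 :: real ^ 'n) \<bar>R + 1\<bar>)"
  proof (rule emeasure_mono)
    show "(\<Union>i. C i) \<subseteq> cball 0 \<bar>R + 1\<bar>"
    proof
      fix p assume "p \<in> (\<Union>i. C i)"
      then obtain i where i: "i \<in> I" "p \<in> cball (x i) (r i)" by (auto simp: C_def split: if_splits)
      then have "norm (x i) < R" "r i \<le> \<delta>" "norm (p - x i) \<le> r i" using I
        by (auto simp: dist_norm norm_minus_commute)
      then have "norm p \<le> R + 1" using \<delta> norm_triangle_ineq2[of p "x i"] by linarith
      then show "p \<in> cball 0 \<bar>R + 1\<bar>" by simp
    qed
  qed auto
  also have "emeasure lborel (cball (0 :: real ^ 'n) \<bar>R + 1\<bar>) = ennreal (b * \<bar>R + 1\<bar> ^ ?n)"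
    by (simp add: emeasure_cball b_def)
  also have "ennreal K * ennreal (b * \<bar>R + 1\<bar> ^ ?n) = ennreal ((2 * \<delta>) powr (s - real ?n) * 2 ^ ?n * \<bar>R + 1\<bar> ^ ?n)"
    using b K by (simp add: ennreal_mult[symmetric] K_def)
  finally show "(\<Sum>i. if i \<in> I then ennreal ((2 * r i) powr s) else 0) \<le>
     ennreal ((2 * \<delta>) powr (s - real ?n) * 2 ^ ?n * \<bar>R + 1\<bar> ^ ?n)"
    by (simp add: mult_left_mono)
qed

lemma packing_measure_UNIV_eq_0:
  assumes s: "real CARD('n) < s"
  shows "packing_measure s (UNIV :: (real ^ 'n) set) = 0"
proof -
  have "packing_premeasure s (ball (0 :: real ^ 'n) R) = 0" for R
  proof -
    define D where "D = 2 ^ CARD('n) * \<bar>R + 1\<bar> ^ CARD('n) + 1"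
    have D: "0 < D" by (simp add: D_def add_nonneg_pos)
    have "packing_premeasure s (ball (0 :: real ^ 'n) R) \<le> 0 + ennreal e" if e: "0 < e" for e
    proof -
      define p where "p = s - real CARD('n)"
      have p: "0 < p" using s by (simp add: p_def)
      define \<delta> where "\<delta> = min 1 ((e / D) powr (1 / p) / 2)"
      have \<delta>: "0 < \<delta>" "\<delta> \<le> 1" using e D by (auto simp: \<delta>_def)
      have "(2 * \<delta>) powr p \<le> ((e / D) powr (1 / p)) powr p"
        using p \<delta> by (intro powr_mono2) (auto simp: \<delta>_def)
      also have "\<dots> = e / D" using p e D by (simp add: powr_powr)
      finally have le: "(2 * \<delta>) powr p \<le> e / D" .
      have "packing_premeasure s (ball (0 :: real ^ 'n) R) \<le> packing_premeasure_delta s \<delta> (ball (0 :: real ^ 'n) R)"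
        unfolding packing_premeasure_def using \<delta> by (intro INF_lower) auto
      also have "\<dots> \<le> ennreal ((2 * \<delta>) powr p * 2 ^ CARD('n) * \<bar>R + 1\<bar> ^ CARD('n))"
        unfolding p_def by (rule packing_premeasure_delta_ball_le[OF s \<delta>])
      also have "\<dots> \<le> ennreal ((e / D) * D)"
      proof (rule ennreal_leI)
        have "(2 * \<delta>) powr p * (2 ^ CARD('n) * \<bar>R + 1\<bar> ^ CARD('n)) \<le> (e / D) * D"
          using le e D by (intro mult_mono) (auto simp: D_def)
        then show "(2 * \<delta>) powr p * 2 ^ CARD('n) * \<bar>R + 1\<bar> ^ CARD('n) \<le> (e / D) * D" by (simp only: mult.assoc)
      qed
      finally show ?thesis using D by simp
    qed
    then have "packing_premeasure s (ball (0 :: real ^ 'n) R) \<le> 0" by (rule ennreal_le_epsilon)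
    then show ?thesis by simp
  qed
  moreover have "(UNIV :: (real ^ 'n) set) \<subseteq> (\<Union>i::nat. ball 0 (real i))"
  proof
    fix x :: "real ^ 'n"
    obtain i :: nat where "norm x < real i" using reals_Archimedean2 by blast
    then show "x \<in> (\<Union>i::nat. ball 0 (real i))" by auto
  qed
  then have "packing_measure s (UNIV :: (real ^ 'n) set) \<le> (\<Sum>i::nat. packing_premeasure s (ball (0 :: real ^ 'n) (real i)))"
    unfolding packing_measure_def by (intro INF_lower) auto
  ultimately show ?thesis by simp
qed

lemma packing_dim_eq_CARD:
  fixes E :: "(real ^ 'n) set"
  assumes "\<And>s. 0 \<le> s \<Longrightarrow> s < real CARD('n) \<Longrightarrow> packing_measure s E \<noteq> 0"
  shows "packing_dim E = real CARD('n)"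
proof -
  let ?S = "{s. 0 \<le> s \<and> packing_measure s E = 0}"
  have in_S: "s \<in> ?S" if "real CARD('n) < s" for s
  proof -
    have "packing_measure s E \<le> packing_measure s (UNIV :: (real ^ 'n) set)" by (rule packing_measure_mono) auto
    then have "packing_measure s E = 0" using packing_measure_UNIV_eq_0[OF that] by simp
    then show ?thesis using that by simp
  qed
  have ge: "real CARD('n) \<le> s" if "s \<in> ?S" for s using assms[of s] that by force
  have "real CARD('n) + 1 \<in> ?S" by (rule in_S) simp
  then have ne: "?S \<noteq> {}" by blast
  have bdd: "bdd_below ?S" by (rule bdd_belowI[of _ 0]) auto
  have "Inf ?S \<le> real CARD('n) + e" if "0 < e" for e
    using in_S[of "real CARD('n) + e"] that by (intro cInf_lower bdd) auto
  then have "Inf ?S \<le> real CARD('n)" by (rule field_le_epsilon)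
  moreover have "real CARD('n) \<le> Inf ?S" using ne ge by (rule cInf_greatest)
  ultimately show ?thesis unfolding packing_dim_def by simp
qed

text \<open>This is all that is kept of measure zero: countably many sets whose premeasure at some
  scale is below 1. Each of them is avoided by one step of the construction.\<close>

lemma packing_measure_0_cover:
  fixes E :: "'a::real_normed_vector set"
  assumes "packing_measure s E = 0"
  obtains A :: "nat \<Rightarrow> 'a set" where "E \<subseteq> (\<Union>i. A i)"
    "\<And>i. \<exists>\<delta>>0. packing_premeasure_delta s \<delta> (A i) < 1"
proof -
  have "packing_measure s E < 1" using assms by simp
  then obtain A :: "nat \<Rightarrow> 'a set" where A: "E \<subseteq> (\<Union>i. A i)" "(\<Sum>i. packing_premeasure s (A i)) < 1"
    unfolding packing_measure_def by (auto simp: INF_less_iff)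
  have "packing_premeasure s (A i) < 1" for i
  proof -
    have "packing_premeasure s (A i) \<le> (\<Sum>i. packing_premeasure s (A i))"
      using sum_le_suminf[OF summableI, of "{i}" "\<lambda>i. packing_premeasure s (A i)"] by simp
    then show ?thesis using A(2) by (rule le_less_trans)
  qed
  then have "\<exists>\<delta>>0. packing_premeasure_delta s \<delta> (A i) < 1" for i
    unfolding packing_premeasure_def by (auto simp: INF_less_iff)
  then show ?thesis by (rule that[OF A(1)])
qed

text \<open>Balls of one radius around separated points are an admissible packing.\<close>

lemma card_separated_le:
  fixes a :: "'b \<Rightarrow> 'a::real_normed_vector"
  assumes "packing_premeasure_delta s \<delta> A < 1" "0 < r" "r \<le> \<delta>" "finite C" "\<And>z. z \<in> C \<Longrightarrow> a z \<in> A"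
    and sep: "\<And>z z'. z \<in> C \<Longrightarrow> z' \<in> C \<Longrightarrow> z \<noteq> z' \<Longrightarrow> 2 * r < dist (a z) (a z')"
  shows "real (card C) * (2 * r) powr s \<le> 1"
proof -
  obtain h where h: "bij_betw h {..<card C} C"
    using ex_bij_betw_nat_finite[OF assms(4)] by (auto simp: atLeast0LessThan)
  have hC: "h i \<in> C" if "i < card C" for i using h that by (auto simp: bij_betw_def)
  have disj: "cball (a (h i)) r \<inter> cball (a (h j)) r = {}" if "i < card C" "j < card C" "i \<noteq> j" for i j
  proof -
    have "h i \<noteq> h j" using inj_onD[OF bij_betw_imp_inj_on[OF h], of i j] that by auto
    then have *: "2 * r < dist (a (h i)) (a (h j))" using sep hC that by blast
    then show ?thesis by (intro disjoint_cballI) simp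
  qed
  have "({..<card C}, \<lambda>i. a (h i), \<lambda>_. r) \<in> {(I::nat set, x::nat \<Rightarrow> 'a, r::nat \<Rightarrow> real).
      (\<forall>i\<in>I. x i \<in> A \<and> 0 < r i \<and> r i \<le> \<delta>) \<and>
      (\<forall>i\<in>I. \<forall>j\<in>I. i \<noteq> j \<longrightarrow> cball (x i) (r i) \<inter> cball (x j) (r j) = {})}"
    using disj hC assms(2,3,5) by auto
  from SUP_upper[OF this, of "\<lambda>p. case p of (I, x, r) \<Rightarrow> (\<Sum>i. if i \<in> I then ennreal ((2 * r i) powr s) else 0)"]
  have "(\<Sum>i. if i \<in> {..<card C} then ennreal ((2 * r) powr s) else 0) \<le> packing_premeasure_delta s \<delta> A"
    unfolding packing_premeasure_delta_def by simp
  also have "(\<Sum>i. if i \<in> {..<card C} then ennreal ((2 * r) powr s) else 0)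
      = (\<Sum>i\<in>{..<card C}. if i \<in> {..<card C} then ennreal ((2 * r) powr s) else 0)"
    by (rule suminf_finite) auto
  also have "\<dots> = ennreal (real (card C) * (2 * r) powr s)"
    by (simp add: ennreal_mult ennreal_of_nat_eq_real_of_nat)
  finally have "ennreal (real (card C) * (2 * r) powr s) < 1" using assms(1) by (rule le_less_trans)
  then show ?thesis by (simp add: ennreal_less_one_iff)
qed

lemma escape_small_packing:
  fixes Z :: "(real ^ 'n) set" and F :: "real ^ 'n \<Rightarrow> real ^ 'n"
  assumes Z: "Z \<in> sets lborel" "0 < emeasure lborel Z"
    and \<kappa>: "0 < \<kappa>" "\<And>z z'. z \<in> Z \<Longrightarrow> z' \<in> Z \<Longrightarrow> \<kappa> * norm (z - z') \<le> norm (F z - F z')"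
    and s: "0 \<le> s" "s < real CARD('n)" and \<delta>: "0 < \<delta>" "packing_premeasure_delta s \<delta> A < 1"
  obtains \<eta> where "0 < \<eta>" "\<And>a. (\<And>z. z \<in> Z \<Longrightarrow> norm (a z - F z) \<le> \<eta>) \<Longrightarrow> \<exists>z\<in>Z. a z \<notin> A"
proof -
  let ?n = "CARD('n)"
  obtain e where e: "0 < e" "ennreal e < emeasure lborel Z"
  proof (cases "emeasure lborel Z")
    case (real r)
    then have "0 < r" using Z(2) by (simp add: ennreal_less_zero_iff)
    then show ?thesis using real by (intro that[of "r / 2"]) (auto simp: ennreal_less_iff)
  next
    case top
    then show ?thesis by (intro that[of 1]) auto
  qed
  define b where "b = unit_ball_vol (real ?n)"
  have b: "0 < b" unfolding b_def by (rule unit_ball_vol_pos) simp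
  define D where "D = b * 5 ^ ?n / \<kappa> powr s"
  have D: "0 < D" using b \<kappa>(1) by (simp add: D_def)
  define p where "p = real ?n - s"
  have p: "0 < p" using s by (simp add: p_def)
  \<comment> \<open>The first bound keeps the packing radius \<kappa> R / 2 at most \<delta>; the
    second keeps the measure covered by the balls around C at most e, which is less than that of
    Z.\<close>
  define R where "R = min (2 * \<delta> / \<kappa>) ((e / D) powr (1 / p))"
  have R: "0 < R" "\<kappa> * R / 2 \<le> \<delta>" using \<delta> \<kappa> e D by (auto simp: R_def min_def field_simps)
  have "R powr p \<le> ((e / D) powr (1 / p)) powr p" using p R by (intro powr_mono2) (auto simp: R_def)
  also have "\<dots> = e / D" using p e D by (simp add: powr_powr)
  finally have DR: "D * R powr p \<le> e" using D by (simp add: field_simps)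
  show ?thesis
  proof (rule that[of "\<kappa> * R / 2"])
    show "0 < \<kappa> * R / 2" using \<kappa> R by simp
    fix a assume a: "\<And>z. z \<in> Z \<Longrightarrow> norm (a z - F z) \<le> \<kappa> * R / 2"
    show "\<exists>z\<in>Z. a z \<notin> A"
    proof (rule ccontr)
      assume "\<not> ?thesis"
      then have aA: "\<And>z. z \<in> Z \<Longrightarrow> a z \<in> A" by blast
      obtain C where C: "countable C" "C \<subseteq> Z" "pairwise (\<lambda>i j. disjnt (cball i R) (cball j R)) C"
        "(\<Union>z\<in>Z. cball z R) \<subseteq> (\<Union>z\<in>C. cball z (5 * R))"
        using Vitali_covering_lemma_cballs[where S = "\<Union>z\<in>Z. cball z R" and K = Z and a = "\<lambda>z. z" and r = "\<lambda>_. R" and B = R]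
        using R(1) by auto
      have sep: "\<kappa> * R < dist (a z) (a z')" if zz: "z \<in> C" "z' \<in> C" "z \<noteq> z'" for z z'
      proof -
        have "disjnt (cball z R) (cball z' R)" using C(3) zz by (auto simp: pairwise_def)
        have "2 * R < norm (z - z')"
        proof (rule ccontr)
          assume "\<not> ?thesis"
          then have "dist z z' \<le> 2 * R" by (simp add: dist_norm)
          then have "midpoint z z' \<in> cball z R \<inter> cball z' R" by (simp add: dist_midpoint)
          then show False using \<open>disjnt (cball z R) (cball z' R)\<close> by (auto simp: disjnt_def)
        qed
        then have "\<kappa> * (2 * R) < \<kappa> * norm (z - z')" using \<kappa>(1) by simp
        also have "\<dots> \<le> norm (F z - F z')" using \<kappa>(2) zz C(2) by blast
        also have "\<dots> = norm ((a z - a z') - (a z - F z) + (a z' - F z'))" by simp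
        also have "\<dots> \<le> norm (a z - a z') + norm (a z - F z) + norm (a z' - F z')"
          by (rule order_trans[OF norm_triangle_ineq add_right_mono[OF norm_triangle_ineq4]])
        also have "\<dots> \<le> norm (a z - a z') + \<kappa> * R / 2 + \<kappa> * R / 2"
          using a zz C(2) by (intro add_mono) auto
        finally show ?thesis by (simp add: dist_norm mult.commute)
      qed
      have card: "real (card C') * (\<kappa> * R) powr s \<le> 1" if C': "finite C'" "C' \<subseteq> C" for C'
        using card_separated_le[OF \<delta>(2) _ R(2) C'(1), of a] sep C' C(2) aA \<kappa> R(1) by (simp add: subset_iff)
      have pos: "0 < (\<kappa> * R) powr s" using \<kappa> R by simp
      have finC: "finite C"
      proof (rule ccontr)
        assume inf: "infinite C"
        define m where "m = nat \<lceil>1 / (\<kappa> * R) powr s\<rceil> + 1"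
        obtain C' where C': "C' \<subseteq> C" "finite C'" "card C' = m"
          using infinite_arbitrarily_large[OF inf] by blast
        have "1 / (\<kappa> * R) powr s < real m" unfolding m_def by linarith
        then have "1 < real m * (\<kappa> * R) powr s" using pos by (simp add: field_simps)
        then show False using card[OF C'(2,1)] C'(3) by simp
      qed
      have "Z \<subseteq> (\<Union>z\<in>Z. cball z R)" using R(1) by force
      then have "emeasure lborel Z \<le> emeasure lborel (\<Union>z\<in>C. cball z (5 * R))"
        using C(4) finC by (intro emeasure_mono) auto
      also have "\<dots> \<le> (\<Sum>z\<in>C. emeasure lborel (cball z (5 * R)))"
        using finC by (intro emeasure_subadditive_finite) auto
      also have "\<dots> = ennreal (real (card C) * (b * (5 * R) ^ ?n))"
        using R b by (simp add: emeasure_cball b_def ennreal_mult ennreal_of_nat_eq_real_of_nat)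
      also have "\<dots> \<le> ennreal e"
      proof (rule ennreal_leI)
        have "real (card C) * (\<kappa> * R) powr s * (b * (5 * R) ^ ?n) \<le> 1 * (b * (5 * R) ^ ?n)"
          using card[OF finC order_refl] b R by (intro mult_right_mono) auto
        then have "real (card C) * (b * (5 * R) ^ ?n) \<le> b * (5 * R) ^ ?n / (\<kappa> * R) powr s"
          using pos by (simp add: field_simps)
        also have "\<dots> = D * (R ^ ?n / R powr s)"
          using \<kappa> R by (simp add: D_def powr_mult power_mult_distrib)
        also have "R ^ ?n / R powr s = R powr p" using R by (simp add: p_def powr_diff powr_realpow)
        finally show "real (card C) * (b * (5 * R) ^ ?n) \<le> e" using DR by simp
      qed
      finally show False using e(2) by simp
    qed
  qed
qed

section \<open>The two kinds of phases\<close>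

text \<open>The natural radius \<open>exp (-(n + 1) t)\<close> enlarged by the square of the loss
  \<open>exp (\<delta> t)\<close> of a state. In a balanced phase the new centre is displaced by at
  most half of it, and the other half is left for the new ball.\<close>

definition state_radius :: "nat \<Rightarrow> real \<Rightarrow> real \<Rightarrow> real" where
  "state_radius n \<delta> t = 4 * (real n + 1) * exp ((2 * \<delta> - (real n + 1)) * t)"

lemma state_radius_pos: "0 < state_radius n \<delta> t"
  by (simp add: state_radius_def add_nonneg_pos)

text \<open>A ball fixed at time t has to control the lattice at all earlier times u of the phase,
  and there the loss must be measured against u, not t. This works because the radius shrinks at the
  rate n + 1 - 2 \<delta>.\<close>

lemma exp_mult_state_radius_le:
  assumes "u \<le> t" "2 * \<delta> \<le> 1"
  shows "exp (real (Suc n) * u) * state_radius n \<delta> t \<le> 4 * (real n + 1) * exp (2 * \<delta> * u)"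
proof -
  have "(real n + 1 - 2 * \<delta>) * u \<le> (real n + 1 - 2 * \<delta>) * t"
    using assms by (intro mult_left_mono) auto
  then have "real (Suc n) * u + (2 * \<delta> - (real n + 1)) * t \<le> 2 * \<delta> * u" by (simp add: algebra_simps)
  then have "exp (real (Suc n) * u + (2 * \<delta> - (real n + 1)) * t) \<le> exp (2 * \<delta> * u)" by simp
  then have "4 * (real n + 1) * exp (real (Suc n) * u + (2 * \<delta> - (real n + 1)) * t) \<le> 4 * (real n + 1) * exp (2 * \<delta> * u)"
    by (intro mult_left_mono) auto
  then show ?thesis by (simp add: state_radius_def exp_add mult_ac)
qed

lemma lat_state_mono:
  assumes "lat_state v0 v y t \<Lambda>" "\<Lambda> \<le> \<Lambda>'"
  shows "lat_state v0 v y t \<Lambda>'"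
proof -
  have "0 \<le> fst v0" "exp (real CARD('a) * t) \<le> \<Lambda> * fst v0"
    using assms(1) order_trans unfolding lat_state_def by blast+
  then have "exp (real CARD('a) * t) \<le> \<Lambda>' * fst v0"
    using mult_right_mono[OF assms(2), of "fst v0"] by linarith
  then show ?thesis using assms order_trans unfolding lat_state_def by blast
qed

text \<open>The constant and the n-th power that \<open>lat_state_exists\<close> costs are absorbed
  into \<open>exp (\<delta> * t)\<close>.\<close>

lemma lat_state_renew:
  fixes X :: "(real \<times> (real ^ 'n)) set"
  assumes X: "finite X" "card X \<le> Suc CARD('n)" "span X = UNIV" "\<And>x. x \<in> X \<Longrightarrow> integer_point x"
    and \<Lambda>: "\<And>x. x \<in> X \<Longrightarrow> norm (flow t y x) \<le> \<Lambda>" "1 \<le> \<Lambda>"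
    and \<delta>: "2 * (2 * \<Lambda>) ^ CARD('n) \<le> exp (\<delta> * t)" "\<delta> \<le> 1" and t: "0 \<le> t"
  obtains v0 v where "lat_state v0 v y t (exp (\<delta> * t))"
proof -
  have "2 * \<Lambda> \<le> (2 * \<Lambda>) ^ CARD('n)"
    using power_increasing[of 1 "CARD('n)" "2 * \<Lambda>"] \<Lambda>(2) by (simp add: Suc_le_eq)
  moreover have "0 \<le> (2 * \<Lambda>) ^ CARD('n)" using \<Lambda>(2) by simp
  ultimately have "2 * \<Lambda> \<le> exp (\<delta> * t)" using \<delta>(1) by linarith
  also have "\<dots> \<le> exp t" using \<delta>(2) t mult_right_mono[of \<delta> 1 t] by simp
  finally have "(2 * \<Lambda>) ^ Suc CARD('n) \<le> exp t ^ Suc CARD('n)" using \<Lambda>(2) by (intro power_mono) auto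
  also have "\<dots> = exp (real (Suc CARD('n)) * t)" by (rule exp_of_nat_mult[symmetric])
  finally obtain v0 v where "lat_state v0 v y t (2 * (2 * \<Lambda>) ^ CARD('n))"
    using lat_state_exists[OF X \<Lambda>] by blast
  then show ?thesis using lat_state_mono[OF _ \<delta>(1)] that by blast
qed

text \<open>A linear inverse of \<open>comb\<close> recovers (1, z) from the point up to the scalar
  1 / Q, and Q is bounded on the cube. The constant \<kappa> depends on the state; this is harmless
  because the length of the balanced phase is chosen after it.\<close>

lemma cone_point_lower_Lipschitz:
  fixes v0 :: "real \<times> (real ^ 'n)"
  assumes st: "lat_state v0 v y t \<Lambda>" and \<Lambda>1: "1 \<le> \<Lambda>"
  obtains \<kappa> where "0 < \<kappa>" "\<And>z z'. \<forall>i. 1 \<le> z $ i \<and> z $ i \<le> 2 \<Longrightarrow> \<forall>i. 1 \<le> z' $ i \<and> z' $ i \<le> 2 \<Longrightarrow>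
     \<kappa> * norm (z - z') \<le> norm (cone_point v0 v (1, z) - cone_point v0 v (1, z'))"
proof -
  let ?n = "real CARD('n)"
  obtain g where g: "linear g" "g \<circ> comb v0 v = id"
    using linear_injective_left_inverse[OF linear_comb lat_state_inj[OF st]] by blast
  have gc: "g (comb v0 v x) = x" for x using fun_cong[OF g(2), of x] by simp
  obtain M where M: "0 < M" "\<And>x. norm (g x) \<le> M * norm x" using linear_bounded_pos[OF g(1)] by blast
  define q where "q = (2 * ?n + 1) * fst v0"
  have q: "0 < q" using state_fst_pos[OF st \<Lambda>1] by (simp add: q_def add_nonneg_pos)
  define \<kappa> where "\<kappa> = 1 / (q * M * (1 + 2 * ?n))"
  have \<kappa>: "0 < \<kappa>" using q M by (simp add: \<kappa>_def add_pos_nonneg)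
  show ?thesis
  proof (rule that[OF \<kappa>])
    fix z z' :: "real ^ 'n"
    assume z: "\<forall>i. 1 \<le> z $ i \<and> z $ i \<le> 2" and z': "\<forall>i. 1 \<le> z' $ i \<and> z' $ i \<le> 2"
    define F where "F z = cone_point v0 v (1, z)" for z
    define Q where "Q z = fst (comb v0 v (1, z))" for z
    have Q: "0 < Q x" "Q x \<le> q" "g (1, F x) = (1 / Q x, (1 / Q x) *\<^sub>R x)"
      if x: "\<forall>i. 1 \<le> x $ i \<and> x $ i \<le> 2" for x
    proof -
      have x0: "0 \<le> x $ i" for i using x by (meson order_trans zero_le_one)
      have "fst (1::real, x) * fst v0 \<le> Q x" unfolding Q_def
        by (rule fst_comb_bounds(1)[OF st \<Lambda>1, of _ 2]) (use x x0 in auto)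
      then show Qp: "0 < Q x" using state_fst_pos[OF st \<Lambda>1] by simp
      have "Q x \<le> (fst (1::real, x) + ?n * 2) * fst v0" unfolding Q_def
        by (rule fst_comb_bounds(2)[OF st \<Lambda>1]) (use x x0 in auto)
      then show "Q x \<le> q" by (simp add: q_def algebra_simps)
      have "(1, F x) = (1 / Q x) *\<^sub>R comb v0 v (1, x)"
        using Qp by (simp add: F_def cone_point_def Q_def prod_eq_iff)
      then have "g (1, F x) = (1 / Q x) *\<^sub>R g (comb v0 v (1, x))" by (simp only: linear_scale[OF g(1)])
      then show "g (1, F x) = (1 / Q x, (1 / Q x) *\<^sub>R x)" by (simp add: gc)
    qed
    have "g (1, F z) - g (1, F z') = g (0, F z - F z')"
      using linear_diff[OF g(1), of "(1, F z)" "(1, F z')"] by simp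
    then have gM: "norm (g (1, F z) - g (1, F z')) \<le> M * norm (F z - F z')"
      using M(2)[of "(0, F z - F z')"] by (simp add: norm_Pair)
    define p where "p = (1 / Q z) *\<^sub>R z - (1 / Q z') *\<^sub>R z'"
    have d: "g (1, F z) - g (1, F z') = (1 / Q z - 1 / Q z', p)"
      unfolding Q(3)[OF z] Q(3)[OF z'] p_def by simp
    have 1: "\<bar>1 / Q z - 1 / Q z'\<bar> \<le> M * norm (F z - F z')" "norm p \<le> M * norm (F z - F z')"
      using gM norm_fst_le[of "1 / Q z - 1 / Q z'" p] norm_snd_le[of p "1 / Q z - 1 / Q z'"]
      unfolding d by auto
    \<comment> \<open>Separates the change of the scaled parameter from the change of the scalar 1 /
      Q.\<close>
    have "z - z' = Q z *\<^sub>R p - (Q z * (1 / Q z - 1 / Q z')) *\<^sub>R z'"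
      using Q(1)[OF z] Q(1)[OF z'] by (simp add: p_def algebra_simps)
    then have "norm (z - z') \<le> norm (Q z *\<^sub>R p) + norm ((Q z * (1 / Q z - 1 / Q z')) *\<^sub>R z')"
      using norm_triangle_ineq4 by metis
    also have "\<dots> = Q z * (norm p + \<bar>1 / Q z - 1 / Q z'\<bar> * norm z')"
      by (simp only: norm_scaleR abs_mult abs_of_pos[OF Q(1)[OF z]] distrib_left mult.assoc)
    also have "\<dots> \<le> q * (M * norm (F z - F z') + M * norm (F z - F z') * (2 * ?n))"
    proof (intro mult_mono add_mono)
      have "norm z' \<le> (\<Sum>i\<in>UNIV. \<bar>z' $ i\<bar>)" by (rule norm_le_l1_cart)
      also have "\<dots> \<le> ?n * 2" by (rule sum_abs_coord_le) (use z' in \<open>simp add: abs_le_iff; meson order_trans[of "- _" 0] zero_le_one order_trans neg_le_0_iff_le zero_le_numeral\<close>)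
      finally show "norm z' \<le> 2 * ?n" by simp
    qed (use 1 Q[OF z] q M in auto)
    also have "\<dots> = (q * M * (1 + 2 * ?n)) * norm (F z - F z')" by (simp add: algebra_simps)
    finally have "norm (z - z') \<le> (q * M * (1 + 2 * ?n)) * norm (F z - F z')" .
    moreover have pos: "0 < q * M * (1 + 2 * ?n)" using q M by (simp add: add_pos_nonneg)
    ultimately have "\<kappa> * norm (z - z') \<le> \<kappa> * ((q * M * (1 + 2 * ?n)) * norm (F z - F z'))"
      using \<kappa> by (intro mult_left_mono) auto
    also have "\<dots> = (\<kappa> * (q * M * (1 + 2 * ?n))) * norm (F z - F z')" by (simp only: mult.assoc)
    also have "\<kappa> * (q * M * (1 + 2 * ?n)) = 1"
    proof -
      have "1 / a * a = 1" if "0 < a" for a :: real using that by simp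
      then show ?thesis unfolding \<kappa>_def using pos by blast
    qed
    finally have "\<kappa> * norm (z - z') \<le> 1 * norm (F z - F z')" .
    then show "\<kappa> * norm (z - z') \<le> norm (cone_point v0 v (1, z) - cone_point v0 v (1, z'))"
      by (simp add: F_def)
  qed
qed

lemma exp_dominates:
  fixes a M :: real
  assumes "0 < a" "0 < M"
  obtains T where "\<And>t. T \<le> t \<Longrightarrow> M \<le> exp (a * t)"
proof -
  have "M \<le> exp (a * t)" if "ln M / a \<le> t" for t
  proof -
    have "ln M \<le> a * t" using that assms by (simp add: field_simps)
    then show ?thesis using assms(2) by (metis exp_le_cancel_iff exp_ln)
  qed
  then show ?thesis by (rule that)
qed

text \<open>The order of choices matters. T0 depends on \<delta>' alone, through the constants of
  the parameters Z, so it can be prescribed before the state is known. The end time t' comes last: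
  it has to lie beyond T1, to make the new ball small enough to escape from A, and to turn the
  factor \<open>exp (3 \<delta> t)\<close>, by then a constant, into a loss of at most
  \<open>exp (\<delta>' t')\<close>. Thus the initial loss is forgotten.\<close>

lemma balanced_phase:
  assumes \<delta>': "0 < \<delta>'" "\<delta>' \<le> 1"
  obtains T0 where "\<And>(v0 :: real \<times> (real ^ 'n)) v y t \<delta> \<delta>1 \<delta>2 T1 s r (A :: (real ^ 'n) set).
    lat_state v0 v y t (exp (\<delta> * t)) \<Longrightarrow> 0 \<le> t \<Longrightarrow> 0 \<le> \<delta> \<Longrightarrow> \<delta> \<le> \<delta>1 \<Longrightarrow> \<delta>' \<le> \<delta>2 \<Longrightarrow> 2 * \<delta>2 \<le> 1 \<Longrightarrow>
    0 \<le> s \<Longrightarrow> s < real CARD('n) \<Longrightarrow> 0 < r \<Longrightarrow> packing_premeasure_delta s r A < 1 \<Longrightarrow>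
    \<exists>v0' v' y' t'. T1 \<le> t' \<and> t \<le> t' \<and> lat_state v0' v' y' t' (exp (\<delta>' * t')) \<and>
      cball y' (state_radius CARD('n) \<delta>2 t') \<subseteq> cball y (state_radius CARD('n) \<delta>1 t) \<and>
      cball y' (state_radius CARD('n) \<delta>2 t') \<inter> A = {} \<and>
      (T0 \<le> t \<longrightarrow> (\<forall>\<theta>\<in>cball y' (state_radius CARD('n) \<delta>2 t'). \<forall>u. t \<le> u \<and> u \<le> t' \<longrightarrow>
         split_basis u \<theta> 0 0 (3 * \<delta> + 4 * \<delta>2)))"
proof -
  let ?n = "real CARD('n)"
  have n1: "1 \<le> ?n" by (simp add: Suc_le_eq)
  \<comment> \<open>The lattice loses \<open>exp (\<epsilon> n^2 (u - t))\<close>, and the passage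
    to a new state takes the n-th power; half of \<delta>' is reserved for this and the other half
    for constants.\<close>
  define \<epsilon> where "\<epsilon> = \<delta>' / (2 * ?n ^ 3)"
  have \<epsilon>: "0 < \<epsilon>" using \<delta>' by (simp add: \<epsilon>_def)
  have \<epsilon>n: "\<epsilon> * ?n\<^sup>2 * ?n = \<delta>' / 2" by (simp add: \<epsilon>_def power2_eq_square power3_eq_cube)
  have \<epsilon>n2: "\<epsilon> * ?n\<^sup>2 \<le> \<delta>' / 2"
  proof -
    have "\<epsilon> * ?n\<^sup>2 * 1 \<le> \<epsilon> * ?n\<^sup>2 * ?n" using \<epsilon> n1 by (intro mult_left_mono) auto
    then show ?thesis using \<epsilon>n by simp
  qed
  obtain c and Z :: "(real ^ 'n) set" where c: "0 < c" "c \<le> 1" and Z: "Z \<in> sets lborel" "0 < emeasure lborel Z"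
    "\<And>z i. z \<in> Z \<Longrightarrow> 1 \<le> z $ i \<and> z $ i \<le> 2" "\<And>z J. z \<in> Z \<Longrightarrow> J \<noteq> {} \<Longrightarrow> badly_approx c \<epsilon> J z"
    by (rule badly_approx_positive_measure[OF \<epsilon>]) (rule that)
  define P where "P = 2 * ?n + 2"
  define L where "L = loss c CARD('n) * P\<^sup>2"
  have L1: "1 \<le> L"
  proof -
    have "1 * 1\<^sup>2 \<le> L" unfolding L_def using loss_ge_1[OF c, of "CARD('n)"] n1
      by (intro mult_mono power_mono) (auto simp: P_def)
    then show ?thesis by simp
  qed
  have P0: "0 < P" using n1 by (simp add: P_def)
  obtain T0 where T0: "\<And>t. T0 \<le> t \<Longrightarrow> (1 + 2 * P) * L \<le> exp (\<delta>' * t)"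
    using exp_dominates[of \<delta>' "(1 + 2 * P) * L"] \<delta>' L1 P0 by auto
  show ?thesis
  proof (rule that[of T0])
    fix v0 :: "real \<times> (real ^ 'n)" and v y t \<delta> \<delta>1 \<delta>2 T1 s r and A :: "(real ^ 'n) set"
    assume st: "lat_state v0 v y t (exp (\<delta> * t))" and t: "0 \<le> t" and \<delta>: "0 \<le> \<delta>" "\<delta> \<le> \<delta>1" "\<delta>' \<le> \<delta>2" "2 * \<delta>2 \<le> 1"
      and s: "0 \<le> s" "s < ?n" and r: "0 < r" "packing_premeasure_delta s r A < 1"
    define \<Lambda> where "\<Lambda> = exp (\<delta> * t)"
    have st: "lat_state v0 v y t \<Lambda>" using st by (simp add: \<Lambda>_def)
    have \<Lambda>1: "1 \<le> \<Lambda>" using \<delta> t by (simp add: \<Lambda>_def)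
    have \<Lambda>3: "\<Lambda> ^ 3 = exp (3 * \<delta> * t)" unfolding \<Lambda>_def by (simp add: exp_of_nat_mult[symmetric] mult.assoc)
    let ?F = "\<lambda>z. cone_point v0 v (1, z)"
    obtain \<kappa> where \<kappa>: "0 < \<kappa>" "\<And>z z'. \<forall>i. 1 \<le> z $ i \<and> z $ i \<le> 2 \<Longrightarrow> \<forall>i. 1 \<le> z' $ i \<and> z' $ i \<le> 2 \<Longrightarrow>
        \<kappa> * norm (z - z') \<le> norm (?F z - ?F z')"
      using cone_point_lower_Lipschitz[OF st \<Lambda>1] by blast
    obtain \<eta> where \<eta>: "0 < \<eta>" "\<And>a. (\<And>z. z \<in> Z \<Longrightarrow> norm (a z - ?F z) \<le> \<eta>) \<Longrightarrow> \<exists>z\<in>Z. a z \<notin> A"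
      by (rule escape_small_packing[OF Z(1,2) \<kappa>(1) _ s r, of ?F]) (use \<kappa>(2) Z(3) in auto)
    define x where "x = min \<eta> (state_radius CARD('n) \<delta>1 t / 2)"
    have x: "0 < x" using \<eta>(1) state_radius_pos[of "CARD('n)" \<delta>1 t] by (simp add: x_def)
    obtain T2 where T2: "\<And>t. T2 \<le> t \<Longrightarrow> 2 * P / x \<le> exp (1 * t)"
      using exp_dominates[of 1 "2 * P / x"] x P0 by auto
    \<comment> \<open>The part of the loss at t' that does not grow with t' - t.\<close>
    define M where "M = 2 * (2 * (L * exp (3 * \<delta> * t))) ^ CARD('n)"
    have M0: "0 < M" using L1 by (simp add: M_def)
    obtain T3 where T3: "\<And>t. T3 \<le> t \<Longrightarrow> M \<le> exp (\<delta>' / 2 * t)"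
      using exp_dominates[of "\<delta>' / 2" M] \<delta>' M0 by auto
    define t' where "t' = max (max T1 t) (max T2 T3)"
    have t': "T1 \<le> t'" "t \<le> t'" "T2 \<le> t'" "T3 \<le> t'" "0 \<le> t'" using t by (auto simp: t'_def)
    let ?r' = "state_radius CARD('n) \<delta>2 t'"
    have "?r' \<le> x"
    proof -
      have "2 * \<delta>2 - (?n + 1) \<le> - 1" using \<delta>(4) n1 by linarith
      then have "(2 * \<delta>2 - (?n + 1)) * t' \<le> - 1 * t'" using t'(5) by (rule mult_right_mono)
      then have "?r' \<le> 4 * (?n + 1) * exp (- 1 * t')"
        unfolding state_radius_def by (intro mult_left_mono exp_le_cancel_iff[THEN iffD2]) auto
      also have "\<dots> = 2 * P / exp t'" by (simp add: P_def exp_minus field_simps)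
      also have "\<dots> \<le> x" using T2[OF t'(3)] x by (simp add: field_simps)
      finally show ?thesis .
    qed
    then have r': "?r' \<le> \<eta>" "?r' \<le> state_radius CARD('n) \<delta>1 t / 2" by (auto simp: x_def)
    \<comment> \<open>If every ball met A, choosing a point of A in each would be a small
      perturbation of all images that stays in A.\<close>
    have "\<exists>z\<in>Z. cball (?F z) ?r' \<inter> A = {}"
    proof (rule ccontr)
      assume "\<not> ?thesis"
      then have "\<forall>z\<in>Z. \<exists>a. a \<in> cball (?F z) ?r' \<and> a \<in> A" by blast
      from bchoice[OF this] obtain a where a: "\<forall>z\<in>Z. a z \<in> cball (?F z) ?r' \<and> a z \<in> A" by (rule exE)
      have "norm (a z - ?F z) \<le> \<eta>" if "z \<in> Z" for z
      proof -
        have "dist (?F z) (a z) \<le> ?r'" using a that by auto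
        then show ?thesis using r'(1) by (simp add: dist_norm norm_minus_commute)
      qed
      then have "\<exists>z\<in>Z. a z \<notin> A" by (rule \<eta>(2))
      then show False using a by blast
    qed
    then obtain z where z: "z \<in> Z" "cball (?F z) ?r' \<inter> A = {}" by blast
    let ?y' = "?F z"
    have zb: "1 \<le> z $ i \<and> z $ i \<le> 2" for i using Z(3)[OF z(1)] .
    have z0: "0 \<le> z $ i" for i using zb[of i] by linarith
    have bz: "badly_approx c \<epsilon> UNIV z" by (rule Z(4)[OF z(1)]) simp
    define G where "G u = L * exp (3 * \<delta> * t + \<epsilon> * ?n\<^sup>2 * (u - t))" for u
    have G1: "1 \<le> G u" if "t \<le> u" for u
    proof -
      have "0 \<le> 3 * \<delta> * t + \<epsilon> * ?n\<^sup>2 * (u - t)" using that \<epsilon> \<delta> t by (intro add_nonneg_nonneg mult_nonneg_nonneg) auto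
      then have "1 * 1 \<le> G u" unfolding G_def using L1 by (intro mult_mono) auto
      then show ?thesis by simp
    qed
    have vec: "\<exists>X. finite X \<and> card X \<le> Suc CARD('n) \<and> span X = UNIV \<and> (\<forall>x\<in>X. integer_point x) \<and>
        (\<forall>x\<in>X. norm (flow u ?y' x) \<le> G u)" if u: "t \<le> u" for u
    proof -
      obtain X where X: "finite X" "card X \<le> Suc CARD('n)" "span X = UNIV" "\<And>x. x \<in> X \<Longrightarrow> integer_point x"
        "\<And>x. x \<in> X \<Longrightarrow> norm (flow u ?y' x) \<le> loss c CARD('n) * exp (\<epsilon> * ?n\<^sup>2 * (u - t)) * (P\<^sup>2 * \<Lambda> ^ 3)"
        by (rule generic_point_vectors[OF st \<Lambda>1 zb bz c less_imp_le[OF \<epsilon>] u, folded P_def]) (rule that)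
      have "loss c CARD('n) * exp (\<epsilon> * ?n\<^sup>2 * (u - t)) * (P\<^sup>2 * \<Lambda> ^ 3) = G u"
        unfolding \<Lambda>3 G_def L_def exp_add by (simp only: mult_ac)
      then show ?thesis using X by (intro exI[of _ X]) auto
    qed
    obtain v0' v' where st': "lat_state v0' v' ?y' t' (exp (\<delta>' * t'))"
    proof -
      obtain X where X: "finite X" "card X \<le> Suc CARD('n)" "span X = UNIV" "\<And>x. x \<in> X \<Longrightarrow> integer_point x"
        "\<And>x. x \<in> X \<Longrightarrow> norm (flow t' ?y' x) \<le> G t'"
        using vec[OF t'(2)] by blast
      have "2 * (2 * G t') ^ CARD('n) = M * exp (\<epsilon> * ?n\<^sup>2 * ?n * (t' - t))"
        by (simp add: G_def M_def exp_add power_mult_distrib exp_of_nat_mult[symmetric] mult_ac)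
      also have "\<dots> \<le> exp (\<delta>' / 2 * t') * exp (\<delta>' / 2 * t')"
        unfolding \<epsilon>n using T3[OF t'(4)] \<delta>' t by (intro mult_mono) auto
      also have "\<dots> = exp (\<delta>' * t')" by (simp flip: exp_add)
      finally show ?thesis
        using lat_state_renew[OF X G1[OF t'(2)] _ \<delta>'(2) t'(5)] that by blast
    qed
    have "norm (?y' - y) \<le> (2 * ?n + 1) * \<Lambda>\<^sup>2 * exp (- real (Suc CARD('n)) * t)"
      by (rule cone_point_bounds(1)[OF st \<Lambda>1]) (use zb z0 in auto)
    also have "\<dots> = (2 * ?n + 1) * exp ((2 * \<delta> - (?n + 1)) * t)"
      by (simp add: \<Lambda>_def exp_of_nat_mult[symmetric] exp_add[symmetric] algebra_simps)
    also have "\<dots> \<le> (2 * ?n + 2) * exp ((2 * \<delta>1 - (?n + 1)) * t)"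
      using \<delta> t by (intro mult_mono exp_le_cancel_iff[THEN iffD2] mult_right_mono) auto
    also have "\<dots> = state_radius CARD('n) \<delta>1 t / 2" by (simp add: state_radius_def)
    finally have sub: "cball ?y' ?r' \<subseteq> cball y (state_radius CARD('n) \<delta>1 t)"
      using r'(2) by (intro cball_subset_cball_iff[THEN iffD2] disjI1) (simp add: dist_norm)
    have slack: "split_basis u \<theta> 0 0 (3 * \<delta> + 4 * \<delta>2)"
      if T: "T0 \<le> t" and \<theta>: "\<theta> \<in> cball ?y' ?r'" and u: "t \<le> u" "u \<le> t'" for \<theta> u
    proof -
      obtain X where X: "finite X" "card X \<le> Suc CARD('n)" "span X = UNIV" "\<And>x. x \<in> X \<Longrightarrow> integer_point x"
        "\<And>x. x \<in> X \<Longrightarrow> norm (flow u ?y' x) \<le> G u"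
        using vec[OF u(1)] by blast
      have bal: "split_lattice u ?y' 0 0 (G u)" by (rule split_lattice_balanced[OF X])
      have u0: "0 \<le> u" using t u by simp
      have "exp (real (Suc CARD('n)) * u) * norm (?y' - \<theta>) \<le> exp (real (Suc CARD('n)) * u) * ?r'"
        using \<theta> by (intro mult_left_mono) (auto simp: dist_norm)
      also have "\<dots> \<le> 2 * P * exp (2 * \<delta>2 * u)"
        using exp_mult_state_radius_le[OF u(2) \<delta>(4), of "CARD('n)"] by (simp add: P_def algebra_simps)
      finally have "1 + exp (real (Suc CARD('n)) * u) * norm (?y' - \<theta>) \<le> 1 * exp (2 * \<delta>2 * u) + 2 * P * exp (2 * \<delta>2 * u)"
        using \<delta> \<delta>' u0 by (intro add_mono) auto
      also have "\<dots> = (1 + 2 * P) * exp (2 * \<delta>2 * u)" by (simp only: distrib_right)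
      finally have "(1 + exp (real (Suc CARD('n)) * u) * norm (?y' - \<theta>)) * G u
          \<le> ((1 + 2 * P) * exp (2 * \<delta>2 * u)) * (L * exp (3 * \<delta> * u + \<delta>2 * u))"
      proof (rule mult_mono)
        have "\<epsilon> * ?n\<^sup>2 * (u - t) \<le> \<delta>2 * u"
        proof (rule mult_mono)
          show "\<epsilon> * ?n\<^sup>2 \<le> \<delta>2" using \<epsilon>n2 \<delta>(3) \<delta>' by linarith
        qed (use u t \<delta> \<delta>' in auto)
        moreover have "3 * \<delta> * t \<le> 3 * \<delta> * u" using u \<delta> by (intro mult_left_mono) auto
        ultimately show "G u \<le> L * exp (3 * \<delta> * u + \<delta>2 * u)"
          unfolding G_def using L1 by (intro mult_left_mono exp_le_cancel_iff[THEN iffD2]) auto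
      qed (use P0 G1[OF u(1)] in auto)
      also have "\<dots> = ((1 + 2 * P) * L) * exp (3 * \<delta> * u + 3 * \<delta>2 * u)"
        by (simp add: exp_add[symmetric] algebra_simps)
      also have "\<dots> \<le> exp (\<delta>2 * u) * exp (3 * \<delta> * u + 3 * \<delta>2 * u)"
      proof (rule mult_right_mono)
        have "(1 + 2 * P) * L \<le> exp (\<delta>' * u)" using T0[of u] T u by simp
        also have "\<dots> \<le> exp (\<delta>2 * u)" using \<delta>(3) u0 by (simp add: mult_right_mono)
        finally show "(1 + 2 * P) * L \<le> exp (\<delta>2 * u)" .
      qed simp
      also have "\<dots> = exp ((3 * \<delta> + 4 * \<delta>2) * u)" by (simp add: exp_add[symmetric] algebra_simps)
      finally have le: "(1 + exp (real (Suc CARD('n)) * u) * norm (?y' - \<theta>)) * G u \<le> exp ((3 * \<delta> + 4 * \<delta>2) * u)" .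
      show ?thesis
        by (rule split_lattice_imp_split_basis[OF split_lattice_perturb[OF bal _ le] order_refl])
          (use G1[OF u(1)] in simp)
    qed
    show "\<exists>v0' v' y' t'. T1 \<le> t' \<and> t \<le> t' \<and> lat_state v0' v' y' t' (exp (\<delta>' * t')) \<and>
      cball y' (state_radius CARD('n) \<delta>2 t') \<subseteq> cball y (state_radius CARD('n) \<delta>1 t) \<and>
      cball y' (state_radius CARD('n) \<delta>2 t') \<inter> A = {} \<and>
      (T0 \<le> t \<longrightarrow> (\<forall>\<theta>\<in>cball y' (state_radius CARD('n) \<delta>2 t'). \<forall>u. t \<le> u \<and> u \<le> t' \<longrightarrow>
         split_basis u \<theta> 0 0 (3 * \<delta> + 4 * \<delta>2)))"
      by (rule exI[of _ v0'], rule exI[of _ v'], rule exI[of _ ?y'], rule exI[of _ t'])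
        (use t' st' sub z(2) slack in blast)
  qed
qed

text \<open>\<Theta> t is the time at which the short block is shortest, so a large exponent
  requires a long excursion. Its length is proportional to t; hence the loss \<delta> at the start
  must be smaller than \<delta>' by a factor that depends on \<Theta>, n and d. A preceding balanced
  phase can provide any such \<delta>. The bound on y limits the norm of v0 and thereby the height
  of the subspace.\<close>

lemma excursion_phase:
  assumes d: "d < CARD('n::finite)" and vth: "1 \<le> \<Theta>" and \<delta>': "0 < \<delta>'" "4 * \<delta>' \<le> 1"
  obtains \<delta> T0 where "0 < \<delta>" "\<delta> \<le> \<delta>'"
    "\<And>(v0 :: real \<times> (real ^ 'n)) v y t. lat_state v0 v y t (exp (\<delta> * t)) \<Longrightarrow> T0 \<le> t \<Longrightarrow> 0 \<le> t \<Longrightarrow>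
      norm y \<le> 4 * (real CARD('n) + 1) \<Longrightarrow>
    \<exists>v0' v' y' t'. t \<le> t' \<and> lat_state v0' v' y' t' (exp (\<delta>' * t')) \<and>
      cball y' (state_radius CARD('n) \<delta>' t') \<subseteq> cball y (state_radius CARD('n) (2 * \<delta>') t) \<and>
      (\<forall>\<theta>\<in>cball y' (state_radius CARD('n) \<delta>' t').
        (\<forall>u. t \<le> u \<and> u \<le> t' \<longrightarrow> (\<exists>h. 0 \<le> h \<and> h \<le> (1 - 1 / \<Theta>) * u \<and> split_basis u \<theta> d h (4 * \<delta>'))) \<and>
        (\<exists>L. rat_affine_subspace d L \<and> height L \<le> exp ((real CARD('n) - real d + \<delta>') * t) \<and>
           infdist \<theta> L \<le> exp ((3 * \<delta>' - (real CARD('n) + 1)) * (\<Theta> * t))))"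
proof -
  let ?n = "real CARD('n)" and ?d = "real d"
  have n1: "1 \<le> ?n" by (simp add: Suc_le_eq)
  have nd: "1 \<le> ?n - ?d" using d by simp
  \<comment> \<open>The excursion lasts from t to \<kappa> t.\<close>
  define \<kappa> where "\<kappa> = 1 + (?n + 1) * (\<Theta> - 1) / (?d + 1)"
  have \<kappa>: "1 \<le> \<kappa>" using vth by (simp add: \<kappa>_def)
  \<comment> \<open>Losses are fixed backwards: \<open>exp (\<nu> * t)\<close> is what the whole
    excursion may lose, so that its n-th power stays within \<open>exp (\<delta>' / 2 * t)\<close>,
    and \<mu> is the rate that amounts to \<nu> over the time \<kappa>.\<close>
  define \<nu> where "\<nu> = \<delta>' / (2 * (?n + 1))"
  have \<nu>: "0 < \<nu>" "(?n + 1) * \<nu> = \<delta>' / 2" using \<delta>' n1 by (auto simp: \<nu>_def field_simps)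
  define \<mu> where "\<mu> = \<nu> / \<kappa>"
  have \<mu>: "0 < \<mu>" "\<mu> * \<kappa> = \<nu>" using \<nu> \<kappa> by (auto simp: \<mu>_def)
  have \<mu>\<nu>: "\<mu> \<le> \<nu>" using mult_left_mono[OF \<kappa>, of \<mu>] \<mu> by simp
  define \<delta> where "\<delta> = \<mu> / 3"
  have \<nu>\<delta>: "\<nu> \<le> \<delta>' / 2"
  proof -
    have "1 * \<nu> \<le> (?n + 1) * \<nu>" using \<nu>(1) by (intro mult_right_mono) auto
    then show ?thesis using \<nu>(2) by simp
  qed
  have \<delta>: "0 < \<delta>" "\<delta> \<le> \<delta>'" "(?n + 1) * \<delta> \<le> \<delta>' / 2" "4 * \<delta> \<le> 2 * \<delta>'"
  proof -
    show "0 < \<delta>" using \<mu> by (simp add: \<delta>_def)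
    have le: "\<delta> \<le> \<nu>" using \<mu> \<mu>\<nu> by (simp add: \<delta>_def)
    then show "\<delta> \<le> \<delta>'" using \<nu>\<delta> \<delta>' by linarith
    show "(?n + 1) * \<delta> \<le> \<delta>' / 2" using mult_left_mono[OF le, of "?n + 1"] \<nu>(2) by simp
    show "4 * \<delta> \<le> 2 * \<delta>'" using le \<nu>\<delta> \<delta>' by linarith
  qed
  define \<epsilon> where "\<epsilon> = \<mu> / ?n\<^sup>2"
  have \<epsilon>: "0 < \<epsilon>" "\<epsilon> * ?n\<^sup>2 = \<mu>" using \<mu> n1 by (auto simp: \<epsilon>_def)
  obtain c and Z :: "(real ^ 'n) set" where c: "0 < c" "c \<le> 1" and Z: "0 < emeasure lborel Z"
    "\<And>z i. z \<in> Z \<Longrightarrow> 1 \<le> z $ i \<and> z $ i \<le> 2" "\<And>z J. z \<in> Z \<Longrightarrow> J \<noteq> {} \<Longrightarrow> badly_approx c \<epsilon> J z"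
    by (rule badly_approx_positive_measure[OF \<epsilon>(1)]) (rule that)
  have "Z \<noteq> {}" using Z(1) by auto
  then obtain z where z: "z \<in> Z" by blast
  obtain J :: "'n set" where J: "card J = d" using obtain_subset_with_card_n[of d "UNIV :: 'n set"] d by auto
  then have "J \<noteq> UNIV" using d by auto
  then obtain j0 where j0: "j0 \<notin> J" by blast
  define P where "P = 2 * ?n + 2"
  have P2: "2 \<le> P" using n1 by (simp add: P_def)
  define L where "L = loss c CARD('n) * (8 * P ^ 3)"
  have L1: "1 \<le> L"
  proof -
    have "1 * (8 * 1 ^ 3) \<le> L" unfolding L_def using loss_ge_1[OF c, of "CARD('n)"] P2
      by (intro mult_mono power_mono) auto
    then show ?thesis by simp
  qed
  \<comment> \<open>The sum dominates each constant of the estimates below, so that one threshold T0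
    absorbs them all.\<close>
  define M where "M = L + 2 * (2 * L) ^ CARD('n) + (1 + 2 * P) + (2 + 2 * P) * 2 ^ CARD('n) + (P\<^sup>2 + 2 * P)"
  have Mpos: "0 \<le> 2 * (2 * L) ^ CARD('n)" "0 \<le> (2 + 2 * P) * 2 ^ CARD('n)" "0 \<le> P\<^sup>2 + 2 * P" using L1 P2 by auto
  have M0: "0 < M" using Mpos L1 P2 unfolding M_def by linarith
  have Mge: "L \<le> M" "2 * (2 * L) ^ CARD('n) \<le> M" "1 + 2 * P \<le> M" "2 \<le> M"
    "(2 + 2 * P) * 2 ^ CARD('n) \<le> M" "P\<^sup>2 + 2 * P \<le> M"
    using Mpos L1 P2 unfolding M_def by linarith+
  obtain T0 where T0: "\<And>t. T0 \<le> t \<Longrightarrow> M \<le> exp (\<delta>' / 2 * t)"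
    using exp_dominates[of "\<delta>' / 2" M] \<delta>' M0 by auto
  show ?thesis
  proof (rule that[of \<delta> T0, OF \<delta>(1,2)])
    fix v0 :: "real \<times> (real ^ 'n)" and v y t
    assume st: "lat_state v0 v y t (exp (\<delta> * t))" and t: "T0 \<le> t" "0 \<le> t" and y: "norm y \<le> 4 * (?n + 1)"
    define \<Lambda> where "\<Lambda> = exp (\<delta> * t)"
    have \<Lambda>1: "1 \<le> \<Lambda>" using \<delta> t by (simp add: \<Lambda>_def)
    define \<tau> where "\<tau> = (\<Theta> - 1) * t / (?d + 1)"
    have \<tau>: "0 \<le> \<tau>" using vth t by (simp add: \<tau>_def)
    have d\<tau>: "(?d + 1) * \<tau> = (\<Theta> - 1) * t" by (simp add: \<tau>_def)
    have n\<tau>: "(?n + 1) * \<tau> = (\<kappa> - 1) * t" by (simp add: \<tau>_def \<kappa>_def)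
    interpret E: excursion v0 v y t \<Lambda> J j0 z c \<epsilon> \<tau> P
    proof
      show "lat_state v0 v y t \<Lambda>" using st by (simp add: \<Lambda>_def)
    qed (use \<Lambda>1 j0 Z(2)[OF z] Z(3)[OF z] c \<epsilon>(1) \<tau> in \<open>auto simp: P_def\<close>)
    have Ed: "E.d = d" by (simp add: E.d_def J)
    define t' where "t' = \<kappa> * t"
    have t': "t \<le> t'" "0 \<le> t'" using mult_right_mono[OF \<kappa> t(2)] t by (auto simp: t'_def)
    have t'_eq: "t' = t + (?d + 1) * \<tau> + (?n - ?d) * \<tau>" using n\<tau> by (simp add: t'_def algebra_simps)
    have tb: "t + (?d + 1) * \<tau> = \<Theta> * t" unfolding d\<tau> by (simp add: algebra_simps)
    have \<Theta>t: "t \<le> \<Theta> * t" using mult_right_mono[OF vth t(2)] by simp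
    have tb': "\<Theta> * t \<le> t'" unfolding tb[symmetric] t'_eq using nd \<tau> by simp
    \<comment> \<open>The rate \<mu> over the time \<open>(n + 1) \<tau> = (\<kappa> - 1) t\<close>,
      together with three times the initial loss \<open>\<mu> / 3 * t\<close>, gives exactly \<nu>
      t.\<close>
    have B: "E.B = L * exp (\<nu> * t)"
    proof -
      have "\<epsilon> * ?n\<^sup>2 * ((?n + 1) * \<tau>) + 3 * (\<delta> * t) = \<mu> * \<kappa> * t"
        unfolding \<epsilon>(2) n\<tau> by (simp add: \<delta>_def algebra_simps)
      then have e: "exp (\<epsilon> * ?n\<^sup>2 * ((?n + 1) * \<tau>)) * exp (3 * (\<delta> * t)) = exp (\<nu> * t)"
        unfolding exp_add[symmetric] \<mu>(2) by simp
      have "\<Lambda> ^ 3 = exp (3 * (\<delta> * t))" unfolding \<Lambda>_def by (simp add: exp_of_nat_mult[symmetric])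
      then have "E.B = L * (exp (\<epsilon> * ?n\<^sup>2 * ((?n + 1) * \<tau>)) * exp (3 * (\<delta> * t)))"
        unfolding E.B_def E.\<rho>_def L_def by (simp only: mult_ac)
      then show ?thesis unfolding e .
    qed
    have Mt: "M \<le> exp (\<delta>' / 2 * u)" if "t \<le> u" for u by (rule T0) (use t that in simp)
    have B1: "1 \<le> E.B"
    proof -
      have "1 * 1 \<le> L * exp (\<nu> * t)" using L1 \<nu> t by (intro mult_mono) auto
      then show ?thesis by (simp add: B)
    qed
    \<comment> \<open>On the way down h = u - t and t \<ge> u / \<Theta>; on the way up h is at most
      (\<Theta> - 1) t while u exceeds \<Theta> t. Either way h is at most the fraction 1 - 1 /
      \<Theta> of u.\<close>
    have split: "\<exists>h. 0 \<le> h \<and> h \<le> (1 - 1 / \<Theta>) * u \<and> split_lattice u E.\<theta> d h E.B" if u: "t \<le> u" "u \<le> t'" for u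
    proof (cases "u \<le> \<Theta> * t")
      case True
      have "split_lattice (t + (u - t)) E.\<theta> E.d (u - t) E.B"
        by (rule E.split_descent) (use u True d\<tau> Ed in \<open>auto simp: algebra_simps\<close>)
      moreover have "u - t \<le> (1 - 1 / \<Theta>) * u"
      proof -
        have "u / \<Theta> \<le> t" using True vth by (simp add: pos_divide_le_eq mult.commute)
        then show ?thesis by (simp add: left_diff_distrib)
      qed
      ultimately show ?thesis using u Ed by (intro exI[of _ "u - t"]) simp
    next
      case False
      define \<sigma> where "\<sigma> = u - \<Theta> * t"
      define h where "h = (?d + 1) / (?n - ?d) * ((?n - ?d) * \<tau> - \<sigma>)"
      have \<sigma>: "0 \<le> \<sigma>" "\<sigma> \<le> (?n - ?d) * \<tau>" using False u t'_eq tb by (auto simp: \<sigma>_def)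
      have "split_lattice (t + (?d + 1) * \<tau> + \<sigma>) E.\<theta> d h E.B"
        unfolding h_def using E.split_ascent[unfolded Ed, OF \<sigma>] .
      moreover have "t + (?d + 1) * \<tau> + \<sigma> = u" unfolding tb by (simp add: \<sigma>_def)
      moreover have "0 \<le> h" using \<sigma> nd by (simp add: h_def)
      moreover have "h \<le> (1 - 1 / \<Theta>) * u"
      proof -
        have "h \<le> (?d + 1) / (?n - ?d) * ((?n - ?d) * \<tau>)" unfolding h_def using \<sigma> nd by (intro mult_left_mono) auto
        also have "\<dots> = (?d + 1) * \<tau>" using nd by simp
        also have "\<dots> = (1 - 1 / \<Theta>) * (\<Theta> * t)" unfolding d\<tau> using vth by (simp add: field_simps)
        also have "\<dots> \<le> (1 - 1 / \<Theta>) * u" using False vth by (intro mult_left_mono) auto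
        finally show ?thesis .
      qed
      ultimately show ?thesis by (intro exI[of _ h]) simp
    qed
    have end_split: "split_lattice t' E.\<theta> d 0 E.B"
    proof -
      have "split_lattice (t + (?d + 1) * \<tau> + (?n - ?d) * \<tau>) E.\<theta> d ((?d + 1) / (?n - ?d) * ((?n - ?d) * \<tau> - (?n - ?d) * \<tau>)) E.B"
        by (rule E.split_ascent[unfolded Ed]) (use nd \<tau> in auto)
      then show ?thesis unfolding t'_eq by simp
    qed
    obtain v0' v' where st': "lat_state v0' v' E.\<theta> t' (exp (\<delta>' * t'))"
    proof -
      obtain X1 X2 where X: "finite X1" "finite X2" "card X1 \<le> Suc d" "card X2 \<le> CARD('n) - d"
        "span (X1 \<union> X2) = UNIV" "\<forall>x\<in>X1 \<union> X2. integer_point x"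
        "\<forall>x\<in>X1. norm (flow t' E.\<theta> x) \<le> E.B" "\<forall>x\<in>X2. norm (flow t' E.\<theta> x) \<le> E.B"
        using end_split unfolding split_lattice_def by auto
      have "card (X1 \<union> X2) \<le> card X1 + card X2" by (rule card_Un_le)
      then have cX: "card (X1 \<union> X2) \<le> Suc CARD('n)" using X(3,4) d by linarith
      have "2 * (2 * E.B) ^ CARD('n) = 2 * (2 * L) ^ CARD('n) * exp (?n * \<nu> * t)"
        by (simp add: B power_mult_distrib exp_of_nat_mult[symmetric] mult_ac)
      also have "\<dots> \<le> exp (\<delta>' / 2 * t) * exp (\<delta>' / 2 * t)"
      proof (rule mult_mono)
        show "2 * (2 * L) ^ CARD('n) \<le> exp (\<delta>' / 2 * t)" using Mge(2) Mt[of t] by linarith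
        have "?n * \<nu> \<le> (?n + 1) * \<nu>" using \<nu>(1) by (intro mult_right_mono) auto
        then have "?n * \<nu> \<le> \<delta>' / 2" using \<nu>(2) by simp
        then show "exp (?n * \<nu> * t) \<le> exp (\<delta>' / 2 * t)"
          using t(2) by (intro exp_le_cancel_iff[THEN iffD2] mult_right_mono)
      qed auto
      also have "\<dots> = exp (\<delta>' * t)" by (simp flip: exp_add)
      also have "\<dots> \<le> exp (\<delta>' * t')" using t' \<delta>' by (simp add: mult_left_mono)
      finally have le: "2 * (2 * E.B) ^ CARD('n) \<le> exp (\<delta>' * t')" .
      have fX: "finite (X1 \<union> X2)" using X by simp
      show ?thesis
        by (rule lat_state_renew[OF fX cX X(5) _ _ B1 le _ t'(2)]) (use X(6-8) \<delta>' that in auto)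
    qed
    let ?r' = "state_radius CARD('n) \<delta>' t'"
    have r'_le: "?r' \<le> 2 * P * exp ((2 * \<delta>' - (?n + 1)) * u)" if "u \<le> t'" for u
    proof -
      have "(2 * \<delta>' - (?n + 1)) * t' \<le> (2 * \<delta>' - (?n + 1)) * u"
        using that \<delta>' n1 by (intro mult_left_mono_neg) auto
      then have "4 * (?n + 1) * exp ((2 * \<delta>' - (?n + 1)) * t') \<le> 4 * (?n + 1) * exp ((2 * \<delta>' - (?n + 1)) * u)"
        by (intro mult_left_mono) auto
      then show ?thesis by (simp add: state_radius_def P_def algebra_simps)
    qed
    have "norm (E.\<theta> - y) \<le> (2 * ?n + 1) * \<Lambda>\<^sup>2 * exp (- real (Suc CARD('n)) * t)" by (rule E.cone(1))
    also have "\<dots> = (2 * ?n + 1) * exp ((2 * \<delta> - (?n + 1)) * t)"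
      by (simp add: \<Lambda>_def exp_of_nat_mult[symmetric] exp_add[symmetric] algebra_simps)
    also have "\<dots> \<le> P * exp ((2 * \<delta>' - (?n + 1)) * t)"
      using \<delta> t by (intro mult_mono exp_le_cancel_iff[THEN iffD2] mult_right_mono) (auto simp: P_def)
    finally have "norm (E.\<theta> - y) + ?r' \<le> 3 * P * exp ((2 * \<delta>' - (?n + 1)) * t)"
      using r'_le[OF t'(1)] by linarith
    also have "\<dots> \<le> (2 * P * exp (2 * \<delta>' * t)) * exp ((2 * \<delta>' - (?n + 1)) * t)"
    proof (rule mult_right_mono)
      have "2 \<le> exp (\<delta>' / 2 * t)" using Mge(4) Mt[of t] by linarith
      also have "\<dots> \<le> exp (2 * \<delta>' * t)"
        using \<delta>' t(2) by (intro exp_le_cancel_iff[THEN iffD2] mult_right_mono) auto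
      finally have "2 * P * 2 \<le> 2 * P * exp (2 * \<delta>' * t)" using P2 by (intro mult_left_mono) auto
      then show "3 * P \<le> 2 * P * exp (2 * \<delta>' * t)" using P2 by linarith
    qed simp
    also have "\<dots> = state_radius CARD('n) (2 * \<delta>') t"
      by (simp add: state_radius_def P_def exp_add[symmetric] algebra_simps)
    finally have sub: "cball E.\<theta> ?r' \<subseteq> cball y (state_radius CARD('n) (2 * \<delta>') t)"
      by (intro cball_subset_cball_iff[THEN iffD2] disjI1) (simp add: dist_norm)
    obtain Ls where Ls: "rat_affine_subspace d Ls"
      "height Ls \<le> (2 + norm y) * \<Lambda> * (2 * \<Lambda>) ^ d * exp ((?n - ?d) * t)"
      "infdist E.\<theta> Ls \<le> P\<^sup>2 * \<Lambda> ^ 4 * exp (- (?n + 1) * (\<Theta> * t))"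
      by (rule E.subspace_near[OF t(2), unfolded Ed tb]) (rule that)
    have ht: "height Ls \<le> exp ((?n - ?d + \<delta>') * t)"
    proof -
      have "(2 + norm y) * \<Lambda> * (2 * \<Lambda>) ^ d = ((2 + norm y) * 2 ^ d) * \<Lambda> ^ Suc d"
        by (simp add: power_mult_distrib)
      also have "\<dots> \<le> exp (\<delta>' / 2 * t) * exp (\<delta>' / 2 * t)"
      proof (rule mult_mono)
        have "(2 + norm y) * 2 ^ d \<le> (2 + 2 * P) * 2 ^ CARD('n)"
          using y d by (intro mult_mono power_increasing) (auto simp: P_def)
        then show "(2 + norm y) * 2 ^ d \<le> exp (\<delta>' / 2 * t)" using Mge(5) Mt[of t] by linarith
        have "\<Lambda> ^ Suc d = exp ((?d + 1) * \<delta> * t)"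
          unfolding \<Lambda>_def exp_of_nat_mult[symmetric] by (simp add: algebra_simps)
        moreover have "(?d + 1) * \<delta> \<le> \<delta>' / 2"
          using mult_right_mono[of "?d + 1" "?n + 1" \<delta>] d \<delta> by linarith
        ultimately show "\<Lambda> ^ Suc d \<le> exp (\<delta>' / 2 * t)"
          using mult_right_mono[of "(?d + 1) * \<delta>" "\<delta>' / 2" t] t(2) by (simp only: exp_le_cancel_iff)
      qed (use \<Lambda>1 in auto)
      also have "\<dots> = exp (\<delta>' * t)" by (simp flip: exp_add)
      finally have "(2 + norm y) * \<Lambda> * (2 * \<Lambda>) ^ d * exp ((?n - ?d) * t) \<le> exp (\<delta>' * t) * exp ((?n - ?d) * t)"
        by (rule mult_right_mono) simp
      also have "\<dots> = exp ((?n - ?d + \<delta>') * t)" by (simp add: exp_add[symmetric] algebra_simps)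
      finally show ?thesis using Ls(2) by linarith
    qed
    have near: "infdist \<theta> Ls \<le> exp ((3 * \<delta>' - (?n + 1)) * (\<Theta> * t))" if \<theta>: "\<theta> \<in> cball E.\<theta> ?r'" for \<theta>
    proof -
      have "infdist \<theta> Ls \<le> infdist E.\<theta> Ls + dist \<theta> E.\<theta>" by (rule infdist_triangle)
      also have "dist \<theta> E.\<theta> \<le> 2 * P * exp ((2 * \<delta>' - (?n + 1)) * (\<Theta> * t))"
        using \<theta> r'_le[OF tb'] by (simp add: dist_commute)
      also have "infdist E.\<theta> Ls \<le> P\<^sup>2 * exp ((2 * \<delta>' - (?n + 1)) * (\<Theta> * t))"
      proof -
        have "4 * \<delta> * t \<le> 2 * \<delta>' * (\<Theta> * t)"
          by (rule mult_mono[OF \<delta>(4) \<Theta>t]) (use \<delta>'(1) t(2) in auto)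
        then have "exp (4 * \<delta> * t) * exp (- (?n + 1) * (\<Theta> * t)) \<le> exp ((2 * \<delta>' - (?n + 1)) * (\<Theta> * t))"
          unfolding exp_add[symmetric] by (simp add: algebra_simps)
        moreover have "\<Lambda> ^ 4 = exp (4 * \<delta> * t)" unfolding \<Lambda>_def by (simp add: exp_of_nat_mult[symmetric] mult.assoc)
        ultimately have "P\<^sup>2 * (\<Lambda> ^ 4 * exp (- (?n + 1) * (\<Theta> * t))) \<le> P\<^sup>2 * exp ((2 * \<delta>' - (?n + 1)) * (\<Theta> * t))"
          by (intro mult_left_mono) auto
        then show ?thesis using Ls(3) by (simp only: mult.assoc)
      qed
      finally have "infdist \<theta> Ls \<le> (P\<^sup>2 + 2 * P) * exp ((2 * \<delta>' - (?n + 1)) * (\<Theta> * t))"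
        by (simp add: distrib_right)
      also have "\<dots> \<le> exp (\<delta>' * (\<Theta> * t)) * exp ((2 * \<delta>' - (?n + 1)) * (\<Theta> * t))"
      proof (rule mult_right_mono)
        have "P\<^sup>2 + 2 * P \<le> exp (\<delta>' / 2 * (\<Theta> * t))" using Mge(6) Mt[OF \<Theta>t] by linarith
        also have "\<dots> \<le> exp (\<delta>' * (\<Theta> * t))"
          using \<delta>' t(2) \<Theta>t by (intro exp_le_cancel_iff[THEN iffD2] mult_right_mono) auto
        finally show "P\<^sup>2 + 2 * P \<le> exp (\<delta>' * (\<Theta> * t))" .
      qed simp
      also have "\<dots> = exp ((3 * \<delta>' - (?n + 1)) * (\<Theta> * t))" by (simp add: exp_add[symmetric] algebra_simps)
      finally show ?thesis .
    qed
    have slack: "\<exists>h. 0 \<le> h \<and> h \<le> (1 - 1 / \<Theta>) * u \<and> split_basis u \<theta> d h (4 * \<delta>')"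
      if \<theta>: "\<theta> \<in> cball E.\<theta> ?r'" and u: "t \<le> u" "u \<le> t'" for \<theta> u
    proof -
      obtain h where h: "0 \<le> h" "h \<le> (1 - 1 / \<Theta>) * u" "split_lattice u E.\<theta> d h E.B" using split[OF u] by blast
      have u0: "0 \<le> u" using t u by simp
      have "exp (real (Suc CARD('n)) * u) * norm (E.\<theta> - \<theta>) \<le> exp (real (Suc CARD('n)) * u) * ?r'"
        using \<theta> by (intro mult_left_mono) (auto simp: dist_norm)
      also have "\<dots> \<le> 2 * P * exp (2 * \<delta>' * u)"
        using exp_mult_state_radius_le[OF u(2), of \<delta>' "CARD('n)"] \<delta>' by (simp add: P_def algebra_simps)
      finally have "1 + exp (real (Suc CARD('n)) * u) * norm (E.\<theta> - \<theta>) \<le> 1 * exp (2 * \<delta>' * u) + 2 * P * exp (2 * \<delta>' * u)"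
        using \<delta>' u0 by (intro add_mono) auto
      also have "\<dots> = (1 + 2 * P) * exp (2 * \<delta>' * u)" by (simp only: distrib_right)
      also have "\<dots> \<le> exp (\<delta>' / 2 * u) * exp (2 * \<delta>' * u)"
        using Mge(3) Mt[OF u(1)] by (intro mult_right_mono) auto
      finally have f1: "1 + exp (real (Suc CARD('n)) * u) * norm (E.\<theta> - \<theta>) \<le> exp (\<delta>' / 2 * u) * exp (2 * \<delta>' * u)" .
      have "E.B \<le> exp (\<delta>' / 2 * u) * exp (\<delta>' / 2 * u)"
        unfolding B
      proof (rule mult_mono)
        show "L \<le> exp (\<delta>' / 2 * u)" using Mge(1) Mt[OF u(1)] by linarith
        show "exp (\<nu> * t) \<le> exp (\<delta>' / 2 * u)"
          using \<nu> \<nu>\<delta> u t by (intro exp_le_cancel_iff[THEN iffD2] mult_mono) auto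
      qed auto
      then have "(1 + exp (real (Suc CARD('n)) * u) * norm (E.\<theta> - \<theta>)) * E.B
          \<le> (exp (\<delta>' / 2 * u) * exp (2 * \<delta>' * u)) * (exp (\<delta>' / 2 * u) * exp (\<delta>' / 2 * u))"
        using f1 B1 by (intro mult_mono) auto
      also have "\<dots> \<le> exp (4 * \<delta>' * u)"
        using \<delta>' u0 unfolding exp_add[symmetric] by (simp add: algebra_simps)
      finally have le: "(1 + exp (real (Suc CARD('n)) * u) * norm (E.\<theta> - \<theta>)) * E.B \<le> exp (4 * \<delta>' * u)" .
      have "split_basis u \<theta> d h (4 * \<delta>')"
        by (rule split_lattice_imp_split_basis[OF split_lattice_perturb[OF h(3) _ le] order_refl]) (use B1 in simp)
      then show ?thesis using h by blast
    qed
    show "\<exists>v0' v' y' t'. t \<le> t' \<and> lat_state v0' v' y' t' (exp (\<delta>' * t')) \<and>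
      cball y' (state_radius CARD('n) \<delta>' t') \<subseteq> cball y (state_radius CARD('n) (2 * \<delta>') t) \<and>
      (\<forall>\<theta>\<in>cball y' (state_radius CARD('n) \<delta>' t').
        (\<forall>u. t \<le> u \<and> u \<le> t' \<longrightarrow> (\<exists>h. 0 \<le> h \<and> h \<le> (1 - 1 / \<Theta>) * u \<and> split_basis u \<theta> d h (4 * \<delta>'))) \<and>
        (\<exists>L. rat_affine_subspace d L \<and> height L \<le> exp ((?n - ?d + \<delta>') * t) \<and>
           infdist \<theta> L \<le> exp ((3 * \<delta>' - (?n + 1)) * (\<Theta> * t))))"
      by (rule exI[of _ v0'], rule exI[of _ v'], rule exI[of _ "E.\<theta>"], rule exI[of _ t'])
        (use t'(1) st' sub slack near Ls(1) ht in blast)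
  qed
qed

section \<open>Points with prescribed exponents\<close>

lemma split_basis_mono:
  fixes \<theta> :: "real ^ 'n"
  assumes "split_basis u \<theta> d h \<epsilon>" "\<epsilon> \<le> \<epsilon>'" "0 \<le> u"
  shows "split_basis u \<theta> d h \<epsilon>'"
proof -
  have "\<epsilon> * u \<le> \<epsilon>' * u" using assms by (intro mult_right_mono)
  then have *: "norm (flow u \<theta> x) \<le> exp (a + \<epsilon>' * u)" if "norm (flow u \<theta> x) \<le> exp (a + \<epsilon> * u)" for x a
    by (intro order_trans[OF that]) simp
  obtain X1 X2 where X: "finite X1 \<and> finite X2 \<and> card X1 \<le> Suc d \<and> card X2 \<le> CARD('n) - d \<and>
     span (X1 \<union> X2) = UNIV \<and> (\<forall>x\<in>X1 \<union> X2. integer_point x)"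
    and n: "\<forall>x\<in>X1. norm (flow u \<theta> x) \<le> exp (- (real CARD('n) - real d) / (real d + 1) * h + \<epsilon> * u)"
    "\<forall>x\<in>X2. norm (flow u \<theta> x) \<le> exp (h + \<epsilon> * u)"
    using assms(1) unfolding split_basis_def by blast
  show ?thesis unfolding split_basis_def
    by (rule exI[of _ X1], rule exI[of _ X2]) (use X n * in blast)
qed

text \<open>One step is a balanced phase that leaves \<open>A j\<close>, followed by an excursion of
  type \<open>d j\<close>. All properties are established for every member of the resulting closed
  ball, hence they hold for a point common to the nested balls.\<close>

lemma point_with_excursions:
  fixes A :: "nat \<Rightarrow> (real ^ 'n) set"
  assumes s: "0 \<le> s" "s < real CARD('n)"
    and A: "\<And>j. \<exists>r>0. packing_premeasure_delta s r (A j) < 1"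
    and d: "\<And>j. d j < CARD('n)" and \<Theta>: "\<And>j. 1 \<le> \<Theta> j"
  obtains \<theta> T where "\<And>j. \<theta> \<notin> A j" "\<And>j::nat. real j \<le> T j"
    "\<And>j. split_basis (T j) \<theta> 0 0 (1 / (real j + 1))"
    "\<And>j u. T j \<le> u \<Longrightarrow> u \<le> T (Suc j) \<Longrightarrow> \<exists>d' h. d' < CARD('n) \<and> 0 \<le> h \<and> split_basis u \<theta> d' h (1 / (real j + 1)) \<and>
       (h = 0 \<or> d' = d j \<and> h \<le> (1 - 1 / \<Theta> j) * u)"
    "\<And>j. \<exists>t L. real j \<le> t \<and> rat_affine_subspace (d j) L \<and>
       height L \<le> exp ((real CARD('n) - real (d j) + 1 / (real j + 1)) * t) \<and>
       infdist \<theta> L \<le> exp ((1 / (real j + 1) - (real CARD('n) + 1)) * (\<Theta> j * t))"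
proof -
  let ?n = "CARD('n)"
  \<comment> \<open>The factor 16 leaves room for the loss
    \<open>3 \<delta> j + 8 \<delta> (Suc j)\<close> of a balanced phase within 1 / (j + 1).\<close>
  define \<delta> where "\<delta> j = 1 / (16 * (real j + 1))" for j :: nat
  have \<delta>0: "0 < \<delta> j" "\<delta> (Suc j) \<le> \<delta> j" "\<delta> j \<le> 1 / 16" "16 * \<delta> j = 1 / (real j + 1)" for j
    by (auto simp: \<delta>_def field_simps)
  have \<delta>4: "4 * \<delta> j \<le> 1" for j using \<delta>0(3)[of j] by simp
  \<comment> \<open>The conclusions of the two phases are turned into predicates, so that thresholds
    and losses can be chosen for all j before the recursion begins.\<close>
  define E where "E j \<epsilon> T0 \<longleftrightarrow> 0 < \<epsilon> \<and> \<epsilon> \<le> \<delta> (Suc j) \<and>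
    (\<forall>(v0 :: real \<times> (real ^ 'n)) v y t. lat_state v0 v y t (exp (\<epsilon> * t)) \<longrightarrow> T0 \<le> t \<longrightarrow> 0 \<le> t \<longrightarrow>
      norm y \<le> 4 * (real ?n + 1) \<longrightarrow>
    (\<exists>v0' v' y' t'. t \<le> t' \<and> lat_state v0' v' y' t' (exp (\<delta> (Suc j) * t')) \<and>
      cball y' (state_radius ?n (\<delta> (Suc j)) t') \<subseteq> cball y (state_radius ?n (2 * \<delta> (Suc j)) t) \<and>
      (\<forall>\<theta>\<in>cball y' (state_radius ?n (\<delta> (Suc j)) t').
        (\<forall>u. t \<le> u \<and> u \<le> t' \<longrightarrow> (\<exists>h. 0 \<le> h \<and> h \<le> (1 - 1 / \<Theta> j) * u \<and> split_basis u \<theta> (d j) h (4 * \<delta> (Suc j)))) \<and>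
        (\<exists>L. rat_affine_subspace (d j) L \<and> height L \<le> exp ((real ?n - real (d j) + \<delta> (Suc j)) * t) \<and>
           infdist \<theta> L \<le> exp ((3 * \<delta> (Suc j) - (real ?n + 1)) * (\<Theta> j * t))))))" for j \<epsilon> T0
  have "\<exists>\<epsilon> T0. E j \<epsilon> T0" for j
  proof -
    obtain \<epsilon> T0 where e: "0 < \<epsilon>" "\<epsilon> \<le> \<delta> (Suc j)" and
      E: "\<And>(v0 :: real \<times> (real ^ 'n)) v y t. lat_state v0 v y t (exp (\<epsilon> * t)) \<Longrightarrow> T0 \<le> t \<Longrightarrow> 0 \<le> t \<Longrightarrow>
      norm y \<le> 4 * (real ?n + 1) \<Longrightarrow>
    (\<exists>v0' v' y' t'. t \<le> t' \<and> lat_state v0' v' y' t' (exp (\<delta> (Suc j) * t')) \<and>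
      cball y' (state_radius ?n (\<delta> (Suc j)) t') \<subseteq> cball y (state_radius ?n (2 * \<delta> (Suc j)) t) \<and>
      (\<forall>\<theta>\<in>cball y' (state_radius ?n (\<delta> (Suc j)) t').
        (\<forall>u. t \<le> u \<and> u \<le> t' \<longrightarrow> (\<exists>h. 0 \<le> h \<and> h \<le> (1 - 1 / \<Theta> j) * u \<and> split_basis u \<theta> (d j) h (4 * \<delta> (Suc j)))) \<and>
        (\<exists>L. rat_affine_subspace (d j) L \<and> height L \<le> exp ((real ?n - real (d j) + \<delta> (Suc j)) * t) \<and>
           infdist \<theta> L \<le> exp ((3 * \<delta> (Suc j) - (real ?n + 1)) * (\<Theta> j * t)))))"
      by (rule excursion_phase[OF d[of j] \<Theta>[of j] \<delta>0(1)[of "Suc j"] \<delta>4[of "Suc j"]]) (rule that)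
    have "E j \<epsilon> T0" unfolding E_def using e E by (intro conjI allI impI) assumption+
    then show ?thesis by blast
  qed
  then have "\<forall>j. \<exists>p. E j (fst p) (snd p)" by simp
  from choice[OF this] obtain p where p: "\<forall>j. E j (fst (p j)) (snd (p j))" by (rule exE)
  define \<epsilon>' where "\<epsilon>' j = fst (p j)" for j
  define TE where "TE j = snd (p j)" for j
  have E: "E j (\<epsilon>' j) (TE j)" for j using p by (simp add: \<epsilon>'_def TE_def)
  have \<epsilon>': "0 < \<epsilon>' j" "\<epsilon>' j \<le> \<delta> (Suc j)" "\<epsilon>' j \<le> 1" for j
    using E[of j] \<delta>0(3)[of "Suc j"] unfolding E_def by auto
  define G where "G \<epsilon> T0 \<longleftrightarrow> (\<forall>(v0 :: real \<times> (real ^ 'n)) v y t \<delta> \<delta>1 \<delta>2 T1 s r (A :: (real ^ 'n) set).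
    lat_state v0 v y t (exp (\<delta> * t)) \<longrightarrow> 0 \<le> t \<longrightarrow> 0 \<le> \<delta> \<longrightarrow> \<delta> \<le> \<delta>1 \<longrightarrow> \<epsilon> \<le> \<delta>2 \<longrightarrow> 2 * \<delta>2 \<le> 1 \<longrightarrow>
    0 \<le> s \<longrightarrow> s < real CARD('n) \<longrightarrow> 0 < r \<longrightarrow> packing_premeasure_delta s r A < 1 \<longrightarrow>
    (\<exists>v0' v' y' t'. T1 \<le> t' \<and> t \<le> t' \<and> lat_state v0' v' y' t' (exp (\<epsilon> * t')) \<and>
      cball y' (state_radius CARD('n) \<delta>2 t') \<subseteq> cball y (state_radius CARD('n) \<delta>1 t) \<and>
      cball y' (state_radius CARD('n) \<delta>2 t') \<inter> A = {} \<and>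
      (T0 \<le> t \<longrightarrow> (\<forall>\<theta>\<in>cball y' (state_radius CARD('n) \<delta>2 t'). \<forall>u. t \<le> u \<and> u \<le> t' \<longrightarrow>
         split_basis u \<theta> 0 0 (3 * \<delta> + 4 * \<delta>2)))))" for \<epsilon> T0
  have Gex: "\<exists>T0. G \<epsilon> T0" if e: "0 < \<epsilon>" "\<epsilon> \<le> 1" for \<epsilon>
  proof -
    obtain T0 where T0: "\<And>(v0 :: real \<times> (real ^ 'n)) v y t \<delta> \<delta>1 \<delta>2 T1 s r (A :: (real ^ 'n) set).
    lat_state v0 v y t (exp (\<delta> * t)) \<Longrightarrow> 0 \<le> t \<Longrightarrow> 0 \<le> \<delta> \<Longrightarrow> \<delta> \<le> \<delta>1 \<Longrightarrow> \<epsilon> \<le> \<delta>2 \<Longrightarrow> 2 * \<delta>2 \<le> 1 \<Longrightarrow>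
    0 \<le> s \<Longrightarrow> s < real CARD('n) \<Longrightarrow> 0 < r \<Longrightarrow> packing_premeasure_delta s r A < 1 \<Longrightarrow>
    (\<exists>v0' v' y' t'. T1 \<le> t' \<and> t \<le> t' \<and> lat_state v0' v' y' t' (exp (\<epsilon> * t')) \<and>
      cball y' (state_radius CARD('n) \<delta>2 t') \<subseteq> cball y (state_radius CARD('n) \<delta>1 t) \<and>
      cball y' (state_radius CARD('n) \<delta>2 t') \<inter> A = {} \<and>
      (T0 \<le> t \<longrightarrow> (\<forall>\<theta>\<in>cball y' (state_radius CARD('n) \<delta>2 t'). \<forall>u. t \<le> u \<and> u \<le> t' \<longrightarrow>
         split_basis u \<theta> 0 0 (3 * \<delta> + 4 * \<delta>2))))"
      by (rule balanced_phase[OF e]) (rule that)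
    have "G \<epsilon> T0" unfolding G_def by (intro allI impI) (rule T0)
    then show ?thesis by blast
  qed
  have "\<forall>j. \<exists>T0. G (\<epsilon>' j) T0" using Gex \<epsilon>' by blast
  from choice[OF this] obtain TG where TG: "\<forall>j. G (\<epsilon>' j) (TG j)" by (rule exE)
  define D where "D j x = (case x of (v0 :: real \<times> (real ^ 'n), v :: 'n \<Rightarrow> real \<times> (real ^ 'n), y :: real ^ 'n, t) \<Rightarrow>
     cball y (state_radius ?n (\<delta> j) t))" for j x
  define time where "time x = (case x of (v0 :: real \<times> (real ^ 'n), v :: 'n \<Rightarrow> real \<times> (real ^ 'n), y :: real ^ 'n, t :: real) \<Rightarrow> t)" for x
  \<comment> \<open>\<open>TG j \<le> t\<close> belongs to the invariant because the next balanced
    phase controls the lattice only from that threshold on.\<close>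
  define R where "R j x \<longleftrightarrow> (case x of (v0 :: real \<times> (real ^ 'n), v, y, t) \<Rightarrow> lat_state v0 v y t (exp (\<delta> j * t)) \<and> TG j \<le> t \<and>
      real j \<le> t \<and> cball y (state_radius ?n (\<delta> j) t) \<subseteq> cball 0 (4 * (real ?n + 1)))" for j x
  define good where "good j \<theta> t t' \<longleftrightarrow> split_basis t \<theta> 0 0 (1 / (real j + 1)) \<and>
     (\<forall>u. t \<le> u \<longrightarrow> u \<le> t' \<longrightarrow> (\<exists>d' h. d' < ?n \<and> 0 \<le> h \<and> split_basis u \<theta> d' h (1 / (real j + 1)) \<and>
       (h = 0 \<or> d' = d j \<and> h \<le> (1 - 1 / \<Theta> j) * u))) \<and>
     (\<exists>t L. real j \<le> t \<and> rat_affine_subspace (d j) L \<and>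
       height L \<le> exp ((real ?n - real (d j) + 1 / (real j + 1)) * t) \<and>
       infdist \<theta> L \<le> exp ((1 / (real j + 1) - (real ?n + 1)) * (\<Theta> j * t)))" for j and \<theta> :: "real ^ 'n" and t t'
  have "\<exists>f. \<forall>j. R j (f j) \<and> (D (Suc j) (f (Suc j)) \<subseteq> D j (f j) \<and> D (Suc j) (f (Suc j)) \<inter> A j = {} \<and>
     time (f j) \<le> time (f (Suc j)) \<and> (\<forall>\<theta>\<in>D (Suc j) (f (Suc j)). good j \<theta> (time (f j)) (time (f (Suc j)))))"
  proof (rule dependent_nat_choice)
    obtain r where r: "0 < r" "packing_premeasure_delta s r (A 0) < 1" using A by blast
    obtain T0 where T0: "G (\<delta> 0) T0" using Gex[OF \<delta>0(1)[of 0]] \<delta>0(3)[of 0] by auto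
    \<comment> \<open>At time 0 the standard lattice is balanced without loss; a first balanced
      phase brings it to a time that satisfies the invariant. The ball at time 0 has radius
      \<open>4 * (n + 1)\<close>, whence the bound on all later centres.\<close>
    have st: "lat_state (1, 0) (\<lambda>i. (0, axis i 1)) (0 :: real ^ 'n) 0 (exp (0 * 0))" using lat_state_standard by simp
    have e2: "2 * \<delta> 0 \<le> 1" using \<delta>4[of 0] \<delta>0(1)[of 0] by linarith
    from T0[unfolded G_def, rule_format, OF st order_refl order_refl order_refl[of 0] order_refl e2 s r, of "max (TG 0) 0"]
    obtain v0' v' t' and y' :: "real ^ 'n" where *: "max (TG 0) 0 \<le> t'" "lat_state v0' v' y' t' (exp (\<delta> 0 * t'))"
      "cball y' (state_radius ?n (\<delta> 0) t') \<subseteq> cball 0 (state_radius ?n 0 0)"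
      by (elim exE conjE) (rule that)
    show "\<exists>x. R 0 x"
      by (rule exI[of _ "(v0', v', y', t')"]) (use * in \<open>simp add: R_def state_radius_def\<close>)
  next
    fix x j assume x: "R j x"
    obtain v0 v y t where x_eq: "x = (v0, v, y, t)" by (cases x) auto
    have st: "lat_state v0 v y t (exp (\<delta> j * t))" and t: "TG j \<le> t" "real j \<le> t"
      and sub0: "cball y (state_radius ?n (\<delta> j) t) \<subseteq> cball 0 (4 * (real ?n + 1))"
      using x by (auto simp: R_def x_eq)
    have t0: "0 \<le> t" using t(2) by (meson of_nat_0_le_iff order_trans)
    obtain r where r: "0 < r" "packing_premeasure_delta s r (A j) < 1" using A by blast
    \<comment> \<open>The balanced phase ends with the small loss \<open>\<epsilon>' j\<close>
      demanded by the excursion, but with the wider ball for \<open>2 * \<delta> (Suc j)\<close>,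
      inside which the excursion places its own ball.\<close>
    have e2: "\<epsilon>' j \<le> 2 * \<delta> (Suc j)" using \<epsilon>'(2)[of j] \<delta>0(1)[of "Suc j"] by linarith
    have e3: "2 * (2 * \<delta> (Suc j)) \<le> 1" using \<delta>4[of "Suc j"] by simp
    from TG[unfolded G_def, rule_format, OF st t0 less_imp_le[OF \<delta>0(1)] order_refl e2 e3 s r,
        of "max (TE j) (max (TG (Suc j)) (real (Suc j)))"]
    obtain v1 v1' y1 t1 where g: "max (TE j) (max (TG (Suc j)) (real (Suc j))) \<le> t1" "t \<le> t1"
      "lat_state v1 v1' y1 t1 (exp (\<epsilon>' j * t1))"
      "cball y1 (state_radius ?n (2 * \<delta> (Suc j)) t1) \<subseteq> cball y (state_radius ?n (\<delta> j) t)"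
      "cball y1 (state_radius ?n (2 * \<delta> (Suc j)) t1) \<inter> A j = {}"
      "TG j \<le> t \<longrightarrow> (\<forall>\<theta>\<in>cball y1 (state_radius ?n (2 * \<delta> (Suc j)) t1). \<forall>u. t \<le> u \<and> u \<le> t1 \<longrightarrow>
         split_basis u \<theta> 0 0 (3 * \<delta> j + 4 * (2 * \<delta> (Suc j))))"
      by (elim exE conjE) (rule that)
    have t1: "0 \<le> t1" "TE j \<le> t1" "TG (Suc j) \<le> t1" "real (Suc j) \<le> t1" using g(1,2) t0 by auto
    have "y1 \<in> cball y1 (state_radius ?n (2 * \<delta> (Suc j)) t1)" using less_imp_le[OF state_radius_pos] by simp
    then have "y1 \<in> cball 0 (4 * (real ?n + 1))" using g(4) sub0 by blast
    then have ny1: "norm y1 \<le> 4 * (real ?n + 1)" by simp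
    from E[of j, unfolded E_def, THEN conjunct2, THEN conjunct2, rule_format, OF g(3) t1(2,1) ny1]
    obtain v2 v2' y2 t2 where h: "t1 \<le> t2" "lat_state v2 v2' y2 t2 (exp (\<delta> (Suc j) * t2))"
      "cball y2 (state_radius ?n (\<delta> (Suc j)) t2) \<subseteq> cball y1 (state_radius ?n (2 * \<delta> (Suc j)) t1)"
      "\<forall>\<theta>\<in>cball y2 (state_radius ?n (\<delta> (Suc j)) t2).
        (\<forall>u. t1 \<le> u \<and> u \<le> t2 \<longrightarrow> (\<exists>h. 0 \<le> h \<and> h \<le> (1 - 1 / \<Theta> j) * u \<and> split_basis u \<theta> (d j) h (4 * \<delta> (Suc j)))) \<and>
        (\<exists>L. rat_affine_subspace (d j) L \<and> height L \<le> exp ((real ?n - real (d j) + \<delta> (Suc j)) * t1) \<and>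
           infdist \<theta> L \<le> exp ((3 * \<delta> (Suc j) - (real ?n + 1)) * (\<Theta> j * t1)))"
      by (elim exE conjE) (rule that)
    have sl: "3 * \<delta> j + 4 * (2 * \<delta> (Suc j)) \<le> 1 / (real j + 1)" "4 * \<delta> (Suc j) \<le> 1 / (real j + 1)"
      "3 * \<delta> (Suc j) \<le> 1 / (real j + 1)" "\<delta> (Suc j) \<le> 1 / (real j + 1)"
      using \<delta>0(1,2,4)[of j] \<delta>0(1)[of "Suc j"] by linarith+
    have gd: "good j \<theta> t t2" if \<theta>: "\<theta> \<in> cball y2 (state_radius ?n (\<delta> (Suc j)) t2)" for \<theta>
    proof -
      have \<theta>1: "\<theta> \<in> cball y1 (state_radius ?n (2 * \<delta> (Suc j)) t1)" using \<theta> h(3) by blast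
      have 1: "split_basis u \<theta> 0 0 (1 / (real j + 1))" if "t \<le> u" "u \<le> t1" for u
        by (rule split_basis_mono[OF _ sl(1)]) (use g(6) t(1) \<theta>1 that t0 in auto)
      have 2: "\<exists>h. 0 \<le> h \<and> h \<le> (1 - 1 / \<Theta> j) * u \<and> split_basis u \<theta> (d j) h (1 / (real j + 1))"
        if u: "t1 \<le> u" "u \<le> t2" for u
      proof -
        obtain h' where "0 \<le> h'" "h' \<le> (1 - 1 / \<Theta> j) * u" "split_basis u \<theta> (d j) h' (4 * \<delta> (Suc j))"
          using h(4) \<theta> u by blast
        moreover have "0 \<le> u" using u t1 by simp
        ultimately show ?thesis using split_basis_mono[OF _ sl(2)] by blast
      qed
      obtain L where L: "rat_affine_subspace (d j) L" "height L \<le> exp ((real ?n - real (d j) + \<delta> (Suc j)) * t1)"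
        "infdist \<theta> L \<le> exp ((3 * \<delta> (Suc j) - (real ?n + 1)) * (\<Theta> j * t1))"
        using h(4) \<theta> by blast
      have "exp ((real ?n - real (d j) + \<delta> (Suc j)) * t1) \<le> exp ((real ?n - real (d j) + 1 / (real j + 1)) * t1)"
        using sl(4) t1(1) by (intro exp_le_cancel_iff[THEN iffD2] mult_right_mono) auto
      moreover have "0 \<le> \<Theta> j * t1" using \<Theta>[of j] t1(1) by simp
      then have "exp ((3 * \<delta> (Suc j) - (real ?n + 1)) * (\<Theta> j * t1)) \<le> exp ((1 / (real j + 1) - (real ?n + 1)) * (\<Theta> j * t1))"
        using sl(3) by (intro exp_le_cancel_iff[THEN iffD2] mult_right_mono) auto
      moreover have "real j \<le> t1" using t1(4) by simp
      ultimately have 3: "\<exists>t L. real j \<le> t \<and> rat_affine_subspace (d j) L \<and>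
         height L \<le> exp ((real ?n - real (d j) + 1 / (real j + 1)) * t) \<and>
         infdist \<theta> L \<le> exp ((1 / (real j + 1) - (real ?n + 1)) * (\<Theta> j * t))"
        using L order_trans by (intro exI[of _ t1] exI[of _ L] conjI) blast+
      have "\<exists>d' h. d' < ?n \<and> 0 \<le> h \<and> split_basis u \<theta> d' h (1 / (real j + 1)) \<and>
         (h = 0 \<or> d' = d j \<and> h \<le> (1 - 1 / \<Theta> j) * u)" if u: "t \<le> u" "u \<le> t2" for u
      proof (cases "u \<le> t1")
        case True
        then show ?thesis using 1[OF u(1)] by (intro exI[of _ 0]) auto
      next
        case False
        then obtain h where "0 \<le> h" "h \<le> (1 - 1 / \<Theta> j) * u" "split_basis u \<theta> (d j) h (1 / (real j + 1))"
          using 2[of u] u(2) by auto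
        then show ?thesis using d[of j] by (intro exI[of _ "d j"] exI[of _ h]) auto
      qed
      then show ?thesis unfolding good_def using 1[OF order_refl g(2)] 3 by blast
    qed
    show "\<exists>x'. R (Suc j) x' \<and> D (Suc j) x' \<subseteq> D j x \<and> D (Suc j) x' \<inter> A j = {} \<and>
        time x \<le> time x' \<and> (\<forall>\<theta>\<in>D (Suc j) x'. good j \<theta> (time x) (time x'))"
    proof (rule exI[of _ "(v2, v2', y2, t2)"], intro conjI)
      show "R (Suc j) (v2, v2', y2, t2)"
        unfolding R_def prod.case using h(1-3) t1 g(4) sub0 by (intro conjI) auto
      show "D (Suc j) (v2, v2', y2, t2) \<subseteq> D j x" using h(3) g(4) by (auto simp: D_def x_eq)
      show "D (Suc j) (v2, v2', y2, t2) \<inter> A j = {}" using h(3) g(5) by (auto simp: D_def)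
      show "time x \<le> time (v2, v2', y2, t2)" using g(2) h(1) by (simp add: time_def x_eq)
      show "\<forall>\<theta>\<in>D (Suc j) (v2, v2', y2, t2). good j \<theta> (time x) (time (v2, v2', y2, t2))"
        using gd by (simp add: D_def time_def x_eq)
    qed
  qed
  then obtain f where f: "\<And>j. R j (f j)" "\<And>j. D (Suc j) (f (Suc j)) \<subseteq> D j (f j)"
    "\<And>j. D (Suc j) (f (Suc j)) \<inter> A j = {}"
    "\<And>j \<theta>. \<theta> \<in> D (Suc j) (f (Suc j)) \<Longrightarrow> good j \<theta> (time (f j)) (time (f (Suc j)))"
    by (elim exE) (rule that, blast+)
  have "compact (D j (f j)) \<and> D j (f j) \<noteq> {}" for j
    by (cases "f j" rule: prod_cases4) (simp add: D_def not_less less_imp_le[OF state_radius_pos])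
  moreover have "D k (f k) \<subseteq> D j (f j)" if "j \<le> k" for j k
    using lift_Suc_antimono_le[of "\<lambda>j. D j (f j)", OF f(2) that] .
  ultimately have "(\<Inter>j. D j (f j)) \<noteq> {}"
    by (intro compact_nest) auto
  then obtain \<theta> where \<theta>: "\<And>j. \<theta> \<in> D j (f j)" by blast
  have gd: "good j \<theta> (time (f j)) (time (f (Suc j)))" for j using f(4) \<theta> by blast
  show ?thesis
  proof (rule that[of \<theta> "\<lambda>j. time (f j)"])
    show "\<theta> \<notin> A j" for j using f(3) \<theta> by blast
    show "real j \<le> time (f j)" for j using f(1)[of j] by (auto simp: R_def time_def split: prod.splits)
  qed (use gd in \<open>unfold good_def, blast+\<close>)
qed

section \<open>Arithmetic of the transference inequalities\<close>

text \<open>The index is shifted by one, so that d is compared with its successor. For an infinite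
  exponent only the left inequality has content, in its limiting form.\<close>

locale exponent_sequence =
  fixes n :: nat and \<omega> :: "nat \<Rightarrow> ereal"
  assumes nonneg: "\<And>d. d < n \<Longrightarrow> 0 \<le> \<omega> d"
    and first: "ereal (1 / real n) \<le> \<omega> 0"
    and lower_infinity: "\<And>d. Suc d < n \<Longrightarrow> \<omega> (Suc d) = \<infinity> \<Longrightarrow> ereal (real d + 1) \<le> \<omega> d"
    and lower: "\<And>d w. Suc d < n \<Longrightarrow> \<omega> (Suc d) = ereal w \<Longrightarrow> ereal ((real d + 1) * w / (w + real d + 2)) \<le> \<omega> d"
    and upper: "\<And>d w. Suc d < n \<Longrightarrow> \<omega> (Suc d) = ereal w \<Longrightarrow>
      \<omega> d \<le> ereal (((real n - real d - 1) * w - 1) / (real n - real d))"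
begin

lemma finite_nonneg: "d < n \<Longrightarrow> \<omega> d = ereal w \<Longrightarrow> 0 \<le> w"
  using nonneg[of d] by simp

lemma finite_or_infinity:
  assumes "d < n"
  obtains "\<omega> d = \<infinity>" | w where "\<omega> d = ereal w" "0 \<le> w"
  using nonneg[OF assms] by (cases "\<omega> d") auto

text \<open>The upper transference inequality, rearranged: (n - d)(1 + \<omega> d) does not decrease
  with d. It also shows that finiteness passes to smaller indices.\<close>

lemma finite_below:
  assumes "d \<le> e" "e < n" "\<omega> e = ereal w"
  shows "\<exists>w'. \<omega> d = ereal w' \<and> (real n - real d) * (1 + w') \<le> (real n - real e) * (1 + w)"
  using assms(1)
proof (induction d rule: inc_induct)
  case base
  then show ?case using assms(3) by simp
next
  case (step d)
  then obtain w2 where w2: "\<omega> (Suc d) = ereal w2" "(real n - real (Suc d)) * (1 + w2) \<le> (real n - real e) * (1 + w)"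
    by blast
  have d: "Suc d < n" "d < n" using step assms(2) by auto
  have u: "\<omega> d \<le> ereal (((real n - real d - 1) * w2 - 1) / (real n - real d))" by (rule upper[OF d(1) w2(1)])
  then obtain w' where w': "\<omega> d = ereal w'" using finite_or_infinity[OF d(2)] by (metis ereal_infty_less_eq(1) PInfty_neq_ereal(1))
  have "w' \<le> ((real n - real d - 1) * w2 - 1) / (real n - real d)" using u w' by simp
  then have "w' * (real n - real d) \<le> (real n - real d - 1) * w2 - 1" using d by (simp add: pos_le_divide_eq)
  then have "(real n - real d) * (1 + w') \<le> (real n - real (Suc d)) * (1 + w2)" by (simp add: algebra_simps)
  then show ?case using w' w2(2) by (intro exI[of _ w']) auto
qed

text \<open>At d = 0 the monotone quantity is at least n + 1 by the hypothesis on \<omega> 0. This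
  is what allows excursions to have a stretch of at least 1.\<close>

lemma finite_bound:
  assumes "e < n" "\<omega> e = ereal w"
  shows "real n + 1 \<le> (real n - real e) * (1 + w)"
proof -
  obtain w' where w': "\<omega> 0 = ereal w'" "real n * (1 + w') \<le> (real n - real e) * (1 + w)"
    using finite_below[of 0 e w] assms by auto
  have "1 / real n \<le> w'" using first w'(1) by simp
  then have "1 \<le> w' * real n" using assms(1) by (simp add: pos_divide_le_eq)
  then show ?thesis using w'(2) by (simp add: algebra_simps)
qed

lemma finite_pos:
  assumes "e < n" "\<omega> e = ereal w"
  shows "0 < w"
proof (rule ccontr)
  assume "\<not> 0 < w"
  then have "w = 0" using finite_nonneg[OF assms] by simp
  then show False using finite_bound[OF assms] by simp
qed

text \<open>The lower transference inequality says exactly that this function of \<open>d\<close> decreases.\<close>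

definition slope :: "nat \<Rightarrow> real" where
  "slope d = (if \<omega> d = \<infinity> then 1 else real_of_ereal (\<omega> d) / (1 + real_of_ereal (\<omega> d))) / (real d + 1)"

lemma slope_Suc_le:
  assumes d: "Suc d < n"
  shows "slope (Suc d) \<le> slope d"
proof (cases rule: finite_or_infinity[OF d])
  case 1
  have l: "ereal (real d + 1) \<le> \<omega> d" by (rule lower_infinity[OF d 1])
  show ?thesis
  proof (cases rule: finite_or_infinity[OF Suc_lessD[OF d]])
    case 1
    then show ?thesis using \<open>\<omega> (Suc d) = \<infinity>\<close> by (simp add: slope_def frac_le)
  next
    case (2 w)
    then have "1 * ((1 + w) * (real d + 1)) \<le> w * (real d + 2)" using l by (simp add: algebra_simps)
    then have "1 / (real d + 2) \<le> w / ((1 + w) * (real d + 1))"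
      using 2 by (simp add: pos_divide_le_eq pos_le_divide_eq mult.commute)
    then show ?thesis using 2 \<open>\<omega> (Suc d) = \<infinity>\<close> by (simp add: slope_def add.commute)
  qed
next
  case (2 v)
  have l: "ereal ((real d + 1) * v / (v + real d + 2)) \<le> \<omega> d" by (rule lower[OF d 2(1)])
  show ?thesis
  proof (cases rule: finite_or_infinity[OF Suc_lessD[OF d]])
    case 1
    have "v / (1 + v) / (real (Suc d) + 1) \<le> 1 / (real d + 1)"
      using 2(2) by (intro frac_le) (auto simp: divide_le_eq)
    then show ?thesis using 1 2 by (simp add: slope_def)
  next
    case (2 w)
    have "(real d + 1) * v \<le> w * (v + real d + 2)"
      using l 2 \<open>0 \<le> v\<close> by (simp add: pos_divide_le_eq)
    then have "v * ((1 + w) * (real d + 1)) \<le> w * ((1 + v) * (real d + 2))" by (simp add: algebra_simps)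
    moreover have "0 < (1 + v) * (real d + 2)" "0 < (1 + w) * (real d + 1)" using 2(2) \<open>0 \<le> v\<close> by simp_all
    ultimately have "v / ((1 + v) * (real d + 2)) \<le> w / ((1 + w) * (real d + 1))"
      by (simp add: pos_divide_le_eq pos_le_divide_eq mult.commute del: zero_less_mult_iff)
    then show ?thesis using 2 \<open>\<omega> (Suc d) = ereal v\<close> by (simp add: slope_def add.commute)
  qed
qed

lemma slope_antimono:
  assumes "e \<le> d" "d < n"
  shows "slope d \<le> slope e"
  using assms
proof (induction d rule: dec_induct)
  case (step d)
  then show ?case using slope_Suc_le[of d] by simp
qed simp

text \<open>The right-hand side is the critical rate of \<open>omega_exp_le\<close> for the exponent
  w; in terms of \<open>slope\<close> the rates for different d can be compared.\<close>

lemma slope_eq: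
  assumes "\<omega> d = ereal w" "0 \<le> w"
  shows "(real d + 1) * ((real n + 1) * slope d - 1) = (real n - real d) - (real n + 1) / (1 + w)"
proof -
  have "(real d + 1) * slope d = w / (1 + w)" using assms by (simp add: slope_def)
  moreover have "(real d + 1) * ((real n + 1) * slope d - 1) = (real n + 1) * ((real d + 1) * slope d) - (real d + 1)"
    by (simp add: algebra_simps)
  ultimately have "(real d + 1) * ((real n + 1) * slope d - 1) = (real n + 1) * (w / (1 + w)) - (real d + 1)"
    by simp
  also have "w / (1 + w) = 1 - 1 / (1 + w)" using assms(2) by (simp add: field_simps)
  finally show ?thesis by (simp add: algebra_simps)
qed

context
  fixes d e :: nat and \<Theta> w :: real
  assumes \<Theta>: "1 \<le> \<Theta>" "\<And>v. \<omega> d = ereal v \<Longrightarrow> \<Theta> * (real n + 1) \<le> (real n - real d) * (1 + v)"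
    and w: "\<omega> e = ereal w" "e < n"
begin

text \<open>For d \<le> e the worst completion consists of long vectors only, and the monotonicity
  of (n - d)(1 + \<omega> d) bounds the excursion by the critical rate of e.\<close>

lemma excursion_le_below:
  assumes "d \<le> e"
  shows "(real n - real e) * (1 - 1 / \<Theta>) \<le> (real n - real e) - (real n + 1) / (1 + w)"
proof -
  obtain v where v: "\<omega> d = ereal v" "(real n - real d) * (1 + v) \<le> (real n - real e) * (1 + w)"
    using finite_below[OF assms w(2,1)] by blast
  have "(real n + 1) * \<Theta> \<le> (real n - real e) * (1 + w)" using \<Theta>(2)[OF v(1)] v(2) by (simp add: mult.commute)
  then have "(real n + 1) / (1 + w) \<le> (real n - real e) / \<Theta>"
    using \<Theta>(1) finite_nonneg[OF w(2,1)] by (simp add: pos_divide_le_eq pos_le_divide_eq field_simps)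
  then show ?thesis by (simp add: algebra_simps diff_divide_distrib)
qed

text \<open>An excursion of type d has at most the rate that belongs to \<open>slope d\<close>.
  Passing from d to e scales its cost by (e + 1) / (d + 1), exactly as the critical rate would scale
  with a fixed slope, and the slope at e is at least that at d. If \<omega> d is infinite, 1 - 1 /
  \<Theta> \<le> 1 takes the place of the bound on \<Theta>.\<close>

lemma excursion_le_above:
  assumes "e < d" "d < n"
  shows "(real n - real d) * (real e + 1) / (real d + 1) * (1 - 1 / \<Theta>) \<le> (real n - real e) - (real n + 1) / (1 + w)"
proof -
  have nd: "0 \<le> real n - real d" using assms by simp
  have "(real n - real d) * (1 - 1 / \<Theta>) \<le> (real d + 1) * ((real n + 1) * slope d - 1)"
  proof (cases rule: finite_or_infinity[OF assms(2)])
    case 1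
    have "(real n - real d) * (1 - 1 / \<Theta>) \<le> (real n - real d) * 1"
      using nd \<Theta>(1) by (intro mult_left_mono) auto
    also have "\<dots> = (real d + 1) * ((real n + 1) * slope d - 1)" using 1 by (simp add: slope_def field_simps)
    finally show ?thesis .
  next
    case (2 v)
    have "(real n + 1) * \<Theta> \<le> (real n - real d) * (1 + v)" using \<Theta>(2)[OF 2(1)] by (simp add: mult.commute)
    then have "(real n + 1) / (1 + v) \<le> (real n - real d) / \<Theta>"
      using \<Theta>(1) 2(2) by (simp add: pos_divide_le_eq pos_le_divide_eq field_simps)
    then show ?thesis unfolding slope_eq[OF 2] by (simp add: algebra_simps diff_divide_distrib)
  qed
  then have "(real e + 1) / (real d + 1) * ((real n - real d) * (1 - 1 / \<Theta>)) \<le>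
      (real e + 1) / (real d + 1) * ((real d + 1) * ((real n + 1) * slope d - 1))"
    by (intro mult_left_mono) auto
  also have "\<dots> = (real e + 1) * ((real n + 1) * slope d - 1)" by simp
  also have "\<dots> \<le> (real e + 1) * ((real n + 1) * slope e - 1)"
    using slope_antimono[of e d] assms by (intro mult_left_mono diff_right_mono) auto
  also have "\<dots> = (real n - real e) - (real n + 1) / (1 + w)"
    by (rule slope_eq[OF w(1) finite_nonneg[OF w(2,1)]])
  finally show ?thesis by (simp add: mult_ac)
qed

end

text \<open>An excursion along a \<open>d\<close>-dimensional subspace of height about \<open>exp ((n - d) t)\<close> that brings \<open>\<theta>\<close>
  within \<open>exp (-(n + 1) \<Theta> t)\<close> realises the exponent \<open>w\<close> with \<open>(n - d) (1 + w) = (n + 1) \<Theta>\<close>. The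
  dimension \<open>d\<close> runs cyclically through all residues.\<close>

definition stretch :: "nat \<Rightarrow> real" where
  "stretch j = (if \<omega> (j mod n) = \<infinity> then real j + 1
     else (real n - real (j mod n)) * (1 + real_of_ereal (\<omega> (j mod n))) / (real n + 1))"

lemma stretch_le:
  "\<omega> (j mod n) = ereal v \<Longrightarrow> stretch j * (real n + 1) \<le> (real n - real (j mod n)) * (1 + v)"
  by (simp add: stretch_def)

lemma stretch_ge_1:
  assumes "0 < n"
  shows "1 \<le> stretch j"
proof -
  have "j mod n < n" using assms by simp
  then show ?thesis
  proof (cases rule: finite_or_infinity)
    case 1
    then show ?thesis by (simp add: stretch_def)
  next
    case (2 w)
    then show ?thesis using finite_bound[of "j mod n" w] \<open>j mod n < n\<close> by (simp add: stretch_def)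
  qed
qed

end

section \<open>Exponents of the constructed point\<close>

text \<open>The bound on the height serves as H, and the last condition compares the two exponents
  after taking logarithms. The slack \<delta> is present because the subspaces of the construction
  reach the exponent only in the limit.\<close>

lemma omega_exp_ge:
  fixes \<theta> :: "real ^ 'n"
  assumes d: "d < CARD('n)"
    and H: "\<And>t0. \<exists>\<delta> \<Theta> t L. t0 \<le> t \<and> 0 \<le> t \<and> 0 \<le> \<delta> \<and> rat_affine_subspace d L \<and>
       height L \<le> exp ((real CARD('n) - real d + \<delta>) * t) \<and>
       infdist \<theta> L \<le> exp ((\<delta> - (real CARD('n) + 1)) * (\<Theta> * t)) \<and>
       (1 + w) * (real CARD('n) - real d + \<delta>) \<le> (real CARD('n) + 1 - \<delta>) * \<Theta>"
  shows "ereal w \<le> omega_exp d \<theta>"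
  unfolding omega_exp_def
proof (rule Sup_upper, unfold mem_Collect_eq, rule exI[of _ w], rule conjI[OF refl], rule allI)
  fix H0 :: real
  let ?n = "real CARD('n)"
  obtain \<delta> \<Theta> t L where t: "H0 \<le> t" "0 \<le> t" and \<delta>: "0 \<le> \<delta>" and L: "rat_affine_subspace d L"
    "height L \<le> exp ((?n - real d + \<delta>) * t)" "infdist \<theta> L \<le> exp ((\<delta> - (?n + 1)) * (\<Theta> * t))"
    and gap: "(1 + w) * (?n - real d + \<delta>) \<le> (?n + 1 - \<delta>) * \<Theta>" using H[of H0] by blast
  define H1 where "H1 = exp ((?n - real d + \<delta>) * t)"
  have "1 * t \<le> (?n - real d + \<delta>) * t" using d \<delta> t by (intro mult_right_mono) auto
  then have "exp t \<le> H1" by (simp add: H1_def)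
  then have H01: "H0 \<le> H1" using exp_ge_add_one_self[of t] t by linarith
  have "(1 + w) * (?n - real d + \<delta>) * t \<le> (?n + 1 - \<delta>) * \<Theta> * t" using gap t(2) by (rule mult_right_mono)
  then have "(?n - real d + \<delta>) * t + (\<delta> - (?n + 1)) * (\<Theta> * t) \<le> (?n - real d + \<delta>) * t * - w"
    by (simp add: algebra_simps)
  then have "H1 * exp ((\<delta> - (?n + 1)) * (\<Theta> * t)) \<le> H1 powr - w"
    unfolding H1_def exp_powr_real exp_add[symmetric] by simp
  moreover have "height L * infdist \<theta> L \<le> H1 * exp ((\<delta> - (?n + 1)) * (\<Theta> * t))"
    using L(2,3) by (intro mult_mono) (auto simp: H1_def infdist_nonneg)
  ultimately have "height L * infdist \<theta> L \<le> H1 powr - w" by linarith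
  then show "\<exists>H\<ge>H0. \<exists>L. rat_affine_subspace d L \<and> height L \<le> H \<and> height L * infdist \<theta> L \<le> H powr - w"
    using H01 L(1,2) by (intro exI[of _ H1]) (auto simp: H1_def)
qed

context exponent_sequence
begin

text \<open>The slack 1 / (j + 1) tends to 0 along the residue class of d. For finite \<omega> d the
  stretch is constant on the class and the gap comes from w < \<omega> d; for infinite \<omega> d
  the stretch itself grows with j.\<close>

lemma gap_eventually:
  assumes d: "d < n" and w: "0 < w" "ereal w < \<omega> d"
  shows "\<exists>j. j mod n = d \<and> M \<le> real j \<and>
    (1 + w) * (real n - real d + 1 / (real j + 1)) \<le> (real n + 1 - 1 / (real j + 1)) * stretch j"
proof (cases rule: finite_or_infinity[OF d])
  case 1
  obtain k where k: "max M (2 * (1 + w)) \<le> real k" using real_arch_simple by blast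
  define j where "j = d + n * k"
  have j: "j mod n = d" using d by (simp add: j_def)
  have "k \<le> n * k" using d by simp
  then have kj: "real k \<le> real j" unfolding j_def by linarith
  have "(1 + w) * (real n - real d + 1 / (real j + 1)) \<le> (1 + w) * (real n + 1)"
    using w by (intro mult_left_mono add_mono) auto
  also have "\<dots> \<le> (1 + w) * (2 * real n)" using w d by (intro mult_left_mono) auto
  also have "\<dots> = real n * (2 * (1 + w))" by simp
  also have "\<dots> \<le> real n * (real j + 1)" using k kj by (intro mult_left_mono) auto
  also have "\<dots> \<le> (real n + 1) * (real j + 1) - 1" by (simp add: algebra_simps)
  also have "\<dots> = (real n + 1 - 1 / (real j + 1)) * stretch j"
    using j 1 by (simp add: stretch_def field_simps)
  finally show ?thesis using j kj k by (intro exI[of _ j]) auto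
next
  case (2 v)
  define \<Theta> where "\<Theta> = (real n - real d) * (1 + v) / (real n + 1)"
  have \<Theta>: "0 \<le> \<Theta>" "(real n + 1) * \<Theta> = (real n - real d) * (1 + v)" using d 2(2) by (auto simp: \<Theta>_def)
  have vw: "w < v" using w(2) 2(1) by simp
  obtain k where k: "max M ((1 + w + \<Theta>) / (v - w)) \<le> real k" using real_arch_simple by blast
  define j where "j = d + n * k"
  have j: "j mod n = d" using d by (simp add: j_def)
  have "k \<le> n * k" using d by simp
  then have kj: "real k \<le> real j" unfolding j_def by linarith
  have st: "stretch j = \<Theta>" using j 2(1) by (simp add: stretch_def \<Theta>_def)
  have "(1 + w + \<Theta>) / (v - w) \<le> real j + 1" using k kj by simp
  then have "1 / (real j + 1) * (1 + w + \<Theta>) \<le> v - w" using vw by (simp add: field_simps)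
  also have "\<dots> \<le> (real n - real d) * (v - w)" using vw d by (simp add: mult_le_cancel_right1)
  finally have "1 / (real j + 1) * (1 + w + \<Theta>) \<le> (real n - real d) * (v - w)" .
  moreover have "(real n + 1 - x) * \<Theta> - (1 + w) * (real n - real d + x) = (real n - real d) * (v - w) - x * (1 + w + \<Theta>)" for x
    using \<Theta>(2) by (simp add: algebra_simps)
  ultimately have "(1 + w) * (real n - real d + 1 / (real j + 1)) \<le> (real n + 1 - 1 / (real j + 1)) * stretch j"
    unfolding st by (metis diff_ge_0_iff_ge)
  then show ?thesis using j kj k by (intro exI[of _ j]) auto
qed

lemma omega_exp_ge_sequence:
  fixes \<theta> :: "real ^ 'n"
  assumes n: "n = CARD('n)" and d: "d < n"
    and L: "\<And>j. \<exists>t L. real j \<le> t \<and> rat_affine_subspace (j mod n) L \<and>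
      height L \<le> exp ((real n - real (j mod n) + 1 / (real j + 1)) * t) \<and>
      infdist \<theta> L \<le> exp ((1 / (real j + 1) - (real n + 1)) * (stretch j * t))"
  shows "\<omega> d \<le> omega_exp d \<theta>"
proof (rule ccontr)
  assume "\<not> ?thesis"
  \<comment> \<open>Positivity of \<omega> d leaves room for a positive w strictly between the two
    values, as \<open>gap_eventually\<close> asks for.\<close>
  moreover have "0 < \<omega> d" using finite_pos[OF d] by (cases rule: finite_or_infinity[OF d]) auto
  ultimately have "max (omega_exp d \<theta>) 0 < \<omega> d" by auto
  from ereal_dense2[OF this] obtain w where w: "omega_exp d \<theta> < ereal w" "0 < w" "ereal w < \<omega> d"
    by auto
  have "ereal w \<le> omega_exp d \<theta>"
  proof (rule omega_exp_ge)
    show "d < CARD('n)" using d n by simp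
    fix t0 :: real
    obtain j where j: "j mod n = d" "t0 \<le> real j"
      "(1 + w) * (real n - real d + 1 / (real j + 1)) \<le> (real n + 1 - 1 / (real j + 1)) * stretch j"
      using gap_eventually[OF d w(2,3)] by blast
    obtain t L where t: "real j \<le> t" "rat_affine_subspace d L"
      "height L \<le> exp ((real n - real d + 1 / (real j + 1)) * t)"
      "infdist \<theta> L \<le> exp ((1 / (real j + 1) - (real n + 1)) * (stretch j * t))"
      using L[of j] unfolding j(1) by blast
    have "t0 \<le> t" "0 \<le> t" using t(1) j(2) by (auto intro: order_trans[OF of_nat_0_le_iff])
    then show "\<exists>\<delta> \<Theta> t L. t0 \<le> t \<and> 0 \<le> t \<and> 0 \<le> \<delta> \<and> rat_affine_subspace d L \<and>
       height L \<le> exp ((real CARD('n) - real d + \<delta>) * t) \<and>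
       infdist \<theta> L \<le> exp ((\<delta> - (real CARD('n) + 1)) * (\<Theta> * t)) \<and>
       (1 + w) * (real CARD('n) - real d + \<delta>) \<le> (real CARD('n) + 1 - \<delta>) * \<Theta>"
      unfolding n[symmetric] using t j(3)
      by (intro exI[of _ "1 / (real j + 1)"] exI[of _ "stretch j"] exI[of _ t] exI[of _ L]) auto
  qed
  then show False using w(1) by simp
qed

text \<open>Every large time lies between some \<open>T j\<close> and \<open>T (Suc j)\<close>,
  where the lattice is balanced or in an excursion of type j mod n. By
  \<open>excursion_le_below\<close> and \<open>excursion_le_above\<close> neither costs more than
  the critical rate of e.\<close>

lemma omega_exp_le_sequence:
  fixes \<theta> :: "real ^ 'n" and T :: "nat \<Rightarrow> real"
  assumes n: "n = CARD('n)" and e: "e < n"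
    and T: "\<And>j. real j \<le> T j"
    and sb: "\<And>j u. T j \<le> u \<Longrightarrow> u \<le> T (Suc j) \<Longrightarrow> \<exists>d' h. d' < n \<and> 0 \<le> h \<and>
      split_basis u \<theta> d' h (1 / (real j + 1)) \<and> (h = 0 \<or> d' = j mod n \<and> h \<le> (1 - 1 / stretch j) * u)"
  shows "omega_exp e \<theta> \<le> \<omega> e"
proof (cases rule: finite_or_infinity[OF e])
  case (2 w)
  define s where "s = (real n - real e) - (real n + 1) / (1 + w)"
  have "(real n + 1) / (1 + w) \<le> real n - real e"
    using finite_bound[OF e 2(1)] 2(2) by (simp add: pos_divide_le_eq)
  then have s0: "0 \<le> s" by (simp add: s_def)
  have "omega_exp e \<theta> \<le> ereal w"
  proof (rule omega_exp_le)
    show "e < CARD('n)" "0 \<le> w" using e n 2 by auto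
    show "s = (real CARD('n) - real e) - (real CARD('n) + 1) / (1 + w)" by (simp add: s_def n)
    fix \<epsilon> :: real assume \<epsilon>: "0 < \<epsilon>"
    obtain j0 where j0: "1 / \<epsilon> \<le> real j0" using real_arch_simple by blast
    have "\<exists>d h. d < n \<and> 0 \<le> h \<and> split_basis t \<theta> d h \<epsilon> \<and>
       (d \<le> e \<longrightarrow> (real n - real e) * h \<le> (s + \<epsilon>) * t) \<and>
       (e < d \<longrightarrow> (real n - real d) * (real e + 1) / (real d + 1) * h \<le> (s + \<epsilon>) * t)" if t: "T j0 \<le> t" for t
    proof -
      \<comment> \<open>T is known to be unbounded, not to be monotone, so the interval around t is
        located by the first index from j0 on at which T exceeds t.\<close>
      let ?P = "\<lambda>m. j0 \<le> m \<and> t < T m"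
      have t0: "0 \<le> t" using T[of j0] t by (meson of_nat_0_le_iff order_trans)
      obtain k where "t + 1 \<le> real k" using real_arch_simple by blast
      then have "?P (j0 + k)" using T[of "j0 + k"] by simp
      then obtain m where m: "?P m" "\<And>i. i < m \<Longrightarrow> \<not> ?P i" using exists_least_iff[of ?P] by blast
      have "m \<noteq> j0" using m(1) t by auto
      then obtain j where j: "m = Suc j" "j0 \<le> j" using m(1) by (cases m) auto
      have Tj: "T j \<le> t" "t \<le> T (Suc j)" using m(2)[of j] m(1) j by auto
      obtain d h where h: "d < n" "0 \<le> h" "split_basis t \<theta> d h (1 / (real j + 1))"
        "h = 0 \<or> d = j mod n \<and> h \<le> (1 - 1 / stretch j) * t" using sb[OF Tj] by blast
      have "1 \<le> \<epsilon> * real j0" using j0 \<epsilon> by (simp add: field_simps)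
      also have "\<dots> \<le> \<epsilon> * (real j + 1)" using j(2) \<epsilon> by (intro mult_left_mono) auto
      finally have "1 / (real j + 1) \<le> \<epsilon>" by (simp add: divide_le_eq)
      then have "split_basis t \<theta> d h \<epsilon>" by (rule split_basis_mono[OF h(3) _ t0])
      moreover have le: "c * h \<le> (s + \<epsilon>) * t"
        if "0 \<le> c" "d = j mod n \<Longrightarrow> c * (1 - 1 / stretch j) \<le> s" for c
      proof (cases "h = 0")
        case True
        then show ?thesis using s0 \<epsilon> t0 by simp
      next
        case False
        then have "c * h \<le> c * ((1 - 1 / stretch j) * t)" using h(4) that(1) by (intro mult_left_mono) auto
        also have "\<dots> \<le> s * t" using mult_right_mono[OF that(2) t0] False h(4) by (simp add: mult.assoc)
        also have "\<dots> \<le> (s + \<epsilon>) * t" using \<epsilon> t0 by (intro mult_right_mono) auto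
        finally show ?thesis .
      qed
      have st: "1 \<le> stretch j" "\<And>v. \<omega> (j mod n) = ereal v \<Longrightarrow> stretch j * (real n + 1) \<le> (real n - real (j mod n)) * (1 + v)"
        using stretch_ge_1 stretch_le e by auto
      have "(real n - real e) * h \<le> (s + \<epsilon>) * t" if "d \<le> e"
        by (rule le) (use excursion_le_below[OF st 2(1) e] that e in \<open>auto simp: s_def\<close>)
      moreover have "(real n - real d) * (real e + 1) / (real d + 1) * h \<le> (s + \<epsilon>) * t" if "e < d"
        by (rule le) (use excursion_le_above[OF st 2(1) e] that h(1) in \<open>auto simp: s_def\<close>)
      ultimately show ?thesis using h(1,2) by blast
    qed
    then show "\<exists>t0. \<forall>t\<ge>t0. \<exists>d h. d < CARD('n) \<and> 0 \<le> h \<and> split_basis t \<theta> d h \<epsilon> \<and>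
       (d \<le> e \<longrightarrow> (real CARD('n) - real e) * h \<le> (s + \<epsilon>) * t) \<and>
       (e < d \<longrightarrow> (real CARD('n) - real d) * (real e + 1) / (real d + 1) * h \<le> (s + \<epsilon>) * t)"
      unfolding n by blast
  qed
  then show ?thesis using 2 by simp
qed simp

lemma point_with_exponents:
  fixes A :: "nat \<Rightarrow> (real ^ 'n) set"
  assumes n: "n = CARD('n)" and s: "0 \<le> s" "s < real n"
    and A: "\<And>j. \<exists>r>0. packing_premeasure_delta s r (A j) < 1"
  shows "\<exists>\<theta>. Q_lin_indep \<theta> \<and> (\<forall>d<n. omega_exp d \<theta> = \<omega> d) \<and> (\<forall>j. \<theta> \<notin> A j)"
proof -
  have n0: "0 < n" using n by simp
  obtain \<theta> T where notA: "\<And>j. \<theta> \<notin> A j" and T: "\<And>j::nat. real j \<le> T j"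
    and bal: "\<And>j. split_basis (T j) \<theta> 0 0 (1 / (real j + 1))"
    and sb: "\<And>j u. T j \<le> u \<Longrightarrow> u \<le> T (Suc j) \<Longrightarrow> \<exists>d' h. d' < CARD('n) \<and> 0 \<le> h \<and> split_basis u \<theta> d' h (1 / (real j + 1)) \<and>
       (h = 0 \<or> d' = j mod n \<and> h \<le> (1 - 1 / stretch j) * u)"
    and L: "\<And>j. \<exists>t L. real j \<le> t \<and> rat_affine_subspace (j mod n) L \<and>
       height L \<le> exp ((real CARD('n) - real (j mod n) + 1 / (real j + 1)) * t) \<and>
       infdist \<theta> L \<le> exp ((1 / (real j + 1) - (real CARD('n) + 1)) * (stretch j * t))"
    using point_with_excursions[of s A "\<lambda>j. j mod n" stretch, OF s(1) s(2)[unfolded n] A _ stretch_ge_1[OF n0]] n0 n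
    by (metis mod_less_divisor)
  have "\<exists>t\<ge>t0. \<exists>d. split_basis t \<theta> d 0 (1/2)" for t0
  proof -
    obtain k where k: "t0 \<le> real k" using real_arch_simple by blast
    have "t0 \<le> T (Suc k)" "0 \<le> T (Suc k)" using T[of "Suc k"] k by auto
    moreover have "split_basis (T (Suc k)) \<theta> 0 0 (1/2)"
      by (rule split_basis_mono[OF bal]) (use \<open>0 \<le> T (Suc k)\<close> in \<open>auto simp: field_simps\<close>)
    ultimately show ?thesis by blast
  qed
  then have "Q_lin_indep \<theta>" by (rule Q_lin_indep_of_balanced)
  moreover have "omega_exp d \<theta> = \<omega> d" if "d < n" for d
    using omega_exp_ge_sequence[OF n that, of \<theta>] omega_exp_le_sequence[OF n that T, of \<theta>] sb L
    unfolding n[symmetric] by (intro antisym) auto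
  ultimately show ?thesis using notA by blast
qed

end

theorem theorem4:
  fixes \<omega> :: "nat \<Rightarrow> ereal"
  assumes n2: "CARD('n::finite) \<ge> 2"
    and nonneg: "\<forall>d < CARD('n). 0 \<le> \<omega> d"
    and w0: "\<omega> 0 \<ge> ereal (1 / real CARD('n))"
    and ineq: "\<forall>d \<in> {1..CARD('n) - 1}.
       (\<omega> d = \<infinity> \<longrightarrow> ereal (real d) \<le> \<omega> (d - 1)) \<and>
       (\<forall>w. \<omega> d = ereal w \<longrightarrow>
          ereal (real d * w / (w + real d + 1)) \<le> \<omega> (d - 1) \<and>
          \<omega> (d - 1) \<le> ereal (((real CARD('n) - real d) * w - 1) / (real CARD('n) - real d + 1)))"
  shows "packing_dim (\<Inter>d \<in> {..<CARD('n)}. (W_star d (\<omega> d) :: (real ^ 'n) set)) = real CARD('n)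
       \<and> packing_dim (\<Inter>d \<in> {..<CARD('n)}. (W_set d (\<omega> d) :: (real ^ 'n) set)) = real CARD('n)
       \<and> (\<forall>d < CARD('n). packing_dim (W_star d (\<omega> d) :: (real ^ 'n) set) = real CARD('n)
                        \<and> packing_dim (W_set d (\<omega> d) :: (real ^ 'n) set) = real CARD('n))"
proof -
  have ineq': "(\<omega> (Suc d) = \<infinity> \<longrightarrow> ereal (real d + 1) \<le> \<omega> d) \<and>
       (\<forall>w. \<omega> (Suc d) = ereal w \<longrightarrow>
          ereal ((real d + 1) * w / (w + real d + 2)) \<le> \<omega> d \<and>
          \<omega> d \<le> ereal (((real CARD('n) - real d - 1) * w - 1) / (real CARD('n) - real d)))"
    if "Suc d < CARD('n)" for d
    using bspec[OF ineq, of "Suc d"] that by (simp add: algebra_simps)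
  interpret exponent_sequence "CARD('n)" \<omega>
    by unfold_locales (use nonneg w0 ineq' in blast)+
  let ?E = "\<Inter>d \<in> {..<CARD('n)}. (W_star d (\<omega> d) :: (real ^ 'n) set)"
  have E: "packing_measure s ?E \<noteq> 0" if s: "0 \<le> s" "s < real CARD('n)" for s
  proof
    assume "packing_measure s ?E = 0"
    then obtain A where A: "?E \<subseteq> (\<Union>i::nat. A i)" "\<And>i. \<exists>\<delta>>0. packing_premeasure_delta s \<delta> (A i) < 1"
      by (rule packing_measure_0_cover) (rule that)
    obtain \<theta> where "Q_lin_indep \<theta>" "\<forall>d<CARD('n). omega_exp d \<theta> = \<omega> d" "\<forall>j. \<theta> \<notin> A j"
      using point_with_exponents[OF refl s, of A, OF A(2)] by blast
    then show False using A(1) by (auto simp: W_star_def)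
  qed
  \<comment> \<open>Every set of the theorem contains the intersection of the \<open>W_star\<close>
    sets, so the lower bound for this one set settles all the dimensions.\<close>
  have dim: "packing_dim F = real CARD('n)" if "?E \<subseteq> F" for F
  proof (rule packing_dim_eq_CARD)
    show "packing_measure s F \<noteq> 0" if "0 \<le> s" "s < real CARD('n)" for s
      using packing_measure_mono[OF \<open>?E \<subseteq> F\<close>, of s] E[OF that] by auto
  qed
  have "W_star d (\<omega> d) \<subseteq> (W_set d (\<omega> d) :: (real ^ 'n) set)" for d by (auto simp: W_star_def W_set_def)
  then show ?thesis by (intro conjI allI impI dim) blast+
qed

end
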